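(* Let $k$ be a field of prime characteristic $p$ and let $G$ be a finite $p$-group. For every effective endotrivial complex $C\in\mathcal{K}(G)$ and every subgroup $H\leq G$, there exists a morphism (called an $H$-forerunner of $C$) $\iota^H_C\colon k\to C[-h_C(H)]$ such that $\Psi^H(\iota^H_C)$ is a quasi-isomorphism.
   Context: $\mathcal{K}(G)=\mathrm{K}_b(\mathsf{perm}(kG)^\natural)$ is the bounded homotopy category of finitely generated $p$-permutation $kG$-modules (direct summands of permutation modules; for a $p$-group these are exactly the permutation modules). It is a tensor-triangulated category under $\otimes=\otimes_k$ with diagonal $G$-action, with unit $k=k[0]$. Complexes are graded homologically, and $M[i]$ denotes the module $M$ placed in homological degree $i$; so $(C[i])_n=C_{n-i}$. For $H\leq G$ put $W_G(H)=N_G(H)/H$. The modular fixed-points functor $\Psi^H\colon\mathcal{K}(G)\to\mathcal{K}(W_G(H))$ is the tensor-triangulated functor obtained by applying degreewise the Brauer quotient $M\mapsto M^H/\sum_{L<H}\mathrm{tr}_L^H(M^L)$; it satisfies $\Psi^H(kX)\cong k[X^H]$ naturally in $G$-sets $X$. A complex $C\in\mathcal{K}(G)$ is endotrivial if it is $\otimes$-invertible, i.e. $C^*\otimes C\cong k$ in $\mathcal{K}(G)$. For $C$ endotrivial and $H\leq G$, $\Psi^H(C)$ has nonzero homology in exactly one degree (of $k$-dimension one there), and $h_C(H)\in\mathbb{Z}$ denotes this degree. An endotrivial $C$ is effective if $h_C(K)\geq h_C(H)$ whenever $K\leq H\leq G$. *)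

theory Defs
  imports "HOL-Algebra.Module" "HOL-Algebra.AbelCoset" "HOL-Algebra.Group_Action" "HOL-Computational_Algebra.Primes"
begin

definition has_char :: "('k, 'z) ring_scheme \<Rightarrow> nat \<Rightarrow> bool" where
  "has_char K p \<longleftrightarrow> (\<forall>n::nat. [n] \<cdot>\<^bsub>K\<^esub> \<one>\<^bsub>K\<^esub> = \<zero>\<^bsub>K\<^esub> \<longleftrightarrow> p dvd n)"

section \<open>Modules over a group algebra\<close>

text \<open>A left module over the group algebra of \<open>G\<close> over \<open>K\<close> is a \<open>K\<close>-module together with a
  linear action of \<open>G\<close>. The ring multiplication and unit that the library's module record inherits
  are meaningless and are left unspecified in the constructions below.\<close>

record ('k, 'm, 'g) gmod = "('k, 'm) module" +
  act :: "'g \<Rightarrow> 'm \<Rightarrow> 'm"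

locale kG_module = module K M
  for K :: "('k, 'z) ring_scheme" (structure) and G :: "('g, 'y) monoid_scheme"
    and M :: "('k, 'm, 'g) gmod" (structure) +
  assumes act_closed: "\<lbrakk>g \<in> carrier G; x \<in> carrier M\<rbrakk> \<Longrightarrow> act M g x \<in> carrier M"
    and act_add: "\<lbrakk>g \<in> carrier G; x \<in> carrier M; y \<in> carrier M\<rbrakk> \<Longrightarrow>
      act M g (x \<oplus>\<^bsub>M\<^esub> y) = act M g x \<oplus>\<^bsub>M\<^esub> act M g y"
    and act_smult: "\<lbrakk>g \<in> carrier G; r \<in> carrier K; x \<in> carrier M\<rbrakk> \<Longrightarrow>
      act M g (r \<odot>\<^bsub>M\<^esub> x) = r \<odot>\<^bsub>M\<^esub> act M g x"
    and act_one: "x \<in> carrier M \<Longrightarrow> act M \<one>\<^bsub>G\<^esub> x = x"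
    and act_mult: "\<lbrakk>g \<in> carrier G; h \<in> carrier G; x \<in> carrier M\<rbrakk> \<Longrightarrow>
      act M (g \<otimes>\<^bsub>G\<^esub> h) x = act M g (act M h x)"

definition kG_hom :: "('k, 'z) ring_scheme \<Rightarrow> ('g, 'y) monoid_scheme \<Rightarrow>
    ('k, 'm, 'g) gmod \<Rightarrow> ('k, 'n, 'g) gmod \<Rightarrow> ('m \<Rightarrow> 'n) set" where
  "kG_hom K G M N = {f \<in> hom (add_monoid M) (add_monoid N).
     (\<forall>r \<in> carrier K. \<forall>x \<in> carrier M. f (r \<odot>\<^bsub>M\<^esub> x) = r \<odot>\<^bsub>N\<^esub> f x) \<and>
     (\<forall>g \<in> carrier G. \<forall>x \<in> carrier M. f (act M g x) = act N g (f x))}"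

definition kG_submodule :: "('k, 'z) ring_scheme \<Rightarrow> ('g, 'y) monoid_scheme \<Rightarrow>
    ('k, 'm, 'g) gmod \<Rightarrow> 'm set \<Rightarrow> bool" where
  "kG_submodule K G M A \<longleftrightarrow> submodule A K M \<and> (\<forall>g \<in> carrier G. \<forall>x \<in> A. act M g x \<in> A)"

definition module_span :: "('k, 'z) ring_scheme \<Rightarrow> ('k, 'm, 'g) gmod \<Rightarrow> 'm set \<Rightarrow> 'm set" where
  "module_span K M S = \<Inter>{N. submodule N K M \<and> S \<subseteq> N}"

text \<open>The map on cosets \<open>x + \<dots> \<mapsto> f x + N\<close> induced by a map \<open>f\<close> into \<open>M\<close>; meaningful
  when \<open>f\<close> sends the submodule that is divided out of its domain into \<open>N\<close>.\<close>

definition coset_map :: "('k, 'm, 'g) gmod \<Rightarrow> 'm set \<Rightarrow> ('n \<Rightarrow> 'm) \<Rightarrow> 'n set \<Rightarrow> 'm set" where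
  "coset_map M N f A = (\<Union>x\<in>A. N +>\<^bsub>M\<^esub> f x)"

text \<open>The quotient of \<open>M\<close> by \<open>N\<close> as a module, with action \<open>\<alpha>\<close>. The action is a separate
  argument because the Brauer quotient is acted on by another group than \<open>M\<close> is.\<close>

definition quotient_mod :: "('k, 'm, 'g) gmod \<Rightarrow> 'm set \<Rightarrow> ('h \<Rightarrow> 'm set \<Rightarrow> 'm set) \<Rightarrow>
    ('k, 'm set, 'h) gmod" where
  "quotient_mod M N \<alpha> =
    \<lparr>carrier = a_rcosets\<^bsub>M\<^esub> N, monoid.mult = undefined, one = undefined,
     zero = N, add = set_add M,
     smult = (\<lambda>r. coset_map M N (\<lambda>x. r \<odot>\<^bsub>M\<^esub> x)),
     act = \<alpha>\<rparr>"

section \<open>Permutation modules\<close>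

text \<open>The map of free modules induced by a map \<open>h\<close> of bases.\<close>

definition free_map :: "('k, 'z) ring_scheme \<Rightarrow> ('x \<Rightarrow> 'y) \<Rightarrow> ('x \<Rightarrow> 'k) \<Rightarrow> 'y \<Rightarrow> 'k" where
  "free_map K h \<phi> = (\<lambda>z. \<Oplus>\<^bsub>K\<^esub> w \<in> {w. \<phi> w \<noteq> \<zero>\<^bsub>K\<^esub> \<and> h w = z}. \<phi> w)"

definition free_basis :: "('k, 'z) ring_scheme \<Rightarrow> 'x \<Rightarrow> 'x \<Rightarrow> 'k" where
  "free_basis K x = (\<lambda>y. if y = x then \<one>\<^bsub>K\<^esub> else \<zero>\<^bsub>K\<^esub>)"

definition permutation_module :: "('k, 'z) ring_scheme \<Rightarrow> 'x set \<Rightarrow> ('g \<Rightarrow> 'x \<Rightarrow> 'x) \<Rightarrow>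
    ('k, 'x \<Rightarrow> 'k, 'g) gmod" where
  "permutation_module K X \<alpha> =
    \<lparr>carrier = {\<phi>. (\<forall>x. \<phi> x \<in> carrier K) \<and> (\<forall>x. x \<notin> X \<longrightarrow> \<phi> x = \<zero>\<^bsub>K\<^esub>)
        \<and> finite {x. \<phi> x \<noteq> \<zero>\<^bsub>K\<^esub>}},
     monoid.mult = undefined, one = undefined,
     zero = (\<lambda>_. \<zero>\<^bsub>K\<^esub>), add = (\<lambda>\<phi> \<psi> x. \<phi> x \<oplus>\<^bsub>K\<^esub> \<psi> x),
     smult = (\<lambda>r \<phi> x. r \<otimes>\<^bsub>K\<^esub> \<phi> x),
     act = (\<lambda>g. free_map K (\<alpha> g))\<rparr>"

text \<open>Finitely generated \<open>p\<close>-permutation modules: modules isomorphic to a direct summand \<open>A\<close>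
  (with complement \<open>B\<close>) of the permutation module on a finite \<open>G\<close>-set. Every finite \<open>G\<close>-set is
  isomorphic to one whose elements are natural numbers.\<close>

definition p_permutation :: "('k, 'z) ring_scheme \<Rightarrow> ('g, 'y) monoid_scheme \<Rightarrow>
    ('k, 'm, 'g) gmod \<Rightarrow> bool" where
  "p_permutation K G M \<longleftrightarrow> kG_module K G M \<and>
    (\<exists>(X :: nat set) \<alpha>. finite X \<and> group_action G X \<alpha> \<and>
      (let P = permutation_module K X \<alpha> in
       \<exists>A B. kG_submodule K G P A \<and> kG_submodule K G P B \<and>
         A \<inter> B = {\<zero>\<^bsub>P\<^esub>} \<and> A <+>\<^bsub>P\<^esub> B = carrier P \<and>
         (\<exists>f \<in> kG_hom K G M (P\<lparr>carrier := A\<rparr>). bij_betw f (carrier M) A)))"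

section \<open>Complexes and the homotopy category\<close>

text \<open>Homological grading: \<open>bd C n\<close> goes from degree \<open>n\<close> to degree \<open>n - 1\<close>.\<close>

record ('k, 'm, 'g) gcomplex =
  ob :: "int \<Rightarrow> ('k, 'm, 'g) gmod"
  bd :: "int \<Rightarrow> 'm \<Rightarrow> 'm"

definition kG_complex :: "('k, 'z) ring_scheme \<Rightarrow> ('g, 'y) monoid_scheme \<Rightarrow>
    ('k, 'm, 'g) gcomplex \<Rightarrow> bool" where
  "kG_complex K G C \<longleftrightarrow>
    (\<forall>n. kG_module K G (ob C n) \<and> bd C n \<in> kG_hom K G (ob C n) (ob C (n - 1)) \<and>
      (\<forall>x \<in> carrier (ob C n). bd C (n - 1) (bd C n x) = \<zero>\<^bsub>ob C (n - 2)\<^esub>))"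

definition p_perm_complex :: "('k, 'z) ring_scheme \<Rightarrow> ('g, 'y) monoid_scheme \<Rightarrow>
    ('k, 'm, 'g) gcomplex \<Rightarrow> bool" where
  "p_perm_complex K G C \<longleftrightarrow> kG_complex K G C \<and>
    (\<forall>n. p_permutation K G (ob C n)) \<and>
    finite {n. carrier (ob C n) \<noteq> {\<zero>\<^bsub>ob C n\<^esub>}}"

definition chain_map :: "('k, 'z) ring_scheme \<Rightarrow> ('g, 'y) monoid_scheme \<Rightarrow>
    ('k, 'm, 'g) gcomplex \<Rightarrow> ('k, 'n, 'g) gcomplex \<Rightarrow> (int \<Rightarrow> 'm \<Rightarrow> 'n) \<Rightarrow> bool" where
  "chain_map K G C D f \<longleftrightarrow>
    (\<forall>n. f n \<in> kG_hom K G (ob C n) (ob D n) \<and>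
      (\<forall>x \<in> carrier (ob C n). f (n - 1) (bd C n x) = bd D n (f n x)))"

definition homotopic :: "('k, 'z) ring_scheme \<Rightarrow> ('g, 'y) monoid_scheme \<Rightarrow>
    ('k, 'm, 'g) gcomplex \<Rightarrow> ('k, 'n, 'g) gcomplex \<Rightarrow>
    (int \<Rightarrow> 'm \<Rightarrow> 'n) \<Rightarrow> (int \<Rightarrow> 'm \<Rightarrow> 'n) \<Rightarrow> bool" where
  "homotopic K G C D f g \<longleftrightarrow>
    (\<exists>s. (\<forall>n. s n \<in> kG_hom K G (ob C n) (ob D (n + 1))) \<and>
      (\<forall>n. \<forall>x \<in> carrier (ob C n).
        f n x \<ominus>\<^bsub>ob D n\<^esub> g n x = bd D (n + 1) (s n x) \<oplus>\<^bsub>ob D n\<^esub> s (n - 1) (bd C n x)))"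

text \<open>Isomorphism in the homotopy category.\<close>

definition homotopy_equivalent :: "('k, 'z) ring_scheme \<Rightarrow> ('g, 'y) monoid_scheme \<Rightarrow>
    ('k, 'm, 'g) gcomplex \<Rightarrow> ('k, 'n, 'g) gcomplex \<Rightarrow> bool" where
  "homotopy_equivalent K G C D \<longleftrightarrow>
    (\<exists>f g. chain_map K G C D f \<and> chain_map K G D C g \<and>
      homotopic K G C C (\<lambda>n. g n \<circ> f n) (\<lambda>n. id) \<and>
      homotopic K G D D (\<lambda>n. f n \<circ> g n) (\<lambda>n. id))"

text \<open>\<open>(-1)\<^sup>n x\<close> in the module \<open>M\<close>.\<close>

definition signed :: "('m, 'z) ring_scheme \<Rightarrow> int \<Rightarrow> 'm \<Rightarrow> 'm" where
  "signed M n x = (if even n then x else \<ominus>\<^bsub>M\<^esub> x)"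

definition shift :: "int \<Rightarrow> ('k, 'm, 'g) gcomplex \<Rightarrow> ('k, 'm, 'g) gcomplex" where
  "shift i C =
    \<lparr>ob = (\<lambda>n. ob C (n - i)),
     bd = (\<lambda>n x. signed (ob C (n - 1 - i)) i (bd C (n - i) x))\<rparr>"

definition trivial_module :: "('k, 'z) ring_scheme \<Rightarrow> ('k, 'k, 'g) gmod" where
  "trivial_module K =
    \<lparr>carrier = carrier K, monoid.mult = undefined, one = undefined,
     zero = ring.zero K, add = ring.add K, smult = monoid.mult K, act = (\<lambda>g x. x)\<rparr>"

definition unit_complex :: "('k, 'z) ring_scheme \<Rightarrow> ('k, 'k, 'g) gcomplex" where
  "unit_complex K =
    \<lparr>ob = (\<lambda>n. if n = 0 then trivial_module K
               else (trivial_module K)\<lparr>carrier := {\<zero>\<^bsub>K\<^esub>}\<rparr>),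
     bd = (\<lambda>n x. \<zero>\<^bsub>K\<^esub>)\<rparr>"

text \<open>The tensor product over \<open>K\<close> is the free module on \<open>carrier M \<times> carrier N\<close> (with diagonal
  action) modulo the bilinearity relations.\<close>

definition pairs_module :: "('k, 'z) ring_scheme \<Rightarrow> ('k, 'm, 'g) gmod \<Rightarrow> ('k, 'n, 'g) gmod \<Rightarrow>
    ('k, 'm \<times> 'n \<Rightarrow> 'k, 'g) gmod" where
  "pairs_module K M N =
    permutation_module K (carrier M \<times> carrier N) (\<lambda>g. map_prod (act M g) (act N g))"

definition bilinear_rels :: "('k, 'z) ring_scheme \<Rightarrow> ('k, 'm, 'g) gmod \<Rightarrow> ('k, 'n, 'g) gmod \<Rightarrow>
    ('m \<times> 'n \<Rightarrow> 'k) set" where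
  "bilinear_rels K M N =
    (let F = pairs_module K M N; e = (\<lambda>x y. free_basis K (x, y)) in
     module_span K F
      ({e (x \<oplus>\<^bsub>M\<^esub> x') y \<ominus>\<^bsub>F\<^esub> (e x y \<oplus>\<^bsub>F\<^esub> e x' y) | x x' y.
          x \<in> carrier M \<and> x' \<in> carrier M \<and> y \<in> carrier N} \<union>
       {e x (y \<oplus>\<^bsub>N\<^esub> y') \<ominus>\<^bsub>F\<^esub> (e x y \<oplus>\<^bsub>F\<^esub> e x y') | x y y'.
          x \<in> carrier M \<and> y \<in> carrier N \<and> y' \<in> carrier N} \<union>
       {e (r \<odot>\<^bsub>M\<^esub> x) y \<ominus>\<^bsub>F\<^esub> (r \<odot>\<^bsub>F\<^esub> e x y) | r x y.
          r \<in> carrier K \<and> x \<in> carrier M \<and> y \<in> carrier N} \<union>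
       {e x (r \<odot>\<^bsub>N\<^esub> y) \<ominus>\<^bsub>F\<^esub> (r \<odot>\<^bsub>F\<^esub> e x y) | r x y.
          r \<in> carrier K \<and> x \<in> carrier M \<and> y \<in> carrier N}))"

definition tensor_module :: "('k, 'z) ring_scheme \<Rightarrow> ('k, 'm, 'g) gmod \<Rightarrow> ('k, 'n, 'g) gmod \<Rightarrow>
    ('k, ('m \<times> 'n \<Rightarrow> 'k) set, 'g) gmod" where
  "tensor_module K M N =
    (let F = pairs_module K M N; R = bilinear_rels K M N in
     quotient_mod F R (\<lambda>g. coset_map F R (act F g)))"

text \<open>The map \<open>f \<otimes> g\<close> into \<open>M' \<otimes> N'\<close>.\<close>

definition tensor_map :: "('k, 'z) ring_scheme \<Rightarrow> ('k, 'm2, 'g) gmod \<Rightarrow> ('k, 'n2, 'g) gmod \<Rightarrow>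
    ('m \<Rightarrow> 'm2) \<Rightarrow> ('n \<Rightarrow> 'n2) \<Rightarrow> ('m \<times> 'n \<Rightarrow> 'k) set \<Rightarrow> ('m2 \<times> 'n2 \<Rightarrow> 'k) set" where
  "tensor_map K M' N' f g =
    coset_map (pairs_module K M' N') (bilinear_rels K M' N') (free_map K (map_prod f g))"

definition direct_sum :: "('i \<Rightarrow> ('k, 'm, 'g) gmod) \<Rightarrow> ('k, 'i \<Rightarrow> 'm, 'g) gmod" where
  "direct_sum N =
    \<lparr>carrier = {u. (\<forall>i. u i \<in> carrier (N i)) \<and> finite {i. u i \<noteq> \<zero>\<^bsub>N i\<^esub>}},
     monoid.mult = undefined, one = undefined,
     zero = (\<lambda>i. \<zero>\<^bsub>N i\<^esub>), add = (\<lambda>u v i. u i \<oplus>\<^bsub>N i\<^esub> v i),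
     smult = (\<lambda>r u i. r \<odot>\<^bsub>N i\<^esub> u i),
     act = (\<lambda>g u i. act (N i) g (u i))\<rparr>"

text \<open>Degree \<open>n\<close> is the direct sum over \<open>i\<close> of \<open>ob C i \<otimes> ob D (n - i)\<close>, and the differential is
  \<open>d (x \<otimes> y) = d x \<otimes> y + (-1)\<^sup>i x \<otimes> d y\<close> for \<open>x\<close> of degree \<open>i\<close>; it is written below by its
  component in \<open>ob C i \<otimes> ob D (n - 1 - i)\<close>.\<close>

definition tensor_complex :: "('k, 'z) ring_scheme \<Rightarrow> ('k, 'm, 'g) gcomplex \<Rightarrow>
    ('k, 'n, 'g) gcomplex \<Rightarrow> ('k, int \<Rightarrow> ('m \<times> 'n \<Rightarrow> 'k) set, 'g) gcomplex" where
  "tensor_complex K C D =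
    \<lparr>ob = (\<lambda>n. direct_sum (\<lambda>i. tensor_module K (ob C i) (ob D (n - i)))),
     bd = (\<lambda>n u i.
       (let T = tensor_module K (ob C i) (ob D (n - 1 - i)) in
        tensor_map K (ob C i) (ob D (n - 1 - i)) (bd C (i + 1)) id (u (i + 1)) \<oplus>\<^bsub>T\<^esub>
        signed T i (tensor_map K (ob C i) (ob D (n - 1 - i)) id (bd D (n - i)) (u i))))\<rparr>"

definition dual_module :: "('k, 'z) ring_scheme \<Rightarrow> ('g, 'y) monoid_scheme \<Rightarrow>
    ('k, 'm, 'g) gmod \<Rightarrow> ('k, 'm \<Rightarrow> 'k, 'g) gmod" where
  "dual_module K G M =
    \<lparr>carrier = {\<phi> \<in> carrier M \<rightarrow>\<^sub>E carrier K.
        (\<forall>x \<in> carrier M. \<forall>y \<in> carrier M. \<phi> (x \<oplus>\<^bsub>M\<^esub> y) = \<phi> x \<oplus>\<^bsub>K\<^esub> \<phi> y) \<and>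
        (\<forall>r \<in> carrier K. \<forall>x \<in> carrier M. \<phi> (r \<odot>\<^bsub>M\<^esub> x) = r \<otimes>\<^bsub>K\<^esub> \<phi> x)},
     monoid.mult = undefined, one = undefined,
     zero = (\<lambda>x \<in> carrier M. \<zero>\<^bsub>K\<^esub>),
     add = (\<lambda>\<phi> \<psi>. \<lambda>x \<in> carrier M. \<phi> x \<oplus>\<^bsub>K\<^esub> \<psi> x),
     smult = (\<lambda>r \<phi>. \<lambda>x \<in> carrier M. r \<otimes>\<^bsub>K\<^esub> \<phi> x),
     act = (\<lambda>g \<phi>. \<lambda>x \<in> carrier M. \<phi> (act M (inv\<^bsub>G\<^esub> g) x))\<rparr>"

text \<open>The differential is the internal-hom one, \<open>d \<phi> = - (-1)\<^sup>n (\<phi> \<circ> d)\<close> for \<open>\<phi>\<close> of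
  degree \<open>n\<close>.\<close>

definition dual_complex :: "('k, 'z) ring_scheme \<Rightarrow> ('g, 'y) monoid_scheme \<Rightarrow>
    ('k, 'm, 'g) gcomplex \<Rightarrow> ('k, 'm \<Rightarrow> 'k, 'g) gcomplex" where
  "dual_complex K G C =
    \<lparr>ob = (\<lambda>n. dual_module K G (ob C (- n))),
     bd = (\<lambda>n \<phi>. \<lambda>x \<in> carrier (ob C (1 - n)). signed K (n + 1) (\<phi> (bd C (1 - n) x)))\<rparr>"

definition endotrivial :: "('k, 'z) ring_scheme \<Rightarrow> ('g, 'y) monoid_scheme \<Rightarrow>
    ('k, 'm, 'g) gcomplex \<Rightarrow> bool" where
  "endotrivial K G C \<longleftrightarrow> p_perm_complex K G C \<and>
    homotopy_equivalent K G (tensor_complex K (dual_complex K G C) C) (unit_complex K)"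

section \<open>Homology\<close>

definition cycles :: "('k, 'm, 'g) gcomplex \<Rightarrow> int \<Rightarrow> 'm set" where
  "cycles C n = {x \<in> carrier (ob C n). bd C n x = \<zero>\<^bsub>ob C (n - 1)\<^esub>}"

definition boundaries :: "('k, 'm, 'g) gcomplex \<Rightarrow> int \<Rightarrow> 'm set" where
  "boundaries C n = bd C (n + 1) ` carrier (ob C (n + 1))"

definition homology :: "('k, 'm, 'g) gcomplex \<Rightarrow> int \<Rightarrow> ('k, 'm set, 'g) gmod" where
  "homology C n =
    quotient_mod ((ob C n)\<lparr>carrier := cycles C n\<rparr>) (boundaries C n)
      (\<lambda>g. coset_map (ob C n) (boundaries C n) (act (ob C n) g))"

definition homology_map :: "('k, 'n, 'g) gcomplex \<Rightarrow> (int \<Rightarrow> 'm \<Rightarrow> 'n) \<Rightarrow>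
    int \<Rightarrow> 'm set \<Rightarrow> 'n set" where
  "homology_map D f n = coset_map (ob D n) (boundaries D n) (f n)"

definition quasi_iso :: "('k, 'z) ring_scheme \<Rightarrow> ('g, 'y) monoid_scheme \<Rightarrow>
    ('k, 'm, 'g) gcomplex \<Rightarrow> ('k, 'n, 'g) gcomplex \<Rightarrow> (int \<Rightarrow> 'm \<Rightarrow> 'n) \<Rightarrow> bool" where
  "quasi_iso K G C D f \<longleftrightarrow> chain_map K G C D f \<and>
    (\<forall>n. bij_betw (homology_map D f n) (carrier (homology C n)) (carrier (homology D n)))"

section \<open>Modular fixed points\<close>

definition weyl_group :: "('g, 'y) monoid_scheme \<Rightarrow> 'g set \<Rightarrow> 'g set monoid" where
  "weyl_group G H = (G\<lparr>carrier := normalizer G H\<rparr>) Mod H"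

definition fixed_points :: "('k, 'm, 'g) gmod \<Rightarrow> 'g set \<Rightarrow> 'm set" where
  "fixed_points M H = {x \<in> carrier M. \<forall>h \<in> H. act M h x = x}"

text \<open>The sum of \<open>h x\<close> over representatives of the cosets \<open>h L\<close> in \<open>H\<close>; on elements fixed by
  \<open>L\<close> the representatives do not matter.\<close>

definition rel_transfer :: "('g, 'y) monoid_scheme \<Rightarrow> ('k, 'm, 'g) gmod \<Rightarrow>
    'g set \<Rightarrow> 'g set \<Rightarrow> 'm \<Rightarrow> 'm" where
  "rel_transfer G M L H x =
    (\<Oplus>\<^bsub>M\<^esub> c \<in> (\<lambda>h. h <#\<^bsub>G\<^esub> L) ` H. act M (SOME g. g \<in> c) x)"

definition proper_transfers :: "('k, 'z) ring_scheme \<Rightarrow> ('g, 'y) monoid_scheme \<Rightarrow>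
    'g set \<Rightarrow> ('k, 'm, 'g) gmod \<Rightarrow> 'm set" where
  "proper_transfers K G H M =
    module_span K M (\<Union>L \<in> {L. subgroup L G \<and> L \<subset> H}. rel_transfer G M L H ` fixed_points M L)"

text \<open>An element of the Weyl group is a coset \<open>c\<close> of \<open>H\<close>, all of whose elements act in the same
  way on fixed points of \<open>H\<close>.\<close>

definition brauer_quotient :: "('k, 'z) ring_scheme \<Rightarrow> ('g, 'y) monoid_scheme \<Rightarrow>
    'g set \<Rightarrow> ('k, 'm, 'g) gmod \<Rightarrow> ('k, 'm set, 'g set) gmod" where
  "brauer_quotient K G H M =
    quotient_mod (M\<lparr>carrier := fixed_points M H\<rparr>) (proper_transfers K G H M)
      (\<lambda>c A. \<Union>g \<in> c. coset_map M (proper_transfers K G H M) (act M g) A)"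

definition brauer_map :: "('k, 'z) ring_scheme \<Rightarrow> ('g, 'y) monoid_scheme \<Rightarrow>
    'g set \<Rightarrow> ('k, 'n, 'g) gmod \<Rightarrow> ('m \<Rightarrow> 'n) \<Rightarrow> 'm set \<Rightarrow> 'n set" where
  "brauer_map K G H N f = coset_map N (proper_transfers K G H N) f"

definition modular_fixed :: "('k, 'z) ring_scheme \<Rightarrow> ('g, 'y) monoid_scheme \<Rightarrow>
    'g set \<Rightarrow> ('k, 'm, 'g) gcomplex \<Rightarrow> ('k, 'm set, 'g set) gcomplex" where
  "modular_fixed K G H C =
    \<lparr>ob = (\<lambda>n. brauer_quotient K G H (ob C n)),
     bd = (\<lambda>n. brauer_map K G H (ob C (n - 1)) (bd C n))\<rparr>"

definition modular_fixed_map :: "('k, 'z) ring_scheme \<Rightarrow> ('g, 'y) monoid_scheme \<Rightarrow>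
    'g set \<Rightarrow> ('k, 'n, 'g) gcomplex \<Rightarrow> (int \<Rightarrow> 'm \<Rightarrow> 'n) \<Rightarrow> int \<Rightarrow> 'm set \<Rightarrow> 'n set" where
  "modular_fixed_map K G H D f = (\<lambda>n. brauer_map K G H (ob D n) (f n))"

section \<open>Marks, effective complexes and forerunners\<close>

text \<open>For endotrivial \<open>C\<close> the homology is nonzero in exactly one degree, so that the description
  is unique.\<close>

definition h_mark :: "('k, 'z) ring_scheme \<Rightarrow> ('g, 'y) monoid_scheme \<Rightarrow>
    ('k, 'm, 'g) gcomplex \<Rightarrow> 'g set \<Rightarrow> int" where
  "h_mark K G C H =
    (THE n. let E = homology (modular_fixed K G H C) n in carrier E \<noteq> {\<zero>\<^bsub>E\<^esub>})"

definition effective :: "('k, 'z) ring_scheme \<Rightarrow> ('g, 'y) monoid_scheme \<Rightarrow>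
    ('k, 'm, 'g) gcomplex \<Rightarrow> bool" where
  "effective K G C \<longleftrightarrow>
    (\<forall>L H. subgroup L G \<and> subgroup H G \<and> L \<subseteq> H \<longrightarrow> h_mark K G C L \<ge> h_mark K G C H)"

text \<open>A morphism of the homotopy category is given by a representing chain map; whether it
  satisfies the second condition does not depend on the representative.\<close>

definition forerunner :: "('k, 'z) ring_scheme \<Rightarrow> ('g, 'y) monoid_scheme \<Rightarrow>
    ('k, 'm, 'g) gcomplex \<Rightarrow> 'g set \<Rightarrow> (int \<Rightarrow> 'k \<Rightarrow> 'm) \<Rightarrow> bool" where
  "forerunner K G C H \<iota> \<longleftrightarrow>
    (let D = shift (- h_mark K G C H) C in
     chain_map K G (unit_complex K) D \<iota> \<and>
     quasi_iso K (weyl_group G H)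
       (modular_fixed K G H (unit_complex K)) (modular_fixed K G H D)
       (modular_fixed_map K G H D \<iota>))"

end

theory Submission
  imports Defs "HOL-Algebra.Generated_Groups" "HOL-Algebra.Multiplicative_Group"
begin

text \<open>Choosing invariant spanning sets of the modules of \<open>C\<close> turns \<open>C\<close> into an idempotent and a
  differential, both \<open>G\<close>-invariant matrices whose rows and columns are permuted by \<open>G\<close>. The Brauer
  quotient at \<open>H\<close> becomes the restriction of the matrices to the indices that \<open>H\<close> fixes, and a
  homotopy equivalence of \<open>C\<^sup>* \<otimes> C\<close> with the ground field shows that each of these restrictions is
  one-dimensional up to homotopy.

  Among the subgroups that contain \<open>H\<close> and have the same mark \<open>h\<close>, let \<open>L\<close> be a largest one. If
  \<open>L \<noteq> G\<close>, then \<open>L\<close> has a larger normalizer \<open>N\<close>. The complex \<open>Hom(\<Psi>\<^sup>L C, C)\<close> is contractible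
  in negative degrees because \<open>C\<close> is effective, so that \<open>\<Psi>\<^sup>L C\<close> maps back to \<open>C\<close> equivariantly,
  and cycles of \<open>\<Psi>\<^sup>L C\<close> can be moved to \<open>C\<close>.\<close>

section \<open>Finitely supported matrices\<close>

text \<open>The cycle that is moved from the restriction at \<open>L\<close> to \<open>C\<close> is
  invariant only under the normalizer \<open>N\<close> of \<open>L\<close>. The sum of its
  translates over the cosets of \<open>N\<close> is invariant under \<open>G\<close>. On indices
  fixed by \<open>L\<close>, the translates by cosets that \<open>L\<close> moves cancel in orbits
  of length divisible by \<open>p\<close>. The coset \<open>N\<close> returns the original class;
  for every other coset that \<open>L\<close> fixes, the contribution factors, after conjugation,
  through the restriction at a subgroup strictly larger than \<open>L\<close>, where the mark is
  smaller, and is a boundary. This is the reason for choosing \<open>L\<close> as large as possible.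
  The class stays nonzero on the way down from \<open>L\<close> to \<open>H\<close>, in steps from
  the normalizer of a subgroup to the subgroup, by equivariant contractions above the common mark.

  The obstacle throughout is that nothing can be averaged over a \<open>p\<close>-group in
  characteristic \<open>p\<close>. Equivariant contractions are therefore built by induction on the
  order of the group: indices moved by the group are treated by their stabilizers, indices fixed by
  it in the Brauer quotient. The idempotent spares a proof that a direct summand of a permutation
  module has an invariant basis.\<close>

typedef (overloaded) ('i, 'a) fmat = "{f :: 'i => 'i => 'a::zero. finite {z. f (fst z) (snd z) ~= 0}}"
 morphisms ent Abs_fmat by (rule exI[of _ "%_ _. 0"]) auto

setup_lifting type_definition_fmat

lemma fmat_eqI: "(!!x y. ent a x y = ent b x y) ==> a = b" by (metis ent_inject ext)

text \<open>One finite set for rows and columns alike: a product with \<open>a\<close> on either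
  side is then a sum over \<open>idx a\<close>.\<close>

definition idx :: "('i, 'a::zero) fmat => 'i set" where "idx a = {x. \<exists>y. ent a x y ~= 0 \<or> ent a y x ~= 0}"

lemma finite_idx [simp]: "finite (idx a)"
proof -
 let ?S = "{z. ent a (fst z) (snd z) ~= 0}"
 have "finite ?S" using ent[of a] by simp
 moreover have "idx a \<subseteq> fst ` ?S \<union> snd ` ?S" unfolding idx_def by (auto simp: image_iff)
 ultimately show ?thesis by (meson finite_UnI finite_imageI finite_subset)
qed

lemma ent_idx: "ent a x y ~= 0 ==> x \<in> idx a & y \<in> idx a" unfolding idx_def by blast

lemma finite_supp_subset:
 assumes "finite Z" "!!x y. f x y ~= 0 ==> x \<in> Z & y \<in> Z"
 shows "finite {z. f (fst z) (snd z) ~= 0}"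
 by (rule finite_subset[of _ "Z \<times> Z"]) (use assms in \<open>auto simp: mem_Times_iff\<close>)

instantiation fmat :: (type, comm_ring_1) ring
begin

lift_definition zero_fmat :: "('a, 'b) fmat" is "%_ _. 0" by simp

lift_definition plus_fmat :: "('a, 'b) fmat => ('a, 'b) fmat => ('a, 'b) fmat" is "%f g x y. f x y + g x y"
proof -
 fix f g :: "'a => 'a => 'b"
 assume "finite {z. f (fst z) (snd z) ~= 0}" "finite {z. g (fst z) (snd z) ~= 0}"
 then show "finite {z. f (fst z) (snd z) + g (fst z) (snd z) ~= 0}"
  by (rule rev_finite_subset[OF finite_UnI]) auto
qed

lift_definition uminus_fmat :: "('a, 'b) fmat => ('a, 'b) fmat" is "%f x y. - f x y" by simp

lift_definition minus_fmat :: "('a, 'b) fmat => ('a, 'b) fmat => ('a, 'b) fmat" is "%f g x y. f x y - g x y"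
proof -
 fix f g :: "'a => 'a => 'b"
 assume "finite {z. f (fst z) (snd z) ~= 0}" "finite {z. g (fst z) (snd z) ~= 0}"
 then show "finite {z. f (fst z) (snd z) - g (fst z) (snd z) ~= 0}"
  by (rule rev_finite_subset[OF finite_UnI]) auto
qed

text \<open>The sum runs over the support of a row, so it is finite over any index type. An infinite
  index type has no unit matrix of finite support; hence the instance is a ring without unit, and
  idempotents take over the role of identities.\<close>

lift_definition times_fmat :: "('a, 'b) fmat => ('a, 'b) fmat => ('a, 'b) fmat"
 is "%f g x y. \<Sum>z\<in>{z. f x z ~= 0}. f x z * g z y"
proof -
 fix f g :: "'a => 'a => 'b"
 assume f: "finite {z. f (fst z) (snd z) ~= 0}" and g: "finite {z. g (fst z) (snd z) ~= 0}"
 let ?Z = "fst ` {z. f (fst z) (snd z) ~= 0} \<times> snd ` {z. g (fst z) (snd z) ~= 0}"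
 have "{z. (\<Sum>w\<in>{w. f (fst z) w ~= 0}. f (fst z) w * g w (snd z)) ~= 0} \<subseteq> ?Z"
 proof
  fix z assume "z \<in> {z. (\<Sum>w\<in>{w. f (fst z) w ~= 0}. f (fst z) w * g w (snd z)) ~= 0}"
  then obtain w where "f (fst z) w * g w (snd z) ~= 0"
   by (metis (mono_tags, lifting) mem_Collect_eq sum.neutral)
  then have "f (fst z) w ~= 0" "g w (snd z) ~= 0" by auto
  then show "z \<in> ?Z" by (force simp: mem_Times_iff image_iff)
 qed
 then show "finite {z. (\<Sum>w\<in>{w. f (fst z) w ~= 0}. f (fst z) w * g w (snd z)) ~= 0}"
  using f g by (meson finite_SigmaI finite_imageI finite_subset)
qed

text \<open>The range of summation is left open because later proofs sum over the indices of one
  degree, or over those fixed by a group, which need not contain \<open>idx\<close> of either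
  factor.\<close>

lemma ent_mult_gen:
 assumes "finite Z" "!!z. ent a x z ~= 0 ==> ent b z y ~= 0 ==> z \<in> Z"
 shows "ent (a * b) x y = (\<Sum>z\<in>Z. ent a x z * ent b z y)"
proof -
 have f: "finite {z. ent a x z ~= 0}" by (rule finite_subset[OF _ finite_idx[of a]]) (auto dest: ent_idx)
 have "ent (a * b) x y = (\<Sum>z\<in>{z. ent a x z ~= 0}. ent a x z * ent b z y)" by transfer simp
 also have "... = (\<Sum>z\<in>{z. ent a x z ~= 0} \<inter> Z. ent a x z * ent b z y)"
  by (rule sum.mono_neutral_right) (use f assms in \<open>auto, metis mult_zero_right\<close>)
 also have "... = (\<Sum>z\<in>Z. ent a x z * ent b z y)" by (rule sum.mono_neutral_left) (use f assms in auto)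
 finally show ?thesis .
qed

lemma ent_mult: "finite Z ==> idx a \<subseteq> Z \<or> idx b \<subseteq> Z ==> ent (a * b) x y = (\<Sum>z\<in>Z. ent a x z * ent b z y)"
 by (rule ent_mult_gen, assumption) (metis ent_idx subsetD)

instance
proof
 fix a b c :: "('a, 'b) fmat"
 show "a + b + c = a + (b + c)" by transfer (simp add: add.assoc)
 show "a + b = b + a" by transfer (simp add: add.commute)
 show "0 + a = a" by transfer simp
 show "- a + a = 0" by transfer simp
 show "a - b = a + - b" by transfer simp
 let ?Z = "idx a \<union> idx b \<union> idx c"
 have m: "ent (u * v) x y = (\<Sum>z\<in>?Z. ent u x z * ent v z y)"
  if "idx u \<subseteq> ?Z \<or> idx v \<subseteq> ?Z" for u v :: "('a, 'b) fmat" and x y using that by (intro ent_mult) auto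
 have m1: "ent (a * v) x y = (\<Sum>z\<in>?Z. ent a x z * ent v z y)" for v x y by (rule m) auto
 have m2: "ent (b * v) x y = (\<Sum>z\<in>?Z. ent b x z * ent v z y)" for v x y by (rule m) auto
 have m3: "ent (v * c) x y = (\<Sum>z\<in>?Z. ent v x z * ent c z y)" for v x y by (rule m) auto
 show "a * b * c = a * (b * c)"
 proof (rule fmat_eqI)
  fix x y
  have "ent (a * b * c) x y = (\<Sum>z\<in>?Z. (\<Sum>w\<in>?Z. ent a x w * ent b w z) * ent c z y)" unfolding m3 m1 ..
  also have "... = (\<Sum>w\<in>?Z. \<Sum>z\<in>?Z. ent a x w * (ent b w z * ent c z y))"
   by (subst sum.swap) (simp add: sum_distrib_right mult.assoc)
  also have "... = (\<Sum>w\<in>?Z. ent a x w * (\<Sum>z\<in>?Z. ent b w z * ent c z y))" by (simp add: sum_distrib_left)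
  also have "... = ent (a * (b * c)) x y" unfolding m1 m2 ..
  finally show "ent (a * b * c) x y = ent (a * (b * c)) x y" .
 qed
 have pl: "ent (u + v) x y = ent u x y + ent v x y" for u v :: "('a, 'b) fmat" and x y by transfer simp
 show "(a + b) * c = a * c + b * c"
  by (rule fmat_eqI) (simp add: pl m3 sum.distrib distrib_right del: sum.union_inter)
 show "a * (b + c) = a * b + a * c" by (rule fmat_eqI) (simp add: pl m1 sum.distrib distrib_left)
qed

end

lemma ent_0 [simp]: "ent 0 x y = 0" by transfer simp
lemma ent_add [simp]: "ent (a + b) x y = ent a x y + ent b x y" by transfer simp
lemma ent_uminus [simp]: "ent (- a) x y = - ent a x y" by transfer simp
lemma ent_minus [simp]: "ent (a - b) x y = ent a x y - ent b x y" by transfer simp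
lemma ent_sum [simp]: "ent (sum f A) x y = (\<Sum>i\<in>A. ent (f i) x y)"
 by (induction A rule: infinite_finite_induct) auto

lemma ent_mult_nz:
 assumes "ent (a * b) x y ~= 0" obtains z where "ent a x z ~= 0" "ent b z y ~= 0"
proof -
 have "(\<Sum>z\<in>idx a. ent a x z * ent b z y) ~= 0" using assms by (simp add: ent_mult[of "idx a"])
 then obtain z where "ent a x z * ent b z y ~= 0" by (meson sum.neutral)
 then show thesis using that by (metis mult_zero_left mult_zero_right)
qed

section \<open>Matrix units, transposes and Kronecker products\<close>

lift_definition single :: "'i => 'i => 'a::zero => ('i, 'a) fmat" is
 "%i j c x y. if x = i & y = j then c else 0"
 by (rule finite_supp_subset[of "{i, j}" for i j]) (auto split: if_splits)

lemma ent_single [simp]: "ent (single i j c) x y = (if x = i & y = j then c else 0)" by transfer simp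

lemma ent_mult_single [simp]: "ent (a * single i j c) x y = (if y = j then ent a x i * c else 0)"
 by (subst ent_mult_gen[of "{i}"]) (auto split: if_splits)

lemma ent_single_mult [simp]: "ent (single i j c * a) x y = (if x = i then c * ent a j y else 0)"
 by (subst ent_mult_gen[of "{j}"]) (auto split: if_splits)

lemma single_mult_single: "single i j c * single k l c' = (if j = k then single i l (c * c') else 0)"
 by (rule fmat_eqI) auto

lift_definition tpose :: "('i, 'a::zero) fmat => ('i, 'a) fmat" is "%f x y. f y x"
proof -
 fix f :: "'i => 'i => 'a"
 assume "finite {z. f (fst z) (snd z) ~= 0}"
 then have "finite (prod.swap ` {z. f (fst z) (snd z) ~= 0})" by simp
 then show "finite {z. f (snd z) (fst z) ~= 0}" by (rule rev_finite_subset) (auto simp: image_iff)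
qed

lemma ent_tpose [simp]: "ent (tpose a) x y = ent a y x" by transfer simp

lemma tpose_tpose [simp]: "tpose (tpose a) = a" by (rule fmat_eqI) simp
lemma tpose_0 [simp]: "tpose 0 = 0" by (rule fmat_eqI) simp
lemma tpose_add: "tpose (a + b) = tpose a + tpose b" by (rule fmat_eqI) simp
lemma tpose_diff: "tpose (a - b) = tpose a - tpose b" by (rule fmat_eqI) simp
lemma tpose_uminus: "tpose (- a) = - tpose a" by (rule fmat_eqI) simp
lemma idx_tpose [simp]: "idx (tpose a) = idx a" by (auto simp: idx_def)
lemma tpose_mult: "tpose (a * b) = tpose b * tpose a"
 by (rule fmat_eqI) (simp add: ent_mult[of "idx a"] mult.commute)

lemma tpose_single [simp]: "tpose (single i j c) = single j i c" by (rule fmat_eqI) auto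

lift_definition kron :: "('i, 'a::comm_ring_1) fmat => ('j, 'a) fmat => ('i \<times> 'j, 'a) fmat" is
 "%f g x y. f (fst x) (fst y) * g (snd x) (snd y)"
proof -
 fix f :: "'i => 'i => 'a" and g :: "'j => 'j => 'a"
 assume f: "finite {z. f (fst z) (snd z) ~= 0}" and g: "finite {z. g (fst z) (snd z) ~= 0}"
 let ?f = "{z. f (fst z) (snd z) ~= 0}" and ?g = "{z. g (fst z) (snd z) ~= 0}"
 have "{z. f (fst (fst z)) (fst (snd z)) * g (snd (fst z)) (snd (snd z)) ~= 0}
   \<subseteq> (%(u, v). ((fst u, fst v), (snd u, snd v))) ` (?f \<times> ?g)" (is "?A \<subseteq> ?h ` _")
 proof
  fix z assume "z \<in> ?A"
  then have "((fst (fst z), fst (snd z)), (snd (fst z), snd (snd z))) \<in> ?f \<times> ?g" by auto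
  then show "z \<in> ?h ` (?f \<times> ?g)" by (rule rev_image_eqI) (auto simp: prod_eq_iff)
 qed
 then show "finite ?A" using f g by (meson finite_SigmaI finite_imageI finite_subset)
qed

lemma ent_kron: "ent (kron a b) x y = ent a (fst x) (fst y) * ent b (snd x) (snd y)" by transfer simp

lemma kron_mult: "kron a b * kron a' b' = kron (a * a') (b * b')"
proof (rule fmat_eqI)
 fix x y
 have "ent (kron a b * kron a' b') x y = (\<Sum>z\<in>idx a \<times> idx b. ent (kron a b) x z * ent (kron a' b') z y)"
  by (rule ent_mult_gen) (auto simp: ent_kron mem_Times_iff, (metis ent_idx mult_zero_left mult_zero_right)+)
 also have "... = (\<Sum>z\<in>idx a. \<Sum>w\<in>idx b. (ent a (fst x) z * ent a' z (fst y)) *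
   (ent b (snd x) w * ent b' w (snd y)))" by (simp add: sum.cartesian_product ent_kron mult_ac split_def)
 also have "... = ent (kron (a * a') (b * b')) x y"
  by (simp add: ent_kron ent_mult[of "idx a"] ent_mult[of "idx b"] sum_product)
 finally show "ent (kron a b * kron a' b') x y = ent (kron (a * a') (b * b')) x y" .
qed

lemma kron_add1: "kron (a + a') b = kron a b + kron a' b" by (rule fmat_eqI) (simp add: ent_kron algebra_simps)
lemma kron_add2: "kron a (b + b') = kron a b + kron a b'" by (rule fmat_eqI) (simp add: ent_kron algebra_simps)
lemma kron_diff1: "kron (a - a') b = kron a b - kron a' b" by (rule fmat_eqI) (simp add: ent_kron algebra_simps)
lemma kron_diff2: "kron a (b - b') = kron a b - kron a b'" by (rule fmat_eqI) (simp add: ent_kron algebra_simps)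
lemma kron_uminus1: "kron (- a) b = - kron a b" by (rule fmat_eqI) (simp add: ent_kron)
lemma kron_uminus2: "kron a (- b) = - kron a b" by (rule fmat_eqI) (simp add: ent_kron)
lemma kron_0_1 [simp]: "kron 0 b = 0" by (rule fmat_eqI) (simp add: ent_kron)
lemma kron_0_2 [simp]: "kron a 0 = 0" by (rule fmat_eqI) (simp add: ent_kron)

lift_definition scale :: "'a::comm_ring_1 => ('i, 'a) fmat => ('i, 'a) fmat" is "%c f x y. c * f x y"
 by (erule rev_finite_subset) auto

lemma ent_scale [simp]: "ent (scale c a) x y = c * ent a x y" by transfer simp

subsection \<open>Gradings\<close>

text \<open>The operator \<open>(-1)^deg\<close>, applied from the left. Koszul signs are kept in
  this operator, which is moved through products, instead of in case distinctions by degree.\<close>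

lift_definition sg :: "('i => int) => ('i, 'a::comm_ring_1) fmat => ('i, 'a) fmat" is
 "%dg f x y. if even (dg x) then f x y else - f x y" by (erule rev_finite_subset) auto

lift_definition part :: "('i => int) => int => ('i, 'a::comm_ring_1) fmat => ('i, 'a) fmat" is
 "%dg k f x y. if dg x = dg y + k then f x y else 0" by (erule rev_finite_subset) auto

lemma ent_sg: "ent (sg dg a) x y = (if even (dg x) then ent a x y else - ent a x y)" by transfer simp
lemma ent_part: "ent (part dg k a) x y = (if dg x = dg y + k then ent a x y else 0)" by transfer simp

definition homg :: "('i => int) => int => ('i, 'a::zero) fmat => bool" where
 "homg dg k a \<longleftrightarrow> (\<forall>x y. ent a x y ~= 0 --> dg x = dg y + k)"

lemma homgD: "homg dg k a ==> ent a x y ~= 0 ==> dg x = dg y + k" by (simp add: homg_def)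

lemma homg_0 [simp]: "homg dg k 0" by (simp add: homg_def)
lemma homg_add: "homg dg k a ==> homg dg k b ==> homg dg k (a + b)" unfolding homg_def by (metis add_0 ent_add)
lemma homg_diff: "homg dg k a ==> homg dg k b ==> homg dg k (a - b)"
 for a :: "('i, 'a::comm_ring_1) fmat" unfolding homg_def by (metis diff_self ent_minus)
lemma homg_uminus [simp]: "homg dg k (- a) = homg dg k a" for a :: "('i, 'a::comm_ring_1) fmat"
 unfolding homg_def by simp
lemma homg_mult: "homg dg k a ==> homg dg l b ==> m = k + l ==> homg dg m (a * b)"
 unfolding homg_def by (auto elim!: ent_mult_nz)
lemma homg_tpose: "homg (%x. - dg x) k (tpose a) = homg dg k a" unfolding homg_def by fastforce
lemma homg_sg [simp]: "homg dg k (sg dg a) = homg dg k a" unfolding homg_def by (auto simp: ent_sg)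
lemma homg_part [simp]: "homg dg k (part dg k a)" unfolding homg_def by (auto simp: ent_part)
lemma part_homg: "homg dg k a ==> part dg k a = a" by (rule fmat_eqI) (auto simp: ent_part dest: homgD)
lemma sg_sg [simp]: "sg dg (sg dg a) = a" by (rule fmat_eqI) (simp add: ent_sg)
lemma sg_0 [simp]: "sg dg 0 = 0" by (rule fmat_eqI) (simp add: ent_sg)
lemma sg_add: "sg dg (a + b) = sg dg a + sg dg b" by (rule fmat_eqI) (simp add: ent_sg)
lemma sg_diff: "sg dg (a - b) = sg dg a - sg dg b" by (rule fmat_eqI) (simp add: ent_sg)
lemma sg_uminus: "sg dg (- a) = - sg dg a" by (rule fmat_eqI) (simp add: ent_sg)
lemma sg_mult: "sg dg a * b = sg dg (a * b)" by (rule fmat_eqI) (simp add: ent_sg ent_mult[of "idx b"] sum_negf)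
text \<open>Together with \<open>mult_sg_odd\<close> this is the Koszul rule: an entry of a matrix
  of degree \<open>k\<close> connects rows whose degrees differ by \<open>k\<close>, so passing the
  sign operator costs \<open>(-1)^k\<close>.\<close>

lemma mult_sg_even:
 assumes "homg dg k a" "even k" shows "a * sg dg b = sg dg (a * b)"
proof (rule fmat_eqI)
 fix x y
 have "ent a x z * ent (sg dg b) z y = (if even (dg x) then 1 else - 1) * (ent a x z * ent b z y)" for z
  using homgD[OF assms(1), of x z] \<open>even k\<close> by (cases "ent a x z = 0") (auto simp: ent_sg)
 then show "ent (a * sg dg b) x y = ent (sg dg (a * b)) x y"
  by (simp add: ent_mult[of "idx a"] ent_sg sum_distrib_left[symmetric])
qed
lemma mult_sg_odd:
 assumes "homg dg k a" "odd k" shows "a * sg dg b = - sg dg (a * b)"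
proof (rule fmat_eqI)
 fix x y
 have "ent a x z * ent (sg dg b) z y = (if even (dg x) then - 1 else 1) * (ent a x z * ent b z y)" for z
  using homgD[OF assms(1), of x z] \<open>odd k\<close> by (cases "ent a x z = 0") (auto simp: ent_sg)
 then show "ent (a * sg dg b) x y = ent (- sg dg (a * b)) x y"
  by (simp add: ent_mult[of "idx a"] ent_sg sum_distrib_left[symmetric])
qed

text \<open>Multiplication by a homogeneous matrix merely shifts homogeneous components. An ungraded
  solution of an equation such as \<open>d * s * d = d\<close> can thus be replaced by its component
  of the right degree.\<close>

lemma part_mult_left:
 assumes "homg dg k a" shows "a * part dg l b = part dg (k + l) (a * b)"
proof (rule fmat_eqI)
 fix x y
 have "ent a x z * ent (part dg l b) z y = (if dg x = dg y + (k + l) then ent a x z * ent b z y else 0)" for z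
  using homgD[OF assms, of x z] by (cases "ent a x z = 0") (auto simp: ent_part)
 then show "ent (a * part dg l b) x y = ent (part dg (k + l) (a * b)) x y"
  by (simp add: ent_mult[of "idx a"] ent_part)
qed
lemma part_mult_right:
 assumes "homg dg k a" shows "part dg l b * a = part dg (k + l) (b * a)"
proof (rule fmat_eqI)
 fix x y
 have "ent (part dg l b) x z * ent a z y = (if dg x = dg y + (k + l) then ent b x z * ent a z y else 0)" for z
  using homgD[OF assms, of z y] by (cases "ent a z y = 0") (auto simp: ent_part)
 then show "ent (part dg l b * a) x y = ent (part dg (k + l) (b * a)) x y"
  by (simp add: ent_mult[of "idx a"] ent_part)
qed

subsection \<open>Matrices as vectors\<close>

text \<open>A linear map as an element of \<open>Hom(P, Q)\<close>, which has one index for each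
  pair of a source and a target index; this is why the entries are read in transposed order. An
  element of a module is a matrix with a single column, here the one at
  \<open>(pt, pt)\<close>.\<close>

lift_definition vec :: "'i => ('i, 'a::zero) fmat => ('i \<times> 'i, 'a) fmat" is
 "%pt f x y. if y = (pt, pt) then f (snd x) (fst x) else 0"
proof -
 fix pt and f :: "'i => 'i => 'a"
 assume f: "finite {z. f (fst z) (snd z) ~= 0}"
 have "{z. (if snd z = (pt, pt) then f (snd (fst z)) (fst (fst z)) else 0) ~= 0}
   \<subseteq> (%z. (prod.swap z, (pt, pt))) ` {z. f (fst z) (snd z) ~= 0}" by (auto simp: image_iff split: if_splits)
 then show "finite {z. (if snd z = (pt, pt) then f (snd (fst z)) (fst (fst z)) else 0) ~= 0}"
  using f by (meson finite_imageI finite_subset)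
qed

lift_definition unvec :: "'i => ('i \<times> 'i, 'a::zero) fmat => ('i, 'a) fmat" is "%pt f y x. f (x, y) (pt, pt)"
proof -
 fix pt and f :: "'i \<times> 'i => 'i \<times> 'i => 'a"
 assume f: "finite {z. f (fst z) (snd z) ~= 0}"
 have "{z. f (snd z, fst z) (pt, pt) ~= 0} \<subseteq> (%z. prod.swap (fst z)) ` {z. f (fst z) (snd z) ~= 0}"
  by (force simp: image_iff)
 then show "finite {z. f (snd z, fst z) (pt, pt) ~= 0}" using f by (meson finite_imageI finite_subset)
qed

lemma ent_vec: "ent (vec pt a) x y = (if y = (pt, pt) then ent a (snd x) (fst x) else 0)" by transfer simp
lemma ent_unvec: "ent (unvec pt b) y x = ent b (x, y) (pt, pt)" by transfer simp
lemma unvec_vec [simp]: "unvec pt (vec pt a) = a" by (rule fmat_eqI) (simp add: ent_vec ent_unvec)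
lemma vec_eq_iff: "vec pt a = vec pt b \<longleftrightarrow> a = b" by (metis unvec_vec)
lemma vec_0 [simp]: "vec pt 0 = 0" by (rule fmat_eqI) (simp add: ent_vec)
lemma vec_add: "vec pt (a + b) = vec pt a + vec pt b" by (rule fmat_eqI) (simp add: ent_vec)
lemma vec_diff: "vec pt (a - b) = vec pt a - vec pt b" by (rule fmat_eqI) (simp add: ent_vec)
text \<open>The classical vectorization identity, through which Kronecker products act on
  \<open>Hom\<close> by composition from both sides.\<close>

lemma kron_vec: "kron (tpose c) b * vec pt a = vec pt (b * a * c)"
 for a :: "('i, 'a::comm_ring_1) fmat"
proof (rule fmat_eqI)
 fix x y
 have "ent (kron (tpose c) b * vec pt a) x y
   = (\<Sum>z\<in>idx c \<times> idx b. ent (kron (tpose c) b) x z * ent (vec pt a) z y)"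
  by (rule ent_mult_gen) (auto simp: ent_kron mem_Times_iff, (metis ent_idx mult_zero_left mult_zero_right)+)
 also have "... = (\<Sum>z\<in>idx c. \<Sum>w\<in>idx b. ent c z (fst x) * ent b (snd x) w * ent (vec pt a) (z, w) y)"
  by (simp add: sum.cartesian_product ent_kron split_def)
 also have "... = (if y = (pt, pt) then
   (\<Sum>z\<in>idx c. (\<Sum>w\<in>idx b. ent b (snd x) w * ent a w z) * ent c z (fst x)) else 0)"
  by (simp add: ent_vec sum_distrib_right sum_distrib_left mult_ac)
 also have "... = ent (vec pt (b * a * c)) x y"
  by (simp add: ent_vec ent_mult[of "idx c" "b * a" c] ent_mult[of "idx b" b])
 finally show "ent (kron (tpose c) b * vec pt a) x y = ent (vec pt (b * a * c)) x y" .
qed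

section \<open>Linear algebra over a corner that is a field\<close>

text \<open>A field whose elements form a carrier set enters as the corner \<open>e R\<close> of a
  commutative ring \<open>R\<close> that is a whole type; \<open>e\<close> acts as its unit. Sums
  and matrix products are then those of the type, without closure conditions.\<close>

locale corner_field =
 fixes e :: "'a::comm_ring_1" and p :: nat
 assumes prime_p: "prime p" and idem: "e * e = e" and e_nz: "e ~= 0"
  and corner_inverse: "e * x = x ==> x ~= 0 ==> \<exists>y. e * y = y & x * y = e" and char_p: "of_nat p * e = 0"
begin

definition cor :: "('i, 'a) fmat => bool" where "cor a \<longleftrightarrow> (\<forall>x y. e * ent a x y = ent a x y)"

lemma corD: "cor a ==> e * ent a x y = ent a x y" "cor a ==> ent a x y * e = ent a x y"
 by (simp_all add: cor_def mult.commute)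
lemma cor_0 [simp]: "cor 0" by (simp add: cor_def)
lemma cor_add: "cor a ==> cor b ==> cor (a + b)" by (simp add: cor_def distrib_left)
lemma cor_diff: "cor a ==> cor b ==> cor (a - b)" by (simp add: cor_def right_diff_distrib)
lemma cor_uminus [simp]: "cor (- a) = cor a" by (simp add: cor_def)
lemma cor_mult: "cor a ==> cor (a * b)"
 by (simp add: cor_def ent_mult[of "idx b"] sum_distrib_left mult.assoc[symmetric])
lemma cor_mult2: "cor b ==> cor (a * b)"
 by (simp add: cor_def ent_mult[of "idx b"] sum_distrib_left mult.left_commute[of e])
lemma cor_sum: "(!!i. i \<in> A ==> cor (f i)) ==> cor (sum f A)"
 by (induction A rule: infinite_finite_induct) (auto intro: cor_add)
lemma cor_single: "e * c = c ==> cor (single i j c)" by (simp add: cor_def)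
lemma cor_tpose [simp]: "cor (tpose a) = cor a" by (auto simp: cor_def)
lemma cor_sg [simp]: "cor (sg dg a) = cor a" by (auto simp: cor_def ent_sg)
lemma cor_part: "cor a ==> cor (part dg k a)" by (simp add: cor_def ent_part)
lemma cor_kron: "cor a ==> cor (kron a b)" by (simp add: cor_def ent_kron mult.assoc[symmetric])
lemma cor_vec: "cor a ==> cor (vec pt a)" by (simp add: cor_def ent_vec)
lemma cor_unvec: "cor a ==> cor (unvec pt a)" by (simp add: cor_def ent_unvec)

lemmas cor_intros = cor_add cor_diff cor_mult cor_mult2 cor_single cor_part cor_kron cor_vec cor_unvec

text \<open>McCoy's lemma: if \<open>a - a t a\<close> is regular, so is \<open>a\<close>. Clearing the row of a pivot leaves
 fewer nonzero rows.\<close>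

lemma fmat_regular: "cor a ==> \<exists>b. cor b & a * b * a = a"
proof (induction "card {x. \<exists>y. ent a x y ~= 0}" arbitrary: a rule: less_induct)
 case less
 show ?case
 proof (cases "a = 0")
  case True
  then show ?thesis by (intro exI[of _ 0]) simp
 next
  case False
  then obtain x y where xy: "ent a x y ~= 0" by (metis ent_0 fmat_eqI)
  \<comment> \<open>\<open>c\<close> inverts the pivot and \<open>t\<close> places it at the
    transposed position. So \<open>a * t * a\<close> agrees with \<open>a\<close> on the row
    \<open>x\<close> of the pivot and vanishes on all zero rows of \<open>a\<close>.\<close>
  obtain c where c: "e * c = c" "ent a x y * c = e" using corner_inverse[OF _ xy] corD[OF less.prems] by metis
  define t where "t = single y x c"
  define a' where "a' = a - a * t * a"
  have ent': "ent a' r s = ent a r s - ent a r y * c * ent a x s" for r s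
  proof -
   have "ent (a * t * a) r s = (\<Sum>z\<in>{x}. ent (a * t) r z * ent a z s)"
    by (rule ent_mult_gen) (auto simp: t_def split: if_splits)
   then show ?thesis by (simp add: a'_def t_def)
  qed
  have fin: "finite {x. \<exists>y. ent a x y ~= 0}"
   by (rule finite_subset[OF _ finite_idx[of a]]) (auto dest: ent_idx)
  have "ent a' x s = 0" for s using c corD(1)[OF less.prems, of x s] by (simp add: ent')
  moreover have "ent a' r s = 0" if "\<forall>y. ent a r y = 0" for r s using that by (simp add: ent')
  ultimately have "{x. \<exists>y. ent a' x y ~= 0} \<subset> {x. \<exists>y. ent a x y ~= 0}" using xy by blast
  then have "card {x. \<exists>y. ent a' x y ~= 0} < card {x. \<exists>y. ent a x y ~= 0}"
   using fin by (rule psubset_card_mono[rotated])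
  moreover have "cor a'" by (simp add: a'_def cor_intros less.prems)
  ultimately obtain b where b: "cor b" "a' * b * a' = a'" using less.hyps by blast
  \<comment> \<open>Expanding \<open>a' * b * a'\<close> and taking out one factor \<open>a\<close>
    on each side leaves exactly the four terms other than \<open>t\<close>.\<close>
  define r where "r = t + b - t * a * b - b * a * t + t * a * b * a * t"
  have "a * r * a = a * t * a + a' * b * a'" by (simp add: r_def a'_def algebra_simps)
  also have "... = a" unfolding b(2) by (simp add: a'_def)
  finally have "a * r * a = a" .
  moreover have "cor r" by (simp add: r_def cor_intros b t_def c)
  ultimately show ?thesis by blast
 qed
qed

text \<open>The ground field is modelled by an additional index \<open>pt\<close>: a vector is a
  matrix supported in the column \<open>pt\<close>, a functional one supported in the row
  \<open>pt\<close>, and \<open>upt pt\<close> is the identity of the field.\<close>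

definition upt :: "'i => ('i, 'a) fmat" where "upt pt = single pt pt e"

lemma cor_upt [simp]: "cor (upt pt)" by (simp add: upt_def cor_single idem)
lemma upt_nz: "upt pt ~= 0" by (metis (full_types) e_nz ent_0 ent_single upt_def)
lemma upt_idem [simp]: "upt pt * upt pt = upt pt" by (simp add: upt_def single_mult_single idem)
lemma mult_upt: "cor a ==> ent (a * upt pt) x y = (if y = pt then ent a x y else 0)"
 by (auto simp: upt_def corD)
lemma upt_mult: "cor a ==> ent (upt pt * a) x y = (if x = pt then ent a x y else 0)"
 by (auto simp: upt_def corD)
lemma col_iff: "cor a ==> a * upt pt = a \<longleftrightarrow> (\<forall>x y. y ~= pt --> ent a x y = 0)" by (metis fmat_eqI mult_upt)
lemma upt_scalar: "cor a ==> upt pt * a * upt pt = single pt pt (ent a pt pt)"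
 by (rule fmat_eqI) (auto simp: mult_upt upt_mult cor_mult2 cor_mult)

text \<open>\<open>eps\<close> stands for the identity: the modules of the complex are the images of
  an idempotent matrix, cut into degrees by the grading of the indices.\<close>

definition cplx :: "('i => int) => ('i, 'a) fmat => ('i, 'a) fmat => bool" where
 "cplx dg eps d \<longleftrightarrow> cor eps & cor d & eps * eps = eps & eps * d = d & d * eps = d &
  d * d = 0 & homg dg 0 eps & homg dg (- 1) d"

text \<open>\<open>v\<close> includes the field in degree \<open>h\<close>, \<open>w\<close>
  projects to it, and \<open>s\<close> is the homotopy. The composite \<open>w * v\<close> is the
  identity on the nose; only the other one is the identity up to homotopy.\<close>

definition retracts :: "('i => int) => 'i => ('i, 'a) fmat => ('i, 'a) fmat => int =>
  ('i, 'a) fmat => ('i, 'a) fmat => ('i, 'a) fmat => bool" where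
 "retracts dg pt eps d h s v w \<longleftrightarrow> cor s & cor v & cor w & homg dg 1 s & homg dg h v & homg dg (- h) w &
  eps * s = s & s * eps = s & v * upt pt = v & upt pt * w = w & eps * v = v & w * eps = w &
  d * v = 0 & w * d = 0 & w * v = upt pt & d * s + s * d = eps - v * w"

text \<open>A homotopy equivalence with the ground field placed in degree \<open>h\<close>.\<close>

definition sphere :: "('i => int) => 'i => ('i, 'a) fmat => ('i, 'a) fmat => int => bool" where
 "sphere dg pt eps d h \<longleftrightarrow> (\<exists>s v w. retracts dg pt eps d h s v w)"

definition hom_eps :: "('i, 'a) fmat => ('j, 'a) fmat => ('i \<times> 'j, 'a) fmat" where
 "hom_eps eps eps' = kron (tpose eps) eps'"

text \<open>With the sign operator \<open>\<sigma> = sg dg eps\<close>, the image of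
  \<open>vec a\<close> is \<open>vec\<close> of
  \<open>d' * (a * \<sigma>) - eps' * (a * \<sigma>) * d\<close>: the usual commutator, applied to
  \<open>a * \<sigma>\<close>. These signs are the ones that the tensor product with the dual
  complex has.\<close>

definition hom_d :: "('i => int) => ('i, 'a) fmat => ('i, 'a) fmat =>
  ('j, 'a) fmat => ('j, 'a) fmat => ('i \<times> 'j, 'a) fmat" where "hom_d dg eps d eps' d' =
  kron (tpose (- sg dg d)) eps' + kron (tpose (sg dg eps)) d'"

definition hom_deg :: "('i => int) => ('j => int) => 'i \<times> 'j => int" where
 "hom_deg dg dg' z = dg' (snd z) - dg (fst z)"

lemma homg_kron_tpose:
 "homg dg k a ==> homg dg' l b ==> m = k + l ==> homg (hom_deg dg dg') m (kron (tpose a) b)"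
 unfolding homg_def ent_kron hom_deg_def ent_tpose by (smt (verit) mult_zero_left mult_zero_right)

lemma cplx_hom:
 assumes "cplx dg eps d" "cplx dg' eps' d'"
 shows "cplx (hom_deg dg dg') (hom_eps eps eps') (hom_d dg eps d eps' d')"
proof -
 note [simp] = assms[unfolded cplx_def]
 have sg: "eps * sg dg eps = sg dg eps" "eps * sg dg d = sg dg d" "d * sg dg d = 0" "d * sg dg eps = - sg dg d"
  using mult_sg_even[of dg 0 eps] mult_sg_odd[of dg "-1" d] by simp_all
 have "homg (hom_deg dg dg') (-1) (hom_d dg eps d eps' d')"
  unfolding hom_d_def by (intro homg_add homg_kron_tpose[of dg "-1" _ dg' 0]
    homg_kron_tpose[of dg 0 _ dg' "-1"]) simp_all
 moreover have "homg (hom_deg dg dg') 0 (hom_eps eps eps')"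
  unfolding hom_eps_def by (rule homg_kron_tpose[of dg 0 _ dg' 0]) simp_all
 ultimately show ?thesis by (simp add: cplx_def hom_eps_def hom_d_def cor_intros kron_mult algebra_simps
    tpose_mult[symmetric] tpose_uminus kron_uminus1 sg_mult sg sg_uminus)
qed

lemma sphere_hom:
 assumes P: "cplx dg eps d" and Q: "cplx dg' eps' d'"
  and a: "sphere dg pt eps d a" and b: "sphere dg' pt' eps' d' b"
 shows "sphere (hom_deg dg dg') (pt, pt') (hom_eps eps eps') (hom_d dg eps d eps' d') (b - a)"
proof -
 obtain s v w where 1: "retracts dg pt eps d a s v w" using a by (auto simp: sphere_def)
 obtain s' v' w' where 2: "retracts dg' pt' eps' d' b s' v' w'" using b by (auto simp: sphere_def)
 note P' [simp] = P[unfolded cplx_def] and Q' [simp] = Q[unfolded cplx_def]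
 note R [simp] = 1[unfolded retracts_def] and R' [simp] = 2[unfolded retracts_def]
 have [simp]: "homg dg 1 s" "homg dg (- 1) d" "homg dg 0 eps" by simp_all
 have vw: "homg dg 0 (v * w)" by (rule homg_mult[of _ a _ "- a"]) simp_all
 have sg: "eps * sg dg x = sg dg (eps * x)" "d * sg dg x = - sg dg (d * x)"
  "s * sg dg x = - sg dg (s * x)" for x
  using mult_sg_even[of dg 0 eps x] mult_sg_odd[of dg "-1" d x] mult_sg_odd[of dg 1 s x] by simp_all
 have sgvw: "v * (w * sg dg x) = sg dg (v * (w * x))" for x
  using mult_sg_even[OF vw, of x] by (simp add: mult.assoc)
 have ds: "d * s = eps - v * w - s * d" and ds': "d' * s' = eps' - v' * w' - s' * d'"
  by (metis R add_diff_cancel_right' retracts_def) (metis R' add_diff_cancel_right' retracts_def)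
 have dv: "d * (v * x) = 0" "eps * (v * x) = v * x" for x by (simp_all add: mult.assoc[symmetric])
 have dv': "d' * (v' * x) = 0" "eps' * (v' * x) = v' * x" for x by (simp_all add: mult.assoc[symmetric])
 \<comment> \<open>The homotopy of a tensor product: contract the first factor, and on what remains
   of it, namely \<open>v * w\<close>, contract the second one. The sign operators make the mixed
   terms cancel.\<close>
 define \<sigma> where "\<sigma> = kron (tpose (- (s * sg dg eps))) eps' + kron (tpose (sg dg eps * (v * w))) s'"
 define V where "V = kron (tpose w) v'"
 define W where "W = kron (tpose v) w'"
 let ?d = "hom_d dg eps d eps' d'" and ?e = "hom_eps eps eps'"
 have "?d * \<sigma> + \<sigma> * ?d = ?e - V * W" unfolding hom_d_def \<sigma>_def hom_eps_def V_def W_def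
  by (simp add: kron_mult algebra_simps tpose_mult[symmetric] tpose_uminus kron_uminus1
    kron_uminus2 sg_mult sg sgvw sg_uminus ds ds' dv dv' sg_diff sg_add tpose_diff tpose_add
    kron_diff1 kron_diff2 kron_add1 kron_add2)
 moreover have "homg (hom_deg dg dg') 1 \<sigma>" unfolding \<sigma>_def
  by (intro homg_add homg_kron_tpose[of dg 1 _ dg' 0] homg_kron_tpose[of dg 0 _ dg' 1])
   (simp_all add: sg sg_mult dv vw)
 moreover have "homg (hom_deg dg dg') (b - a) V"
  unfolding V_def by (rule homg_kron_tpose[of dg "- a" _ dg' b]) simp_all
 moreover have "homg (hom_deg dg dg') (- (b - a)) W"
  unfolding W_def by (rule homg_kron_tpose[of dg a _ dg' "- b"]) simp_all
 moreover have up: "upt (pt, pt') = kron (tpose (upt pt)) (upt pt')"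
  by (rule fmat_eqI) (auto simp: upt_def ent_kron idem)
 moreover have "w * sg dg d = 0"
  using mult_sg_even[of dg "- a" w d] mult_sg_odd[of dg "- a" w d] by (cases "even a") simp_all
 ultimately have "retracts (hom_deg dg dg') (pt, pt') ?e ?d (b - a) \<sigma> V W" unfolding retracts_def
  apply (intro conjI)
  apply (simp_all add: \<sigma>_def V_def W_def cor_intros)
  apply (simp_all add: hom_eps_def hom_d_def kron_mult tpose_mult[symmetric] algebra_simps
    sg sg_mult dv tpose_uminus kron_uminus1)
  done
 then show ?thesis by (auto simp: sphere_def)
qed

text \<open>If \<open>P\<^sup>* \<otimes> P\<close> is one-dimensional up to homotopy, then so is \<open>P\<close>: evaluating a cycle of
 the form \<open>\<alpha> \<otimes> b\<close> at a cycle \<open>a\<close> with \<open>\<alpha>(a) = 1\<close> shows that every cycle \<open>b\<close> is homologous to a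
 multiple of \<open>a\<close>.\<close>

lemma sphere_if_sphere_hom:
 assumes P: "cplx dg eps d" and deg0: "dg pt = 0"
  and sph: "sphere (hom_deg dg dg) (pt, pt) (hom_eps eps eps) (hom_d dg eps d eps d) 0"
 shows "\<exists>i. sphere dg pt eps d i"
proof -
 note P' [simp] = P[unfolded cplx_def]
 have [simp]: "homg dg (- 1) d" "homg dg 0 eps" by simp_all
 have [simp]: "d * (d * x) = 0" "eps * (eps * x) = eps * x" "d * (eps * x) = d * x"
   "eps * (d * x) = d * x" for x by (simp_all add: mult.assoc[symmetric])
 let ?d = "hom_d dg eps d eps d" and ?e = "hom_eps eps eps" and ?u = "upt (pt, pt)"
 have sg: "eps * sg dg x = sg dg (eps * x)" "d * sg dg x = - sg dg (d * x)" for x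
  using mult_sg_even[of dg 0 eps x] mult_sg_odd[of dg "-1" d x] by simp_all
 obtain S \<eta> f where "retracts (hom_deg dg dg) (pt, pt) ?e ?d 0 S \<eta> f" using sph by (auto simp: sphere_def)
 then have S [simp]: "?e * S = S" "cor S" and f [simp]: "cor f" "?u * f = f" "f * ?d = 0"
  and \<eta> [simp]: "cor \<eta>" "\<eta> * ?u = \<eta>" "?e * \<eta> = \<eta>" "?d * \<eta> = 0" and f\<eta>: "f * \<eta> = ?u"
  and dS: "?d * S + S * ?d = ?e - \<eta> * f" by (simp_all add: retracts_def)
 \<comment> \<open>A generalized inverse of \<open>d\<close> splits off the boundaries. Its
   component of degree 1, cut down by \<open>eps\<close>, has the same property.\<close>
 obtain s0 where s0: "cor s0" "d * s0 * d = d" using fmat_regular[of d] P' by blast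
 define s where "s = part dg 1 (eps * s0 * eps)"
 have [simp]: "homg dg 1 s" "cor s" by (simp_all add: s_def cor_intros s0)
 have [simp]: "eps * s = s" "s * eps = s"
  by (simp_all add: s_def part_mult_left[of dg 0 eps] part_mult_right[of dg 0 eps] mult.assoc)
 have [simp]: "eps * (s * x) = s * x" for x by (simp add: mult.assoc[symmetric])
 have dsd [simp]: "d * (s * d) = d"
 proof -
  have "part dg 1 (eps * s0 * eps) * d = part dg 0 (eps * s0 * d)"
   by (subst part_mult_right[of dg "- 1"]) (simp_all add: mult.assoc)
  then have "d * (s * d) = part dg (- 1) (d * s0 * d)"
   by (simp add: s_def part_mult_left[of dg "- 1" d] mult.assoc)
  then show ?thesis by (simp add: s0 part_homg)
 qed
 have [simp]: "d * (s * (d * x)) = d * x" for x using dsd by (metis mult.assoc)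
 \<comment> \<open>The columns of \<open>\<pi>\<close> are cycles and \<open>\<pi>\<close> vanishes
   on boundaries. It measures how far \<open>s\<close> is from a contraction.\<close>
 define \<pi> where "\<pi> = eps - d * s - s * d"
 have "homg dg 0 (d * s)" "homg dg 0 (s * d)"
  by (rule homg_mult[of _ "-1" _ 1] homg_mult[of _ 1 _ "-1"], simp_all)+
 then have h\<pi> [simp]: "homg dg 0 \<pi>" unfolding \<pi>_def by (intro homg_diff) simp_all
 have [simp]: "cor \<pi>" "\<pi> * d = 0" "d * \<pi> = 0" "eps * \<pi> = \<pi>" "\<pi> * eps = \<pi>"
  by (simp_all add: \<pi>_def cor_intros algebra_simps)
 have [simp]: "d * (\<pi> * x) = 0" "\<pi> * (d * x) = 0" "eps * (\<pi> * x) = \<pi> * x" for x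
  by (simp_all add: mult.assoc[symmetric])
 show ?thesis
 \<comment> \<open>\<open>d * s\<close> fixes a vector exactly if it is a boundary. If it fixes all
   columns of \<open>\<pi>\<close>, the complex is contractible, and so is its endomorphism complex;
   this contradicts \<open>f * \<eta> = ?u\<close>.\<close>
 proof (cases "d * s * \<pi> = \<pi>")
  case True
  define s2 where "s2 = s + s * \<pi>"
  have s2: "d * s2 + s2 * d = eps" "eps * s2 = s2" "s2 * eps = s2"
   using True by (simp_all add: s2_def algebra_simps) (simp_all add: \<pi>_def algebra_simps)
  have d2: "d * s2 = eps - s2 * d" using s2(1) by (simp add: algebra_simps)
  define \<sigma> where "\<sigma> = kron (tpose (sg dg eps)) s2"
  have "?d * \<sigma> + \<sigma> * ?d = ?e"
   by (simp add: hom_d_def hom_eps_def \<sigma>_def kron_mult algebra_simps tpose_mult[symmetric]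
     sg sg_mult s2 d2 tpose_uminus kron_uminus1 sg_uminus kron_diff2)
  then have "\<eta> = (?d * \<sigma> + \<sigma> * ?d) * \<eta>" by simp
  also have "... = ?d * (\<sigma> * \<eta>)" by (simp add: algebra_simps)
  finally have "f * \<eta> = f * ?d * (\<sigma> * \<eta>)" by (metis mult.assoc)
  then show ?thesis using f\<eta> upt_nz[of "(pt, pt)"] by simp
 next
  case False
  then obtain y0 x0 where nz: "ent (\<pi> - d * s * \<pi>) y0 x0 ~= 0" by (metis ent_0 fmat_eqI right_minus_eq)
  define c where "c = ent (\<pi> - d * s * \<pi>) y0 x0"
  have "e * c = c" unfolding c_def by (rule corD) (simp add: cor_intros)
  then obtain c' where c': "e * c' = c'" "c * c' = e" using corner_inverse nz c_def by blast
  define i where "i = dg x0"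
  have h\<pi>': "homg dg 0 (\<pi> - d * s * \<pi>)"
   by (intro homg_diff homg_mult[of _ 0 _ 0] homg_mult[of _ "-1" _ 1]) simp_all
  have y0: "dg y0 = i" using homgD[OF h\<pi>' nz] by (simp add: i_def)
  \<comment> \<open>The nonzero entry gives a cycle \<open>a\<close>, which is column
    \<open>x0\<close> of \<open>\<pi>\<close>, and a functional \<open>\<alpha>\<close>, which is
    row \<open>y0\<close> of \<open>eps - d * s\<close> up to a scalar and vanishes on boundaries
    since \<open>d * s * d = d\<close>. The factor \<open>c'\<close> normalizes
    \<open>\<alpha> * a\<close>.\<close>
  define a where "a = \<pi> * single x0 pt e"
  define \<alpha> where "\<alpha> = single pt y0 c' * (eps - d * s)"
  have ca [simp]: "cor a" "cor \<alpha>" by (simp_all add: a_def \<alpha>_def cor_intros idem c')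
  have da [simp]: "d * a = 0" "\<alpha> * d = 0" "eps * a = a" "\<alpha> * eps = \<alpha>"
   by (simp_all add: a_def \<alpha>_def algebra_simps)
  have au: "a * upt pt = a" "upt pt * \<alpha> = \<alpha>"
   by (simp_all add: a_def \<alpha>_def upt_def single_mult_single mult.assoc idem c')
    (simp add: single_mult_single mult.assoc[symmetric] c')
  have "\<alpha> * a = single pt y0 c' * (\<pi> - d * s * \<pi>) * single x0 pt e" by (simp add: a_def \<alpha>_def algebra_simps)
  also have "... = upt pt" by (rule fmat_eqI)
    (simp add: upt_def c_def[symmetric] c'(2)[unfolded mult.commute[of c]] idem del: ent_minus)
  finally have \<alpha>a: "\<alpha> * a = upt pt" .
  have cyc: "\<exists>z c. b = d * z + unvec pt \<eta> * a * single pt pt c & e * c = c"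
   if b: "cor b" "b * upt pt = b" "eps * b = b" "d * b = 0" for b
  proof -
   define t where "t = vec pt (b * \<alpha>)"
   have [simp]: "cor t" unfolding t_def by (simp add: cor_intros b)
   have "\<alpha> * sg dg d = 0"
   proof -
    have "\<alpha> * sg dg d = - (\<alpha> * (d * sg dg eps))" by (simp add: sg)
    then show ?thesis by (simp add: mult.assoc[symmetric])
   qed
   moreover have "d * (b * x) = 0" for x by (simp add: mult.assoc[symmetric] b)
   ultimately have dt: "?d * t = 0" unfolding t_def hom_d_def distrib_right kron_vec
    by (simp add: mult.assoc)
   have et: "?e * t = t"
    unfolding t_def hom_eps_def kron_vec by (simp add: mult.assoc) (simp add: mult.assoc[symmetric] b)
   have tu: "t * ?u = t" by (subst col_iff) (simp_all add: t_def ent_vec cor_vec b cor_intros)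
   define w where "w = unvec pt (S * t)"
   have "S * t * ?u = S * t" by (simp add: mult.assoc tu)
   then have wS: "vec pt w = S * t" unfolding w_def by (subst (asm) col_iff)
     (simp_all add: cor_intros, intro fmat_eqI, auto simp: ent_vec ent_unvec)
   have "vec pt w = ?e * vec pt w" by (simp add: wS mult.assoc[symmetric])
   then have ew: "w = eps * w * eps" unfolding hom_eps_def kron_vec by (simp add: vec_eq_iff)
   then have ew': "eps * w = w" "w * eps = w" by (metis P' mult.assoc)+
   define l where "l = ent (f * t) (pt, pt) (pt, pt)"
   have cl: "e * l = l" unfolding l_def by (rule corD) (simp add: cor_intros)
   have "f * t = ?u * (f * t) * ?u" by (simp add: mult.assoc tu) (simp add: mult.assoc[symmetric])
   then have ft: "f * t = single (pt, pt) (pt, pt) l"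
    unfolding l_def by (subst (asm) upt_scalar) (simp_all add: cor_intros)
   have "t = (?d * S + S * ?d) * t + \<eta> * (f * t)" unfolding dS by (simp add: algebra_simps et)
   also have "... = ?d * vec pt w + \<eta> * single (pt, pt) (pt, pt) l"
    by (simp add: distrib_right mult.assoc dt wS ft)
   also have "?d * vec pt w = vec pt (- w * sg dg d + d * w * sg dg eps)"
    unfolding hom_d_def distrib_right kron_vec vec_add[symmetric] by (simp add: ew')
   also have "\<eta> * single (pt, pt) (pt, pt) l = vec pt (scale l (unvec pt \<eta>))"
    by (rule fmat_eqI) (auto simp: ent_vec ent_unvec)
   finally have "b * \<alpha> = - w * sg dg d + d * w * sg dg eps + scale l (unvec pt \<eta>)"
    by (simp add: t_def vec_add[symmetric] vec_eq_iff)
   \<comment> \<open>On the left \<open>\<alpha> * a\<close> disappears as the unit; on the right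
     the term that ends with the differential vanishes because \<open>a\<close> is a cycle.\<close>
   then have "b * \<alpha> * a = (- w * sg dg d + d * w * sg dg eps + scale l (unvec pt \<eta>)) * a" by simp
   then have "b = - w * (sg dg d * a) + d * (w * (sg dg eps * a)) + scale l (unvec pt \<eta>) * a"
    by (simp add: mult.assoc \<alpha>a b(2) distrib_right left_diff_distrib)
   also have "sg dg d * a = 0" by (simp add: sg_mult)
   also have "scale l (unvec pt \<eta>) * a = unvec pt \<eta> * a * single pt pt l"
   proof (rule fmat_eqI)
    fix x y
    have "y ~= pt ==> ent a z y = 0" for z using au(1) ca(1) col_iff by metis
    then show "ent (scale l (unvec pt \<eta>) * a) x y = ent (unvec pt \<eta> * a * single pt pt l) x y"
     by (auto simp: ent_mult[of "idx a" _ a] sum_distrib_right sum_distrib_left mult_ac[where ?'a = 'a])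
   qed
   finally show ?thesis using cl by auto
  qed
  have all: "b - a * \<alpha> * b = d * s * (b - a * \<alpha> * b)"
   if b: "cor b" "b * upt pt = b" "eps * b = b" "d * b = 0" for b
  proof -
   \<comment> \<open>For \<open>b = a\<close> the statement \<open>cyc\<close> shows that
     \<open>a\<close> and its image under the endomorphism \<open>\<eta>\<close> are scalar
     multiples of each other modulo boundaries. So \<open>a\<close> can replace that image, and
     \<open>\<alpha>\<close> then reads off the coefficient of any cycle.\<close>
   obtain z0 c0 where z0: "a = d * z0 + unvec pt \<eta> * a * single pt pt c0" "e * c0 = c0"
    using cyc[of a] au by auto
   define c1 where "c1 = ent (\<alpha> * unvec pt \<eta> * a) pt pt"
   have "\<alpha> * unvec pt \<eta> * a = upt pt * (\<alpha> * unvec pt \<eta> * a) * upt pt"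
    by (simp add: mult.assoc au) (simp add: mult.assoc[symmetric] au)
   then have c1: "\<alpha> * (unvec pt \<eta> * a) = single pt pt c1"
    unfolding c1_def by (subst (asm) upt_scalar) (simp_all add: cor_intros mult.assoc)
   have "upt pt = \<alpha> * (d * z0 + unvec pt \<eta> * a * single pt pt c0)" using z0 \<alpha>a by simp
   also have "... = \<alpha> * (unvec pt \<eta> * a) * single pt pt c0" by (simp add: distrib_left mult.assoc[symmetric])
   also have "... = single pt pt (c1 * c0)" by (simp add: c1 single_mult_single)
   finally have "c1 * c0 = e" by (metis ent_single upt_def)
   then have "single pt pt c0 * single pt pt c1 = upt pt"
    by (simp add: single_mult_single upt_def mult.commute)
   moreover have "a * single pt pt c1
     = d * z0 * single pt pt c1 + unvec pt \<eta> * (a * (single pt pt c0 * single pt pt c1))"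
    by (subst z0(1)) (simp add: distrib_right mult.assoc)
   ultimately have \<eta>a: "unvec pt \<eta> * a = a * single pt pt c1 - d * (z0 * single pt pt c1)"
    by (simp add: au mult.assoc)
   obtain z c where z: "b = d * z + unvec pt \<eta> * a * single pt pt c" "e * c = c" using cyc[OF b] by auto
   define z' where "z' = z - z0 * single pt pt c1 * single pt pt c"
   have bz: "b = d * z' + a * single pt pt (c1 * c)"
    by (subst z(1)) (simp add: \<eta>a z'_def algebra_simps single_mult_single)
   have "a * \<alpha> * b = a * (\<alpha> * d) * z' + a * (\<alpha> * a) * single pt pt (c1 * c)"
    by (subst bz) (simp add: distrib_left mult.assoc del: da)
   also have "... = a * single pt pt (c1 * c)" by (simp add: \<alpha>a au)
   finally have "b - a * \<alpha> * b = d * z'" using bz by (metis add_diff_cancel_right')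
   then show ?thesis by (simp add: mult.assoc)
  qed
  define w where "w = \<alpha> * \<pi>"
  \<comment> \<open>The columns of \<open>\<pi>\<close> are cycles, so \<open>all\<close> applies to
    each of them.\<close>
  have \<pi>aw: "\<pi> - a * w = d * s * (\<pi> - a * w)"
  proof (rule fmat_eqI)
   fix y x
   have "(\<pi> - a * w - d * s * (\<pi> - a * w)) * single x pt e = 0" using all[of "\<pi> * single x pt e"]
    by (simp add: cor_intros mult.assoc upt_def single_mult_single idem w_def algebra_simps)
   then have "ent (\<pi> - a * w - d * s * (\<pi> - a * w)) y x * e = 0" by (metis ent_0 ent_mult_single)
   moreover have "ent (\<pi> - a * w - d * s * (\<pi> - a * w)) y x * e = ent (\<pi> - a * w - d * s * (\<pi> - a * w)) y x"
    by (rule corD) (simp add: cor_intros)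
   ultimately show "ent (\<pi> - a * w) y x = ent (d * s * (\<pi> - a * w)) y x" by simp
  qed
  \<comment> \<open>\<open>s\<close> fails to be a contraction by \<open>\<pi>\<close>. The columns
    of \<open>\<pi> - a * w\<close> are boundaries, and \<open>s\<close> gives preimages of them;
    only \<open>a * w\<close> is left over.\<close>
  define s2 where "s2 = s + s * (\<pi> - a * w)"
  have [simp]: "w * d = 0" "w * eps = w" by (simp_all add: w_def mult.assoc)
  have "d * s2 + s2 * d = d * s + d * s * (\<pi> - a * w) + s * d" by (simp add: s2_def algebra_simps)
  also have "... = eps - a * w" unfolding \<pi>aw[symmetric] by (simp add: \<pi>_def)
  finally have "d * s2 + s2 * d = eps - a * w" .
  moreover have ha: "homg dg i a" unfolding homg_def a_def
  proof (intro allI impI)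
   fix x y assume "ent (\<pi> * single x0 pt e) x y ~= 0"
   then have "y = pt" "ent \<pi> x x0 ~= 0" by (auto split: if_splits)
   then show "dg x = dg y + i" using homgD[OF h\<pi>] deg0 by (simp add: i_def)
  qed
  moreover have hw: "homg dg (- i) w" unfolding homg_def
  proof (intro allI impI)
   fix x y assume "ent w x y ~= 0"
   moreover have "w = single pt y0 c' * ((eps - d * s) * \<pi>)" by (simp add: w_def \<alpha>_def mult.assoc)
   ultimately have "x = pt" "ent ((eps - d * s) * \<pi>) y0 y ~= 0" by (auto split: if_splits)
   moreover have "homg dg 0 ((eps - d * s) * \<pi>)"
    by (intro homg_mult[of _ 0 _ 0] homg_diff homg_mult[of _ "-1" _ 1]) simp_all
   ultimately show "dg x = dg y + - i" using homgD deg0 y0 by fastforce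
  qed
  moreover have "w * a = upt pt"
  proof -
   have "w * a = \<alpha> * (\<pi> * a)" by (simp add: w_def mult.assoc)
   also have "\<pi> * a = a - d * (s * a)" by (simp add: \<pi>_def algebra_simps)
   also have "\<alpha> * ... = \<alpha> * a" by (simp add: right_diff_distrib mult.assoc[symmetric])
   finally show ?thesis by (simp add: \<alpha>a)
  qed
  moreover have haw: "homg dg 0 (a * w)" by (rule homg_mult[OF ha hw]) simp
  have "homg dg 1 s2" unfolding s2_def by (rule homg_add, simp, rule homg_mult[of _ 1 _ 0])
    (simp_all add: homg_diff haw)
  moreover have "eps * s2 = s2" "s2 * eps = s2" by (simp_all add: s2_def algebra_simps)
  moreover have "upt pt * w = w" by (simp add: w_def mult.assoc[symmetric] au)
  moreover have "cor s2" "cor w" by (simp_all add: s2_def w_def cor_intros)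
  ultimately have "retracts dg pt eps d i s2 a w" by (simp add: retracts_def au)
  then show ?thesis by (auto simp: sphere_def)
 qed
qed

end

section \<open>Group actions on matrices and the Brauer homomorphism\<close>

lift_definition restr :: "'i set => ('i, 'a::zero) fmat => ('i, 'a) fmat" is
 "%A f x y. if x \<in> A & y \<in> A then f x y else 0" by (erule rev_finite_subset) auto

lift_definition colr :: "'i set => ('i, 'a::zero) fmat => ('i, 'a) fmat" is
 "%A f x y. if y \<in> A then f x y else 0" by (erule rev_finite_subset) auto

lemma ent_restr [simp]: "ent (restr A a) x y = (if x \<in> A & y \<in> A then ent a x y else 0)" by transfer simp
lemma ent_colr [simp]: "ent (colr A a) x y = (if y \<in> A then ent a x y else 0)" by transfer simp

lemma restr_0 [simp]: "restr A 0 = 0" by (rule fmat_eqI) simp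
lemma restr_add: "restr A (a + b) = restr A a + restr A b" by (rule fmat_eqI) simp
lemma restr_diff: "restr A (a - b) = restr A a - restr A b" by (rule fmat_eqI) simp
lemma restr_uminus: "restr A (- a) = - restr A a" by (rule fmat_eqI) simp
lemma restr_sum: "restr A (sum f I) = (\<Sum>i\<in>I. restr A (f i))"
 by (induction I rule: infinite_finite_induct) (simp_all add: restr_add)
lemma restr_restr: "restr A (restr B a) = restr (A \<inter> B) a" by (rule fmat_eqI) simp
lemma restr_tpose: "restr A (tpose a) = tpose (restr A a)" by (rule fmat_eqI) auto
lemma restr_kron: "restr (A \<times> B) (kron a b) = kron (restr A a) (restr B b)"
 by (rule fmat_eqI) (auto simp: ent_kron mem_Times_iff)
lemma restr_sg: "restr A (sg dg a) = sg dg (restr A a)" by (rule fmat_eqI) (auto simp: ent_sg)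
lemma restr_vec: "pt \<in> A ==> restr (A \<times> A) (vec pt a) = vec pt (restr A a)"
 by (rule fmat_eqI) (auto simp: ent_vec mem_Times_iff)
lemma restr_unvec: "pt \<in> A ==> restr A (unvec pt a) = unvec pt (restr (A \<times> A) a)"
 by (rule fmat_eqI) (auto simp: ent_unvec)
lemma homg_restr: "homg dg k a ==> homg dg k (restr A a)" by (simp add: homg_def)
lemma restr_single [simp]: "restr A (single i j c) = (if i \<in> A & j \<in> A then single i j c else 0)"
 by (rule fmat_eqI) auto

lemma mult_colr: "a * colr A b = colr A (a * b)" by (rule fmat_eqI) (simp add: ent_mult[of "idx a" a])
lemma colr_add: "colr A (a + b) = colr A a + colr A b" by (rule fmat_eqI) simp
lemma colr_diff: "colr A (a - b) = colr A a - colr A b" by (rule fmat_eqI) simp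
lemma colr_0 [simp]: "colr A 0 = 0" by (rule fmat_eqI) simp
lemma colr_colr: "colr A (colr B a) = colr (A \<inter> B) a" by (rule fmat_eqI) simp
lemma restr_colr: "restr A (colr A a) = restr A a" by (rule fmat_eqI) simp
lemma homg_colr: "homg dg k a ==> homg dg k (colr A a)" by (simp add: homg_def)
lemma colr_Compl: "colr (- A) a + colr A a = a" by (rule fmat_eqI) simp

lemma colr_mult_rows:
 assumes "!!x y. ent b x y ~= 0 ==> x \<in> A" shows "colr A a * b = a * b"
proof (rule fmat_eqI)
 fix x y
 have "ent (colr A a) x z * ent b z y = ent a x z * ent b z y" for z
  using assms[of z y] by (cases "ent b z y = 0") auto
 then show "ent (colr A a * b) x y = ent (a * b) x y" by (simp add: ent_mult[of "idx b"])
qed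

text \<open>Keeping the columns of certain degrees restricts a map to these degrees of its source.
  Equations that hold in a range of degrees only are stated in this way.\<close>

abbreviation cdeg :: "('i => int) => (int => bool) => ('i, 'a::zero) fmat => ('i, 'a) fmat" where
 "cdeg dg P \<equiv> colr {x. P (dg x)}"

lemma cdeg_mult:
 assumes "homg dg k b" shows "cdeg dg P a * b = cdeg dg (%n. P (n + k)) (a * b)"
proof (rule fmat_eqI)
 fix x y
 have "ent (cdeg dg P a) x z * ent b z y = (if P (dg y + k) then ent a x z * ent b z y else 0)" for z
  using homgD[OF assms, of z y] by (cases "ent b z y = 0") auto
 then show "ent (cdeg dg P a * b) x y = ent (cdeg dg (%n. P (n + k)) (a * b)) x y"
  by (simp add: ent_mult[of "idx b" _ b])
qed

section \<open>Fixed indices and conjugation of matrices by the group\<close>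

definition fixs :: "('g => 'i => 'i) => 'g set => 'i set" where "fixs ga S = {x. \<forall>g\<in>S. ga g x = x}"

abbreviation rho :: "('g => 'i => 'i) => 'g set => ('i, 'a::zero) fmat => ('i, 'a) fmat" where
 "rho ga S \<equiv> restr (fixs ga S)"

definition pact :: "('g => 'i => 'i) => 'g => 'i \<times> 'i => 'i \<times> 'i" where "pact ga g = map_prod (ga g) (ga g)"

lemma fixs_pact: "fixs (pact ga) S = fixs ga S \<times> fixs ga S" by (auto simp: fixs_def pact_def)
lemma fixs_Un: "fixs ga (S \<union> T) = fixs ga S \<inter> fixs ga T" by (auto simp: fixs_def)
lemma fixs_anti: "S \<subseteq> T ==> fixs ga T \<subseteq> fixs ga S" by (auto simp: fixs_def)

text \<open>Conjugation by the permutation matrix of \<open>g\<close>. It is given by its entries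
  because a permutation of an infinite index type has no matrix of finite support.\<close>

definition tw :: "('g, 'y) monoid_scheme => ('g => 'i => 'i) => 'g =>
  ('i, 'a::zero) fmat => ('i, 'a) fmat" where
 "tw G ga g a = Abs_fmat (%x y. ent a (ga (inv\<^bsub>G\<^esub> g) x) (ga (inv\<^bsub>G\<^esub> g) y))"

definition isact :: "('g, 'y) monoid_scheme => ('g => 'i => 'i) => bool" where "isact G ga \<longleftrightarrow> (\<forall>x. ga \<one>\<^bsub>G\<^esub> x = x) &
  (\<forall>g\<in>carrier G. \<forall>h\<in>carrier G. \<forall>x. ga (g \<otimes>\<^bsub>G\<^esub> h) x = ga g (ga h x))"

definition invt :: "('g, 'y) monoid_scheme => ('g => 'i => 'i) => 'g set => ('i, 'a::zero) fmat => bool" where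
 "invt G ga S a \<longleftrightarrow> (\<forall>g\<in>S. tw G ga g a = a)"

lemma invtD: "invt G ga S a ==> g \<in> S ==> tw G ga g a = a" by (simp add: invt_def)
lemma invt_mono: "invt G ga S a ==> T \<subseteq> S ==> invt G ga T a" by (auto simp: invt_def)

context group
begin

lemma isactD:
 assumes "isact G ga" "g \<in> carrier G"
 shows "ga (inv g) (ga g x) = x" "ga g (ga (inv g) x) = x" "ga \<one> x = x"
 using assms unfolding isact_def by (metis inv_closed l_inv r_inv)+

lemma isact_eq_iff:
 assumes "isact G ga" "g \<in> carrier G"
 shows "ga (inv g) x = y \<longleftrightarrow> x = ga g y" "ga g x = ga g y \<longleftrightarrow> x = y" using isactD[OF assms] by metis+

lemma isact_image_iff:
 assumes "isact G ga" "g \<in> carrier G"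
 shows "x \<in> ga g ` A \<longleftrightarrow> ga (inv g) x \<in> A"
proof
 assume "ga (inv g) x \<in> A"
 then show "x \<in> ga g ` A" by (metis assms image_eqI isactD(2))
qed (auto simp: isactD[OF assms])

lemma isact_pact: "isact G ga ==> isact G (pact ga)" by (simp add: isact_def pact_def)

lemma ent_tw:
 assumes "isact G ga" "g \<in> carrier G"
 shows "ent (tw G ga g a) x y = ent a (ga (inv g) x) (ga (inv g) y)"
proof -
 have "finite {z. ent a (ga (inv g) (fst z)) (ga (inv g) (snd z)) ~= 0}"
  by (rule finite_supp_subset[of "ga g ` idx a"]) (simp_all add: isact_image_iff[OF assms] ent_idx)
 then show ?thesis unfolding tw_def by (subst Abs_fmat_inverse) simp_all
qed

context
 fixes ga :: "'a => 'i => 'i"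
 assumes ga: "isact G ga"
begin

lemma tw_0 [simp]: "g \<in> carrier G ==> tw G ga g 0 = 0" by (rule fmat_eqI) (simp add: ent_tw[OF ga])
lemma tw_add: "g \<in> carrier G ==> tw G ga g (a + b) = tw G ga g a + tw G ga g b"
 by (rule fmat_eqI) (simp add: ent_tw[OF ga])
lemma tw_diff: "g \<in> carrier G ==> tw G ga g (a - b) = tw G ga g a - tw G ga g b"
 by (rule fmat_eqI) (simp add: ent_tw[OF ga])
lemma tw_uminus: "g \<in> carrier G ==> tw G ga g (- a) = - tw G ga g a"
 by (rule fmat_eqI) (simp add: ent_tw[OF ga])
lemma tw_sum: "g \<in> carrier G ==> tw G ga g (sum f I) = (\<Sum>i\<in>I. tw G ga g (f i))"
 by (rule fmat_eqI) (simp add: ent_tw[OF ga])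
lemma tw_mult:
 assumes g: "g \<in> carrier G" shows "tw G ga g (a * b) = tw G ga g a * tw G ga g b"
proof (rule fmat_eqI)
 fix x y
 have inj: "inj_on (ga g) (idx a)" using isact_eq_iff(2)[OF ga g] by (auto simp: inj_on_def)
 have "ent (tw G ga g a * tw G ga g b) x y = (\<Sum>z\<in>ga g ` idx a. ent (tw G ga g a) x z * ent (tw G ga g b) z y)"
  by (rule ent_mult_gen) (simp_all add: ent_tw[OF ga g] isact_image_iff[OF ga g] ent_idx)
 also have "... = (\<Sum>z\<in>idx a. ent a (ga (inv g) x) z * ent b z (ga (inv g) y))"
  by (simp add: sum.reindex[OF inj] ent_tw[OF ga g] isactD(1)[OF ga g])
 finally show "ent (tw G ga g (a * b)) x y = ent (tw G ga g a * tw G ga g b) x y"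
  by (simp add: ent_tw[OF ga g] ent_mult[of "idx a"])
qed
lemma tw_single: "g \<in> carrier G ==> tw G ga g (single i j c) = single (ga g i) (ga g j) c"
 by (rule fmat_eqI) (simp add: ent_tw[OF ga] isact_eq_iff[OF ga])
lemma tw_tw: "g \<in> carrier G ==> h \<in> carrier G ==> tw G ga g (tw G ga h a) = tw G ga (g \<otimes> h) a"
 using ga by (intro fmat_eqI) (simp add: ent_tw[OF ga] inv_mult_group isact_def)
lemma tw_one [simp]: "tw G ga \<one> a = a" by (rule fmat_eqI) (simp add: ent_tw[OF ga] isactD(3)[OF ga one_closed])
lemma tw_tpose: "g \<in> carrier G ==> tw G ga g (tpose a) = tpose (tw G ga g a)"
 by (rule fmat_eqI) (simp add: ent_tw[OF ga])
lemma tw_kron: "g \<in> carrier G ==> tw G (pact ga) g (kron a b) = kron (tw G ga g a) (tw G ga g b)"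
 by (rule fmat_eqI) (simp add: ent_tw[OF ga] ent_tw[OF isact_pact[OF ga]] ent_kron pact_def)
lemma tw_sg: "g \<in> carrier G ==> (!!g x. g \<in> carrier G ==> dg (ga g x) = dg x) ==>
  tw G ga g (sg dg a) = sg dg (tw G ga g a)" by (rule fmat_eqI) (simp add: ent_tw[OF ga] ent_sg)
lemma tw_part: "g \<in> carrier G ==> (!!g x. g \<in> carrier G ==> dg (ga g x) = dg x) ==>
  tw G ga g (part dg k a) = part dg k (tw G ga g a)" by (rule fmat_eqI) (simp add: ent_tw[OF ga] ent_part)
lemma tw_vec:
 assumes "g \<in> carrier G" "ga g pt = pt"
 shows "tw G (pact ga) g (vec pt a) = vec pt (tw G ga g a)"
 by (rule fmat_eqI) (auto simp: ent_tw[OF ga] ent_tw[OF isact_pact[OF ga]] ent_vec pact_def assms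
   isact_eq_iff(1)[OF ga])
lemma tw_unvec:
 assumes "g \<in> carrier G" "ga g pt = pt"
 shows "tw G ga g (unvec pt a) = unvec pt (tw G (pact ga) g a)"
proof -
 have "ga (inv g) pt = pt" using isact_eq_iff(1)[OF ga assms(1)] assms(2) by metis
 then show ?thesis
  by (intro fmat_eqI) (simp add: ent_tw[OF ga] ent_tw[OF isact_pact[OF ga]] ent_unvec pact_def assms)
qed
lemma tw_restr:
 assumes g: "g \<in> carrier G" and A: "!!x. ga g x \<in> B \<longleftrightarrow> x \<in> A"
 shows "tw G ga g (restr A a) = restr B (tw G ga g a)"
proof -
 have "ga (inv g) x \<in> A \<longleftrightarrow> x \<in> B" for x using A[of "ga (inv g) x"] isactD[OF ga g] by simp
 then show ?thesis by (intro fmat_eqI) (simp add: ent_tw[OF ga g])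
qed
lemma tw_colr:
 assumes g: "g \<in> carrier G" and A: "!!x. ga g x \<in> A \<longleftrightarrow> x \<in> A"
 shows "tw G ga g (colr A a) = colr A (tw G ga g a)"
proof -
 have "ga (inv g) x \<in> A \<longleftrightarrow> x \<in> A" for x using A[of "ga (inv g) x"] isactD[OF ga g] by simp
 then show ?thesis by (intro fmat_eqI) (simp add: ent_tw[OF ga g])
qed

lemma fixs_conj:
 assumes g: "g \<in> carrier G" and S: "S \<subseteq> carrier G"
 shows "ga g x \<in> fixs ga ((%h. g \<otimes> h \<otimes> inv g) ` S) \<longleftrightarrow> x \<in> fixs ga S"
proof -
 have "ga (g \<otimes> h \<otimes> inv g) (ga g x) = ga g (ga h x)" if "h \<in> S" for h
 proof -
  have "h \<in> carrier G" using that S by blast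
  then show ?thesis using g ga by (simp add: isact_def isactD(1)[OF ga g])
 qed
 then show ?thesis using isact_eq_iff(2)[OF ga g] by (auto simp: fixs_def)
qed

lemma fixs_stable:
 assumes L: "subgroup L G" and g: "g \<in> L" shows "ga g x \<in> fixs ga L \<longleftrightarrow> x \<in> fixs ga L"
proof -
 have *: "ga h y = y" if "h \<in> L" "y \<in> fixs ga L" for h y using that by (simp add: fixs_def)
 have gc: "g \<in> carrier G" using L g subgroup.mem_carrier by fast
 have "x \<in> fixs ga L" if "ga g x \<in> fixs ga L"
  using *[OF subgroup.m_inv_closed[OF L g] that] isactD[OF ga gc] that by metis
 then show ?thesis using *[OF g] by metis
qed

lemma fixs_stable_normal:
 assumes "subgroup H G" "g \<in> carrier G" "(%h. g \<otimes> h \<otimes> inv g) ` H = H"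
 shows "ga g x \<in> fixs ga H \<longleftrightarrow> x \<in> fixs ga H"
 using fixs_conj[OF assms(2) subgroup.subset[OF assms(1)], of x] assms(3) by simp

lemma tw_rho_self:
 assumes L: "subgroup L G" and g: "g \<in> L" shows "tw G ga g (rho ga L a) = rho ga L a"
proof -
 have gc: "g \<in> carrier G" using L g subgroup.mem_carrier by fast
 have i: "inv g \<in> L" using L g subgroup.m_inv_closed by fast
 show ?thesis using fixs_stable[OF L i] i by (intro fmat_eqI) (auto simp: ent_tw[OF ga gc] fixs_def)
qed

lemma rho_tw_self:
 assumes L: "subgroup L G" and g: "g \<in> L" shows "rho ga L (tw G ga g a) = rho ga L a"
proof -
 have gc: "g \<in> carrier G" using L g subgroup.mem_carrier by fast
 have i: "inv g \<in> L" using L g subgroup.m_inv_closed by fast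
 show ?thesis using i by (intro fmat_eqI) (auto simp: ent_tw[OF ga gc] fixs_def)
qed

lemma invt_rho: "subgroup L G ==> invt G ga L (rho ga L a)" by (simp add: invt_def tw_rho_self)

lemma idx_stable:
 assumes g: "g \<in> carrier G" and a: "tw G ga g a = a" shows "ga g x \<in> idx a \<longleftrightarrow> x \<in> idx a"
proof -
 have "ent a (ga g x) (ga g y) = ent a x y" for x y
  by (subst a[symmetric]) (simp add: ent_tw[OF ga g] isactD[OF ga g])
 moreover have "\<exists>z. y = ga g z" for y using isactD(2)[OF ga g, of y] by metis
 ultimately show ?thesis unfolding idx_def by (simp, metis)
qed

text \<open>At one point of each orbit a choice is made that the stabilizer leaves invariant, and it
  is carried along the orbit. Two group elements leading to the same point differ by the stabilizer,
  so they carry it to the same matrix.\<close>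

lemma equivariant_choice:
 assumes L: "subgroup L G" and stable: "!!g x. g \<in> L ==> x \<in> \<Omega> ==> ga g x \<in> \<Omega>"
  and ex: "!!x. x \<in> \<Omega> ==> \<exists>c. Q x c & (\<forall>g\<in>L. ga g x = x --> tw G ga g c = c)"
  and Q: "!!x g c. x \<in> \<Omega> ==> g \<in> L ==> Q x c ==> Q (ga g x) (tw G ga g c)"
 shows "\<exists>C. \<forall>x\<in>\<Omega>. Q x (C x) & (\<forall>g\<in>L. C (ga g x) = tw G ga g (C x))"
proof -
 have Lc: "g \<in> L ==> g \<in> carrier G" for g using L subgroup.mem_carrier by fast
 have am: "g \<in> L ==> h \<in> L ==> ga (g \<otimes> h) x = ga g (ga h x)" for g h x using ga Lc by (auto simp: isact_def)
 define orb where "orb x = {ga g x | g. g \<in> L}" for x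
 have orb: "orb (ga g x) = orb x" if "g \<in> L" for g x
 proof
  show "orb (ga g x) \<subseteq> orb x"
   unfolding orb_def using that am subgroup.m_closed[OF L] by (smt (verit) mem_Collect_eq subsetI)
  show "orb x \<subseteq> orb (ga g x)"
  proof
   fix y assume "y \<in> orb x"
   then obtain h where h: "h \<in> L" "y = ga h x" by (auto simp: orb_def)
   have "y = ga (h \<otimes> inv g) (ga g x)"
    using h that am subgroup.m_inv_closed[OF L] isactD(1)[OF ga Lc[OF that]] by metis
   then show "y \<in> orb (ga g x)"
    using h that subgroup.m_closed[OF L] subgroup.m_inv_closed[OF L] unfolding orb_def by blast
  qed
 qed
 \<comment> \<open>The representative is chosen from the orbit as a set; therefore it is the same
   for all points of the orbit.\<close>
 define r where "r x = (SOME y. y \<in> orb x)" for x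
 have r: "\<exists>g\<in>L. r x = ga g x" for x
 proof -
  have "x \<in> orb x" unfolding orb_def
   using subgroup.one_closed[OF L] isactD(3)[OF ga one_closed, of x] by (metis (mono_tags, lifting) mem_Collect_eq)
  then have "r x \<in> orb x" unfolding r_def by (rule someI)
  then show ?thesis by (auto simp: orb_def)
 qed
 have r2: "r (ga g x) = r x" if "g \<in> L" for g x using orb[OF that] by (simp add: r_def)
 have "\<exists>g\<in>L. ga g (r x) = x" for x using r[of x] isactD(1)[OF ga Lc] subgroup.m_inv_closed[OF L] by metis
 then obtain k where k: "!!x. k x \<in> L" "!!x. ga (k x) (r x) = x" by metis
 obtain c0 where c0: "!!x. x \<in> \<Omega> ==> Q x (c0 x)"
  "!!x g. x \<in> \<Omega> ==> g \<in> L ==> ga g x = x ==> tw G ga g (c0 x) = c0 x" using ex by metis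
 define C where "C x = tw G ga (k x) (c0 (r x))" for x
 have r\<Omega>: "r x \<in> \<Omega>" if "x \<in> \<Omega>" for x using r[of x] stable that by metis
 have "Q x (C x)" if "x \<in> \<Omega>" for x
  unfolding C_def using Q[OF r\<Omega>[OF that] k(1) c0(1)[OF r\<Omega>[OF that]]] k(2) by metis
 moreover have "C (ga g x) = tw G ga g (C x)" if x: "x \<in> \<Omega>" and g: "g \<in> L" for x g
 proof -
  let ?l = "k (ga g x)" and ?m = "g \<otimes> k x"
  have m: "?m \<in> L" "inv ?m \<otimes> ?l \<in> L" using g k(1) L by (simp_all add: subgroup.m_closed subgroup.m_inv_closed)
  have "ga ?l (r x) = ga ?m (r x)" using k(2)[of "ga g x"] r2[OF g] k am g by metis
  then have "ga (inv ?m \<otimes> ?l) (r x) = r x"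
   using am k(1) subgroup.m_inv_closed[OF L m(1)] isactD(1)[OF ga Lc[OF m(1)]] by metis
  then have *: "tw G ga (inv ?m \<otimes> ?l) (c0 (r x)) = c0 (r x)" using c0(2) r\<Omega>[OF x] m by blast
  have "?l = ?m \<otimes> (inv ?m \<otimes> ?l)" using Lc[OF m(1)] Lc[OF k(1)] by (simp add: m_assoc[symmetric])
  then have "tw G ga ?l (c0 (r x)) = tw G ga ?m (tw G ga (inv ?m \<otimes> ?l) (c0 (r x)))"
   using tw_tw[OF Lc[OF m(1)] Lc[OF m(2)]] by metis
  then show ?thesis unfolding C_def r2[OF g] * by (simp add: tw_tw[OF Lc[OF g] Lc[OF k(1)]])
 qed
 ultimately show ?thesis by blast
qed

end
end

section \<open>Counting orbits of a p-group\<close>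

locale p_group_field = corner_field e p + group G
 for e :: "'a::comm_ring_1" and p and G :: "('g, 'y) monoid_scheme" (structure) +
 assumes finite_G: "finite (carrier G)" and p_group: "\<exists>n. order G = p ^ n"
begin

lemma finite_subgroup: "subgroup L G ==> finite L" using finite_G subgroup.subset finite_subset by blast

lemma card_subgroup: "subgroup L G ==> \<exists>n. card L = p ^ n" using p_group lagrange_finite[OF finite_G] prime_p
 by (metis divides_primepow_nat dvd_triv_right)

text \<open>The multiplication is that of \<open>G\<close> while only elements of \<open>L\<close>
  act, and \<open>b\<close> is arbitrary outside of \<open>W\<close>. This fits actions on indices
  as well as on cosets.\<close>

definition acts_on :: "'g set => ('g => 'w => 'w) => 'w set => bool" where "acts_on L b W \<longleftrightarrow> (\<forall>w\<in>W. b \<one> w = w &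
   (\<forall>g\<in>L. b g w \<in> W & (\<forall>h\<in>L. b (g \<otimes> h) w = b g (b h w))))"

text \<open>The fibres of \<open>L\<close> over the orbit are translates of the stabilizer. So the
  length of the orbit divides the order of \<open>L\<close> and is a power of \<open>p\<close>,
  other than 1 because the point moves.\<close>

lemma orbit_card_dvd:
 assumes L: "subgroup L G" and b: "acts_on L b W" and w: "w \<in> W" and nf: "\<exists>g\<in>L. b g w ~= w"
 shows "p dvd card ((%g. b g w) ` L)"
proof -
 let ?O = "(%g. b g w) ` L" and ?S = "{g\<in>L. b g w = w}"
 have Lc: "g \<in> L ==> g \<in> carrier G" for g using L subgroup.mem_carrier by fast
 have fin: "finite L" using L by (rule finite_subgroup)
 have fib: "card {g\<in>L. b g w = u} = card ?S" if u: "u \<in> ?O" for u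
 proof -
  obtain k where k: "k \<in> L" "u = b k w" using u by auto
  have "bij_betw (%g. k \<otimes> g) ?S {g\<in>L. b g w = u}"
  proof (rule bij_betwI[of _ _ _ "%g. inv k \<otimes> g"])
   show "(%g. k \<otimes> g) \<in> ?S \<rightarrow> {g\<in>L. b g w = u}" using k b w L by (auto simp: acts_on_def subgroup.m_closed)
   show "(%g. inv k \<otimes> g) \<in> {g\<in>L. b g w = u} \<rightarrow> ?S"
   proof safe
    fix g assume g: "g \<in> L" "u = b g w"
    have ik: "inv k \<in> L" using L k subgroup.m_inv_closed by fast
    have "b (inv k \<otimes> g) w = b (inv k) (b k w)" using b w ik g k by (simp add: acts_on_def)
    also have "... = b (inv k \<otimes> k) w" using b w ik k by (simp add: acts_on_def)
    finally show "b (inv k \<otimes> g) w = w" using Lc[OF k(1)] b w by (simp add: acts_on_def)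
    show "inv k \<otimes> g \<in> L" using L ik g subgroup.m_closed by fast
   qed
  qed (use k Lc in \<open>auto simp: m_assoc[symmetric]\<close>)
  then show ?thesis by (simp add: bij_betw_same_card)
 qed
 have "card L = (\<Sum>u\<in>?O. card {g\<in>L. b g w = u})" using sum.group[of L ?O "%g. b g w" "%_. 1::nat"] fin by simp
 also have "... = card ?O * card ?S" by (simp add: fib)
 finally have "card ?O dvd card L" by simp
 then obtain m where m: "card ?O = p ^ m" using card_subgroup[OF L] prime_p by (metis divides_primepow_nat)
 have "card ?O ~= 1"
 proof
  assume "card ?O = 1"
  then obtain v where "?O = {v}" by (auto simp: card_1_singleton_iff)
  moreover have "w \<in> ?O" using b w L by (auto simp: acts_on_def image_iff dest: subgroup.one_closed intro!: bexI[of _ \<one>])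
  ultimately show False using nf by auto
 qed
 then show ?thesis using m by (cases m) auto
qed

lemma of_nat_dvd_e: "p dvd n ==> e * x = x ==> of_nat n * x = 0"
proof -
 assume "p dvd n" "e * x = x"
 then obtain k where "n = p * k" by auto
 have "of_nat n * x = of_nat n * (e * x)" using \<open>e * x = x\<close> by simp
 also have "... = of_nat k * (of_nat p * e) * x" by (simp add: \<open>n = p * k\<close> mult_ac)
 finally show ?thesis by (simp add: char_p)
qed

text \<open>Removing one orbit after the other proves both claims at once: \<open>f\<close> is
  constant on an orbit, and the length of the orbit is zero in the corner.\<close>

lemma no_fixed_points:
 assumes L: "subgroup L G"
 shows "finite W ==> acts_on L b W ==> \<forall>w\<in>W. \<exists>g\<in>L. b g w ~= w ==>
  \<forall>w\<in>W. e * f w = f w & (\<forall>g\<in>L. f (b g w) = f w) ==> sum f W = 0 & p dvd card W"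
proof (induction "card W" arbitrary: W rule: less_induct)
 case less
 show ?case
 proof (cases "W = {}")
  case False
  then obtain w where w: "w \<in> W" by auto
  let ?O = "(%g. b g w) ` L"
  have O: "?O \<subseteq> W" "finite ?O" using less.prems w finite_subgroup[OF L] by (auto simp: acts_on_def)
  have wO: "w \<in> ?O" using less.prems w L by (auto simp: acts_on_def image_iff dest: subgroup.one_closed intro!: bexI[of _ \<one>])
  have "b g v \<in> ?O \<longleftrightarrow> v \<in> ?O" if g: "g \<in> L" and v: "v \<in> W" for g v
  proof
   assume "v \<in> ?O"
   then show "b g v \<in> ?O" using g less.prems(2) w subgroup.m_closed[OF L] by (force simp: acts_on_def)
  next
   assume "b g v \<in> ?O"
   then obtain h where h: "h \<in> L" "b g v = b h w" by auto
   have ig: "inv g \<in> L" "g \<in> carrier G" using L g subgroup.m_inv_closed subgroup.mem_carrier by fast+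
   have "v = b (inv g \<otimes> g) v" using v less.prems(2) ig by (simp add: acts_on_def)
   also have "... = b (inv g) (b g v)" using v less.prems(2) ig g unfolding acts_on_def by metis
   also have "... = b (inv g \<otimes> h) w" using v less.prems(2) ig g h w by (simp add: acts_on_def)
   finally show "v \<in> ?O" using L ig h subgroup.m_closed by fast
  qed
  then have "acts_on L b (W - ?O)" using less.prems(2) by (auto simp: acts_on_def)
  moreover have "card (W - ?O) < card W"
   using wO w less.prems(1) by (metis DiffE Diff_subset psubsetI psubset_card_mono)
  ultimately have IH: "sum f (W - ?O) = 0 & p dvd card (W - ?O)"
   using less.hyps[of "W - ?O"] less.prems by auto
  have pO: "p dvd card ?O" using orbit_card_dvd[OF L less.prems(2) w] less.prems(3) w by blast
  have "sum f ?O = (\<Sum>v\<in>?O. f w)" using less.prems(4) w by (intro sum.cong) auto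
  also have "... = of_nat (card ?O) * f w" by simp
  also have "... = 0" using of_nat_dvd_e[OF pO] less.prems(4) w by blast
  finally have "sum f ?O = 0" .
  then have "sum f W = 0" using IH sum.subset_diff[OF O(1) less.prems(1), of f] by simp
  moreover have "card W = card (W - ?O) + card ?O"
   using O less.prems(1) by (metis add.commute card_Diff_subset card_mono le_add_diff_inverse)
  ultimately show ?thesis using IH pO by simp
 qed simp
qed

lemma acts_on_nonfixed:
 assumes L: "subgroup L G" and W: "acts_on L b W"
 shows "acts_on L b {w\<in>W. \<exists>g\<in>L. b g w ~= w}" unfolding acts_on_def
proof (intro ballI conjI)
 fix w assume w: "w \<in> {w \<in> W. \<exists>g\<in>L. b g w ~= w}"
 then show "b \<one> w = w" using W by (simp add: acts_on_def)
 fix g assume g: "g \<in> L"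
 show "b (g \<otimes> h) w = b g (b h w)" if "h \<in> L" for h using W w g that by (simp add: acts_on_def)
 have ig: "inv g \<in> L" "g \<in> carrier G" using L g subgroup.m_inv_closed subgroup.mem_carrier by fast+
 have bg: "b g w \<in> W" using W w g by (simp add: acts_on_def)
 have "\<exists>h\<in>L. b h (b g w) ~= b g w"
 proof (rule ccontr)
  assume c: "\<not> ?thesis"
  then have f: "\<forall>h\<in>L. b h (b g w) = b g w" by blast
  have wW: "w \<in> W" using w by simp
  have "b (inv g \<otimes> g) w = b (inv g) (b g w)" using W wW g ig(1) unfolding acts_on_def by blast
  also have "... = b g w" using f ig by blast
  finally have "w = b g w" using W wW ig unfolding acts_on_def by (metis l_inv)
  then show False using f w by auto
 qed
 then show "b g w \<in> {w \<in> W. \<exists>g\<in>L. b g w ~= w}" using bg by simp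
qed

lemma sum_fixed_points:
 assumes L: "subgroup L G" and fin: "finite W" and W: "acts_on L b W"
  and f: "!!w. w \<in> W ==> e * f w = f w" "!!w g. w \<in> W ==> g \<in> L ==> f (b g w) = f w"
 shows "sum f W = sum f {w\<in>W. \<forall>g\<in>L. b g w = w}"
proof -
 let ?N = "{w\<in>W. \<exists>g\<in>L. b g w ~= w}" and ?F = "{w\<in>W. \<forall>g\<in>L. b g w = w}"
 have "\<forall>w\<in>?N. e * f w = f w & (\<forall>g\<in>L. f (b g w) = f w)" using f by blast
 moreover have "\<forall>w\<in>?N. \<exists>g\<in>L. b g w ~= w" by blast
 moreover have fN: "finite ?N" "finite ?F" using fin by simp_all
 ultimately have "sum f ?N = 0" using no_fixed_points[OF L _ acts_on_nonfixed[OF L W], of f] by blast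
 moreover have "sum f (?N \<union> ?F) = sum f ?N + sum f ?F" by (rule sum.union_disjoint) (use fN in blast)+
 moreover have "?N \<union> ?F = W" by blast
 ultimately show ?thesis by simp
qed

lemma card_fixed_points:
 assumes L: "subgroup L G" and fin: "finite W" and W: "acts_on L b W"
 shows "p dvd card W \<longleftrightarrow> p dvd card {w\<in>W. \<forall>g\<in>L. b g w = w}"
proof -
 let ?N = "{w\<in>W. \<exists>g\<in>L. b g w ~= w}" and ?F = "{w\<in>W. \<forall>g\<in>L. b g w = w}"
 have fN: "finite ?N" "finite ?F" using fin by simp_all
 have "\<forall>w\<in>?N. \<exists>g\<in>L. b g w ~= w" by blast
 then have "p dvd card ?N" using no_fixed_points[OF L fN(1) acts_on_nonfixed[OF L W], of "%_. 0"] by simp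
 moreover have "card (?N \<union> ?F) = card ?N + card ?F" by (rule card_Un_disjoint) (use fN in blast)+
 moreover have "?N \<union> ?F = W" by blast
 ultimately show ?thesis by (simp add: dvd_add_right_iff)
qed

text \<open>The Brauer homomorphism: in a product of two \<open>L\<close>-invariant matrices the contributions of the
 indices that \<open>L\<close> moves cancel, because their orbits have length divisible by \<open>p\<close>.\<close>

lemma rho_mult:
 assumes ga: "isact G ga" and L: "subgroup L G" and a: "invt G ga L a" and b: "invt G ga L b" and c: "cor a"
 shows "rho ga L (a * b) = rho ga L a * rho ga L b"
proof (rule fmat_eqI)
 fix x y
 have Lc: "g \<in> L ==> g \<in> carrier G" for g using L subgroup.mem_carrier by fast
 let ?F = "fixs ga L"
 show "ent (rho ga L (a * b)) x y = ent (rho ga L a * rho ga L b) x y"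
 proof (cases "x \<in> ?F & y \<in> ?F")
  case True
  let ?W = "idx a"
  have ea: "ent a (ga g x') (ga g y') = ent a x' y'" if "g \<in> L" for g x' y'
   using ent_tw[OF ga Lc[OF that], of a "ga g x'" "ga g y'"] invtD[OF a that]
    isactD[OF ga Lc[OF that]] by simp
  have eb: "ent b (ga g x') (ga g y') = ent b x' y'" if "g \<in> L" for g x' y'
   using ent_tw[OF ga Lc[OF that], of b "ga g x'" "ga g y'"] invtD[OF b that]
    isactD[OF ga Lc[OF that]] by simp
  have "acts_on L ga ?W" unfolding acts_on_def
   using idx_stable[OF ga Lc invtD[OF a]] ga Lc by (auto simp: isact_def)
  moreover have "ent a x (ga g z) * ent b (ga g z) y = ent a x z * ent b z y" if "g \<in> L" for g z
   using ea[OF that, of x z] eb[OF that, of z y] True that by (simp add: fixs_def)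
  ultimately have "(\<Sum>z\<in>?W. ent a x z * ent b z y) = (\<Sum>z\<in>{z\<in>?W. \<forall>g\<in>L. ga g z = z}. ent a x z * ent b z y)"
   using corD(1)[OF c] by (intro sum_fixed_points[OF L]) (simp_all add: mult.assoc[symmetric])
  also have "... = (\<Sum>z\<in>{z\<in>?W. \<forall>g\<in>L. ga g z = z}. ent (rho ga L a) x z * ent (rho ga L b) z y)"
   using True by (intro sum.cong) (auto simp: fixs_def)
  also have "... = ent (rho ga L a * rho ga L b) x y"
   using True by (intro ent_mult_gen[symmetric]) (auto simp: fixs_def dest: ent_idx split: if_splits)
  finally show ?thesis using True by (simp add: ent_mult[of ?W a])
 next
  case False
  then have "ent (rho ga L a) x z * ent (rho ga L b) z y = 0" for z by auto
  then show ?thesis using False by (auto simp: ent_mult[of "idx (rho ga L a)" "rho ga L a"])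
 qed
qed

lemma invt_closed:
 assumes ga: "isact G ga" and S: "S \<subseteq> carrier G"
 shows "invt G ga S a ==> invt G ga S b ==> invt G ga S (a + b)"
  and "invt G ga S a ==> invt G ga S b ==> invt G ga S (a - b)"
  and "invt G ga S a ==> invt G ga S b ==> invt G ga S (a * b)" and "invt G ga S a ==> invt G ga S (tpose a)"
  and "invt G ga S a ==> invt G ga S (- a)" and "invt G ga S 0" using S unfolding invt_def
 by (auto simp: tw_add[OF ga] tw_diff[OF ga] tw_mult[OF ga] tw_tpose[OF ga] tw_0[OF ga]
   tw_uminus[OF ga] subset_iff)

end

section \<open>Equivariant contractions\<close>

lemma cdeg_rows:
 assumes "cdeg dg P a = cdeg dg P b" "!!x y. ent z x y ~= 0 ==> P (dg x)"
 shows "a * z = b * z"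
proof -
 have "cdeg dg P a * z = a * z" "cdeg dg P b * z = b * z" by (rule colr_mult_rows; simp add: assms(2))+
 then show ?thesis using assms(1) by simp
qed

context p_group_field
begin

lemma cor_restr: "cor a ==> cor (restr A a)" and cor_colr: "cor a ==> cor (colr A a)" by (simp_all add: cor_def)

lemma point_stabilizer:
 assumes ga: "isact G ga" and L: "subgroup L G" shows "subgroup {g\<in>L. ga g x = x} G"
proof (rule subgroupI)
 have Lc: "g \<in> L ==> g \<in> carrier G" for g using L subgroup.mem_carrier by fast
 show "{g \<in> L. ga g x = x} \<subseteq> carrier G" using Lc by blast
 show "{g \<in> L. ga g x = x} ~= {}" using subgroup.one_closed[OF L] isactD(3)[OF ga one_closed] by blast
 show "inv g \<in> {g \<in> L. ga g x = x}" if "g \<in> {g \<in> L. ga g x = x}" for g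
  using that subgroup.m_inv_closed[OF L] isactD(1)[OF ga Lc, of g x] by auto
 show "g \<otimes> h \<in> {g \<in> L. ga g x = x}" if "g \<in> {g \<in> L. ga g x = x}" "h \<in> {g \<in> L. ga g x = x}" for g h
  using that subgroup.m_closed[OF L] ga Lc by (auto simp: isact_def)
qed

context
 fixes ga :: "'g => 'i => 'i" and dg :: "'i => int" and pt :: 'i
 assumes ga: "isact G ga" and dg: "!!g x. g \<in> carrier G ==> dg (ga g x) = dg x"
  and pt: "!!g. g \<in> carrier G ==> ga g pt = pt"
begin

text \<open>Here \<open>q\<close> fixes all cycles of degree \<open>n\<close>, so the claim is that
  these cycles are boundaries in an equivariant way. By induction on the order of \<open>L\<close>,
  columns of \<open>q\<close> at moved indices are lifted by means of their stabilizers. Columns at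
  fixed indices are first lifted in the Brauer quotient; the error has moved rows only, and there
  the first part has already provided a lift.\<close>

lemma lift_through_boundary:
 assumes C: "cplx dg eps d" and N: "subgroup N G" and inv: "invt G ga N eps" "invt G ga N d" "invt G ga N q"
  and q: "cor q" "homg dg 0 q" "eps * q = q" "d * q = 0" "!!x y. ent q x y ~= 0 ==> dg y = n"
  and qc: "!!c. eps * c = c ==> d * c = 0 ==> (!!x y. ent c x y ~= 0 ==> dg x = n) ==> q * c = c"
  and ex: "!!L. subgroup L G ==> L \<subseteq> N ==> \<exists>\<sigma>. cor \<sigma> & homg dg 1 \<sigma> & rho ga L eps * \<sigma> = \<sigma> &
    rho ga L d * (\<sigma> * rho ga L q) = rho ga L q"
 shows "subgroup L G ==> L \<subseteq> N ==> \<exists>t. cor t & invt G ga L t & d * t = q"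
proof (induction "card L" arbitrary: L rule: less_induct)
 case less
 note L = less.prems(1) and LN = less.prems(2)
 note C' [simp] = C[unfolded cplx_def]
 have Lc: "g \<in> L ==> g \<in> carrier G" for g using L subgroup.mem_carrier by fast
 have LC: "L \<subseteq> carrier G" using Lc by blast
 note cl = invt_closed[OF ga LC]
 have invL: "invt G ga L eps" "invt G ga L d" "invt G ga L q" using inv invt_mono LN by blast+
 define F where "F = fixs ga L"
 \<comment> \<open>\<open>c\<close> is a vector that lifts the column \<open>x\<close> of
   \<open>q\<close> through \<open>d\<close>.\<close>
 define Q where "Q x c \<longleftrightarrow> cor c & c * upt pt = c & d * c = q * single x pt e" for x c
 have Fst: "ga g x \<in> F \<longleftrightarrow> x \<in> F" if "g \<in> L" for g x unfolding F_def by (rule fixs_stable[OF ga L that])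
 have twu: "tw G ga g (upt pt) = upt pt" if "g \<in> L" for g
  by (simp add: upt_def tw_single[OF ga Lc[OF that]] pt Lc[OF that])
 \<comment> \<open>The stabilizer of a moved index is a proper subgroup. The lift that the induction
   hypothesis gives for it is carried along the orbit.\<close>
 have "\<exists>C. \<forall>x\<in>- F. Q x (C x) & (\<forall>g\<in>L. C (ga g x) = tw G ga g (C x))"
 proof (rule equivariant_choice[OF ga L])
  show "ga g x \<in> - F" if "g \<in> L" "x \<in> - F" for g x using that Fst by simp
 next
  fix x assume x: "x \<in> - F"
  let ?M = "{g\<in>L. ga g x = x}"
  have M: "subgroup ?M G" by (rule point_stabilizer[OF ga L])
  have "?M \<subset> L" using x by (auto simp: F_def fixs_def)
  then have "card ?M < card L" using finite_subgroup[OF L] by (rule psubset_card_mono[rotated])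
  then obtain t where t: "cor t" "invt G ga ?M t" "d * t = q" using less.hyps[OF _ M] LN by blast
  have "Q x (t * single x pt e)"
   unfolding Q_def by (simp add: cor_intros t mult.assoc upt_def single_mult_single idem)
    (simp add: mult.assoc[symmetric] t)
  moreover have "tw G ga g (t * single x pt e) = t * single x pt e" if "g \<in> L" "ga g x = x" for g
   using invtD[OF t(2), of g] that
   by (simp add: tw_mult[OF ga Lc[OF that(1)]] tw_single[OF ga Lc[OF that(1)]] pt Lc[OF that(1)])
  ultimately show "\<exists>c. Q x c & (\<forall>g\<in>L. ga g x = x --> tw G ga g c = c)" by blast
 next
  fix x g c assume "x \<in> - F" and g: "g \<in> L" and Q: "Q x c"
  have "d * tw G ga g c = tw G ga g (d * c)" using invtD[OF invL(2) g] by (simp add: tw_mult[OF ga Lc[OF g]])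
  also have "... = q * single (ga g x) pt e" using Q invtD[OF invL(3) g]
   by (simp add: Q_def tw_mult[OF ga Lc[OF g]] tw_single[OF ga Lc[OF g]] pt Lc[OF g])
  moreover have "tw G ga g c * upt pt = tw G ga g (c * upt pt)"
   using twu[OF g] by (simp add: tw_mult[OF ga Lc[OF g]])
  moreover have "cor (tw G ga g c)" using Q by (simp add: Q_def cor_def ent_tw[OF ga Lc[OF g]])
  ultimately show "Q (ga g x) (tw G ga g c)" using Q by (simp add: Q_def)
 qed
 then obtain c where c: "!!x. x \<in> - F ==> Q x (c x)"
  "!!x g. x \<in> - F ==> g \<in> L ==> c (ga g x) = tw G ga g (c x)" by metis
 define X where "X = idx q - F"
 define t' where "t' = (\<Sum>x\<in>X. c x * single pt x e)"
 have it': "invt G ga L t'" unfolding invt_def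
 proof
  fix g assume g: "g \<in> L"
  have Xst: "ga g x \<in> X \<longleftrightarrow> x \<in> X" for x
   using Fst[OF g] idx_stable[OF ga Lc[OF g] invtD[OF invL(3) g]] by (simp add: X_def)
  have im: "ga g ` X = X"
  proof
   show "X \<subseteq> ga g ` X"
   proof
    fix x assume "x \<in> X"
    then have "ga (inv g) x \<in> X" using Xst[of "ga (inv g) x"] by (simp add: isactD[OF ga Lc[OF g]])
    then show "x \<in> ga g ` X" by (simp add: isact_image_iff[OF ga Lc[OF g]])
   qed
  qed (use Xst in auto)
  have inj: "inj_on (ga g) X" using isact_eq_iff(2)[OF ga Lc[OF g]] by (auto simp: inj_on_def)
  have "tw G ga g t' = (\<Sum>x\<in>X. c (ga g x) * single pt (ga g x) e)" unfolding t'_def tw_sum[OF ga Lc[OF g]]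
   by (rule sum.cong) (auto simp: tw_mult[OF ga Lc[OF g]] tw_single[OF ga Lc[OF g]] pt Lc[OF g] c(2)[OF _ g] X_def)
  also have "... = t'" unfolding t'_def by (subst (2) im[symmetric]) (simp add: sum.reindex[OF inj])
  finally show "tw G ga g t' = t'" .
 qed
 have ct': "cor t'" unfolding t'_def by (rule cor_sum) (use c(1) in \<open>auto simp: X_def Q_def intro!: cor_mult\<close>)
 have dt': "d * t' = colr (- F) q"
 proof (rule fmat_eqI)
  fix x y
  have "d * t' = (\<Sum>z\<in>X. q * single z z e)" unfolding t'_def sum_distrib_left
  proof (rule sum.cong)
   fix z assume "z \<in> X"
   then have "d * c z = q * single z pt e" using c(1)[of z] by (simp add: X_def Q_def)
   then show "d * (c z * single pt z e) = q * single z z e"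
    by (simp add: mult.assoc[symmetric]) (simp add: mult.assoc single_mult_single idem)
  qed simp
  then have "ent (d * t') x y = (\<Sum>z\<in>X. if z = y then ent q x y else 0)"
   by (simp add: corD(2)[OF q(1)] cong: sum.cong) (rule sum.cong, auto simp: corD(2)[OF q(1)])
  also have "... = ent (colr (- F) q) x y" using ent_idx[of q x y] by (auto simp: X_def)
  finally show "ent (d * t') x y = ent (colr (- F) q) x y" .
 qed
 obtain \<sigma> where \<sigma>: "cor \<sigma>" "homg dg 1 \<sigma>" "rho ga L eps * \<sigma> = \<sigma>"
  "rho ga L d * (\<sigma> * rho ga L q) = rho ga L q" using ex[OF L LN] by blast
 \<comment> \<open>The lift in the Brauer quotient. All its rows and columns are at indices fixed by
   \<open>L\<close>, so it is invariant although \<open>\<sigma>\<close> is arbitrary.\<close>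
 define c0 where "c0 = \<sigma> * rho ga L q"
 define c1 where "c1 = eps * c0"
 define c2 where "c2 = colr F q - d * c1"
 have c0: "rho ga L c0 = c0"
 proof (rule fmat_eqI)
  fix x y
  have "c0 = rho ga L eps * c0" by (simp add: c0_def mult.assoc[symmetric] \<sigma>)
  then have "ent c0 x y ~= 0 ==> x \<in> fixs ga L & y \<in> fixs ga L" by (metis c0_def ent_mult_nz ent_restr)
  then show "ent (rho ga L c0) x y = ent c0 x y" by auto
 qed
 have "invt G ga L c0" using invt_rho[OF ga L, of c0] c0 by simp
 then have i1: "invt G ga L c1" unfolding c1_def by (rule cl(3)[OF invL(1)])
 have iF: "invt G ga L (colr F q)" unfolding invt_def by (auto simp: tw_colr[OF ga Lc Fst] invtD[OF invL(3)])
 have i2: "invt G ga L c2" unfolding c2_def by (intro cl iF invL i1)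
 have cc: "cor c0" "cor c1" "cor c2" by (simp_all add: c0_def c1_def c2_def cor_intros \<sigma> cor_def[of "colr F q"] corD[OF q(1)])
 \<comment> \<open>The Brauer homomorphism makes \<open>c1\<close> a correct lift on the fixed
   indices. Hence the error \<open>c2\<close> has no entry with both indices fixed; as its columns
   are fixed, its rows are moved.\<close>
 have "rho ga L (d * c1) = rho ga L d * (rho ga L eps * c0)"
  unfolding c1_def using c0 \<open>invt G ga L c0\<close> invL i1[unfolded c1_def] by (simp add: rho_mult[OF ga L])
 also have "rho ga L eps * c0 = c0" by (simp add: c0_def mult.assoc[symmetric] \<sigma>)
 also have "rho ga L d * c0 = rho ga L q" by (simp add: c0_def \<sigma>)
 finally have r2: "rho ga L c2 = 0" by (simp add: c2_def restr_diff F_def restr_colr)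
 have "ent c0 x y ~= 0 ==> y \<in> F" for x y unfolding c0_def F_def by (metis ent_mult_nz ent_restr)
 then have colF0: "colr F c0 = c0" by (intro fmat_eqI) auto
 then have colF: "colr F c2 = c2" by (simp add: c2_def c1_def colr_diff mult_colr[symmetric] colr_colr)
 have c2F: "x \<in> - F" if "ent c2 x y ~= 0" for x y
 proof -
  have "y \<in> F" using that colF by (metis ent_colr)
  then show ?thesis using that arg_cong[OF r2, of "%a. ent a x y"] by (auto simp: F_def)
 qed
 have c2n: "dg x = n" if nz: "ent c2 x y ~= 0" for x y
 proof -
  have "homg dg 1 c0" unfolding c0_def by (rule homg_mult[of _ 1 _ 0]) (simp_all add: \<sigma> homg_restr q)
  then have "homg dg 1 c1" unfolding c1_def by (rule homg_mult[of _ 0, rotated]) simp_all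
  then have "homg dg 0 (d * c1)" by (rule homg_mult[of _ "- 1", rotated]) simp_all
  then have "homg dg 0 c2" unfolding c2_def by (intro homg_diff homg_colr q)
  then have "dg x = dg y" using homgD nz by force
  moreover have "dg y = n"
  proof (rule ccontr)
   assume "dg y ~= n"
   then have qz: "ent q z y = 0" for z using q(5) by blast
   then have "ent c0 z y = 0" for z unfolding c0_def by (metis ent_mult_nz ent_restr)
   then have "ent (d * c1) x y = 0" unfolding c1_def by (metis ent_mult_nz)
   then show False using nz by (simp add: c2_def qz split: if_splits)
  qed
  ultimately show ?thesis by simp
 qed
 \<comment> \<open>The error consists of cycles of degree \<open>n\<close>, so \<open>q\<close>
   reproduces it. Since its rows are moved, this involves only the columns of \<open>q\<close> at
   moved indices, and those are \<open>d * t'\<close>.\<close>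
 have "d * c2 = 0" "eps * c2 = c2"
  by (simp_all add: c2_def c1_def right_diff_distrib mult_colr q mult.assoc[symmetric])
 then have "c2 = q * c2" using qc c2n by metis
 also have "... = colr (- F) q * c2" by (rule colr_mult_rows[symmetric, OF c2F])
 also have "... = d * (t' * c2)" by (simp add: dt'[symmetric] mult.assoc)
 finally have "d * (t' + c1 + t' * c2) = colr (- F) q + d * c1 + c2" by (simp add: distrib_left dt')
 also have "... = q" by (simp add: c2_def colr_Compl)
 finally have "d * (t' + c1 + t' * c2) = q" .
 moreover have "invt G ga L (t' + c1 + t' * c2)" using it' i1 i2 by (intro cl)
 moreover have "cor (t' + c1 + t' * c2)" using cc ct' by (intro cor_intros)
 ultimately show ?case by blast
qed

text \<open>The contraction is extended upwards by one degree at a time, starting below the support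
  of the complex. In the next degree the defect \<open>eps - s * d\<close> takes values in the
  cycles and fixes them, so \<open>lift_through_boundary\<close> applies to it.\<close>

lemma bottom_contraction:
 assumes N: "subgroup N G" and C: "cplx dg eps d" and inv: "invt G ga N eps" "invt G ga N d"
  and ex: "!!L. subgroup L G ==> L \<subseteq> N ==> \<exists>\<sigma>. cor \<sigma> & homg dg 1 \<sigma> & rho ga L eps * \<sigma> = \<sigma> &
    cdeg dg (%n. n < b) (rho ga L d * \<sigma> + \<sigma> * rho ga L d) = cdeg dg (%n. n < b) (rho ga L eps)"
 shows "\<exists>s. cor s & invt G ga N s & homg dg 1 s & eps * s = s & s * eps = s &
  cdeg dg (%n. n < b) (d * s + s * d) = cdeg dg (%n. n < b) eps"
proof -
 note C' [simp] = C[unfolded cplx_def]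
 have NC: "N \<subseteq> carrier G" using N subgroup.subset by blast
 note cl = invt_closed[OF ga NC]
 have degst: "ga g x \<in> {x. P (dg x)} \<longleftrightarrow> x \<in> {x. P (dg x)}" if "g \<in> carrier G" for g x P
  using dg[OF that] by simp
 have invc: "invt G ga N a ==> invt G ga N (cdeg dg P a)" for a :: "('i, 'a) fmat" and P
  using NC by (auto simp: invt_def tw_colr[OF ga _ degst] subset_iff)
 have step: "\<exists>s. cor s & invt G ga N s & homg dg 1 s & eps * s = s & s * eps = s &
   cdeg dg (%m. m < n + 1) (d * s + s * d) = cdeg dg (%m. m < n + 1) eps"
  if n: "n < b" and s: "cor s" "invt G ga N s" "homg dg 1 s" "eps * s = s" "s * eps = s"
   "cdeg dg (%m. m < n) (d * s + s * d) = cdeg dg (%m. m < n) eps" for n s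
 proof -
  let ?A = "%m. m = n"
  \<comment> \<open>The defect in degree \<open>n\<close>. It is killed by \<open>d\<close> because
    \<open>s\<close> is a contraction in degree \<open>n - 1\<close>, where it gives
    \<open>d * s * d = d\<close>.\<close>
  define q where "q = cdeg dg ?A (eps - s * d)"
  have "homg dg 0 (s * d)" by (rule homg_mult[of _ 1 _ "- 1"]) (simp_all add: s)
  then have hq: "homg dg 0 q" unfolding q_def by (intro homg_colr homg_diff) simp_all
  have cq: "cor q" unfolding q_def by (intro cor_colr cor_diff cor_mult s) simp
  have eq: "eps * q = q" by (simp add: q_def mult_colr right_diff_distrib mult.assoc[symmetric] s)
  have qe: "q * eps = q"
   by (simp add: q_def cdeg_mult[of dg 0 eps "%m. m = n"] left_diff_distrib mult.assoc s)
  have iq: "invt G ga N q" unfolding q_def by (intro invc cl inv s)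
  have dq: "d * q = 0"
  proof -
   have "(d * s + s * d) * cdeg dg ?A d = eps * cdeg dg ?A d"
    by (rule cdeg_rows[OF s(6)]) (auto dest!: homgD[of dg "- 1" d, rotated] split: if_splits)
   then have "cdeg dg ?A (d * (s * d)) = cdeg dg ?A d" by (simp add: distrib_right mult_colr mult.assoc)
   then show ?thesis by (simp add: q_def mult_colr right_diff_distrib colr_diff)
  qed
  have qn: "dg y = n" if "ent q x y ~= 0" for x y using that by (simp add: q_def split: if_splits)
  have qc: "q * c = c" if "eps * c = c" "d * c = 0" "!!x y. ent c x y ~= 0 ==> dg x = n" for c
  proof -
   have "q * c = (eps - s * d) * c" unfolding q_def by (rule colr_mult_rows) (simp add: that(3))
   then show ?thesis using that by (simp add: left_diff_distrib mult.assoc)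
  qed
  have "\<exists>t. cor t & invt G ga N t & d * t = q"
  proof (rule lift_through_boundary[OF C N inv iq cq hq eq dq qn qc])
   fix L assume L: "subgroup L G" "L \<subseteq> N"
   then obtain \<sigma> where \<sigma>: "cor \<sigma>" "homg dg 1 \<sigma>" "rho ga L eps * \<sigma> = \<sigma>"
    "cdeg dg (%n. n < b) (rho ga L d * \<sigma> + \<sigma> * rho ga L d) = cdeg dg (%n. n < b) (rho ga L eps)"
    using ex by blast
   have iL: "invt G ga L eps" "invt G ga L d" "invt G ga L q" using inv iq L invt_mono by blast+
   have "rho ga L d * rho ga L q = 0" "rho ga L eps * rho ga L q = rho ga L q"
    using rho_mult[OF ga L(1) iL(2,3)] rho_mult[OF ga L(1) iL(1,3)] dq eq by simp_all
   moreover have "(rho ga L d * \<sigma> + \<sigma> * rho ga L d) * rho ga L q = rho ga L eps * rho ga L q"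
    by (rule cdeg_rows[OF \<sigma>(4)]) (use homgD[OF hq] qn n in \<open>fastforce split: if_splits\<close>)
   ultimately have "rho ga L d * (\<sigma> * rho ga L q) = rho ga L q" by (simp add: distrib_right mult.assoc)
   then show "\<exists>\<sigma>. cor \<sigma> & homg dg 1 \<sigma> & rho ga L eps * \<sigma> = \<sigma> &
    rho ga L d * (\<sigma> * rho ga L q) = rho ga L q" using \<sigma> by blast
  qed (use N in auto)
  then obtain t where t: "cor t" "invt G ga N t" "d * t = q" by blast
  \<comment> \<open>The lift is cut down to degree 1, to the image of \<open>eps\<close> on both
    sides and to columns of degree \<open>n\<close>; none of this changes its product with
    \<open>d\<close>.\<close>
  define t3 where "t3 = cdeg dg ?A (eps * part dg 1 t * eps)"
  have invp: "invt G ga N (part dg 1 t)" unfolding invt_def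
  proof
   fix g assume "g \<in> N"
   then show "tw G ga g (part dg 1 t) = part dg 1 t"
    using tw_part[OF ga, of g dg 1 t] dg NC invtD[OF t(2)] by (metis subsetD)
  qed
  have "d * part dg 1 t = q" by (subst part_mult_left[of dg "- 1"]) (simp_all add: t part_homg hq)
  moreover have "d * t3 = cdeg dg ?A (d * part dg 1 t * eps)"
   unfolding t3_def by (simp add: mult_colr mult.assoc[symmetric])
  ultimately have dt3: "d * t3 = q" by (simp add: qe) (simp add: q_def colr_colr)
  have ht3: "homg dg 1 t3"
   unfolding t3_def by (intro homg_colr homg_mult[of _ 1 _ 0] homg_mult[of _ 0 _ 1]) simp_all
  \<comment> \<open>The values of \<open>s\<close> from degree \<open>n\<close> on are discarded.
    The new piece does not disturb the degrees up to \<open>n\<close> through \<open>t3 * d\<close>,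
    which has columns of degree \<open>n + 1\<close> only.\<close>
  define s' where "s' = cdeg dg (%m. m < n) s + t3"
  have sd: "s' * d = cdeg dg (%m. m < n + 1) (s * d) + t3 * d"
   by (simp add: s'_def distrib_right cdeg_mult[of dg "- 1" d "%m. m < n"] algebra_simps)
  have t3d: "cdeg dg (%m. m < n + 1) (t3 * d) = 0"
   unfolding t3_def by (simp add: cdeg_mult[of dg "- 1" d "%m. m = n"] colr_colr) (rule fmat_eqI, auto)
  have "cdeg dg (%m. m < n + 1) (d * s' + s' * d) =
    cdeg dg (%m. m < n) (d * s) + q + cdeg dg (%m. m < n + 1) (s * d)" unfolding sd colr_add t3d
   by (simp add: s'_def distrib_left mult_colr dt3 colr_add colr_colr) (rule fmat_eqI, auto simp: q_def)
  also have "... = cdeg dg (%m. m < n) (d * s + s * d) + cdeg dg (%m. m = n) eps"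
   by (rule fmat_eqI) (auto simp: q_def)
  also have "... = cdeg dg (%m. m < n + 1) eps" unfolding s(6) by (rule fmat_eqI) auto
  finally have "cdeg dg (%m. m < n + 1) (d * s' + s' * d) = cdeg dg (%m. m < n + 1) eps" .
  moreover have "cor s'" unfolding s'_def t3_def by (intro cor_add cor_colr cor_mult s) simp
  moreover have "invt G ga N s'" unfolding s'_def t3_def by (intro cl invc s inv invp)
  moreover have "homg dg 1 s'" unfolding s'_def by (intro homg_add homg_colr s ht3)
  moreover have "eps * s' = s'" by (simp add: s'_def t3_def distrib_left mult_colr s mult.assoc[symmetric])
  moreover have "s' * eps = s'" by (simp add: s'_def t3_def distrib_right cdeg_mult[of dg 0 eps "%m. m = n"]
     cdeg_mult[of dg 0 eps "%m. m < n"] s mult.assoc)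
  ultimately show ?thesis by blast
 qed
 \<comment> \<open>Below \<open>n0\<close> the matrix \<open>eps\<close> has no columns, so the zero
   map starts the induction.\<close>
 obtain n0 where n0: "!!x. x \<in> idx eps ==> n0 \<le> dg x"
 proof (cases "idx eps = {}")
  case False
  then show thesis using that[of "Min (dg ` idx eps)"] by simp
 qed (use that in auto)
 have claim: "\<exists>s. cor s & invt G ga N s & homg dg 1 s & eps * s = s & s * eps = s &
   cdeg dg (%m. m < min b (n0 + int k)) (d * s + s * d) = cdeg dg (%m. m < min b (n0 + int k)) eps" for k
 proof (induction k)
  case 0
  have "cdeg dg (%m. m < min b (n0 + int 0)) eps = 0" by (rule fmat_eqI) (use n0 ent_idx in fastforce)
  then show ?case by (intro exI[of _ 0]) (simp add: cl)
 next
  case (Suc k)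
  then obtain s where s: "cor s" "invt G ga N s" "homg dg 1 s" "eps * s = s" "s * eps = s"
   "cdeg dg (%m. m < min b (n0 + int k)) (d * s + s * d) = cdeg dg (%m. m < min b (n0 + int k)) eps" by blast
  show ?case
  proof (cases "n0 + int k < b")
   case True
   then have "min b (n0 + int k) = n0 + int k" "min b (n0 + int (Suc k)) = n0 + int k + 1" by auto
   then show ?thesis using step[OF True s(1-5)] s(6) by simp
  next
   case False
   then have "min b (n0 + int (Suc k)) = min b (n0 + int k)" by auto
   then show ?thesis using s by auto
  qed
 qed
 have "min b (n0 + int (nat (b - n0))) = b" by auto
 then show ?thesis using claim[of "nat (b - n0)"] by simp
qed

text \<open>The homotopy of \<open>retracts\<close> contracts the restriction at \<open>L\<close> in
  degrees below \<open>b\<close>, though not equivariantly: the remaining term \<open>v * w\<close>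
  has columns of degree \<open>h L\<close> only.\<close>

lemma bottom_contraction_sphere:
 assumes N: "subgroup N G" and C: "cplx dg eps d" and inv: "invt G ga N eps" "invt G ga N d"
  and sph: "!!L. subgroup L G ==> L \<subseteq> N ==> sphere dg pt (rho ga L eps) (rho ga L d) (h L) & b \<le> h L"
  and deg0: "dg pt = 0"
 shows "\<exists>s. cor s & invt G ga N s & homg dg 1 s & eps * s = s & s * eps = s &
  (\<forall>z. (\<forall>x y. ent z x y ~= 0 --> dg x < b) --> (d * s + s * d) * z = eps * z)"
proof -
 have "\<exists>s. cor s & invt G ga N s & homg dg 1 s & eps * s = s & s * eps = s &
  cdeg dg (%n. n < b) (d * s + s * d) = cdeg dg (%n. n < b) eps"
 proof (rule bottom_contraction[OF N C inv])
  fix L assume L: "subgroup L G" "L \<subseteq> N"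
  then obtain s v w where r: "retracts dg pt (rho ga L eps) (rho ga L d) (h L) s v w" and b: "b \<le> h L"
   using sph unfolding sphere_def by blast
  have "cdeg dg (%n. n < b) (v * w) = 0"
  proof (rule fmat_eqI)
   fix x y
   have "homg dg (- h L) w" "cor w" "upt pt * w = w" using r by (simp_all add: retracts_def)
   then have "ent w z y = 0" if "dg y < b" for z
    using that b deg0 homgD[of dg "- h L" w z y] upt_mult[of w pt z y]
    by (cases "ent w z y = 0"; cases "z = pt") auto
   then show "ent (cdeg dg (%n. n < b) (v * w)) x y = ent 0 x y" by (auto simp: ent_mult[of "idx w" v])
  qed
  then show "\<exists>\<sigma>. cor \<sigma> & homg dg 1 \<sigma> & rho ga L eps * \<sigma> = \<sigma> &
    cdeg dg (%n. n < b) (rho ga L d * \<sigma> + \<sigma> * rho ga L d) = cdeg dg (%n. n < b) (rho ga L eps)"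
   using r by (intro exI[of _ s]) (simp add: retracts_def colr_diff)
 qed
 then show ?thesis using cdeg_rows[of "%n. n < b" dg] by blast
qed

end

text \<open>Transposing all matrices and negating the degrees exchanges bottom and top.\<close>

lemma top_contraction_sphere:
 fixes ga :: "'g => 'i => 'i" and dg :: "'i => int" and pt :: 'i
 assumes ga: "isact G ga" and dg: "!!g x. g \<in> carrier G ==> dg (ga g x) = dg x"
  and pt: "!!g. g \<in> carrier G ==> ga g pt = pt" and N: "subgroup N G" and C: "cplx dg eps d"
  and inv: "invt G ga N eps" "invt G ga N d"
  and sph: "!!L. subgroup L G ==> L \<subseteq> N ==> sphere dg pt (rho ga L eps) (rho ga L d) (h L) & h L \<le> b"
  and deg0: "dg pt = 0"
 shows "\<exists>s. cor s & invt G ga N s & homg dg 1 s & eps * s = s & s * eps = s &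
  (\<forall>z. (\<forall>x y. ent z x y ~= 0 --> b < dg x) --> (d * s + s * d) * z = eps * z)"
proof -
 let ?dg = "%x. - dg x"
 note C' [simp] = C[unfolded cplx_def]
 have NC: "N \<subseteq> carrier G" using N subgroup.subset by blast
 have "cplx ?dg (tpose eps) (tpose d)" unfolding cplx_def by (simp add: tpose_mult[symmetric] homg_tpose)
 note cpT = this
 have bc: "\<exists>s. cor s & invt G ga N s & homg ?dg 1 s & tpose eps * s = s & s * tpose eps = s &
    cdeg ?dg (%n. n < - b) (tpose d * s + s * tpose d) = cdeg ?dg (%n. n < - b) (tpose eps)"
  if ex: "!!L. subgroup L G ==> L \<subseteq> N ==> \<exists>\<sigma>. cor \<sigma> & homg ?dg 1 \<sigma> & rho ga L (tpose eps) * \<sigma> = \<sigma> &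
    cdeg ?dg (%n. n < - b) (rho ga L (tpose d) * \<sigma> + \<sigma> * rho ga L (tpose d))
    = cdeg ?dg (%n. n < - b) (rho ga L (tpose eps))"
  by (rule bottom_contraction[OF ga _ pt N cpT invt_closed(4)[OF ga NC inv(1)]
     invt_closed(4)[OF ga NC inv(2)] ex]) (simp_all add: dg)
 have "\<exists>\<sigma>. cor \<sigma> & homg ?dg 1 \<sigma> & rho ga L (tpose eps) * \<sigma> = \<sigma> &
   cdeg ?dg (%n. n < - b) (rho ga L (tpose d) * \<sigma> + \<sigma> * rho ga L (tpose d))
   = cdeg ?dg (%n. n < - b) (rho ga L (tpose eps))" if L: "subgroup L G" "L \<subseteq> N" for L
 proof -
  obtain s v w where r: "retracts dg pt (rho ga L eps) (rho ga L d) (h L) s v w" and b: "h L \<le> b"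
   using sph[OF L] unfolding sphere_def by blast
  have "cdeg ?dg (%n. n < - b) (tpose (v * w)) = 0"
  proof (rule fmat_eqI)
   fix x y
   have "homg dg (h L) v" "cor v" "v * upt pt = v" using r by (simp_all add: retracts_def)
   then have "ent v y z = 0" if "- dg y < - b" for z
    using that b deg0 homgD[of dg "h L" v y z] mult_upt[of v pt y z]
    by (cases "ent v y z = 0"; cases "z = pt") auto
   then show "ent (cdeg ?dg (%n. n < - b) (tpose (v * w))) x y = ent 0 x y"
    by (auto simp: ent_mult[of "idx v" v])
  qed
  then show ?thesis using r by (intro exI[of _ "tpose s"])
    (simp add: retracts_def restr_tpose tpose_mult[symmetric] tpose_add[symmetric]
     homg_tpose add.commute[of "s * _"], simp add: tpose_diff colr_diff)
 qed
 then obtain s where s: "cor s" "invt G ga N s" "homg ?dg 1 s" "tpose eps * s = s" "s * tpose eps = s"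
  "cdeg ?dg (%n. n < - b) (tpose d * s + s * tpose d) = cdeg ?dg (%n. n < - b) (tpose eps)" using bc by blast
 define t where "t = tpose s"
 have st: "s = tpose t" by (simp add: t_def)
 have t: "cor t" "homg dg 1 t" "eps * t = t" "t * eps = t"
  using s(1,3-5) unfolding st by (simp_all add: homg_tpose tpose_mult[symmetric]) (metis tpose_tpose)+
 have it: "invt G ga N t" unfolding t_def by (rule invt_closed(4)[OF ga NC s(2)])
 have z: "(d * t + t * d) * z = eps * z" if z: "!!x y. ent z x y ~= 0 ==> b < dg x" for z
 proof -
  \<comment> \<open>The transposed equation says that the error \<open>A\<close> has no rows of
    degree above \<open>b\<close>. Since \<open>A\<close> has degree 0, it has no such columns
    either.\<close>
  define A where "A = d * t + t * d - eps"
  have "homg dg 0 (d * t)" "homg dg 0 (t * d)"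
   by (rule homg_mult[of _ "-1" _ 1] homg_mult[of _ 1 _ "-1"], simp_all add: t)+
  then have hA: "homg dg 0 A" unfolding A_def by (intro homg_diff homg_add) simp_all
  have A0: "ent A y x = 0" if "b < dg y" for x y using that arg_cong[OF s(6), of "%a. ent a x y"]
   by (simp add: A_def st tpose_mult[symmetric] add.commute)
  have "A * z = 0"
  proof (rule fmat_eqI)
   fix x y
   have "ent A x w * ent z w y = 0" for w using A0[of x w] homgD[OF hA, of x w] z[of w y] by force
   then show "ent (A * z) x y = ent 0 x y" by (simp add: ent_mult[of "idx A" A])
  qed
  then show ?thesis by (simp add: A_def left_diff_distrib)
 qed
 show ?thesis using t it z by blast
qed

end

section \<open>Forerunners of complexes of matrices\<close>

text \<open>An index fixed by two subgroups is fixed by all they generate. Iterated restriction thus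
  leads to the join of the subgroups, and its mark enters the estimates.\<close>

lemma rho_rho_generate:
 assumes G: "group G" and ga: "isact G ga" and S: "H \<union> L \<subseteq> carrier G"
 shows "rho ga L (rho ga H a) = rho ga (generate G (H \<union> L)) a"
proof -
 interpret group G by (rule G)
 have "x \<in> fixs ga (generate G (H \<union> L))" if "x \<in> fixs ga (H \<union> L)" for x unfolding fixs_def
 proof safe
  fix g assume "g \<in> generate G (H \<union> L)"
  then show "ga g x = x"
  proof (induction rule: generate.induct)
   case one
   then show ?case using isactD(3)[OF ga one_closed] by simp
  next
   case (incl h)
   then show ?case using that by (simp add: fixs_def)
  next
   case (inv h)
   then have "h \<in> carrier G" "ga h x = x" using that S by (auto simp: fixs_def)
   then show ?case using isactD(1)[OF ga] by metis
  next
   case (eng h1 h2)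
   moreover have "h1 \<in> carrier G" "h2 \<in> carrier G" using eng generate_in_carrier[OF S] by blast+
   ultimately show ?case using ga by (simp add: isact_def)
  qed
 qed
 moreover have "fixs ga (generate G (H \<union> L)) \<subseteq> fixs ga (H \<union> L)" by (rule fixs_anti) (auto intro: generate.incl)
 ultimately have "fixs ga (generate G (H \<union> L)) = fixs ga L \<inter> fixs ga H" by (auto simp: fixs_Un)
 then show ?thesis by (simp add: restr_restr)
qed

section \<open>Conjugates, normalizers and left cosets\<close>

context group
begin

definition conj_set :: "'a => 'a set => 'a set" where "conj_set g H = (%h. g \<otimes> h \<otimes> inv g) ` H"

lemma conj_set_mult:
 assumes "g \<in> carrier G" "k \<in> carrier G" "H \<subseteq> carrier G"
 shows "conj_set (g \<otimes> k) H = conj_set g (conj_set k H)" unfolding conj_set_def image_image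
 by (rule image_cong) (use assms in \<open>auto simp: m_assoc inv_mult_group subset_iff\<close>)

lemma conj_set_one: "H \<subseteq> carrier G ==> conj_set \<one> H = H" by (force simp: conj_set_def subset_iff image_iff)

lemma conj_set_inv:
 assumes "g \<in> carrier G" "H \<subseteq> carrier G"
 shows "conj_set (inv g) (conj_set g H) = H" "conj_set g (conj_set (inv g) H) = H"
 using conj_set_mult[of "inv g" g H] conj_set_mult[of g "inv g" H] conj_set_one assms by simp_all

lemma card_conj_set: "g \<in> carrier G ==> H \<subseteq> carrier G ==> card (conj_set g H) = card H"
 unfolding conj_set_def by (rule card_image) (auto simp: inj_on_def subset_iff)

lemma subgroup_conj_set:
 assumes g: "g \<in> carrier G" and H: "subgroup H G" shows "subgroup (conj_set g H) G"
proof (rule subgroupI)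
 have Hc: "h \<in> H ==> h \<in> carrier G" for h using H subgroup.mem_carrier by fast
 show "conj_set g H \<subseteq> carrier G" using g Hc by (auto simp: conj_set_def)
 show "conj_set g H ~= {}" using subgroup.one_closed[OF H] by (auto simp: conj_set_def)
 show "inv x \<in> conj_set g H" if x: "x \<in> conj_set g H" for x
 proof -
  obtain h where h: "h \<in> H" "x = g \<otimes> h \<otimes> inv g" using x by (auto simp: conj_set_def)
  then have "inv x = g \<otimes> inv h \<otimes> inv g" using g Hc by (simp add: inv_mult_group m_assoc)
  then show ?thesis using h subgroup.m_inv_closed[OF H] by (auto simp: conj_set_def)
 qed
 show "x \<otimes> y \<in> conj_set g H" if x: "x \<in> conj_set g H" "y \<in> conj_set g H" for x y
 proof -
  obtain h k where h: "h \<in> H" "x = g \<otimes> h \<otimes> inv g" "k \<in> H" "y = g \<otimes> k \<otimes> inv g"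
   using x by (auto simp: conj_set_def)
  have "inv g \<otimes> (g \<otimes> z) = z" if "z \<in> carrier G" for z using g that by (simp add: m_assoc[symmetric])
  then have "x \<otimes> y = g \<otimes> (h \<otimes> k) \<otimes> inv g" using g Hc h by (simp add: m_assoc)
  then show ?thesis using h subgroup.m_closed[OF H] by (auto simp: conj_set_def)
 qed
qed

text \<open>The normalizer is taken relative to \<open>L\<close>, because the descent from a larger
  subgroup works with normalizers inside that subgroup.\<close>

definition normalizes :: "'a set => 'a set => 'a set" where "normalizes L H = {g\<in>L. conj_set g H = H}"

lemma subgroup_normalizes:
 assumes L: "subgroup L G" and H: "H \<subseteq> carrier G" shows "subgroup (normalizes L H) G"
proof (rule subgroupI)
 have Lc: "g \<in> L ==> g \<in> carrier G" for g using L subgroup.mem_carrier by fast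
 show "normalizes L H \<subseteq> carrier G" using Lc by (auto simp: normalizes_def)
 show "normalizes L H ~= {}" using subgroup.one_closed[OF L] conj_set_one[OF H] by (auto simp: normalizes_def)
 show "inv g \<in> normalizes L H" if "g \<in> normalizes L H" for g
 proof -
  have "g \<in> L" "conj_set g H = H" using that by (auto simp: normalizes_def)
  then show ?thesis
   using conj_set_inv(1)[OF Lc H, of g] subgroup.m_inv_closed[OF L] by (simp add: normalizes_def)
 qed
 show "g \<otimes> k \<in> normalizes L H" if "g \<in> normalizes L H" "k \<in> normalizes L H" for g k
  using that conj_set_mult[OF Lc Lc H] subgroup.m_closed[OF L] by (auto simp: normalizes_def)
qed

lemma subset_normalizes:
 assumes H: "subgroup H G" and HL: "H \<subseteq> L" shows "H \<subseteq> normalizes L H"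
proof
 fix h assume h: "h \<in> H"
 have Hc: "h \<in> H ==> h \<in> carrier G" for h using H subgroup.mem_carrier by fast
 have *: "conj_set k H \<subseteq> H" if "k \<in> H" for k
  using that subgroup.m_closed[OF H] subgroup.m_inv_closed[OF H] by (auto simp: conj_set_def)
 have "H = conj_set h (conj_set (inv h) H)" using conj_set_inv(2)[of h H] h Hc by auto
 also have "... \<subseteq> conj_set h H" using *[OF subgroup.m_inv_closed[OF H h]] by (auto simp: conj_set_def)
 finally show "h \<in> normalizes L H" using * h HL by (auto simp: normalizes_def)
qed

definition lcoset_set :: "'a set => 'a set => 'a set set" where "lcoset_set L N = (%g. (%n. g \<otimes> n) ` N) ` L"

lemma lcoset_eq:
 assumes N: "subgroup N G" and g: "g \<in> carrier G" and a: "a \<in> (%n. g \<otimes> n) ` N"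
 shows "(%n. a \<otimes> n) ` N = (%n. g \<otimes> n) ` N"
proof -
 obtain m where m: "m \<in> N" "a = g \<otimes> m" using a by auto
 have Nc: "n \<in> N ==> n \<in> carrier G" for n using N subgroup.mem_carrier by fast
 have "(%n. m \<otimes> n) ` N = N"
 proof
  show "(%n. m \<otimes> n) ` N \<subseteq> N" using m N subgroup.m_closed by fast
  show "N \<subseteq> (%n. m \<otimes> n) ` N"
  proof
   fix n assume "n \<in> N"
   then have "n = m \<otimes> (inv m \<otimes> n)" "inv m \<otimes> n \<in> N"
    using m Nc N by (simp_all add: m_assoc[symmetric] subgroup.m_closed subgroup.m_inv_closed)
   then show "n \<in> (%n. m \<otimes> n) ` N" by blast
  qed
 qed
 then have "(%n. g \<otimes> n) ` N = (%n. g \<otimes> (m \<otimes> n)) ` N" by (metis image_image)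
 also have "... = (%n. a \<otimes> n) ` N" using m g Nc by (intro image_cong) (simp_all add: m_assoc)
 finally show ?thesis ..
qed

end

context p_group_field
begin

lemma acts_on_lcosets:
 assumes H: "subgroup H G" and HL: "H \<subseteq> L" and L: "subgroup L G" and N: "N \<subseteq> carrier G"
 shows "acts_on H (%g A. (%a. g \<otimes> a) ` A) (lcoset_set L N)"
proof -
 have Lc: "g \<in> L ==> g \<in> carrier G" for g using L subgroup.mem_carrier by fast
 have img: "(%a. k \<otimes> a) ` ((%n. g \<otimes> n) ` N) = (%n. k \<otimes> g \<otimes> n) ` N" if "k \<in> carrier G" "g \<in> carrier G" for k g
  unfolding image_image using that N by (intro image_cong) (auto simp: m_assoc)
 show ?thesis unfolding acts_on_def
 proof (intro ballI conjI)
  fix A assume "A \<in> lcoset_set L N"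
  then obtain g where g: "g \<in> L" "A = (%n. g \<otimes> n) ` N" by (auto simp: lcoset_set_def)
  show "(%a. \<one> \<otimes> a) ` A = A" using img[of \<one> g] Lc[OF g(1)] g(2) by simp
  fix k assume k: "k \<in> H"
  then have kL: "k \<in> L" using HL by auto
  show "(%a. k \<otimes> a) ` A \<in> lcoset_set L N"
   using img[OF Lc[OF kL] Lc[OF g(1)]] subgroup.m_closed[OF L kL g(1)] g(2) unfolding lcoset_set_def by blast
  fix h assume "h \<in> H"
  then have hL: "h \<in> L" using HL by auto
  show "(%a. k \<otimes> h \<otimes> a) ` A = (%a. k \<otimes> a) ` ((%a. h \<otimes> a) ` A)" using Lc kL hL g by (simp add: img m_assoc)
 qed
qed

text \<open>The equation \<open>h g N = g N\<close> says that \<open>g^-1 h g\<close> lies in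
  \<open>N\<close>.\<close>

lemma fixed_lcoset:
 assumes H: "subgroup H G" and N: "subgroup N G" and g: "g \<in> carrier G"
  and fixed: "!!h. h \<in> H ==> (%a. h \<otimes> a) ` ((%n. g \<otimes> n) ` N) = (%n. g \<otimes> n) ` N"
 shows "conj_set (inv g) H \<subseteq> N"
proof
 fix x assume "x \<in> conj_set (inv g) H"
 then obtain h where h: "h \<in> H" "x = inv g \<otimes> h \<otimes> g" using g by (auto simp: conj_set_def)
 have hc: "h \<in> carrier G" using h H subgroup.mem_carrier by fast
 have "g \<in> (%n. g \<otimes> n) ` N" using g subgroup.one_closed[OF N] by (auto intro!: image_eqI[of _ _ \<one>])
 then have "h \<otimes> g \<in> (%n. g \<otimes> n) ` N" using fixed[OF h(1)] by blast
 then obtain n where n: "n \<in> N" "h \<otimes> g = g \<otimes> n" by auto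
 have "n \<in> carrier G" using n N subgroup.mem_carrier by fast
 then have "x = n" using h n g hc by (simp add: m_assoc) (simp add: m_assoc[symmetric])
 then show "x \<in> N" using n by simp
qed

text \<open>\<open>H\<close> acts on its cosets in \<open>L\<close>, whose number is divisible by
  \<open>p\<close>; so is the number of fixed ones. The coset \<open>H\<close> is fixed, hence there
  is another fixed coset \<open>g H\<close>, and its \<open>g\<close> normalizes
  \<open>H\<close>.\<close>

lemma normalizer_grows:
 assumes H: "subgroup H G" and L: "subgroup L G" and HL: "H \<subset> L"
 shows "H \<subset> normalizes L H"
proof -
 have Lc: "g \<in> L ==> g \<in> carrier G" for g using L subgroup.mem_carrier by fast
 have Hc: "g \<in> H ==> g \<in> carrier G" for g using H subgroup.mem_carrier by fast
 have finL: "finite L" by (rule finite_subgroup[OF L])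
 let ?W = "lcoset_set L H" and ?b = "%g A. (%a. g \<otimes> a) ` A"
 have finW: "finite ?W" using finL by (simp add: lcoset_set_def)
 have fib: "{g\<in>L. (%n. g \<otimes> n) ` H = A} = A" if A: "A \<in> ?W" for A
 proof -
  obtain k where k: "k \<in> L" "A = (%n. k \<otimes> n) ` H" using A by (auto simp: lcoset_set_def)
  have 1: "g \<in> (%n. g \<otimes> n) ` H" if "g \<in> L" for g
   using Lc[OF that] subgroup.one_closed[OF H] by (auto intro!: image_eqI[of _ _ \<one>])
  have 2: "(%n. g \<otimes> n) ` H = A" if "g \<in> A" for g using lcoset_eq[OF H Lc[OF k(1)]] that k by simp
  have 3: "A \<subseteq> L" using k HL subgroup.m_closed[OF L] by auto
  show ?thesis
  proof
   show "{g\<in>L. (%n. g \<otimes> n) ` H = A} \<subseteq> A" using 1 by blast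
   show "A \<subseteq> {g\<in>L. (%n. g \<otimes> n) ` H = A}" by (intro subsetI CollectI conjI) (use 3 2 in blast)+
  qed
 qed
 have cA: "card A = card H" if A: "A \<in> ?W" for A
 proof -
  obtain k where k: "k \<in> L" "A = (%n. k \<otimes> n) ` H" using A by (auto simp: lcoset_set_def)
  show ?thesis unfolding k(2) by (rule card_image) (use Hc Lc[OF k(1)] in \<open>auto simp: inj_on_def\<close>)
 qed
 have "card L = (\<Sum>A\<in>?W. card {g\<in>L. (%n. g \<otimes> n) ` H = A})"
  using sum.group[of L ?W "%g. (%n. g \<otimes> n) ` H" "%_. 1::nat"] finL finW by (simp add: lcoset_set_def)
 also have "... = card ?W * card H" by (simp add: fib cA)
 finally have cL: "card L = card ?W * card H" .
 have "card H < card L" using HL finL by (rule psubset_card_mono[rotated])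
 then have "card ?W ~= 1" using cL by auto
 moreover obtain m where "card L = p ^ m" using card_subgroup[OF L] by blast
 then obtain m' where "card ?W = p ^ m'" using cL prime_p by (metis divides_primepow_nat dvd_triv_left)
 ultimately have "p dvd card ?W" by (cases m') auto
 then have pd: "p dvd card {A\<in>?W. \<forall>g\<in>H. ?b g A = A}"
  using card_fixed_points[OF H finW acts_on_lcosets[OF H _ L]] HL Hc by blast
 have bH: "?b g H = H" if "g \<in> H" for g
  using lcoset_eq[OF H one_closed, of g] that Hc by (simp cong: image_cong)
 have "H \<in> ?W" unfolding lcoset_set_def
  by (rule image_eqI[of _ _ \<one>]) (use Hc subgroup.one_closed[OF L] in \<open>simp_all cong: image_cong\<close>)
 then have HF: "H \<in> {A\<in>?W. \<forall>g\<in>H. ?b g A = A}" using bH by blast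
 define S where "S = {A\<in>?W. \<forall>g\<in>H. ?b g A = A}"
 have "S ~= {H}"
 proof
  assume "S = {H}"
  then have "p dvd 1" using pd by (simp add: S_def)
  then show False using prime_p by simp
 qed
 moreover have "H \<in> S" using HF by (simp add: S_def)
 ultimately obtain A where AS: "A \<in> S" "A ~= H" by blast
 then have A: "A \<in> ?W" "!!g. g \<in> H ==> ?b g A = A" "A ~= H" by (simp_all add: S_def)
 obtain g where g: "g \<in> L" "A = (%n. g \<otimes> n) ` H" using A(1) by (auto simp: lcoset_set_def)
 have "conj_set (inv g) H \<subseteq> H" using fixed_lcoset[OF H H Lc[OF g(1)]] A(2) g(2) by simp
 then have "conj_set (inv g) H = H"
  using card_conj_set[of "inv g" H] Lc[OF g(1)] Hc finite_subgroup[OF H] by (simp add: card_subset_eq subset_iff)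
 then have "conj_set g H = H" using conj_set_inv(2)[OF Lc[OF g(1)], of H] Hc by auto
 then have "g \<in> normalizes L H" using g by (simp add: normalizes_def)
 moreover have "g ~: H" using A(3) g bH by auto
 ultimately show ?thesis using subset_normalizes[OF H] HL by blast
qed

section \<open>Powers and roots of unity in the corner\<close>

lemma corner_domain: "e * x = x ==> x * y = 0 ==> e * y = y ==> x = 0 \<or> y = 0"
 by (metis corner_inverse mult.assoc mult.commute mult_zero_right)

lemma corner_nilpotent: "e * x = x ==> x ^ n = 0 ==> n > 0 ==> x = 0"
proof (induction n)
 case (Suc n)
 show ?case
 proof (cases "n = 0")
  case False
  then have "e * x ^ n = x ^ n" using Suc.prems(1) by (cases n) (auto simp: mult.assoc[symmetric])
  then show ?thesis using Suc corner_domain[of x "x ^ n"] False by auto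
 qed (use Suc in simp)
qed simp

lemma power_e: "n > 0 ==> e ^ n = e"
 by (induction n) (auto simp: idem, metis gr0I idem mult.right_neutral power_0)

text \<open>In characteristic \<open>p\<close> the binomial formula gives
  \<open>x^p - 1 = (x - 1)^p\<close>, with \<open>e\<close> in place of 1, and a field has no
  nilpotent elements.\<close>

lemma corner_pth_root_one:
 assumes x: "e * x = x" and "x ^ p = e" shows "x = e"
proof -
 define z where "z = x - e"
 have z: "e * z = z" by (simp add: z_def right_diff_distrib x idem)
 have p1: "p > 0" using prime_p prime_gt_0_nat by blast
 have "x ^ p = (z + e) ^ p" by (simp add: z_def)
 also have "... = (\<Sum>k\<le>p. of_nat (p choose k) * z ^ k * e ^ (p - k))" by (rule binomial_ring)
 also have "... = (\<Sum>k\<in>{0, p}. of_nat (p choose k) * z ^ k * e ^ (p - k))"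
 proof (rule sum.mono_neutral_right)
  show "\<forall>k\<in>{..p} - {0, p}. of_nat (p choose k) * z ^ k * e ^ (p - k) = 0"
  proof
   fix k assume k: "k \<in> {..p} - {0, p}"
   then have "p dvd (p choose k)" using prime_p by (intro dvd_choose_prime) auto
   moreover have "e * (z ^ k * e ^ (p - k)) = z ^ k * e ^ (p - k)"
    using k z by (cases k) (auto simp: mult.assoc[symmetric])
   ultimately show "of_nat (p choose k) * z ^ k * e ^ (p - k) = 0" using of_nat_dvd_e by (metis mult.assoc)
  qed
 qed auto
 also have "... = e + z ^ p" using p1 power_e[OF p1] by simp
 finally have "z ^ p = 0" using assms(2) by simp
 then have "z = 0" using corner_nilpotent[OF z _ p1] by blast
 then show ?thesis by (simp add: z_def)
qed

lemma corner_root_one: "e * x = x ==> x ^ (p ^ n) = e ==> x = e"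
proof (induction n)
 case 0
 then show ?case by simp
next
 case (Suc n)
 have "e * x ^ (p ^ n) = x ^ (p ^ n)"
  using Suc.prems(1) prime_p by (cases "p ^ n") (auto simp: mult.assoc[symmetric] prime_gt_0_nat)
 moreover have "(x ^ (p ^ n)) ^ p = e" using Suc.prems(2) by (simp add: power_mult[symmetric] mult.commute)
 ultimately show ?case using Suc corner_pth_root_one by blast
qed

end

section \<open>An invariant cycle that is no boundary in the Brauer quotient\<close>

context p_group_field
begin

text \<open>\<open>h\<close> is the mark as a function of the subgroup, \<open>sph\<close> says that
  the restriction at \<open>L\<close> is one-dimensional up to homotopy in that degree, and
  \<open>mono\<close> is effectiveness.\<close>

context
 fixes ga :: "'g => 'i => 'i" and dg :: "'i => int" and pt :: 'i
  and eps d :: "('i, 'a) fmat" and h :: "'g set => int"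
 assumes ga: "isact G ga" and dg: "!!g x. g \<in> carrier G ==> dg (ga g x) = dg x"
  and pt: "!!g. g \<in> carrier G ==> ga g pt = pt" and deg0: "dg pt = 0" and C: "cplx dg eps d"
  and inv: "invt G ga (carrier G) eps" "invt G ga (carrier G) d"
  and sph: "!!L. subgroup L G ==> sphere dg pt (rho ga L eps) (rho ga L d) (h L)"
  and mono: "!!L H. subgroup L G ==> subgroup H G ==> L \<subseteq> H ==> h H \<le> h L"
begin

lemma pt_fixs: "subgroup L G ==> pt \<in> fixs ga L"
 unfolding fixs_def by (intro CollectI ballI pt) (rule subgroup.mem_carrier)

lemma invt_sub: "invt G ga (carrier G) a ==> subgroup L G ==> invt G ga L a"
 using invt_mono subgroup.subset by blast

lemma rho_mult_inv:
 assumes "subgroup L G" "invt G ga L a" "invt G ga L b" "cor a"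
 shows "rho ga L (a * b) = rho ga L a * rho ga L b" by (rule rho_mult[OF ga assms])

lemma cplx_rho:
 assumes H: "subgroup H G" shows "cplx dg (rho ga H eps) (rho ga H d)"
proof -
 note [simp] = C[unfolded cplx_def]
 note i = invt_sub[OF inv(1) H] invt_sub[OF inv(2) H]
 show ?thesis unfolding cplx_def using homg_restr[of dg 0 eps] homg_restr[of dg "- 1" d]
  by (simp add: cor_restr rho_mult_inv[OF H, symmetric] i)
qed

text \<open>Elements that normalize \<open>H\<close> permute the indices fixed by \<open>H\<close>,
  so the restriction keeps their symmetry. This is the action of the Weyl group on the Brauer
  quotient.\<close>

lemma invt_rho_normal:
 assumes H: "subgroup H G" and N: "N \<subseteq> normalizes (carrier G) H" and a: "invt G ga N a"
 shows "invt G ga N (rho ga H a)" unfolding invt_def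
proof
 fix g assume g: "g \<in> N"
 then have gc: "g \<in> carrier G" and c: "(%h. g \<otimes> h \<otimes> inv g) ` H = H"
  using N by (auto simp: normalizes_def conj_set_def)
 show "tw G ga g (rho ga H a) = rho ga H a"
  using tw_restr[OF ga gc fixs_stable_normal[OF ga H gc c], of a] invtD[OF a g] by simp
qed

lemma join_subgroup:
 assumes H: "subgroup H G" and L: "subgroup L G"
 shows "subgroup (generate G (H \<union> L)) G" "H \<subseteq> generate G (H \<union> L)" "L \<subseteq> generate G (H \<union> L)"
  "rho ga L (rho ga H a) = rho ga (generate G (H \<union> L)) a"
proof -
 have "H \<union> L \<subseteq> carrier G" using subgroup.subset[OF H] subgroup.subset[OF L] by blast
 then show "subgroup (generate G (H \<union> L)) G" "rho ga L (rho ga H a) = rho ga (generate G (H \<union> L)) a"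
  by (rule generate_is_subgroup, rule rho_rho_generate[OF is_group ga])
 show "H \<subseteq> generate G (H \<union> L)" "L \<subseteq> generate G (H \<union> L)" by (auto intro: generate.incl)
qed

text \<open>The complex \<open>Hom(\<Psi>\<^sup>H C, C)\<close> has its homology in degrees \<open>h L - h (H L) \<ge> 0\<close>, so that it is
 contractible in negative degrees, equivariantly. Subtracting the contraction of its boundary turns
 the obvious section of \<open>C \<rightarrow> \<Psi>\<^sup>H C\<close> into a chain map.\<close>

lemma inflation_to_complex:
 assumes H: "subgroup H G" and N: "subgroup N G" "N \<subseteq> normalizes (carrier G) H" "H \<subseteq> N"
 shows "\<exists>F. cor F & invt G ga N F & homg dg 0 F & eps * F = F & F * rho ga H eps = F &
  d * F = F * rho ga H d & rho ga H F = rho ga H eps"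
proof -
 let ?p = "pact ga" and ?eH = "rho ga H eps" and ?dH = "rho ga H d"
 let ?dg = "hom_deg dg dg" and ?E = "hom_eps ?eH eps" and ?D = "hom_d dg ?eH ?dH eps d"
 have NC: "N \<subseteq> carrier G" by (rule subgroup.subset[OF N(1)])
 note C' [simp] = C[unfolded cplx_def]
 note CH = cplx_rho[OF H] note CH' [simp] = CH[unfolded cplx_def]
 have cE: "cplx ?dg ?E ?D" by (rule cplx_hom[OF CH C])
 have pa: "isact G ?p" by (rule isact_pact[OF ga])
 have iN: "invt G ga N eps" "invt G ga N d" using invt_sub inv N(1) by blast+
 note iNH = invt_rho_normal[OF H N(2) iN(1)] invt_rho_normal[OF H N(2) iN(2)]
 note cl = invt_closed[OF ga NC]
 have isg: "invt G ga N (sg dg a)" if "invt G ga N a" for a :: "('i, 'a) fmat" unfolding invt_def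
 proof
  fix g assume g: "g \<in> N"
  then show "tw G ga g (sg dg a) = sg dg a"
   using tw_sg[OF ga, of g dg a] dg NC invtD[OF that g] by (metis subsetD)
 qed
 have ikron: "invt G ?p N (kron a b)" if "invt G ga N a" "invt G ga N b" for a b :: "('i, 'a) fmat"
  unfolding invt_def using that NC by (simp add: tw_kron[OF ga] subset_iff invt_def)
 have iE: "invt G ?p N ?E" unfolding hom_eps_def by (intro ikron cl iN iNH)
 have iD: "invt G ?p N ?D" unfolding hom_d_def by (intro invt_closed(1)[OF pa NC] ikron cl isg iN iNH)
 have "\<exists>s. cor s & invt G ?p N s & homg ?dg 1 s & ?E * s = s & s * ?E = s &
  (\<forall>z. (\<forall>x y. ent z x y ~= 0 --> ?dg x < 0) --> (?D * s + s * ?D) * z = ?E * z)"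
 proof (rule bottom_contraction_sphere[OF pa _ _ N(1) cE iE iD,
    where pt = "(pt, pt)" and h = "%L. h L - h (generate G (H \<union> L))"])
  fix L assume L: "subgroup L G" "L \<subseteq> N"
  note J = join_subgroup[OF H L(1)]
  have "rho ?p L ?E = hom_eps (rho ga (generate G (H \<union> L)) eps) (rho ga L eps)"
   unfolding hom_eps_def fixs_pact restr_kron restr_tpose J(4) ..
  moreover have "rho ?p L ?D = hom_d dg (rho ga (generate G (H \<union> L)) eps)
    (rho ga (generate G (H \<union> L)) d) (rho ga L eps) (rho ga L d)"
   unfolding hom_d_def fixs_pact restr_add restr_kron restr_tpose restr_uminus restr_sg J(4) ..
  moreover have "0 \<le> h L - h (generate G (H \<union> L))" using mono[OF L(1) J(1,3)] by simp
  ultimately show "sphere ?dg (pt, pt) (rho ?p L ?E) (rho ?p L ?D) (h L - h (generate G (H \<union> L))) &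
    0 \<le> h L - h (generate G (H \<union> L))"
   using sphere_hom[OF cplx_rho[OF J(1)] cplx_rho[OF L(1)] sph[OF J(1)] sph[OF L(1)]] by simp
 qed (simp_all add: pact_def hom_deg_def dg pt deg0)
 then obtain S where S: "cor S" "invt G ?p N S" "homg ?dg 1 S" "?E * S = S"
  "!!z. (!!x y. ent z x y ~= 0 ==> ?dg x < 0) ==> (?D * S + S * ?D) * z = ?E * z" by metis
 \<comment> \<open>The differential \<open>?D\<close> of the \<open>Hom\<close> complex, read on
   matrices instead of on vectors.\<close>
 define \<delta> where "\<delta> a = d * a * sg dg ?eH - eps * a * sg dg ?dH" for a
 have D\<delta>: "?D * vec pt a = vec pt (\<delta> a)" for a
  unfolding hom_d_def \<delta>_def distrib_right kron_vec by (simp add: vec_add[symmetric])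
 have E_vec: "?E * vec pt a = vec pt (eps * a * ?eH)" for a unfolding hom_eps_def kron_vec ..
 have sgH: "?eH * sg dg x = sg dg (?eH * x)" "?dH * sg dg x = - sg dg (?dH * x)" for x
  using mult_sg_even[of dg 0 ?eH x] mult_sg_odd[of dg "-1" ?dH x] by simp_all
 \<comment> \<open>\<open>eps * ?eH\<close> is the obvious map from the fixed indices into the
   complex. The sign operator is attached because cycles of \<open>Hom\<close> become chain maps
   only after multiplication by it.\<close>
 define a0 where "a0 = eps * ?eH * sg dg ?eH"
 have ca0: "cor a0" by (simp add: a0_def cor_intros)
 have ha0: "homg dg 0 a0" unfolding a0_def by (intro homg_mult[of _ 0 _ 0]) simp_all
 have ia0: "invt G ga N a0" unfolding a0_def by (intro cl isg iN iNH)
 have ea0: "eps * a0 = a0" "a0 * ?eH = a0"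
  by (simp_all add: a0_def mult.assoc[symmetric]) (simp add: mult.assoc sg_mult sgH)
 \<comment> \<open>\<open>u0\<close> measures how far this map is from a chain map. It is a cycle of
   degree -1 in \<open>Hom\<close>, where the equivariant contraction \<open>S\<close> exists, so it
   is the boundary of \<open>W\<close>.\<close>
 define u0 where "u0 = \<delta> a0"
 have cu0: "cor u0" by (simp add: u0_def \<delta>_def cor_intros)
 have hu0: "homg dg (- 1) u0" unfolding u0_def \<delta>_def
  by (intro homg_diff homg_mult[of _ "- 1" _ 0] homg_mult[of _ 0 _ "- 1"] homg_mult[OF _ ha0]) simp_all
 have iu0: "invt G ga N u0" unfolding u0_def \<delta>_def by (intro cl isg iN iNH ia0)
 define W where "W = S * vec pt u0"
 have cW: "cor W" by (simp add: W_def cor_intros S)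
 have "?D * vec pt u0 = ?D * ?D * vec pt a0" by (simp add: u0_def D\<delta>[symmetric] mult.assoc)
 then have Du0: "?D * vec pt u0 = 0" using cE by (simp add: cplx_def)
 have "?E * vec pt u0 = ?E * ?D * vec pt a0" by (simp add: u0_def D\<delta>[symmetric] mult.assoc)
 then have Eu0: "?E * vec pt u0 = vec pt u0" using cE by (simp add: cplx_def u0_def D\<delta>)
 have "(?D * S + S * ?D) * vec pt u0 = ?E * vec pt u0"
 proof (rule S(5))
  fix x y assume "ent (vec pt u0) x y ~= 0"
  then have "ent u0 (snd x) (fst x) ~= 0" by (simp add: ent_vec split: if_splits)
  then show "?dg x < 0" using homgD[OF hu0] by (fastforce simp: hom_deg_def)
 qed
 then have DW: "?D * W = vec pt u0" by (simp add: W_def distrib_right mult.assoc Du0 Eu0)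
 define wm where "wm = unvec pt W"
 have W0: "ent W x y = 0" if "y ~= (pt, pt)" for x y
 proof -
  have "ent (vec pt u0) z y = 0" for z using that by (simp add: ent_vec)
  then show ?thesis unfolding W_def by (metis ent_mult_nz)
 qed
 have vwm: "vec pt wm = W" by (rule fmat_eqI) (use W0 in \<open>auto simp: wm_def ent_vec ent_unvec\<close>)
 have "vec pt (eps * wm * ?eH) = vec pt wm"
  unfolding E_vec[symmetric] vwm by (simp add: W_def mult.assoc[symmetric] S)
 then have ewm': "eps * wm * ?eH = wm" by (simp add: vec_eq_iff)
 have ewm: "eps * wm = wm" "wm * ?eH = wm"
  by (subst (2) ewm'[symmetric], subst ewm'[symmetric], simp add: mult.assoc[symmetric])
   (subst (2) ewm'[symmetric], subst ewm'[symmetric], simp add: mult.assoc)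
 have hW: "homg ?dg 0 W"
 proof -
  have "homg ?dg (- 1) (vec pt u0)" unfolding homg_def ent_vec using homgD[OF hu0] by (auto simp: hom_deg_def)
  then show ?thesis unfolding W_def by (rule homg_mult[OF S(3)]) simp
 qed
 have hwm: "homg dg 0 wm"
  unfolding homg_def wm_def ent_unvec using homgD[OF hW] by (fastforce simp: hom_deg_def)
 have iW: "invt G ?p N W"
 proof -
  have "invt G ?p N (vec pt u0)"
   unfolding invt_def using tw_vec[OF ga, of _ pt u0] NC pt invtD[OF iu0] by (metis subsetD)
  then show ?thesis unfolding W_def by (rule invt_closed(3)[OF pa NC S(2)])
 qed
 have iwm: "invt G ga N wm"
  unfolding invt_def wm_def using tw_unvec[OF ga, of _ pt W] NC pt invtD[OF iW] by (metis subsetD)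
 define a1 where "a1 = a0 - wm"
 have "?D * vec pt a1 = 0" unfolding a1_def vec_diff right_diff_distrib vwm DW by (simp add: D\<delta> u0_def)
 then have "\<delta> a1 = 0" unfolding D\<delta> by (metis unvec_vec vec_0)
 moreover have ea1: "eps * a1 = a1" "a1 * ?eH = a1"
  by (simp_all add: a1_def right_diff_distrib left_diff_distrib ea0 ewm)
 ultimately have da1: "d * a1 * sg dg ?eH = a1 * sg dg ?dH" by (simp add: \<delta>_def)
 \<comment> \<open>This undoes the twist by the sign operator: \<open>\<delta> a1 = 0\<close> means
   that \<open>a1\<close> followed by this factor commutes with the differentials.\<close>
 define F where "F = a1 * sg dg ?eH"
 have "d * F = F * ?dH" using da1 by (simp add: F_def mult.assoc sg_mult)
 moreover have "F * ?eH = F" by (simp add: F_def mult.assoc sg_mult)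
 moreover have "eps * F = F" by (simp add: F_def mult.assoc[symmetric] ea1)
 moreover have "homg dg 0 F"
  unfolding F_def a1_def by (rule homg_mult[of _ 0 _ 0]) (simp_all add: homg_diff ha0 hwm)
 moreover have iF: "invt G ga N F" unfolding F_def a1_def by (intro cl isg ia0 iwm iNH)
 moreover have ca1: "cor a1" unfolding a1_def wm_def by (intro cor_intros ca0 cW)
 then have "cor F" by (simp add: F_def cor_mult)
 \<comment> \<open>On the fixed indices \<open>a0\<close> is a cycle from the start. So
   \<open>u0\<close>, and with it the correction \<open>wm\<close>, restricts to zero, and only the
   identity remains.\<close>
 moreover have "rho ga H F = ?eH"
 proof -
  have iH: "invt G ga H a" if "invt G ga N a" for a :: "('i, 'a) fmat" using that N(3) invt_mono by blast
  note rm = rho_mult_inv[OF H iH iH]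
  have rr: "rho ga H (sg dg (rho ga H x)) = sg dg (rho ga H x)" "rho ga H (rho ga H x) = rho ga H x"
   for x :: "('i, 'a) fmat" by (simp_all add: restr_sg restr_restr)
  have ra0: "rho ga H a0 = sg dg ?eH"
  proof -
   have "rho ga H a0 = rho ga H (eps * ?eH) * rho ga H (sg dg ?eH)"
    unfolding a0_def by (rule rm) (intro cl isg iN iNH cor_intros | simp)+
   also have "rho ga H (eps * ?eH) = rho ga H eps * rho ga H ?eH" by (rule rm) (intro iN iNH | simp)+
   finally show ?thesis by (simp add: rr sgH)
  qed
  have "rho ga H u0 = rho ga H (d * a0) * rho ga H (sg dg ?eH) - rho ga H (eps * a0) * rho ga H (sg dg ?dH)"
   unfolding u0_def \<delta>_def restr_diff
   by (intro arg_cong2[of _ _ _ _ "(-)"] rm cl isg iN iNH ia0 cor_mult) simp_all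
  also have "rho ga H (d * a0) = ?dH * rho ga H a0" by (intro rm iN ia0) simp
  also have "rho ga H (eps * a0) = ?eH * rho ga H a0" by (intro rm iN ia0) simp
  finally have "rho ga H u0 = 0" by (simp add: ra0 rr mult.assoc sg_mult sgH sg_uminus)
  moreover have "rho ?p H (vec pt u0) = vec pt (rho ga H u0)"
   unfolding fixs_pact by (rule restr_vec[OF pt_fixs[OF H]])
  moreover have "rho ?p H W = rho ?p H S * rho ?p H (vec pt u0)" unfolding W_def
  proof (rule rho_mult[OF pa H])
   show "invt G ?p H S" using S(2) N(3) invt_mono by blast
   show "invt G ?p H (vec pt u0)" unfolding invt_def
    using tw_vec[OF ga, of _ pt u0] NC pt invtD[OF iu0] N(3) by (metis subsetD)
  qed (rule S(1))
  ultimately have "rho ?p H W = 0" by simp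
  then have "rho ga H wm = 0" unfolding wm_def restr_unvec[OF pt_fixs[OF H]] fixs_pact[symmetric]
   by (simp, intro fmat_eqI, simp add: ent_unvec)
  then have "rho ga H a1 = sg dg ?eH" by (simp add: a1_def restr_diff ra0)
  moreover have "rho ga H F = rho ga H a1 * rho ga H (sg dg ?eH)"
   unfolding F_def by (rule rm) (simp_all add: isg iNH ca1, simp add: a1_def cl ia0 iwm)
  ultimately show ?thesis by (simp add: rr sg_mult sgH)
 qed
 ultimately show ?thesis by blast
qed

text \<open>The homology of a complex with all marks at most \<open>h H\<close> is generated in degree \<open>h H\<close> by a fixed
 cycle, since a \<open>p\<close>-group acts trivially on a one-dimensional space in characteristic \<open>p\<close>.\<close>

lemma top_cycle:
 assumes H: "subgroup H G" and N: "subgroup N G" "N \<subseteq> normalizes (carrier G) H"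
 shows "\<exists>y w. cor y & cor w & homg dg (h H) y & y * upt pt = y & rho ga H eps * y = y &
  rho ga H d * y = 0 & invt G ga N y & w * rho ga H d = 0 & w * y = upt pt"
proof -
 let ?eH = "rho ga H eps" and ?dH = "rho ga H d"
 have NC: "N \<subseteq> carrier G" by (rule subgroup.subset[OF N(1)])
 note CH = cplx_rho[OF H] note CH' [simp] = CH[unfolded cplx_def]
 have iN: "invt G ga N eps" "invt G ga N d" using invt_sub inv N(1) by blast+
 note iNH = invt_rho_normal[OF H N(2) iN(1)] invt_rho_normal[OF H N(2) iN(2)]
 \<comment> \<open>The restriction at \<open>L\<close> of the complex at \<open>H\<close> belongs to
   the join of \<open>H\<close> and \<open>L\<close>, which contains \<open>H\<close>; so its mark
   is at most \<open>h H\<close>, and the complex at \<open>H\<close> is contractible above that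
   degree, equivariantly.\<close>
 have "\<exists>s. cor s & invt G ga N s & homg dg 1 s & ?eH * s = s & s * ?eH = s &
  (\<forall>z. (\<forall>x y. ent z x y ~= 0 --> h H < dg x) --> (?dH * s + s * ?dH) * z = ?eH * z)"
 proof (rule top_contraction_sphere[OF ga dg pt N(1) CH iNH _ deg0, where h = "%L. h (generate G (H \<union> L))"])
  fix L assume L: "subgroup L G" "L \<subseteq> N"
  note J = join_subgroup[OF H L(1)]
  show "sphere dg pt (rho ga L ?eH) (rho ga L ?dH) (h (generate G (H \<union> L))) & h (generate G (H \<union> L)) \<le> h H"
   unfolding J(4) using sph[OF J(1)] mono[OF H J(1,2)] by simp
 qed
 then obtain s where s: "cor s" "invt G ga N s" "homg dg 1 s" "?eH * s = s"
  "!!z. (!!x y. ent z x y ~= 0 ==> h H < dg x) ==> (?dH * s + s * ?dH) * z = ?eH * z" by metis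
 obtain t v w where r: "retracts dg pt ?eH ?dH (h H) t v w" using sph[OF H] unfolding sphere_def by blast
 then have [simp]: "cor t" "cor v" "cor w" "?eH * v = v" "w * ?eH = w" "?dH * v = 0" "w * ?dH = 0"
  "v * upt pt = v" "?eH * t = t" "w * v = upt pt" "upt pt * w = w"
  and hv: "homg dg (h H) v" and ht: "homg dg 1 t" and dt: "?dH * t + t * ?dH = ?eH - v * w"
  by (simp_all add: retracts_def)
 \<comment> \<open>The generator \<open>v\<close> need not be invariant. The map
   \<open>\<theta>\<close> is equivariant and vanishes on boundaries of degree \<open>h H\<close>,
   because \<open>s\<close> is a contraction in degree \<open>h H + 1\<close>. So
   \<open>\<theta> * v\<close> depends on the class of \<open>v\<close> only.\<close>
 define \<theta> where "\<theta> = ?eH - ?dH * s"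
 define y where "y = \<theta> * v"
 have c\<theta>: "cor \<theta>" by (simp add: \<theta>_def cor_intros)
 have i\<theta>: "invt G ga N \<theta>" unfolding \<theta>_def by (intro invt_closed[OF ga NC] iNH s)
 have wy: "w * y = upt pt" by (simp add: y_def \<theta>_def left_diff_distrib right_diff_distrib mult.assoc[symmetric])
 have \<theta>d: "\<theta> * (?dH * z) = 0" if z: "?eH * z = z" "!!x y. ent z x y ~= 0 ==> dg x = h H + 1" for z
 proof -
  have "(?dH * s + s * ?dH) * z = ?eH * z" by (rule s(5)) (use z(2) in force)
  then have "?dH * ((?dH * s + s * ?dH) * z) = ?dH * z" by (simp add: z)
  then have "?dH * (s * (?dH * z)) = ?dH * z" by (simp add: distrib_right distrib_left mult.assoc[symmetric])
  then show ?thesis by (simp add: \<theta>_def left_diff_distrib mult.assoc) (simp add: mult.assoc[symmetric])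
 qed
 \<comment> \<open>The scalar by which \<open>g\<close> acts on the one-dimensional homology; it
   turns out to be multiplicative in \<open>g\<close>.\<close>
 define \<chi> where "\<chi> g = ent (w * tw G ga g v) pt pt" for g
 have tu: "tw G ga g (upt pt) = upt pt" if "g \<in> carrier G" for g
  using that by (simp add: upt_def tw_single[OF ga] pt)
 have ctw: "cor (tw G ga g a)" if "g \<in> carrier G" "cor a" for g and a :: "('i, 'a) fmat"
  using that by (simp add: cor_def ent_tw[OF ga])
 have c\<chi>: "e * \<chi> g = \<chi> g" for g unfolding \<chi>_def by (rule corD(1)) (simp add: cor_mult)
 have ty: "tw G ga g y = y * single pt pt (\<chi> g)" if g: "g \<in> N" for g
 proof -
  have gc: "g \<in> carrier G" using g NC by blast
  let ?v = "tw G ga g v"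
  have v1: "?v * upt pt = ?v" using tw_mult[OF ga gc, of v "upt pt"] tu[OF gc] by simp
  have v2: "?eH * ?v = ?v" "?dH * ?v = 0"
   using tw_mult[OF ga gc, of ?eH v] tw_mult[OF ga gc, of ?dH v] invtD[OF iNH(1) g] invtD[OF iNH(2) g]
   by (simp_all add: tw_0[OF ga gc])
  have "upt pt * (w * ?v) * upt pt = w * ?v" by (simp add: mult.assoc v1) (simp add: mult.assoc[symmetric])
  then have wv: "w * ?v = single pt pt (\<chi> g)" unfolding \<chi>_def by (subst (asm) upt_scalar) (simp_all add: cor_mult)
  have hv': "homg dg (h H) ?v" unfolding homg_def
  proof (intro allI impI)
   fix x z assume "ent ?v x z ~= 0"
   then have "ent v (ga (inv g) x) (ga (inv g) z) ~= 0" by (simp add: ent_tw[OF ga gc])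
   from homgD[OF hv this] show "dg x = dg z + h H" using gc by (simp add: dg)
  qed
  have "?v = ?eH * ?v" by (simp add: v2)
  also have "... = (?dH * t + t * ?dH + v * w) * ?v" by (simp add: dt)
  also have "... = ?dH * (t * ?v) + v * single pt pt (\<chi> g)" by (simp add: distrib_right mult.assoc v2 wv)
  finally have v3: "?v = ?dH * (t * ?v) + v * single pt pt (\<chi> g)" .
  have "\<theta> * (?dH * (t * ?v)) = 0"
  proof (rule \<theta>d)
   show "?eH * (t * ?v) = t * ?v" by (simp add: mult.assoc[symmetric])
   have ht': "homg dg (h H + 1) (t * ?v)" by (rule homg_mult[OF ht hv']) simp
   fix x z assume nz: "ent (t * ?v) x z ~= 0"
   have "t * ?v * upt pt = t * ?v" by (simp add: mult.assoc v1)
   then have "z = pt" using nz col_iff[of "t * ?v" pt] by (simp add: cor_mult) metis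
   then show "dg x = h H + 1" using homgD[OF ht' nz] deg0 by simp
  qed
  then have "\<theta> * ?v = y * single pt pt (\<chi> g)" by (subst v3) (simp add: distrib_left y_def mult.assoc)
  then show ?thesis using tw_mult[OF ga gc, of \<theta> v] invtD[OF i\<theta> g] by (simp add: y_def)
 qed
 have \<chi>m: "\<chi> (g \<otimes> k) = \<chi> g * \<chi> k" if g: "g \<in> N" and k: "k \<in> N" for g k
 proof -
  have gc: "g \<in> carrier G" and kc: "k \<in> carrier G" using g k NC by blast+
  have gk: "g \<otimes> k \<in> N" using subgroup.m_closed[OF N(1) g k] .
  have "y * single pt pt (\<chi> (g \<otimes> k)) = tw G ga g (tw G ga k y)" by (simp only: tw_tw[OF ga gc kc] ty[OF gk])
  also have "... = tw G ga g y * single pt pt (\<chi> k)"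
   unfolding ty[OF k] by (simp add: tw_mult[OF ga gc] tw_single[OF ga gc] pt gc)
  also have "... = y * single pt pt (\<chi> g * \<chi> k)" unfolding ty[OF g] by (simp add: mult.assoc single_mult_single)
  finally have "w * (y * single pt pt (\<chi> (g \<otimes> k))) = w * (y * single pt pt (\<chi> g * \<chi> k))" by simp
  then have "single pt pt (\<chi> (g \<otimes> k)) = (single pt pt (\<chi> g * \<chi> k) :: ('i, 'a) fmat)"
   using c\<chi>[of "g \<otimes> k"] c\<chi>[of g] by (simp add: mult.assoc[symmetric] wy)
    (simp add: upt_def single_mult_single mult.assoc[symmetric])
  then show ?thesis by (metis ent_single)
 qed
 have \<chi>1: "\<chi> \<one> = e" unfolding \<chi>_def by (simp add: tw_one[OF ga]) (simp add: upt_def)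
 have \<chi>: "\<chi> g = e" if g: "g \<in> N" for g
 proof -
  have gc: "g \<in> carrier G" using g NC by blast
  have pw: "g [^] (n::nat) \<in> N & \<chi> (g [^] (Suc n)) = \<chi> g ^ Suc n" for n
  proof (induction n)
   case 0
   then show ?case using subgroup.one_closed[OF N(1)] gc by simp
  next
   case (Suc n)
   have "g [^] Suc n \<in> N" using Suc subgroup.m_closed[OF N(1)] g by simp
   then show ?case using Suc \<chi>m[OF _ g, of "g [^] Suc n"] by (simp add: mult_ac)
  qed
  obtain m where m: "order G = p ^ m" using p_group by blast
  have "p ^ m > 0" using prime_p prime_gt_0_nat by simp
  then obtain q where q: "p ^ m = Suc q" using gr0_implies_Suc by blast
  have "g [^] (p ^ m) = \<one>" using pow_order_eq_1[OF gc] m by simp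
  then have "\<chi> g ^ (p ^ m) = e" using pw[of q] q \<chi>1 by simp
  then show ?thesis using corner_root_one[OF c\<chi>] by blast
 qed
 have yu: "y * upt pt = y" by (simp add: y_def mult.assoc)
 have "invt G ga N y" unfolding invt_def using ty \<chi> yu by (simp add: upt_def)
 moreover have "?eH * y = y" "?dH * y = 0"
  by (simp_all add: y_def \<theta>_def left_diff_distrib right_diff_distrib mult.assoc[symmetric])
 moreover have "homg dg (h H) y" unfolding y_def \<theta>_def left_diff_distrib
  by (intro homg_diff homg_mult[of _ 0 _ "h H"] homg_mult[of _ "- 1" _ 1]) (simp_all add: hv s)
 ultimately show ?thesis using wy yu by (intro exI[of _ y] exI[of _ w]) (simp add: y_def cor_mult c\<theta>)
qed

lemma col_restr:
 assumes "cor a" "a * upt pt = a" shows "restr A a * upt pt = restr A a"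
 using assms col_iff[of a pt] col_iff[of "restr A a" pt] by (simp add: cor_restr)

text \<open>\<open>F\<close> carries the cycle \<open>y\<close> of the restriction to a cycle
  \<open>x\<close> that is invariant under the normalizer \<open>N\<close>, and the translates of
  \<open>x\<close> over the cosets of \<open>N\<close> are added up. The restriction of this sum is
  \<open>y\<close> plus boundaries.\<close>

lemma forerunner_at_maximal:
 assumes H: "subgroup H G" and max: "!!L. subgroup L G ==> H \<subset> L ==> h L < h H"
 shows "\<exists>X. cor X & X * upt pt = X & eps * X = X & d * X = 0 & homg dg (h H) X &
  invt G ga (carrier G) X & (\<forall>z. rho ga H X ~= rho ga H d * z)"
proof -
 note C' [simp] = C[unfolded cplx_def]
 let ?eH = "rho ga H eps" and ?dH = "rho ga H d"
 have Hc: "H \<subseteq> carrier G" by (rule subgroup.subset[OF H])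
 define N where "N = normalizes (carrier G) H"
 have N: "subgroup N G" "N \<subseteq> normalizes (carrier G) H" "H \<subseteq> N"
  unfolding N_def using subgroup_normalizes[OF subgroup_self Hc] subset_normalizes[OF H Hc] by simp_all
 have NC: "N \<subseteq> carrier G" by (rule subgroup.subset[OF N(1)])
 obtain F where F: "cor F" "invt G ga N F" "homg dg 0 F" "eps * F = F" "F * ?eH = F"
  "d * F = F * ?dH" "rho ga H F = ?eH" using inflation_to_complex[OF H N] by blast
 obtain y w where y: "cor y" "cor w" "homg dg (h H) y" "y * upt pt = y" "?eH * y = y"
  "?dH * y = 0" "invt G ga N y" "w * ?dH = 0" "w * y = upt pt" using top_cycle[OF H N(1,2)] by blast
 define x where "x = F * y"
 have ix: "invt G ga N x" unfolding x_def by (intro invt_closed(3)[OF ga NC] F y)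
 \<comment> \<open>\<open>H\<close> and \<open>H'\<close> generate a larger group \<open>K\<close>,
   with \<open>h K < h H\<close> by maximality. The restriction of \<open>y\<close> at
   \<open>H'\<close> is a cycle of degree \<open>h H\<close> in a complex with homology in degree
   \<open>h K\<close> only, hence a boundary, and \<open>F\<close> commutes with the
   differentials.\<close>
 have bnd: "\<exists>z. rho ga H' x = rho ga H' d * z" if H': "subgroup H' G" "H' \<subseteq> N" "\<not> H' \<subseteq> H" for H'
 proof -
  define K where "K = generate G (H \<union> H')"
  note J = join_subgroup[OF H H'(1), folded K_def]
  have "h K < h H" using max[OF J(1)] J(2,3) H'(3) by blast
  have iN: "invt G ga N eps" "invt G ga N d" using invt_sub inv N(1) by blast+
  note iNH = invt_rho_normal[OF H N(2) iN(1)] invt_rho_normal[OF H N(2) iN(2)]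
  note iH' = invt_mono[OF _ H'(2)]
  note CK [simp] = cplx_rho[OF J(1), unfolded cplx_def]
  note CH [simp] = cplx_rho[OF H, unfolded cplx_def]
  obtain t v w' where r: "retracts dg pt (rho ga K eps) (rho ga K d) (h K) t v w'"
   using sph[OF J(1)] unfolding sphere_def by blast
  then have w': "homg dg (- h K) w'" "upt pt * w' = w'" "cor w'"
   and dt: "rho ga K d * t + t * rho ga K d = rho ga K eps - v * w'" by (simp_all add: retracts_def)
  define y' where "y' = rho ga H' y"
  have y'u: "y' * upt pt = y'" unfolding y'_def by (rule col_restr[OF y(1,4)])
  have "rho ga K d * y' = rho ga H' (?dH * y)"
   unfolding y'_def J(4)[symmetric] by (rule rho_mult_inv[OF H'(1), symmetric]) (simp_all add: iH' iNH y)
  then have dy': "rho ga K d * y' = 0" by (simp add: y)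
  have "rho ga K eps * y' = rho ga H' (?eH * y)"
   unfolding y'_def J(4)[symmetric] by (rule rho_mult_inv[OF H'(1), symmetric]) (simp_all add: iH' iNH y)
  then have ey': "rho ga K eps * y' = y'" by (simp add: y y'_def)
  have "w' * y' = 0"
  proof (rule fmat_eqI)
   fix r c
   have "homg dg (- h K + h H) (w' * y')" by (rule homg_mult[OF w'(1)]) (simp_all add: y'_def homg_restr y)
   then have *: "ent (w' * y') r c ~= 0 ==> dg r ~= dg c" using homgD \<open>h K < h H\<close> by fastforce
   have "w' * y' = upt pt * (w' * y') * upt pt"
    by (simp add: mult.assoc y'u) (simp add: mult.assoc[symmetric] w')
   also have "... = single pt pt (ent (w' * y') pt pt)" by (rule upt_scalar) (simp add: cor_mult w')
   finally have "w' * y' = single pt pt (ent (w' * y') pt pt)" .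
   then have "ent (w' * y') r c ~= 0 ==> r = c" by (metis ent_single)
   then show "ent (w' * y') r c = ent 0 r c" using * by auto
  qed
  then have "(rho ga K d * t + t * rho ga K d) * y' = y'"
   unfolding dt by (simp add: left_diff_distrib ey' mult.assoc)
  then have y'b: "y' = rho ga K d * (t * y')" by (simp add: distrib_right mult.assoc dy')
  have "rho ga H' x = rho ga H' F * y'"
   unfolding x_def y'_def by (rule rho_mult_inv[OF H'(1)]) (simp_all add: iH' F y)
  also have "... = rho ga H' F * rho ga H' ?dH * (t * y')" by (subst y'b) (simp add: J(4) mult.assoc)
  also have "rho ga H' F * rho ga H' ?dH = rho ga H' (F * ?dH)"
   by (rule rho_mult_inv[OF H'(1), symmetric]) (simp_all add: iH' F iNH)
  also have "... = rho ga H' d * rho ga H' F"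
   unfolding F(6)[symmetric] by (rule rho_mult_inv[OF H'(1)]) (simp_all add: iH' F iN)
  finally show ?thesis by (metis mult.assoc)
 qed
 let ?I = "lcoset_set (carrier G) N" and ?b = "%g A. (%a. g \<otimes> a) ` A"
 \<comment> \<open>The translate of \<open>x\<close> by a coset of \<open>N\<close>. The choice of a
   representative is harmless because \<open>x\<close> is invariant under \<open>N\<close>.\<close>
 define \<phi> where "\<phi> A = tw G ga (SOME g. g \<in> A) x" for A
 have \<phi>: "\<phi> ((%n. g \<otimes> n) ` N) = tw G ga g x" if g: "g \<in> carrier G" for g
 proof -
  have "(SOME a. a \<in> (%n. g \<otimes> n) ` N) \<in> (%n. g \<otimes> n) ` N"
   by (rule someI_ex) (use subgroup.one_closed[OF N(1)] in blast)
  then obtain n where n: "n \<in> N" "(SOME a. a \<in> (%n. g \<otimes> n) ` N) = g \<otimes> n" by blast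
  have nc: "n \<in> carrier G" using n(1) NC by blast
  show ?thesis unfolding \<phi>_def n(2) tw_tw[OF ga g nc, symmetric] invtD[OF ix n(1)] ..
 qed
 have finI: "finite ?I" using finite_G by (simp add: lcoset_set_def)
 have aI: "acts_on (carrier G) ?b ?I" by (rule acts_on_lcosets[OF subgroup_self _ subgroup_self NC]) simp
 have \<phi>b: "\<phi> (?b k A) = tw G ga k (\<phi> A)" if k: "k \<in> carrier G" and A: "A \<in> ?I" for k A
 proof -
  obtain g where g: "g \<in> carrier G" "A = (%n. g \<otimes> n) ` N" using A unfolding lcoset_set_def by blast
  have "?b k A = (%n. (k \<otimes> g) \<otimes> n) ` N"
   unfolding g(2) image_image by (rule image_cong) (use k g NC in \<open>auto simp: m_assoc\<close>)
  then show ?thesis using \<phi>[OF g(1)] \<phi>[OF m_closed[OF k g(1)]] g(2) tw_tw[OF ga k g(1), of x] by simp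
 qed
 define X where "X = (\<Sum>A\<in>?I. \<phi> A)"
 have iX: "invt G ga (carrier G) X" unfolding invt_def
 proof
  fix k assume k: "k \<in> carrier G"
  have bij: "bij_betw (?b k) ?I ?I"
  proof (rule bij_betwI[of _ _ _ "?b (inv k)"])
   show "?b k \<in> ?I \<rightarrow> ?I" "?b (inv k) \<in> ?I \<rightarrow> ?I"
    using aI k unfolding acts_on_def by (intro funcsetI; metis inv_closed)+
   fix A assume A: "A \<in> ?I"
   have "?b (inv k) (?b k A) = ?b (inv k \<otimes> k) A" using aI k A unfolding acts_on_def by (metis inv_closed)
   then show "?b (inv k) (?b k A) = A" using aI k A unfolding acts_on_def by (metis l_inv)
   have "?b k (?b (inv k) A) = ?b (k \<otimes> inv k) A" using aI k A unfolding acts_on_def by (metis inv_closed)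
   then show "?b k (?b (inv k) A) = A" using aI k A unfolding acts_on_def by (metis r_inv)
  qed
  have "tw G ga k X = (\<Sum>A\<in>?I. \<phi> (?b k A))"
   unfolding X_def tw_sum[OF ga k] by (rule sum.cong) (simp_all add: \<phi>b[OF k])
  also have "... = X" unfolding X_def by (rule sum.reindex_bij_betw[OF bij])
  finally show "tw G ga k X = X" .
 qed
 have tw\<phi>: "\<exists>g\<in>carrier G. \<phi> A = tw G ga g x" if "A \<in> ?I" for A using that \<phi> unfolding lcoset_set_def by blast
 have c\<phi>: "cor (\<phi> A)" if "A \<in> ?I" for A
  using tw\<phi>[OF that] F(1) by (auto simp: x_def cor_def[of "tw _ _ _ _"] ent_tw[OF ga] corD(1) cor_mult)
 have tx: "tw G ga g x * upt pt = tw G ga g x" "eps * tw G ga g x = tw G ga g x"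
  "d * tw G ga g x = 0" "homg dg (h H) (tw G ga g x)" if g: "g \<in> carrier G" for g
 proof -
  have "tw G ga g (upt pt) = upt pt" using g by (simp add: upt_def tw_single[OF ga] pt)
  then show "tw G ga g x * upt pt = tw G ga g x"
   using tw_mult[OF ga g, of x "upt pt"] by (simp add: x_def mult.assoc y)
  show "eps * tw G ga g x = tw G ga g x"
   using tw_mult[OF ga g, of eps x] invtD[OF inv(1) g] by (simp add: x_def mult.assoc[symmetric] F)
  have "d * x = F * (?dH * y)" by (simp add: x_def mult.assoc[symmetric] F)
  then show "d * tw G ga g x = 0"
   using tw_mult[OF ga g, of d x] invtD[OF inv(2) g] by (simp add: y tw_0[OF ga g])
  have hx: "homg dg (h H) x" unfolding x_def by (rule homg_mult[OF F(3) y(3)]) simp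
  show "homg dg (h H) (tw G ga g x)" unfolding homg_def
  proof (intro allI impI)
   fix r c assume "ent (tw G ga g x) r c ~= 0"
   then have "ent x (ga (inv g) r) (ga (inv g) c) ~= 0" by (simp add: ent_tw[OF ga g])
   from homgD[OF hx this] show "dg r = dg c + h H" using g by (simp add: dg)
  qed
 qed
 have "X * upt pt = X" unfolding X_def sum_distrib_right by (rule sum.cong) (use tw\<phi> tx in \<open>auto dest!: tw\<phi>\<close>)
 moreover have "eps * X = X" unfolding X_def sum_distrib_left by (rule sum.cong) (use tx in \<open>auto dest!: tw\<phi>\<close>)
 moreover have "d * X = 0" unfolding X_def sum_distrib_left by (rule sum.neutral) (use tx in \<open>auto dest!: tw\<phi>\<close>)
 moreover have "homg dg (h H) X"
 proof -
  have "homg dg (h H) (\<Sum>A\<in>J. \<phi> A)" if "J \<subseteq> ?I" for J using finite_subset[OF that finI] that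
   by (induction J rule: finite_induct) (use tx in \<open>auto dest!: tw\<phi> intro!: homg_add\<close>)
  then show ?thesis by (simp add: X_def)
 qed
 moreover have "cor X" unfolding X_def by (rule cor_sum) (rule c\<phi>)
 moreover have "rho ga H X ~= ?dH * z" for z
 proof
  assume z: "rho ga H X = ?dH * z"
  let ?Fx = "{A\<in>?I. \<forall>g\<in>H. ?b g A = A}"
  have aH: "acts_on H ?b ?I" by (rule acts_on_lcosets[OF H Hc subgroup_self NC])
  \<comment> \<open>Translates along an orbit of \<open>H\<close> agree on the indices that
    \<open>H\<close> fixes, so the cosets moved by \<open>H\<close> contribute zero.\<close>
  have "rho ga H X = (\<Sum>A\<in>?Fx. rho ga H (\<phi> A))"
  proof (rule fmat_eqI)
   fix r c
   have "ent (rho ga H X) r c = (\<Sum>A\<in>?I. ent (rho ga H (\<phi> A)) r c)" unfolding X_def restr_sum ent_sum ..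
   also have "... = (\<Sum>A\<in>?Fx. ent (rho ga H (\<phi> A)) r c)"
   proof (rule sum_fixed_points[OF H finI aH])
    show "e * ent (rho ga H (\<phi> A)) r c = ent (rho ga H (\<phi> A)) r c" if "A \<in> ?I" for A
     by (rule corD(1)) (rule cor_restr[OF c\<phi>[OF that]])
    show "ent (rho ga H (\<phi> (?b g A))) r c = ent (rho ga H (\<phi> A)) r c" if "A \<in> ?I" "g \<in> H" for A g
    proof -
     have gc: "g \<in> carrier G" using that Hc by blast
     show ?thesis unfolding \<phi>b[OF gc that(1)] rho_tw_self[OF ga H that(2)] ..
    qed
   qed
   finally show "ent (rho ga H X) r c = ent (\<Sum>A\<in>?Fx. rho ga H (\<phi> A)) r c" by simp
  qed
  also have "... = rho ga H (\<phi> N) + (\<Sum>A\<in>?Fx - {N}. rho ga H (\<phi> A))"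
  proof (rule sum.remove)
   show "finite ?Fx" using finI by simp
   have "N = (%n. \<one> \<otimes> n) ` N" using NC by (simp cong: image_cong add: subset_iff)
   then have "N \<in> ?I" unfolding lcoset_set_def by blast
   moreover have "?b g N = N" if "g \<in> H" for g
   proof -
    have "g \<in> (%n. \<one> \<otimes> n) ` N" using that N(3) \<open>N = (%n. \<one> \<otimes> n) ` N\<close> by blast
    then show ?thesis using lcoset_eq[OF N(1) one_closed] \<open>N = (%n. \<one> \<otimes> n) ` N\<close> by metis
   qed
   ultimately show "N \<in> ?Fx" by blast
  qed
  also have "\<phi> N = x"
  proof -
   have "N = (%n. \<one> \<otimes> n) ` N" using NC by (simp cong: image_cong add: subset_iff)
   then show ?thesis using \<phi>[OF one_closed] tw_one[OF ga, of x] by metis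
  qed
  also have "rho ga H x = y"
  proof -
   have "rho ga H x = rho ga H F * rho ga H y"
    unfolding x_def by (rule rho_mult_inv[OF H]) (simp_all add: invt_mono[OF F(2) N(3)] invt_mono[OF y(7) N(3)] F)
   also have "... = ?eH * y"
   proof (rule fmat_eqI)
    fix r c
    have "?eH * y = y" by (rule y)
    have "rho ga H y = y"
    proof (rule fmat_eqI)
     fix r c
     have "ent y r c ~= 0 ==> r \<in> fixs ga H" using y(5) by (metis ent_mult_nz ent_restr)
     moreover have "ent y r c ~= 0 ==> c \<in> fixs ga H" using y(4) col_iff[OF y(1)] pt_fixs[OF H] by metis
     ultimately show "ent (rho ga H y) r c = ent y r c" by auto
    qed
    then show "ent (rho ga H F * rho ga H y) r c = ent (?eH * y) r c" by (simp add: F)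
   qed
   finally show ?thesis by (simp add: y)
  qed
  finally have sumX: "rho ga H X = y + (\<Sum>A\<in>?Fx - {N}. rho ga H (\<phi> A))" .
  \<comment> \<open>A fixed coset of \<open>g\<close> means that the conjugate \<open>H'\<close> of
    \<open>H\<close> by \<open>inv g\<close> lies in \<open>N\<close>. It is not contained in
    \<open>H\<close>, for otherwise it would equal \<open>H\<close> and \<open>g\<close> would lie
    in \<open>N\<close>. So \<open>bnd\<close> applies to \<open>H'\<close>, and conjugation by
    \<open>g\<close> carries its conclusion to \<open>H\<close>.\<close>
  have "\<exists>u. rho ga H (\<phi> A) = ?dH * u" if A: "A \<in> ?Fx - {N}" for A
  proof -
   obtain g where g: "g \<in> carrier G" "A = (%n. g \<otimes> n) ` N" using A unfolding lcoset_set_def by blast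
   define H' where "H' = conj_set (inv g) H"
   have H': "subgroup H' G" unfolding H'_def by (rule subgroup_conj_set[OF inv_closed[OF g(1)] H])
   have "H' \<subseteq> N" unfolding H'_def using A g by (intro fixed_lcoset[OF H N(1) g(1)]) blast
   have cH': "conj_set g H' = H" unfolding H'_def by (rule conj_set_inv(2)[OF g(1) Hc])
   have "\<not> H' \<subseteq> H"
   proof
    assume "H' \<subseteq> H"
    moreover have "card H' = card H" unfolding H'_def using card_conj_set[of "inv g" H] g(1) Hc by simp
    ultimately have "H' = H" using finite_subgroup[OF H] by (simp add: card_subset_eq)
    then have "g \<in> N" using cH' g(1) by (simp add: N_def normalizes_def)
    moreover have "N = (%n. \<one> \<otimes> n) ` N" using NC by (simp cong: image_cong add: subset_iff)
    ultimately have "A = N" using lcoset_eq[OF N(1) one_closed, of g] g(2) by metis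
    then show False using A by blast
   qed
   then obtain u where u: "rho ga H' x = rho ga H' d * u" using bnd[OF H' \<open>H' \<subseteq> N\<close>] by blast
   have tr: "tw G ga g (rho ga H' a) = rho ga H (tw G ga g a)" for a :: "('i, 'a) fmat"
    using tw_restr[OF ga g(1) fixs_conj[OF ga g(1) subgroup.subset[OF H']], of a] cH'
    by (simp add: conj_set_def)
   have "rho ga H (\<phi> A) = tw G ga g (rho ga H' d * u)" unfolding g(2) \<phi>[OF g(1)] tr[symmetric] u ..
   also have "... = ?dH * tw G ga g u" unfolding tw_mult[OF ga g(1)] tr invtD[OF inv(2) g(1)] ..
   finally show ?thesis by blast
  qed
  then have "\<forall>A\<in>?Fx - {N}. \<exists>u. rho ga H (\<phi> A) = ?dH * u" by (rule ballI)
  from bchoice[OF this] obtain u where "\<forall>A\<in>?Fx - {N}. rho ga H (\<phi> A) = ?dH * u A" ..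
  then have u: "rho ga H (\<phi> A) = ?dH * u A" if "A \<in> ?Fx - {N}" for A using that by (rule bspec)
  have "(\<Sum>A\<in>?Fx - {N}. rho ga H (\<phi> A)) = ?dH * (\<Sum>A\<in>?Fx - {N}. u A)"
   unfolding sum_distrib_left by (rule sum.cong[OF refl]) (rule u)
  \<comment> \<open>Then \<open>y\<close> would be a boundary, but \<open>w\<close> vanishes on
    boundaries while \<open>w * y\<close> is the unit.\<close>
  then have "y = ?dH * (z - (\<Sum>A\<in>?Fx - {N}. u A))" using sumX z by (simp add: right_diff_distrib algebra_simps)
  then have "w * y = w * (?dH * (z - (\<Sum>A\<in>?Fx - {N}. u A)))" by (rule arg_cong)
  also have "... = 0" unfolding mult.assoc[symmetric] y(8) by (rule mult_zero_left)
  finally show False using y(9) upt_nz[of pt] by simp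
 qed
 ultimately show ?thesis using iX by blast
qed

text \<open>Let \<open>N\<close> be the normalizer of \<open>H\<close> in \<open>L\<close>; its mark
  is squeezed between two equal ones. Above this mark the restriction at \<open>H\<close> has a
  contraction that is equivariant under \<open>N\<close>. If \<open>X\<close> became a boundary at
  \<open>H\<close>, the contraction would provide an invariant preimage, and restricting it to the
  indices fixed by \<open>N\<close> would make \<open>X\<close> a boundary at
  \<open>N\<close>.\<close>

lemma nonboundary_descends:
 assumes L: "subgroup L G" and X: "cor X" "invt G ga (carrier G) X" "homg dg (h L) X"
  "X * upt pt = X" and nb: "!!z. rho ga L X ~= rho ga L d * z"
 shows "subgroup H G ==> H \<subseteq> L ==> h H = h L ==> rho ga H X ~= rho ga H d * z"
proof (induction "card L - card H" arbitrary: H z rule: less_induct)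
 case less
 note H = less.prems(1) and HL = less.prems(2) and hH = less.prems(3)
 have finL: "finite L" by (rule finite_subgroup[OF L])
 have Hc: "H \<subseteq> carrier G" by (rule subgroup.subset[OF H])
 show ?case
 proof (cases "H = L")
  case False
  then have HL': "H \<subset> L" using HL by blast
  define N where "N = normalizes L H"
  have HN: "H \<subset> N" unfolding N_def by (rule normalizer_grows[OF H L HL'])
  have N: "subgroup N G" "N \<subseteq> L" "N \<subseteq> normalizes (carrier G) H"
   unfolding N_def using subgroup_normalizes[OF L Hc] subgroup.subset[OF L] by (auto simp: normalizes_def)
  have NC: "N \<subseteq> carrier G" by (rule subgroup.subset[OF N(1)])
  have hN: "h N = h L" using mono[OF N(1) L N(2)] mono[OF H N(1)] HN hH by auto
  have "card H < card N" using HN finite_subgroup[OF N(1)] by (rule psubset_card_mono[rotated])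
  moreover have "card N \<le> card L" using N(2) finL by (rule card_mono[rotated])
  ultimately have IH: "rho ga N X ~= rho ga N d * z" for z using less.hyps[OF _ N(1,2) hN] by simp
  let ?eH = "rho ga H eps" and ?dH = "rho ga H d"
  note CH = cplx_rho[OF H] note CH' [simp] = CH[unfolded cplx_def]
  have iN: "invt G ga N eps" "invt G ga N d" "invt G ga N X" using invt_sub inv N(1) X by blast+
  note iNH = invt_rho_normal[OF H N(3) iN(1)] invt_rho_normal[OF H N(3) iN(2)] invt_rho_normal[OF H N(3) iN(3)]
  have "\<exists>s. cor s & invt G ga N s & homg dg 1 s & ?eH * s = s & s * ?eH = s &
   (\<forall>z. (\<forall>x y. ent z x y ~= 0 --> h H < dg x) --> (?dH * s + s * ?dH) * z = ?eH * z)"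
  proof (rule top_contraction_sphere[OF ga dg pt N(1) CH iNH(1,2) _ deg0,
     where h = "%L. h (generate G (H \<union> L))"])
   fix L' assume L': "subgroup L' G" "L' \<subseteq> N"
   note J = join_subgroup[OF H L'(1)]
   show "sphere dg pt (rho ga L' ?eH) (rho ga L' ?dH) (h (generate G (H \<union> L'))) &
     h (generate G (H \<union> L')) \<le> h H" unfolding J(4) using sph[OF J(1)] mono[OF H J(1,2)] by simp
  qed
  then obtain s where s: "cor s" "invt G ga N s" "homg dg 1 s" "?eH * s = s"
   "!!z. (!!x y. ent z x y ~= 0 ==> h H < dg x) ==> (?dH * s + s * ?dH) * z = ?eH * z" by metis
  show ?thesis
  proof
   assume z: "rho ga H X = ?dH * z"
   define \<xi> where "\<xi> = rho ga H X"
   have \<xi>u: "\<xi> * upt pt = \<xi>" unfolding \<xi>_def by (rule col_restr[OF X(1,4)])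
   have h\<xi>: "homg dg (h H) \<xi>" unfolding \<xi>_def hH by (rule homg_restr[OF X(3)])
   \<comment> \<open>Any preimage may be replaced by one that is a single vector of degree
     \<open>h H + 1\<close>, to which the contraction applies.\<close>
   define z0 where "z0 = part dg (h H + 1) (?eH * z * upt pt)"
   have "?dH * z0 = part dg (h H) (?dH * (?eH * z * upt pt))"
    unfolding z0_def by (subst part_mult_left[of dg "- 1"]) simp_all
   also have "?dH * (?eH * z * upt pt) = ?dH * ?eH * z * upt pt" by (simp only: mult.assoc)
   also have "... = \<xi>" using z \<xi>u by (simp add: \<xi>_def)
   finally have dz0: "?dH * z0 = \<xi>" by (simp add: part_homg h\<xi>)
   have ez0: "?eH * z0 = z0"
    unfolding z0_def by (subst part_mult_left[of dg 0]) (simp_all add: mult.assoc[symmetric])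
   have "(?dH * s + s * ?dH) * z0 = ?eH * z0"
   proof (rule s(5))
    fix x y assume nz: "ent z0 x y ~= 0"
    then have "dg x = dg y + (h H + 1)" "ent (?eH * z * upt pt) x y ~= 0"
     by (auto simp: z0_def ent_part split: if_splits)
    moreover have "y = pt"
     using \<open>ent (?eH * z * upt pt) x y ~= 0\<close> mult_upt[of "?eH * z" pt x y] by (simp add: cor_mult split: if_splits)
    ultimately show "h H < dg x" using deg0 by simp
   qed
   \<comment> \<open>Applying the differential to the contraction formula shows that
     \<open>s * \<xi>\<close> is a preimage as well; unlike \<open>z0\<close> it is invariant under
     \<open>N\<close>.\<close>
   then have "?dH * ((?dH * s + s * ?dH) * z0) = ?dH * z0" by (simp add: ez0)
   then have ds\<xi>: "?dH * (s * \<xi>) = \<xi>"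
    by (simp add: distrib_right distrib_left mult.assoc dz0) (simp add: mult.assoc[symmetric])
   have "rho ga N (?dH * (s * \<xi>)) = rho ga N ?dH * rho ga N (s * \<xi>)"
    by (rule rho_mult_inv[OF N(1) iNH(2) invt_closed(3)[OF ga NC s(2) iNH(3)[folded \<xi>_def]]]) simp
   moreover have "fixs ga N \<inter> fixs ga H = fixs ga N" using fixs_anti[of H N ga] HN by blast
   then have "rho ga N (rho ga H a) = rho ga N a" for a :: "('i, 'a) fmat" by (simp add: restr_restr)
   ultimately have "rho ga N X = rho ga N d * rho ga N (s * \<xi>)" unfolding ds\<xi> by (simp add: \<xi>_def)
   then show False using IH by blast
  qed
 qed (use nb in blast)
qed

text \<open>A largest subgroup \<open>L\<close> among those above \<open>H\<close> with the mark of
  \<open>H\<close> satisfies the maximality that \<open>forerunner_at_maximal\<close> asks for. The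
  cycle found there stays a nonboundary down to \<open>H\<close>.\<close>

theorem matrix_forerunner:
 assumes H: "subgroup H G"
 shows "\<exists>X. cor X & X * upt pt = X & eps * X = X & d * X = 0 & homg dg (h H) X &
  invt G ga (carrier G) X & (\<forall>z. rho ga H X ~= rho ga H d * z)"
proof -
 define P where "P L \<longleftrightarrow> subgroup L G & H \<subseteq> L & h L = h H" for L
 have "card L < Suc (card (carrier G))" if "P L" for L
  using that subgroup.subset finite_G by (metis P_def card_mono le_imp_less_Suc)
 then obtain L where L: "P L" "!!L'. P L' ==> card L' \<le> card L"
  using ex_has_greatest_nat[of P H card "Suc (card (carrier G))"] H unfolding P_def by blast
 have sL: "subgroup L G" "H \<subseteq> L" "h L = h H" using L(1) by (simp_all add: P_def)
 have "h L' < h L" if L': "subgroup L' G" "L \<subset> L'" for L'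
 proof (rule ccontr)
  assume "\<not> h L' < h L"
  moreover have "h L' \<le> h L" using mono[OF sL(1) L'(1)] L'(2) by blast
  ultimately have "P L'" using L' sL by (auto simp: P_def)
  moreover have "card L < card L'" using L'(2) finite_subgroup[OF L'(1)] by (rule psubset_card_mono[rotated])
  ultimately show False using L(2) by fastforce
 qed
 then obtain X where X: "cor X" "X * upt pt = X" "eps * X = X" "d * X = 0" "homg dg (h L) X"
  "invt G ga (carrier G) X" "!!z. rho ga L X ~= rho ga L d * z" using forerunner_at_maximal[OF sL(1)] by blast
 have "rho ga H X ~= rho ga H d * z" for z
  by (rule nonboundary_descends[OF sL(1) X(1,6,5,2,7) H sL(2)]) (simp add: sL)
 then show ?thesis using X sL(3) by metis
qed

end
end

section \<open>Embedding the ground field into a commutative ring type\<close>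

text \<open>The integers times the product of all fields with elements in \<open>'k\<close> form a type that is a
 commutative ring with \<open>0 ~= 1\<close>; each field \<open>K\<close> is a corner of it.\<close>

typedef ('k, 'z) fam = "{f :: int \<times> (('k, 'z) ring_scheme => 'k).
   (\<forall>K. field K --> snd f K \<in> carrier K) & (\<forall>K. \<not> field K --> snd f K = undefined)}"
 by (rule exI[of _ "(0, %K. if field K then \<zero>\<^bsub>K\<^esub> else undefined)"])
  (auto intro: ring.ring_simprules cring.axioms(1) domain.axioms(1) field.axioms(1))

setup_lifting type_definition_fam

lemma field_cring: "field K ==> cring K" by (simp add: domain.axioms(1) field.axioms(1))

instantiation fam :: (type, type) comm_ring_1
begin

lift_definition zero_fam :: "('a, 'b) fam" is "(0, %K. if field K then \<zero>\<^bsub>K\<^esub> else undefined)"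
 by (auto dest!: field_cring intro: cring.cring_simprules)
lift_definition one_fam :: "('a, 'b) fam" is "(1, %K. if field K then \<one>\<^bsub>K\<^esub> else undefined)"
 by (auto dest!: field_cring intro: cring.cring_simprules)
lift_definition plus_fam :: "('a, 'b) fam => ('a, 'b) fam => ('a, 'b) fam" is
 "%f g. (fst f + fst g, %K. if field K then snd f K \<oplus>\<^bsub>K\<^esub> snd g K else undefined)"
 by (auto intro!: cring.cring_simprules field_cring)
lift_definition uminus_fam :: "('a, 'b) fam => ('a, 'b) fam" is
 "%f. (- fst f, %K. if field K then \<ominus>\<^bsub>K\<^esub> snd f K else undefined)"
 by (auto intro!: cring.cring_simprules field_cring)
lift_definition minus_fam :: "('a, 'b) fam => ('a, 'b) fam => ('a, 'b) fam" is
 "%f g. (fst f - fst g, %K. if field K then snd f K \<ominus>\<^bsub>K\<^esub> snd g K else undefined)"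
 by (auto intro!: cring.cring_simprules field_cring)
lift_definition times_fam :: "('a, 'b) fam => ('a, 'b) fam => ('a, 'b) fam" is
 "%f g. (fst f * fst g, %K. if field K then snd f K \<otimes>\<^bsub>K\<^esub> snd g K else undefined)"
 by (auto intro!: cring.cring_simprules field_cring)

instance
proof
 fix a b c :: "('a, 'b) fam"
 show "a * b * c = a * (b * c)"
  by transfer (auto simp: prod_eq_iff fun_eq_iff intro!: cring.cring_simprules field_cring)
 show "a * b = b * a" by transfer (auto simp: prod_eq_iff fun_eq_iff intro!: cring.cring_simprules field_cring)
 show "1 * a = a" by transfer (auto simp: prod_eq_iff fun_eq_iff intro!: cring.cring_simprules field_cring)
 show "a + b + c = a + (b + c)"
  by transfer (auto simp: prod_eq_iff fun_eq_iff intro!: cring.cring_simprules field_cring)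
 show "a + b = b + a" by transfer (auto simp: prod_eq_iff fun_eq_iff intro!: cring.cring_simprules field_cring)
 show "0 + a = a" by transfer (auto simp: prod_eq_iff fun_eq_iff intro!: cring.cring_simprules field_cring)
 show "- a + a = 0" by transfer (auto simp: prod_eq_iff fun_eq_iff intro!: cring.cring_simprules field_cring)
 show "a - b = a + - b" by transfer (auto simp: prod_eq_iff fun_eq_iff a_minus_def)
 show "(a + b) * c = a * c + b * c"
  by transfer (auto simp: prod_eq_iff fun_eq_iff distrib_right intro!: cring.cring_simprules field_cring)
 show "(0 :: ('a, 'b) fam) ~= 1" by transfer (simp add: prod_eq_iff)
qed

end

text \<open>All components other than the one at \<open>K\<close> are zero, including the integer.
  So \<open>emb K\<close> respects sums and products, but it sends the unit of \<open>K\<close> to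
  an idempotent other than 1.\<close>

definition emb :: "('k, 'z) ring_scheme => 'k => ('k, 'z) fam" where
 "emb K c = Abs_fam (0, %K'. if field K' then (if K' = K then c else \<zero>\<^bsub>K'\<^esub>) else undefined)"

definition coef :: "('k, 'z) ring_scheme => ('k, 'z) fam => 'k" where "coef K x = snd (Rep_fam x) K"

context field
begin

lemma Rep_emb: "c \<in> carrier R ==> Rep_fam (emb R c)
  = (0, %K'. if field K' then (if K' = R then c else \<zero>\<^bsub>K'\<^esub>) else undefined)" unfolding emb_def
 by (subst Abs_fam_inverse) (auto dest!: field_cring intro: cring.cring_simprules)

lemma fam_eqI: "Rep_fam x = Rep_fam y ==> x = y" by (simp add: Rep_fam_inject)

lemma is_field: "field R" by (rule field_axioms)

lemma emb_add:
 assumes "a \<in> carrier R" "b \<in> carrier R" shows "emb R (a \<oplus> b) = emb R a + emb R b"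
 by (rule fam_eqI) (use assms in \<open>auto simp: Rep_emb plus_fam.rep_eq fun_eq_iff
   dest!: field_cring intro!: cring.cring_simprules(8)[symmetric] cring.cring_simprules\<close>)

lemma emb_mult:
 assumes "a \<in> carrier R" "b \<in> carrier R" shows "emb R (a \<otimes> b) = emb R a * emb R b"
 by (rule fam_eqI) (use assms in \<open>auto simp: Rep_emb times_fam.rep_eq fun_eq_iff
   dest!: field_cring intro!: cring.cring_simprules(26)[symmetric] cring.cring_simprules\<close>)

lemma emb_zero [simp]: "emb R \<zero> = 0" by (rule fam_eqI) (auto simp: Rep_emb zero_fam.rep_eq fun_eq_iff)

lemma coef_emb [simp]: "c \<in> carrier R ==> coef R (emb R c) = c" by (simp add: coef_def Rep_emb is_field)

lemma emb_inj: "a \<in> carrier R ==> b \<in> carrier R ==> emb R a = emb R b \<longleftrightarrow> a = b" by (metis coef_emb)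

lemma emb_0_iff: "a \<in> carrier R ==> emb R a = 0 \<longleftrightarrow> a = \<zero>" using emb_inj[of a \<zero>] by simp

lemma coef_closed [simp]: "coef R x \<in> carrier R" using Rep_fam[of x] is_field unfolding coef_def by simp

text \<open>The idempotent deletes all components other than the one at the field; thus the corner
  is exactly the image of \<open>emb\<close>.\<close>

lemma one_emb_mult: "emb R \<one> * x = emb R (coef R x)"
proof (rule fam_eqI)
 have "\<zero>\<^bsub>K'\<^esub> \<otimes>\<^bsub>K'\<^esub> snd (Rep_fam x) K' = \<zero>\<^bsub>K'\<^esub>" if "field K'" for K'
 proof -
  have "snd (Rep_fam x) K' \<in> carrier K'" using Rep_fam[of x] that by auto
  then show ?thesis using cring.cring_simprules(26)[OF field_cring[OF that]] by blast
 qed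
 moreover have "\<one> \<otimes> coef R x = coef R x" by simp
 ultimately show "Rep_fam (emb R \<one> * x) = Rep_fam (emb R (coef R x))"
  by (auto simp: Rep_emb times_fam.rep_eq fun_eq_iff coef_def[symmetric])
qed

lemma emb_uminus: "a \<in> carrier R ==> emb R (\<ominus> a) = - emb R a"
 using emb_add[of a "\<ominus> a"] by (simp add: r_neg eq_neg_iff_add_eq_0 add.commute)

lemma emb_minus: "a \<in> carrier R ==> b \<in> carrier R ==> emb R (a \<ominus> b) = emb R a - emb R b"
 by (simp add: a_minus_def emb_add emb_uminus)

lemma emb_finsum: "f \<in> A \<rightarrow> carrier R ==> emb R (finsum R f A) = (\<Sum>x\<in>A. emb R (f x))"
proof (induction A rule: infinite_finite_induct)
 case (insert x A)
 then show ?case by (simp add: emb_add Pi_iff)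
qed auto

lemma of_nat_emb: "of_nat n * emb R \<one> = emb R ([n] \<cdot> \<one>)"
 by (induction n) (simp_all add: emb_add distrib_right add.commute)

end

locale fbase = K: field K + group G
 for K :: "('k, 'z) ring_scheme" and G :: "('g, 'y) monoid_scheme" (structure) and p :: nat +
 assumes fb: "prime p" "has_char K p" "finite (carrier G)" "\<exists>n. order G = p ^ n"

sublocale fbase \<subseteq> p_group_field "emb K \<one>\<^bsub>K\<^esub>" p G
proof
 show "emb K \<one>\<^bsub>K\<^esub> * emb K \<one>\<^bsub>K\<^esub> = emb K \<one>\<^bsub>K\<^esub>" by (simp add: K.emb_mult[symmetric])
 show "emb K \<one>\<^bsub>K\<^esub> ~= 0" by (simp add: K.emb_0_iff)
 show "\<exists>y. emb K \<one>\<^bsub>K\<^esub> * y = y & x * y = emb K \<one>\<^bsub>K\<^esub>" if x: "emb K \<one>\<^bsub>K\<^esub> * x = x" "x ~= 0" for x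
 proof -
  define c where "c = coef K x"
  have c: "x = emb K c" "c \<in> carrier K" using x K.one_emb_mult[of x] by (simp_all add: c_def)
  have "c \<in> Units K" using x(2) c K.emb_0_iff[OF c(2)] K.field_Units by blast
  then have "inv\<^bsub>K\<^esub> c \<in> carrier K" "c \<otimes>\<^bsub>K\<^esub> inv\<^bsub>K\<^esub> c = \<one>\<^bsub>K\<^esub>" by (simp_all add: K.Units_r_inv)
  then show ?thesis using c by (intro exI[of _ "emb K (inv\<^bsub>K\<^esub> c)"]) (simp add: K.emb_mult[symmetric])
 qed
 show "of_nat p * emb K \<one>\<^bsub>K\<^esub> = 0"
 proof -
  have "[p] \<cdot>\<^bsub>K\<^esub> \<one>\<^bsub>K\<^esub> = \<zero>\<^bsub>K\<^esub>" using fb(2) by (simp add: has_char_def)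
  then show ?thesis by (simp add: K.of_nat_emb)
 qed
qed (use fb in auto)

section \<open>Matrices of equivariant maps\<close>

definition linf :: "('k, 'z) ring_scheme => ('k, 'm, 'g) gmod => ('m => 'k) => bool" where
 "linf K M \<Lambda> \<longleftrightarrow> (\<forall>u\<in>carrier M. \<Lambda> u \<in> carrier K) & (\<forall>u\<in>carrier M. \<forall>v\<in>carrier M. \<Lambda> (u \<oplus>\<^bsub>M\<^esub> v) = \<Lambda> u \<oplus>\<^bsub>K\<^esub> \<Lambda> v) &
   (\<forall>r\<in>carrier K. \<forall>u\<in>carrier M. \<Lambda> (r \<odot>\<^bsub>M\<^esub> u) = r \<otimes>\<^bsub>K\<^esub> \<Lambda> u)"

lemma linfD:
 assumes "linf K M \<Lambda>"
 shows "u \<in> carrier M ==> \<Lambda> u \<in> carrier K" "u \<in> carrier M ==> v \<in> carrier M ==> \<Lambda> (u \<oplus>\<^bsub>M\<^esub> v) = \<Lambda> u \<oplus>\<^bsub>K\<^esub> \<Lambda> v"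
  "r \<in> carrier K ==> u \<in> carrier M ==> \<Lambda> (r \<odot>\<^bsub>M\<^esub> u) = r \<otimes>\<^bsub>K\<^esub> \<Lambda> u" using assms unfolding linf_def by blast+

lemma kG_homD:
 assumes "f \<in> kG_hom K G M N"
 shows "u \<in> carrier M ==> f u \<in> carrier N" "u \<in> carrier M ==> v \<in> carrier M ==> f (u \<oplus>\<^bsub>M\<^esub> v) = f u \<oplus>\<^bsub>N\<^esub> f v"
  "r \<in> carrier K ==> u \<in> carrier M ==> f (r \<odot>\<^bsub>M\<^esub> u) = r \<odot>\<^bsub>N\<^esub> f u"
  "g \<in> carrier G ==> u \<in> carrier M ==> f (act M g u) = act N g (f u)"
 using assms unfolding kG_hom_def hom_def by (auto simp: Pi_iff)

lemma kG_homI: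
 assumes "!!u. u \<in> carrier M ==> f u \<in> carrier N"
  "!!u v. u \<in> carrier M ==> v \<in> carrier M ==> f (u \<oplus>\<^bsub>M\<^esub> v) = f u \<oplus>\<^bsub>N\<^esub> f v"
  "!!r u. r \<in> carrier K ==> u \<in> carrier M ==> f (r \<odot>\<^bsub>M\<^esub> u) = r \<odot>\<^bsub>N\<^esub> f u"
  "!!g u. g \<in> carrier G ==> u \<in> carrier M ==> f (act M g u) = act N g (f u)"
 shows "f \<in> kG_hom K G M N" using assms unfolding kG_hom_def hom_def by (auto simp: Pi_iff)

lemma linf_comp:
 assumes "f \<in> kG_hom K G M N" "linf K N \<Lambda>" shows "linf K M (%u. \<Lambda> (f u))"
 using assms kG_homD[OF assms(1)] linfD[OF assms(2)] unfolding linf_def by simp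

lemma linf_minus:
 assumes M: "Module.module K M" and L: "linf K M \<Lambda>" and u: "u \<in> carrier M" "v \<in> carrier M"
 shows "\<Lambda> (u \<ominus>\<^bsub>M\<^esub> v) = \<Lambda> u \<ominus>\<^bsub>K\<^esub> \<Lambda> v" "\<Lambda> \<zero>\<^bsub>M\<^esub> = \<zero>\<^bsub>K\<^esub>" "\<Lambda> (\<ominus>\<^bsub>M\<^esub> v) = \<ominus>\<^bsub>K\<^esub> \<Lambda> v"
proof -
 interpret Module.module K M by (rule M)
 note D = linfD[OF L]
 have "\<Lambda> \<zero>\<^bsub>M\<^esub> \<oplus>\<^bsub>K\<^esub> \<Lambda> \<zero>\<^bsub>M\<^esub> = \<Lambda> \<zero>\<^bsub>M\<^esub>" using D(2)[of "\<zero>\<^bsub>M\<^esub>" "\<zero>\<^bsub>M\<^esub>"] by simp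
 then show z: "\<Lambda> \<zero>\<^bsub>M\<^esub> = \<zero>\<^bsub>K\<^esub>" using D(1)[of "\<zero>\<^bsub>M\<^esub>"] by (simp add: R.add.r_cancel_one')
 have "\<Lambda> v \<oplus>\<^bsub>K\<^esub> \<Lambda> (\<ominus>\<^bsub>M\<^esub> v) = \<zero>\<^bsub>K\<^esub>" using D(2)[of v "\<ominus>\<^bsub>M\<^esub> v"] u z by (simp add: M.r_neg)
 then show n: "\<Lambda> (\<ominus>\<^bsub>M\<^esub> v) = \<ominus>\<^bsub>K\<^esub> \<Lambda> v" using D(1) u by (metis M.a_inv_closed R.add.m_comm R.minus_equality)
 show "\<Lambda> (u \<ominus>\<^bsub>M\<^esub> v) = \<Lambda> u \<ominus>\<^bsub>K\<^esub> \<Lambda> v" using D(2)[of u "\<ominus>\<^bsub>M\<^esub> v"] u n by (simp add: a_minus_def)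
qed

text \<open>The vectors \<open>t\<close> and the functionals \<open>\<kappa>\<close> behave like a
  dual basis of a projective module: the vectors may be dependent, so the matrix of the identity is
  an idempotent. \<open>recon\<close> is stated after applying a functional, which turns a sum in
  the module into one in the field. The index \<open>pt\<close> of the ground field lies outside of
  \<open>J\<close>. Both the complex and its tensor product with the dual are instances.\<close>

locale framed = fbase K G p
 for K :: "('k, 'z) ring_scheme" and G :: "('g, 'y) monoid_scheme" (structure) and p :: nat +
 fixes ob :: "int => ('k, 'm, 'g) gmod" and J :: "'j set" and dg :: "'j => int"
  and t :: "'j => 'm" and \<kappa> :: "'j => 'm => 'k" and ga :: "'g => 'j => 'j" and pt :: 'j
 assumes fin_J: "finite J" and obmod: "!!n. Module.module K (ob n)"
  and t_in: "!!z. z \<in> J ==> t z \<in> carrier (ob (dg z))" and \<kappa>_lin: "!!z. z \<in> J ==> linf K (ob (dg z)) (\<kappa> z)"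
  and recon: "!!n \<Lambda> u. linf K (ob n) \<Lambda> ==> u \<in> carrier (ob n) ==>
   \<Lambda> u = (\<Oplus>\<^bsub>K\<^esub>z\<in>{z\<in>J. dg z = n}. \<kappa> z u \<otimes>\<^bsub>K\<^esub> \<Lambda> (t z))"
  and ga: "isact G ga" and ga_J: "!!g z. g \<in> carrier G ==> ga g z \<in> J \<longleftrightarrow> z \<in> J"
  and dg_ga: "!!g z. g \<in> carrier G ==> dg (ga g z) = dg z"
  and t_act: "!!g z. g \<in> carrier G ==> z \<in> J ==> act (ob (dg z)) g (t z) = t (ga g z)"
  and \<kappa>_act: "!!g z u. g \<in> carrier G ==> z \<in> J ==> u \<in> carrier (ob (dg z)) ==>
   \<kappa> (ga g z) (act (ob (dg z)) g u) = \<kappa> z u"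
  and pt_J: "pt ~: J" and pt_ga: "!!g. g \<in> carrier G ==> ga g pt = pt" and dg_pt: "dg pt = 0"
begin

abbreviation ee :: "('k, 'z) fam" where "ee \<equiv> emb K \<one>\<^bsub>K\<^esub>"

definition cvec :: "int => 'm => ('j, ('k, 'z) fam) fmat" where
 "cvec n u = Abs_fmat (%x y. if y = pt & x \<in> J & dg x = n then emb K (\<kappa> x u) else 0)"

text \<open>The columns are coordinates of actual vectors, namely of the images of the spanning
  vectors. This makes composition agree with the matrix product even if these vectors are
  dependent.\<close>

definition mt :: "int => (int => 'm => 'm) => ('j, ('k, 'z) fam) fmat" where
 "mt k F = Abs_fmat (%x y. if x \<in> J & y \<in> J & dg x = dg y + k
   then emb K (\<kappa> x (F (dg y) (t y))) else 0)"

definition hfam :: "int => (int => 'm => 'm) => bool" where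
 "hfam k F \<longleftrightarrow> (\<forall>n. F n \<in> kG_hom K G (ob n) (ob (n + k)))"

lemma ent_cvec: "ent (cvec n u) x y = (if y = pt & x \<in> J & dg x = n then emb K (\<kappa> x u) else 0)"
 unfolding cvec_def
 by (subst Abs_fmat_inverse, unfold mem_Collect_eq, rule finite_supp_subset[of "insert pt J"])
  (auto simp: fin_J split: if_splits)

lemma ent_mt: "ent (mt k F) x y = (if x \<in> J & y \<in> J & dg x = dg y + k then emb K (\<kappa> x (F (dg y) (t y))) else 0)"
 unfolding mt_def by (subst Abs_fmat_inverse, unfold mem_Collect_eq, rule finite_supp_subset[of J])
  (auto simp: fin_J split: if_splits)

lemma hfamD: "hfam k F ==> F n \<in> kG_hom K G (ob n) (ob (n + k))" by (simp add: hfam_def)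

lemma hfam_id: "hfam 0 (%n. id)" by (simp add: hfam_def kG_homI)

lemma hfam_comp:
 assumes "hfam k F" "hfam l F'" shows "hfam (k + l) (%n. F (n + l) \<circ> F' n)" unfolding hfam_def
proof
 fix n
 have eq: "n + l + k = n + (k + l)" by simp
 note 1 = kG_homD[OF hfamD[OF assms(1), of "n + l"], unfolded eq] and 2 = kG_homD[OF hfamD[OF assms(2), of n]]
 show "F (n + l) \<circ> F' n \<in> kG_hom K G (ob n) (ob (n + (k + l)))" by (rule kG_homI) (simp_all add: 1 2)
qed

lemma emb_cor: "c \<in> carrier K ==> ee * emb K c = emb K c" by (simp add: K.one_emb_mult)

lemma \<kappa>_closed: "z \<in> J ==> u \<in> carrier (ob (dg z)) ==> \<kappa> z u \<in> carrier K" using linfD(1)[OF \<kappa>_lin] .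

lemma \<kappa>_hfam: "hfam k F ==> z \<in> J ==> dg z = n + k ==> linf K (ob n) (%u. \<kappa> z (F n u))"
 using linf_comp[OF hfamD[of k F n], of "\<kappa> z"] \<kappa>_lin[of z] by simp

lemma \<kappa>F_closed: "hfam k F ==> x \<in> J ==> dg x = n + k ==> u \<in> carrier (ob n) ==> \<kappa> x (F n u) \<in> carrier K"
 using linfD(1)[OF \<kappa>_hfam] by simp

lemma emb_cor': "c \<in> carrier K ==> emb K c * ee = emb K c" using emb_cor[of c] by (simp add: mult.commute)

lemma cor_cvec: "u \<in> carrier (ob n) ==> cor (cvec n u)" by (auto simp: cor_def ent_cvec emb_cor \<kappa>_closed)

lemma cor_mt: "hfam k F ==> cor (mt k F)" by (auto simp: cor_def ent_mt emb_cor \<kappa>F_closed t_in)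

lemma homg_mt: "homg dg k (mt k F)" by (auto simp: homg_def ent_mt split: if_splits)
lemma homg_cvec: "homg dg n (cvec n u)" by (auto simp: homg_def ent_cvec dg_pt split: if_splits)
lemma cvec_upt: "u \<in> carrier (ob n) ==> cvec n u * upt pt = cvec n u"
 by (subst col_iff) (auto simp: cor_cvec ent_cvec)

text \<open>The expansion of the product is \<open>recon\<close> for the functional that sends
  \<open>u\<close> to \<open>\<kappa> x (F n u)\<close>.\<close>

lemma mt_cvec:
 assumes F: "hfam k F" and u: "u \<in> carrier (ob n)"
 shows "mt k F * cvec n u = cvec (n + k) (F n u)"
proof (rule fmat_eqI)
 fix x y
 let ?Z = "{z\<in>J. dg z = n}"
 show "ent (mt k F * cvec n u) x y = ent (cvec (n + k) (F n u)) x y"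
 proof (cases "y = pt & x \<in> J & dg x = n + k")
  case True
  note L = \<kappa>_hfam[OF F, of x n]
  have "ent (mt k F * cvec n u) x y = (\<Sum>z\<in>?Z. ent (mt k F) x z * ent (cvec n u) z y)"
   by (rule ent_mult_gen) (auto simp: fin_J ent_cvec split: if_splits)
  also have "... = (\<Sum>z\<in>?Z. emb K (\<kappa> z u \<otimes>\<^bsub>K\<^esub> \<kappa> x (F n (t z))))" using True u \<kappa>F_closed[OF F, of x n] t_in
   by (intro sum.cong) (auto simp: ent_mt ent_cvec K.emb_mult \<kappa>_closed mult.commute)
  also have "... = emb K (\<Oplus>\<^bsub>K\<^esub>z\<in>?Z. \<kappa> z u \<otimes>\<^bsub>K\<^esub> \<kappa> x (F n (t z)))"
   using True u \<kappa>F_closed[OF F, of x n] t_in by (intro K.emb_finsum[symmetric]) (auto simp: \<kappa>_closed)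
  also have "... = emb K (\<kappa> x (F n u))" using recon[OF L u] True by simp
  finally show ?thesis using True by (simp add: ent_cvec)
 next
  case False
  then have "ent (mt k F) x z * ent (cvec n u) z y = 0" for z by (auto simp: ent_mt ent_cvec)
  then show ?thesis using False by (auto simp: ent_mult[of "idx (mt k F)"] ent_cvec)
 qed
qed

lemma mt_single:
 assumes "hfam k F" "z \<in> J" shows "mt k F * single z pt ee = cvec (dg z + k) (F (dg z) (t z))" using assms(2)
 by (intro fmat_eqI) (auto simp: ent_cvec ent_mt emb_cor' \<kappa>F_closed[OF assms(1)] t_in)

lemma mt_single_out: "z ~: J ==> mt k F * single z pt ee = 0" by (rule fmat_eqI) (auto simp: ent_mt)

lemma col_eqI:
 assumes "cor a" "cor b" "!!z. a * single z pt ee = b * single z pt ee" shows "a = b"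
proof (rule fmat_eqI)
 fix x z
 have "ent (a * single z pt ee) x pt = ent (b * single z pt ee) x pt" using assms(3) by simp
 then show "ent a x z = ent b x z" using corD(2)[OF assms(1)] corD(2)[OF assms(2)] by simp
qed

lemma mt_mult:
 assumes F: "hfam k F" "hfam l F'"
 shows "mt k F * mt l F' = mt (k + l) (%n. F (n + l) \<circ> F' n)"
proof (rule col_eqI)
 show "cor (mt k F * mt l F')" by (rule cor_mult[OF cor_mt[OF F(1)]])
 show "cor (mt (k + l) (%n. F (n + l) \<circ> F' n))" by (rule cor_mt[OF hfam_comp[OF F]])
 fix z
 show "mt k F * mt l F' * single z pt ee = mt (k + l) (%n. F (n + l) \<circ> F' n) * single z pt ee"
 proof (cases "z \<in> J")
  case True
  then show ?thesis
   using kG_homD(1)[OF hfamD[OF F(2)] t_in[OF True]] mt_cvec[OF F(1), of "F' (dg z) (t z)" "dg z + l"]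
   by (simp add: mult.assoc mt_single[OF F(2)] mt_single[OF hfam_comp[OF F]] add_ac)
 qed (simp add: mult.assoc mt_single_out)
qed

lemma tw_cvec:
 assumes g: "g \<in> carrier G" and u: "u \<in> carrier (ob n)"
 shows "tw G ga g (cvec n u) = cvec n (act (ob n) g u)"
proof (rule fmat_eqI)
 fix x y
 have *: "ga (inv g) x \<in> J \<longleftrightarrow> x \<in> J" "dg (ga (inv g) x) = dg x" "ga (inv g) y = pt \<longleftrightarrow> y = pt"
  using g ga_J dg_ga pt_ga isact_eq_iff(1)[OF ga g, of y pt] by auto
 have "\<kappa> (ga (inv g) x) u = \<kappa> x (act (ob n) g u)" if "x \<in> J" "dg x = n"
  using \<kappa>_act[OF g, of "ga (inv g) x" u] that * u isactD(2)[OF ga g, of x] by simp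
 then show "ent (tw G ga g (cvec n u)) x y = ent (cvec n (act (ob n) g u)) x y"
  using * by (simp add: ent_tw[OF ga g] ent_cvec)
qed

lemma invt_mt:
 assumes F: "hfam k F" shows "invt G ga (carrier G) (mt k F)" unfolding invt_def
proof
 fix g assume g: "g \<in> carrier G"
 have ig: "inv g \<in> carrier G" using g by simp
 show "tw G ga g (mt k F) = mt k F"
 proof (rule fmat_eqI)
  fix x y
  have *: "ga (inv g) x \<in> J \<longleftrightarrow> x \<in> J" "dg (ga (inv g) x) = dg x" for x using g ga_J dg_ga by auto
  have "\<kappa> (ga (inv g) x) (F (dg y) (t (ga (inv g) y))) = \<kappa> x (F (dg y) (t y))"
   if "x \<in> J" "y \<in> J" "dg x = dg y + k"
  proof -
   have ty: "t y \<in> carrier (ob (dg y))" using t_in that by blast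
   have "F (dg y) (t (ga (inv g) y)) = act (ob (dg x)) (inv g) (F (dg y) (t y))"
    using kG_homD(4)[OF hfamD[OF F, of "dg y"] ig ty] t_act[OF ig that(2)] that(3) by simp
   moreover have "F (dg y) (t y) \<in> carrier (ob (dg x))" using kG_homD(1)[OF hfamD[OF F] ty] that(3) by simp
   ultimately show ?thesis using \<kappa>_act[OF ig that(1)] by simp
  qed
  then show "ent (tw G ga g (mt k F)) x y = ent (mt k F) x y" using * by (simp add: ent_tw[OF ga g] ent_mt)
 qed
qed

lemma cvec_add: "u \<in> carrier (ob n) ==> v \<in> carrier (ob n) ==> cvec n (u \<oplus>\<^bsub>ob n\<^esub> v) = cvec n u + cvec n v"
 using linfD[OF \<kappa>_lin] by (intro fmat_eqI) (auto simp: ent_cvec K.emb_add)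

lemma cvec_minus: "u \<in> carrier (ob n) ==> v \<in> carrier (ob n) ==> cvec n (u \<ominus>\<^bsub>ob n\<^esub> v) = cvec n u - cvec n v"
 using linf_minus(1)[OF obmod \<kappa>_lin] linfD(1)[OF \<kappa>_lin] by (intro fmat_eqI) (auto simp: ent_cvec K.emb_minus)

lemma cvec_zero [simp]: "cvec n \<zero>\<^bsub>ob n\<^esub> = 0"
proof -
 interpret Module.module K "ob n" by (rule obmod)
 show ?thesis using cvec_add[of "\<zero>\<^bsub>ob n\<^esub>" n "\<zero>\<^bsub>ob n\<^esub>"] by simp
qed

lemma cvec_smult: "r \<in> carrier K ==> u \<in> carrier (ob n) ==>
  cvec n (r \<odot>\<^bsub>ob n\<^esub> u) = cvec n u * single pt pt (emb K r)"
 using linfD[OF \<kappa>_lin] by (intro fmat_eqI) (auto simp: ent_cvec K.emb_mult mult.commute)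

abbreviation idm :: "('j, ('k, 'z) fam) fmat" where "idm \<equiv> mt 0 (%n. id)"

lemma idm_cvec: "u \<in> carrier (ob n) ==> idm * cvec n u = cvec n u" using mt_cvec[OF hfam_id] by simp

lemma idm_mt: "hfam k F ==> idm * mt k F = mt k F" "hfam k F ==> mt k F * idm = mt k F"
 using mt_mult[OF hfam_id, of k F] mt_mult[OF _ hfam_id, of k F] by simp_all

lemma cplx_mt:
 assumes D: "hfam (- 1) D" and dd: "!!n u. u \<in> carrier (ob n) ==> D (n - 1) (D n u) = \<zero>\<^bsub>ob (n - 2)\<^esub>"
 shows "cplx dg idm (mt (- 1) D)"
proof -
 have "mt (- 1) D * mt (- 1) D = 0"
 proof (rule col_eqI)
  fix z
  show "mt (- 1) D * mt (- 1) D * single z pt ee = 0 * single z pt ee"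
  proof (cases "z \<in> J")
   case True
   then have "mt (- 1) D * (mt (- 1) D * single z pt ee) = cvec (dg z - 2) (D (dg z - 1) (D (dg z) (t z)))"
    using mt_cvec[OF D, of "D (dg z) (t z)" "dg z - 1"] kG_homD(1)[OF hfamD[OF D] t_in[OF True]]
    by (simp add: mt_single[OF D])
   then show ?thesis using dd[OF t_in[OF True]] by (simp add: mult.assoc)
  qed (simp add: mult.assoc mt_single_out)
 qed (simp_all add: cor_mult cor_mt D)
 then show ?thesis unfolding cplx_def using idm_mt[OF D] idm_mt[OF hfam_id]
  by (simp add: cor_mt hfam_id D homg_mt)
qed

text \<open>An equivalence with the field in degree 0 amounts to an invariant functional
  \<open>f\<close>, an invariant cycle \<open>\<eta>\<close> and a homotopy. They become a row, a
  column and a square matrix, all invariant, so that they can be restricted to fixed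
  indices.\<close>

lemma retracts_mt:
 assumes D: "hfam (- 1) D" and S: "hfam 1 S"
  and f: "linf K (ob 0) f" "!!g u. g \<in> carrier G ==> u \<in> carrier (ob 0) ==> f (act (ob 0) g u) = f u"
   "!!u. u \<in> carrier (ob 1) ==> f (D 1 u) = \<zero>\<^bsub>K\<^esub>"
  and \<eta>: "\<eta> \<in> carrier (ob 0)" "!!g. g \<in> carrier G ==> act (ob 0) g \<eta> = \<eta>" "D 0 \<eta> = \<zero>\<^bsub>ob (- 1)\<^esub>" "f \<eta> = \<one>\<^bsub>K\<^esub>"
  and hty: "!!n u. u \<in> carrier (ob n) ==> (if n = 0 then f u \<odot>\<^bsub>ob 0\<^esub> \<eta> else \<zero>\<^bsub>ob n\<^esub>) \<ominus>\<^bsub>ob n\<^esub> u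
   = D (n + 1) (S n u) \<oplus>\<^bsub>ob n\<^esub> S (n - 1) (D n u)"
 shows "\<exists>s v w. retracts dg pt idm (mt (- 1) D) 0 s v w & invt G ga (carrier G) s &
  invt G ga (carrier G) v & invt G ga (carrier G) w"
proof -
 define w where "w = Abs_fmat (%x y. if x = pt & y \<in> J & dg y = 0 then emb K (f (t y)) else 0)"
 have ent_w: "ent w x y = (if x = pt & y \<in> J & dg y = 0 then emb K (f (t y)) else 0)" for x y unfolding w_def
  by (subst Abs_fmat_inverse, unfold mem_Collect_eq, rule finite_supp_subset[of "insert pt J"])
   (auto simp: fin_J split: if_splits)
 define v where "v = cvec 0 \<eta>"
 \<comment> \<open>The sign arises because the homotopy \<open>S\<close> bounds the composite minus
   the identity, while \<open>retracts\<close> asks for the identity minus the composite.\<close>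
 define s where "s = - mt 1 S"
 let ?d = "mt (- 1) D"
 have w_cvec: "w * cvec n u = (if n = 0 then single pt pt (emb K (f u)) else 0)"
  if u: "u \<in> carrier (ob n)" for n u
 proof (rule fmat_eqI)
  fix x y
  let ?Z = "{z\<in>J. dg z = n}"
  show "ent (w * cvec n u) x y = ent (if n = 0 then single pt pt (emb K (f u)) else 0) x y"
  proof (cases "x = pt & y = pt & n = 0")
   case True
   have fZ: "f (t z) \<in> carrier K" if "z \<in> ?Z" for z using that True linfD(1)[OF f(1)] t_in[of z] by simp
   have "ent (w * cvec n u) x y = (\<Sum>z\<in>?Z. ent w x z * ent (cvec n u) z y)"
    by (rule ent_mult_gen) (auto simp: fin_J ent_cvec split: if_splits)
   also have "... = (\<Sum>z\<in>?Z. emb K (\<kappa> z u \<otimes>\<^bsub>K\<^esub> f (t z)))"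
    using True u fZ by (intro sum.cong) (auto simp: ent_w ent_cvec K.emb_mult \<kappa>_closed mult.commute)
   also have "... = emb K (\<Oplus>\<^bsub>K\<^esub>z\<in>?Z. \<kappa> z u \<otimes>\<^bsub>K\<^esub> f (t z))"
    using True u fZ by (intro K.emb_finsum[symmetric]) (auto simp: \<kappa>_closed)
   also have "... = emb K (f u)" using recon[OF f(1), of u] u True by simp
   finally show ?thesis using True by simp
  next
   case False
   then have "ent w x z * ent (cvec n u) z y = 0" for z by (auto simp: ent_w ent_cvec)
   then show ?thesis using False by (auto simp: ent_mult[of "idx w"])
  qed
 qed
 have fc: "f u \<in> carrier K" if "u \<in> carrier (ob 0)" for u using linfD(1)[OF f(1) that] .
 have cw: "cor w" using fc t_in by (auto simp: cor_def ent_w emb_cor) (metis emb_cor)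
 have iw: "invt G ga (carrier G) w" unfolding invt_def
 proof
  fix g assume g: "g \<in> carrier G"
  have ig: "inv g \<in> carrier G" using g by simp
  show "tw G ga g w = w"
  proof (rule fmat_eqI)
   fix x y
   have *: "ga (inv g) x \<in> J \<longleftrightarrow> x \<in> J" "dg (ga (inv g) x) = dg x" "ga (inv g) x = pt \<longleftrightarrow> x = pt" for x
    using g ga_J dg_ga pt_ga isact_eq_iff(1)[OF ga g, of x pt] by auto
   have "f (t (ga (inv g) y)) = f (t y)" if "y \<in> J" "dg y = 0"
    using t_act[OF ig that(1)] f(2)[OF ig] t_in[OF that(1)] that(2) by metis
   then show "ent (tw G ga g w) x y = ent w x y" using * by (simp add: ent_tw[OF ga g] ent_w)
  qed
 qed
 have wid: "w * idm = w"
 proof (rule col_eqI)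
  fix z
  show "w * idm * single z pt ee = w * single z pt ee"
  proof (cases "z \<in> J")
   case True
   then show ?thesis using w_cvec[OF t_in[OF True]] fc t_in[OF True]
    by (auto simp: mult.assoc mt_single[OF hfam_id] intro!: fmat_eqI)
     (auto simp: ent_w K.emb_mult[symmetric])
  next
   case False
   then show ?thesis by (simp add: mult.assoc mt_single_out) (rule fmat_eqI, simp add: ent_w)
  qed
 qed (simp_all add: cw cor_mult)
 have wd: "w * ?d = 0"
 proof (rule col_eqI)
  fix z
  show "w * ?d * single z pt ee = 0 * single z pt ee"
  proof (cases "z \<in> J")
   case True
   have "D (dg z) (t z) \<in> carrier (ob (dg z - 1))" using kG_homD(1)[OF hfamD[OF D] t_in[OF True]] by simp
   then show ?thesis using w_cvec[of "D (dg z) (t z)" "dg z - 1"] f(3) t_in[OF True] True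
    by (auto simp: mult.assoc mt_single[OF D]) (metis K.emb_zero ent_0 ent_single fmat_eqI)
  qed (simp add: mult.assoc mt_single_out)
 qed (simp_all add: cw cor_mult)
 have hty': "?d * s + s * ?d = idm - v * w"
 proof (rule col_eqI)
  show "cor (?d * s + s * ?d)" unfolding s_def by (intro cor_intros cor_mt D) (simp add: cor_mt S)
  show "cor (idm - v * w)" unfolding v_def by (intro cor_intros cor_mt hfam_id cor_cvec \<eta>)
  fix z
  show "(?d * s + s * ?d) * single z pt ee = (idm - v * w) * single z pt ee"
  proof (cases "z \<in> J")
   case True
   let ?n = "dg z" and ?u = "t z"
   interpret M: Module.module K "ob ?n" by (rule obmod)
   note u = t_in[OF True]
   have Su: "S ?n ?u \<in> carrier (ob (?n + 1))" using kG_homD(1)[OF hfamD[OF S] u] .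
   have Du: "D ?n ?u \<in> carrier (ob (?n - 1))" using kG_homD(1)[OF hfamD[OF D] u] by simp
   have DSu: "D (?n + 1) (S ?n ?u) \<in> carrier (ob ?n)" using kG_homD(1)[OF hfamD[OF D] Su] by simp
   have SDu: "S (?n - 1) (D ?n ?u) \<in> carrier (ob ?n)" using kG_homD(1)[OF hfamD[OF S] Du] by simp
   have 1: "?d * (mt 1 S * single z pt ee) = cvec ?n (D (?n + 1) (S ?n ?u))"
    using mt_cvec[OF D Su] by (simp add: mt_single[OF S True])
   have 2: "mt 1 S * (?d * single z pt ee) = cvec ?n (S (?n - 1) (D ?n ?u))"
    using mt_cvec[OF S Du] by (simp add: mt_single[OF D True])
   have 3: "v * (w * single z pt ee) = cvec ?n (if ?n = 0 then f ?u \<odot>\<^bsub>ob 0\<^esub> \<eta> else \<zero>\<^bsub>ob ?n\<^esub>)"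
   proof (cases "?n = 0")
    case True
    have "w * single z pt ee = single pt pt (emb K (f ?u))"
     using True \<open>z \<in> J\<close> fc u by (intro fmat_eqI) (auto simp: ent_w K.emb_mult[symmetric])
    then show ?thesis using True u fc by (simp add: v_def cvec_smult \<eta>)
   next
    case False
    then have "w * single z pt ee = 0" by (intro fmat_eqI) (auto simp: ent_w)
    then show ?thesis using False by simp
   qed
   have c: "(if ?n = 0 then f ?u \<odot>\<^bsub>ob 0\<^esub> \<eta> else \<zero>\<^bsub>ob ?n\<^esub>) \<in> carrier (ob ?n)"
    using u fc Module.module.smult_closed[OF obmod] \<eta>(1) by auto
   have "cvec ?n ((if ?n = 0 then f ?u \<odot>\<^bsub>ob 0\<^esub> \<eta> else \<zero>\<^bsub>ob ?n\<^esub>) \<ominus>\<^bsub>ob ?n\<^esub> ?u)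
     = cvec ?n (D (?n + 1) (S ?n ?u) \<oplus>\<^bsub>ob ?n\<^esub> S (?n - 1) (D ?n ?u))" using hty[OF u] by simp
   then have "v * (w * single z pt ee) - cvec ?n ?u
     = ?d * (mt 1 S * single z pt ee) + mt 1 S * (?d * single z pt ee)"
    unfolding cvec_minus[OF c u] cvec_add[OF DSu SDu] 1 2 3 .
   then show ?thesis
    by (simp add: s_def left_diff_distrib distrib_right mult.assoc mt_single[OF hfam_id True])
     (simp add: algebra_simps)
  next
   case False
   then have "w * single z pt ee = 0" by (intro fmat_eqI) (auto simp: ent_w)
   then show ?thesis using False
    by (simp add: s_def distrib_right left_diff_distrib mult.assoc mt_single_out)
  qed
 qed
 have "retracts dg pt idm ?d 0 s v w" unfolding retracts_def
 proof (intro conjI)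
  show "cor s" "cor v" "cor w" by (simp_all add: s_def v_def cor_mt S cor_cvec \<eta> cw)
  show "homg dg 1 s" "homg dg 0 v" by (simp_all add: s_def v_def homg_mt homg_cvec)
  show "homg dg (- 0) w" by (auto simp: homg_def ent_w dg_pt split: if_splits)
  show "idm * s = s" "s * idm = s" by (simp_all add: s_def idm_mt S)
  show "v * upt pt = v" by (simp add: v_def cvec_upt \<eta>)
  show "upt pt * w = w" by (rule fmat_eqI) (auto simp: upt_mult cw ent_w)
  show "idm * v = v" by (simp add: v_def idm_cvec \<eta>)
  show "?d * v = 0" using mt_cvec[OF D \<eta>(1)] \<eta>(3) by (simp add: v_def)
  show "w * v = upt pt" using w_cvec[OF \<eta>(1)] by (simp add: v_def \<eta> upt_def)
 qed (use wid wd hty' in auto)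
 moreover have "invt G ga (carrier G) s"
  unfolding s_def by (rule invt_closed(5)[OF ga subset_refl invt_mt[OF S]])
 moreover have "invt G ga (carrier G) v" unfolding invt_def v_def by (simp add: tw_cvec \<eta>)
 ultimately show ?thesis using iw by blast
qed

end

section \<open>Quotients, free modules, tensor products and duals\<close>

text \<open>Linearity without equivariance, so that source and target may carry actions of different
  groups, as a module and its Brauer quotient do.\<close>

definition lmap :: "('k, 'z) ring_scheme => ('k, 'm, 'g) gmod => ('k, 'n, 'h) gmod => ('m => 'n) => bool" where
 "lmap K M N f \<longleftrightarrow> (\<forall>u\<in>carrier M. f u \<in> carrier N) & (\<forall>u\<in>carrier M. \<forall>v\<in>carrier M. f (u \<oplus>\<^bsub>M\<^esub> v) = f u \<oplus>\<^bsub>N\<^esub> f v) &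
   (\<forall>r\<in>carrier K. \<forall>u\<in>carrier M. f (r \<odot>\<^bsub>M\<^esub> u) = r \<odot>\<^bsub>N\<^esub> f u)"

lemma lmapD:
 assumes "lmap K M N f"
 shows "u \<in> carrier M ==> f u \<in> carrier N" "u \<in> carrier M ==> v \<in> carrier M ==> f (u \<oplus>\<^bsub>M\<^esub> v) = f u \<oplus>\<^bsub>N\<^esub> f v"
  "r \<in> carrier K ==> u \<in> carrier M ==> f (r \<odot>\<^bsub>M\<^esub> u) = r \<odot>\<^bsub>N\<^esub> f u" using assms unfolding lmap_def by blast+

lemma kG_hom_lmap: "f \<in> kG_hom K G M N ==> lmap K M N f" unfolding lmap_def by (simp add: kG_homD)

lemma lmap_comp: "lmap K M N f ==> lmap K N P g ==> lmap K M P (%u. g (f u))" unfolding lmap_def by simp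

lemma linf_iff_lmap: "linf K M \<Lambda> = lmap K M (trivial_module K :: ('k, 'k, unit) gmod) \<Lambda>"
 for K :: "('k, 'z) ring_scheme" unfolding linf_def lmap_def trivial_module_def by simp

lemma module_trivial:
 assumes "cring K" shows "Module.module K (trivial_module K)"
proof -
 interpret cring K by (rule assms)
 show ?thesis by (intro Module.moduleI abelian_groupI assms)
   (auto simp: trivial_module_def l_distr r_distr m_assoc a_ac intro: l_neg)
qed

lemma linf_lmap:
 assumes "lmap K M N f" "linf K N \<Lambda>" shows "linf K M (%u. \<Lambda> (f u))"
 unfolding linf_def by (simp add: lmapD[OF assms(1)] linfD[OF assms(2)])

lemma lmap_zero:
 assumes "Module.module K M" "Module.module K N" "lmap K M N f"
 shows "f \<zero>\<^bsub>M\<^esub> = \<zero>\<^bsub>N\<^esub>" "u \<in> carrier M ==> f (\<ominus>\<^bsub>M\<^esub> u) = \<ominus>\<^bsub>N\<^esub> f u"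
  "u \<in> carrier M ==> v \<in> carrier M ==> f (u \<ominus>\<^bsub>M\<^esub> v) = f u \<ominus>\<^bsub>N\<^esub> f v"
proof -
 interpret M: Module.module K M by (rule assms(1))
 interpret N: Module.module K N by (rule assms(2))
 note D = lmapD[OF assms(3)]
 have "f \<zero>\<^bsub>M\<^esub> \<oplus>\<^bsub>N\<^esub> f \<zero>\<^bsub>M\<^esub> = f \<zero>\<^bsub>M\<^esub>" using D(2)[of "\<zero>\<^bsub>M\<^esub>" "\<zero>\<^bsub>M\<^esub>"] by simp
 then show z: "f \<zero>\<^bsub>M\<^esub> = \<zero>\<^bsub>N\<^esub>" using D(1)[of "\<zero>\<^bsub>M\<^esub>"] by (simp add: N.add.r_cancel_one')
 have n: "f (\<ominus>\<^bsub>M\<^esub> u) = \<ominus>\<^bsub>N\<^esub> f u" if u: "u \<in> carrier M" for u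
 proof -
  have "f u \<oplus>\<^bsub>N\<^esub> f (\<ominus>\<^bsub>M\<^esub> u) = \<zero>\<^bsub>N\<^esub>" using D(2)[of u "\<ominus>\<^bsub>M\<^esub> u"] u z by (simp add: M.M.r_neg)
  then show ?thesis using D(1) u by (metis M.M.a_inv_closed N.M.add.m_comm N.M.minus_equality)
 qed
 then show "u \<in> carrier M ==> f (\<ominus>\<^bsub>M\<^esub> u) = \<ominus>\<^bsub>N\<^esub> f u" .
 show "f (u \<ominus>\<^bsub>M\<^esub> v) = f u \<ominus>\<^bsub>N\<^esub> f v" if "u \<in> carrier M" "v \<in> carrier M"
  using D(2)[of u "\<ominus>\<^bsub>M\<^esub> v"] that n by (simp add: a_minus_def)
qed

lemma submodule_vimage:
 assumes M: "Module.module K M" "Module.module K N" and f: "lmap K M N f" and S: "submodule S K N"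
 shows "submodule {u\<in>carrier M. f u \<in> S} K M"
proof -
 interpret M: Module.module K M by (rule M(1))
 interpret N: Module.module K N by (rule M(2))
 note E = N.submoduleE[OF S] and z = lmap_zero[OF M f]
 have "\<zero>\<^bsub>N\<^esub> \<in> S" using submodule.axioms(1)[OF S] subgroup.one_closed by fastforce
 then show ?thesis by (intro M.submoduleI) (auto simp: z E lmapD[OF f])
qed

lemma linf_zero: "Module.module K M ==> linf K M \<Lambda> ==> \<Lambda> \<zero>\<^bsub>M\<^esub> = \<zero>\<^bsub>K\<^esub>" using linf_minus(2)[of K M \<Lambda> "\<zero>\<^bsub>M\<^esub>" "\<zero>\<^bsub>M\<^esub>"]
 by (meson Module.module_def abelian_group_def abelian_monoid.zero_closed)

lemma linf_ker:
 assumes M: "Module.module K M" and L: "linf K M \<Lambda>"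
 shows "submodule {u\<in>carrier M. \<Lambda> u = \<zero>\<^bsub>K\<^esub>} K M"
proof -
 interpret M: Module.module K M by (rule M)
 show ?thesis by (intro M.submoduleI) (auto simp: linf_minus[OF M L] linf_zero[OF M L] linfD[OF L])
qed

lemma linf_finsum:
 assumes M: "Module.module K M" and L: "linf K M \<Lambda>" and f: "f \<in> A \<rightarrow> carrier M"
 shows "\<Lambda> (finsum M f A) = (\<Oplus>\<^bsub>K\<^esub>x\<in>A. \<Lambda> (f x))"
proof -
 interpret M: Module.module K M by (rule M)
 show ?thesis using f
 proof (induction A rule: infinite_finite_induct)
  case (insert x A)
  then show ?case using linfD[OF L] by (simp add: Pi_iff)
 qed (simp_all add: linf_zero[OF M L])
qed

lemma module_span_least: "submodule N K M ==> S \<subseteq> N ==> module_span K M S \<subseteq> N"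
 unfolding module_span_def by blast

lemma module_span_incl: "S \<subseteq> module_span K M S" unfolding module_span_def by blast

lemma coset_map_eq:
 assumes "N0 ~= {}" "!!n. n \<in> N0 ==> N +>\<^bsub>M\<^esub> f (n \<oplus>\<^bsub>M0\<^esub> x) = N +>\<^bsub>M\<^esub> y"
 shows "coset_map M N f (N0 +>\<^bsub>M0\<^esub> x) = N +>\<^bsub>M\<^esub> y"
 unfolding coset_map_def a_r_coset_def'[of M0] using assms by auto

locale gmodule = Module.module K M
 for K :: "('k, 'z) ring_scheme" (structure) and M :: "('k, 'm, 'g) gmod" (structure)
begin

lemma submodule_span:
 assumes S: "S \<subseteq> carrier M" shows "submodule (module_span K M S) K M"
proof (rule submoduleI)
 show "module_span K M S \<subseteq> carrier M" by (rule module_span_least[OF carrier_is_submodule S])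
 have z: "\<zero>\<^bsub>M\<^esub> \<in> N" if "submodule N K M" for N
  using submodule.axioms(1)[OF that] subgroup.one_closed by fastforce
 then show "\<zero>\<^bsub>M\<^esub> \<in> module_span K M S" unfolding module_span_def by blast
 show "\<ominus>\<^bsub>M\<^esub> a \<in> module_span K M S" if "a \<in> module_span K M S" for a
  using that submoduleE(3) unfolding module_span_def by blast
 show "a \<oplus>\<^bsub>M\<^esub> b \<in> module_span K M S" if "a \<in> module_span K M S" "b \<in> module_span K M S" for a b
  using that submoduleE(5) unfolding module_span_def by blast
 show "r \<odot>\<^bsub>M\<^esub> a \<in> module_span K M S" if "r \<in> carrier K" "a \<in> module_span K M S" for r a
  using that submoduleE(4) unfolding module_span_def by blast
qed

lemma abelian_subgroup_submodule: "submodule N K M ==> abelian_subgroup N M"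
 by (rule abelian_subgroupI3[OF additive_subgroupI]) (auto dest: submodule.axioms(1) intro: M.abelian_group_axioms)

lemma submodule_zero: "submodule N K M ==> \<zero>\<^bsub>M\<^esub> \<in> N" using submodule.axioms(1) subgroup.one_closed by fastforce

lemma coset_add: "submodule N K M ==> x \<in> carrier M ==> y \<in> carrier M ==>
  set_add M (N +>\<^bsub>M\<^esub> x) (N +>\<^bsub>M\<^esub> y) = N +>\<^bsub>M\<^esub> (x \<oplus>\<^bsub>M\<^esub> y)"
 by (rule abelian_subgroup.a_rcos_sum[OF abelian_subgroup_submodule])

lemma coset_self: "submodule N K M ==> x \<in> carrier M ==> x \<in> N +>\<^bsub>M\<^esub> x"
 by (rule abelian_subgroup.a_rcos_self[OF abelian_subgroup_submodule])

lemma coset_eq_iff: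
 assumes N: "submodule N K M" and x: "x \<in> carrier M" "y \<in> carrier M"
 shows "N +>\<^bsub>M\<^esub> x = N +>\<^bsub>M\<^esub> y \<longleftrightarrow> x \<ominus>\<^bsub>M\<^esub> y \<in> N"
proof -
 interpret N: abelian_subgroup N M by (rule abelian_subgroup_submodule[OF N])
 show ?thesis using N.a_rcos_module[OF x(2,1)] N.a_repr_independence'[of x y] N.a_rcos_self[OF x(1)] x
  by (auto simp: a_minus_def)
qed

lemma coset_zero: "submodule N K M ==> N +>\<^bsub>M\<^esub> \<zero>\<^bsub>M\<^esub> = N"
 using abelian_subgroup.a_rcos_const[OF abelian_subgroup_submodule submodule_zero] .

lemma coset_eq_zero_iff:
 assumes N: "submodule N K M" and x: "x \<in> carrier M" shows "N +>\<^bsub>M\<^esub> x = N \<longleftrightarrow> x \<in> N"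
 using coset_eq_iff[OF N x M.zero_closed] x
  M.minus_equality[of "\<zero>\<^bsub>M\<^esub>" "\<zero>\<^bsub>M\<^esub>"] by (simp add: coset_zero[OF N] a_minus_def)

lemma coset_absorb:
 assumes N: "submodule N K M" and x: "x \<in> carrier M" and n: "n \<in> N"
 shows "N +>\<^bsub>M\<^esub> (n \<oplus>\<^bsub>M\<^esub> x) = N +>\<^bsub>M\<^esub> x"
proof -
 have nc: "n \<in> carrier M" using n submoduleE(1)[OF N] by blast
 have "n \<oplus>\<^bsub>M\<^esub> x \<ominus>\<^bsub>M\<^esub> x = n" using nc x by (simp add: a_minus_def M.a_assoc M.r_neg)
 then show ?thesis using coset_eq_iff[OF N, of "n \<oplus>\<^bsub>M\<^esub> x" x] nc x n by simp
qed

text \<open>The source \<open>M0\<close> need not be a module by itself; only its addition matters.\<close>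

lemma coset_map_coset:
 assumes N: "submodule N K M" and "N0 ~= {}" and x: "f x \<in> carrier M"
  and f: "!!n. n \<in> N0 ==> f n \<in> N" "!!n. n \<in> N0 ==> f (n \<oplus>\<^bsub>M0\<^esub> x) = f n \<oplus>\<^bsub>M\<^esub> f x"
 shows "coset_map M N f (N0 +>\<^bsub>M0\<^esub> x) = N +>\<^bsub>M\<^esub> f x"
 by (rule coset_map_eq[OF assms(2)]) (simp add: f coset_absorb[OF N x])

lemma carrier_quotient: "carrier (quotient_mod M N \<alpha>) = (%x. N +>\<^bsub>M\<^esub> x) ` carrier M"
 by (auto simp: quotient_mod_def A_RCOSETS_def')

lemma quotient_simps:
 assumes N: "submodule N K M"
 shows "\<zero>\<^bsub>quotient_mod M N \<alpha>\<^esub> = N" "x \<in> carrier M ==> N +>\<^bsub>M\<^esub> x \<in> carrier (quotient_mod M N \<alpha>)"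
  "x \<in> carrier M ==> y \<in> carrier M ==> (N +>\<^bsub>M\<^esub> x) \<oplus>\<^bsub>quotient_mod M N \<alpha>\<^esub> (N +>\<^bsub>M\<^esub> y) = N +>\<^bsub>M\<^esub> (x \<oplus>\<^bsub>M\<^esub> y)"
  "r \<in> carrier K ==> x \<in> carrier M ==> r \<odot>\<^bsub>quotient_mod M N \<alpha>\<^esub> (N +>\<^bsub>M\<^esub> x) = N +>\<^bsub>M\<^esub> (r \<odot>\<^bsub>M\<^esub> x)"
proof -
 show "\<zero>\<^bsub>quotient_mod M N \<alpha>\<^esub> = N" by (simp add: quotient_mod_def)
 show "x \<in> carrier M ==> N +>\<^bsub>M\<^esub> x \<in> carrier (quotient_mod M N \<alpha>)" by (simp add: carrier_quotient)
 show "x \<in> carrier M ==> y \<in> carrier M ==> (N +>\<^bsub>M\<^esub> x) \<oplus>\<^bsub>quotient_mod M N \<alpha>\<^esub> (N +>\<^bsub>M\<^esub> y) = N +>\<^bsub>M\<^esub> (x \<oplus>\<^bsub>M\<^esub> y)"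
  by (simp add: quotient_mod_def coset_add[OF N])
 show "r \<odot>\<^bsub>quotient_mod M N \<alpha>\<^esub> (N +>\<^bsub>M\<^esub> x) = N +>\<^bsub>M\<^esub> (r \<odot>\<^bsub>M\<^esub> x)" if "r \<in> carrier K" "x \<in> carrier M"
 proof -
  have "coset_map M N (%x. r \<odot>\<^bsub>M\<^esub> x) (N +>\<^bsub>M\<^esub> x) = N +>\<^bsub>M\<^esub> (r \<odot>\<^bsub>M\<^esub> x)" using submoduleE[OF N] that
   by (intro coset_map_coset[OF N]) (auto simp: smult_r_distr subset_iff)
  then show ?thesis by (simp add: quotient_mod_def)
 qed
qed

lemma module_quotient:
 assumes N: "submodule N K M" shows "Module.module K (quotient_mod M N \<alpha>)"
proof (rule Module.moduleI)
 note q = quotient_simps[OF N, where \<alpha> = \<alpha>]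
 show "cring K" by (rule R.cring_axioms)
 show "abelian_group (quotient_mod M N \<alpha>)"
 proof (rule abelian_groupI)
  fix A assume "A \<in> carrier (quotient_mod M N \<alpha>)"
  then obtain x where x: "x \<in> carrier M" "A = N +>\<^bsub>M\<^esub> x" by (auto simp: carrier_quotient)
  have "(N +>\<^bsub>M\<^esub> (\<ominus>\<^bsub>M\<^esub> x)) \<oplus>\<^bsub>quotient_mod M N \<alpha>\<^esub> A = \<zero>\<^bsub>quotient_mod M N \<alpha>\<^esub>"
   using x by (simp add: q M.l_neg coset_zero[OF N])
  then show "\<exists>B\<in>carrier (quotient_mod M N \<alpha>). B \<oplus>\<^bsub>quotient_mod M N \<alpha>\<^esub> A = \<zero>\<^bsub>quotient_mod M N \<alpha>\<^esub>"
   using x(1) quotient_simps(2)[OF N, of "\<ominus>\<^bsub>M\<^esub> x" \<alpha>] by blast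
  have "(N +>\<^bsub>M\<^esub> \<zero>\<^bsub>M\<^esub>) \<oplus>\<^bsub>quotient_mod M N \<alpha>\<^esub> A = A" using x by (simp add: q del: coset_zero)
  then show "\<zero>\<^bsub>quotient_mod M N \<alpha>\<^esub> \<oplus>\<^bsub>quotient_mod M N \<alpha>\<^esub> A = A" by (simp add: q coset_zero[OF N])
 next
  show "\<zero>\<^bsub>quotient_mod M N \<alpha>\<^esub> \<in> carrier (quotient_mod M N \<alpha>)"
   using quotient_simps(2)[OF N M.zero_closed, of \<alpha>] by (simp add: q coset_zero[OF N])
 qed (auto simp: carrier_quotient q M.a_ac)
qed (auto simp: carrier_quotient quotient_simps[OF N] smult_l_distr smult_r_distr smult_assoc1)

lemma lmap_quotient:
 assumes N: "submodule N K M" shows "lmap K M (quotient_mod M N \<alpha>) (%x. N +>\<^bsub>M\<^esub> x)"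
 unfolding lmap_def by (simp add: quotient_simps[OF N])

end

section \<open>Free modules and linear extension from a basis\<close>

context field
begin

lemma emb_one_mult_emb [simp]: "a \<in> carrier R ==> emb R \<one> * emb R a = emb R a" by (simp add: one_emb_mult)

lemma emb_coef: "emb R \<one> * x = x ==> emb R (coef R x) = x" by (simp add: one_emb_mult)

lemma perm_simps [simp]: "\<phi> \<in> carrier (permutation_module R X \<alpha>) \<longleftrightarrow>
   (\<forall>x. \<phi> x \<in> carrier R) & (\<forall>x. x ~: X --> \<phi> x = \<zero>) & finite {x. \<phi> x ~= \<zero>}" "\<zero>\<^bsub>permutation_module R X \<alpha>\<^esub> = (%_. \<zero>)"
 "\<phi> \<oplus>\<^bsub>permutation_module R X \<alpha>\<^esub> \<psi> = (%x. \<phi> x \<oplus> \<psi> x)" "r \<odot>\<^bsub>permutation_module R X \<alpha>\<^esub> \<phi> = (%x. r \<otimes> \<phi> x)"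
 "act (permutation_module R X \<alpha>) g = free_map R (\<alpha> g)" by (simp_all add: permutation_module_def)

lemma module_perm: "Module.module R (permutation_module R X \<alpha>)"
proof -
 have fa: "finite {x. \<phi> x \<oplus> \<psi> x ~= \<zero>}" if "finite {x. \<phi> x ~= \<zero>}" "finite {x. \<psi> x ~= \<zero>}" for \<phi> \<psi> :: "'x => 'a"
  by (rule finite_subset[OF _ finite_UnI[OF that]]) auto
 have fs: "finite {x. r \<otimes> \<phi> x ~= \<zero>}" if "finite {x. \<phi> x ~= \<zero>}" "r \<in> carrier R" for r and \<phi> :: "'x => 'a"
  by (rule finite_subset[OF _ that(1)]) (use that(2) in auto)
 show ?thesis
 proof (rule Module.moduleI)
 show "cring R" by (rule is_cring)
 show "abelian_group (permutation_module R X \<alpha>)"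
 proof (rule abelian_groupI)
  fix \<phi> assume "\<phi> \<in> carrier (permutation_module R X \<alpha>)"
  then show "\<exists>\<psi>\<in>carrier (permutation_module R X \<alpha>). \<psi> \<oplus>\<^bsub>permutation_module R X \<alpha>\<^esub> \<phi> = \<zero>\<^bsub>permutation_module R X \<alpha>\<^esub>"
   by (intro bexI[of _ "%x. \<ominus> \<phi> x"]) (auto simp: l_neg elim!: rev_finite_subset)
 qed (auto simp: fa a_ac fun_eq_iff)
qed (auto simp: fa fs l_distr r_distr m_assoc)
qed

lemma free_basis_perm [simp]: "x \<in> X ==> free_basis R x \<in> carrier (permutation_module R X \<alpha>)"
 by (auto simp: free_basis_def)

lemma perm_induct:
 assumes "\<phi> \<in> carrier (permutation_module R X \<alpha>)" "Q (%_. \<zero>)"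
  and step: "!!x r \<psi>. x \<in> X ==> r \<in> carrier R ==> \<psi> \<in> carrier (permutation_module R X \<alpha>) ==> Q \<psi> ==>
   Q (r \<odot>\<^bsub>permutation_module R X \<alpha>\<^esub> free_basis R x \<oplus>\<^bsub>permutation_module R X \<alpha>\<^esub> \<psi>)"
 shows "Q \<phi>" using assms(1)
proof (induction "card {x. \<phi> x ~= \<zero>}" arbitrary: \<phi> rule: less_induct)
 case less
 then have c: "!!x. \<phi> x \<in> carrier R" "!!x. x ~: X ==> \<phi> x = \<zero>" "finite {x. \<phi> x ~= \<zero>}" by simp_all
 show ?case
 proof (cases "\<exists>x. \<phi> x ~= \<zero>")
  case True
  then obtain x where x: "\<phi> x ~= \<zero>" by blast
  define \<psi> where "\<psi> = \<phi>(x := \<zero>)"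
  have s: "{y. \<psi> y ~= \<zero>} = {y. \<phi> y ~= \<zero>} - {x}" by (auto simp: \<psi>_def)
  have "card {y. \<psi> y ~= \<zero>} < card {y. \<phi> y ~= \<zero>}" unfolding s by (rule card_Diff1_less[OF c(3)]) (simp add: x)
  moreover have \<psi>: "\<psi> \<in> carrier (permutation_module R X \<alpha>)" using c s by (auto simp: \<psi>_def)
  ultimately have "Q \<psi>" using less.hyps by blast
  moreover have "\<phi> = \<phi> x \<odot>\<^bsub>permutation_module R X \<alpha>\<^esub> free_basis R x \<oplus>\<^bsub>permutation_module R X \<alpha>\<^esub> \<psi>"
   using c by (auto simp: \<psi>_def free_basis_def)
  ultimately show ?thesis using step[of x "\<phi> x" \<psi>] c \<psi> x by metis
 next
  case False
  then have "\<phi> = (%_. \<zero>)" by auto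
  then show ?thesis using assms(2) by simp
 qed
qed

lemma perm_ext:
 assumes N: "Module.module R N"
  and L: "lmap R (permutation_module R X \<alpha>) N \<Lambda>" "lmap R (permutation_module R X \<alpha>) N \<Lambda>'"
  and eq: "!!x. x \<in> X ==> \<Lambda> (free_basis R x) = \<Lambda>' (free_basis R x)"
  and \<phi>: "\<phi> \<in> carrier (permutation_module R X \<alpha>)"
 shows "\<Lambda> \<phi> = \<Lambda>' \<phi>"
proof -
 interpret P: Module.module R "permutation_module R X \<alpha>" by (rule module_perm)
 show ?thesis
 proof (rule perm_induct[OF \<phi>, of "%\<phi>. \<Lambda> \<phi> = \<Lambda>' \<phi>"])
  show "\<Lambda> (%_. \<zero>) = \<Lambda>' (%_. \<zero>)"
   using lmap_zero(1)[OF module_perm N L(1)] lmap_zero(1)[OF module_perm N L(2)] by simp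
 next
  fix x r \<psi> assume x: "x \<in> X" "r \<in> carrier R" "\<psi> \<in> carrier (permutation_module R X \<alpha>)" "\<Lambda> \<psi> = \<Lambda>' \<psi>"
  let ?P = "permutation_module R X \<alpha>"
  have b: "free_basis R x \<in> carrier ?P" by (rule free_basis_perm[OF x(1)])
  have "r \<odot>\<^bsub>?P\<^esub> free_basis R x \<in> carrier ?P" using P.smult_closed[OF x(2) b] .
  then show "\<Lambda> (r \<odot>\<^bsub>?P\<^esub> free_basis R x \<oplus>\<^bsub>?P\<^esub> \<psi>) = \<Lambda>' (r \<odot>\<^bsub>?P\<^esub> free_basis R x \<oplus>\<^bsub>?P\<^esub> \<psi>)"
   by (simp only: lmapD(2,3)[OF L(1)] lmapD(2,3)[OF L(2)] x b eq)
 qed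
qed

text \<open>The linear extension of \<open>B\<close> from the basis. It is computed in the ring
  type, where sums have no side conditions, and brought back by \<open>coef\<close>.\<close>

definition ev :: "('x => 'a) => ('x => 'a) => 'a" where
 "ev B \<phi> = coef R (\<Sum>w\<in>{w. \<phi> w ~= \<zero>}. emb R (\<phi> w) * emb R (B w))"

lemma ev_closed [simp]: "ev B \<phi> \<in> carrier R" by (simp add: ev_def)

lemma emb_ev:
 assumes "!!w. \<phi> w \<in> carrier R" "finite S" "{w. \<phi> w ~= \<zero>} \<subseteq> S"
 shows "emb R (ev B \<phi>) = (\<Sum>w\<in>S. emb R (\<phi> w) * emb R (B w))"
proof -
 have "emb R (ev B \<phi>) = (\<Sum>w\<in>{w. \<phi> w ~= \<zero>}. emb R (\<phi> w) * emb R (B w))" unfolding ev_def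
  by (rule emb_coef) (simp add: sum_distrib_left mult.assoc[symmetric] assms(1))
 also have "... = (\<Sum>w\<in>S. emb R (\<phi> w) * emb R (B w))" by (rule sum.mono_neutral_left) (use assms in auto)
 finally show ?thesis .
qed

lemma linf_ev: "linf R (permutation_module R X \<alpha>) (ev B)" unfolding linf_def
proof (intro conjI ballI)
 let ?P = "permutation_module R X \<alpha>"
 fix \<phi> assume \<phi>: "\<phi> \<in> carrier ?P"
 show "ev B \<phi> \<in> carrier R" by simp
 show "ev B (\<phi> \<oplus>\<^bsub>?P\<^esub> \<psi>) = ev B \<phi> \<oplus> ev B \<psi>" if \<psi>: "\<psi> \<in> carrier ?P" for \<psi>
 proof -
  let ?S = "{w. \<phi> w ~= \<zero>} \<union> {w. \<psi> w ~= \<zero>}"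
  have f: "finite ?S" using \<phi> \<psi> by simp
  have "emb R (ev B (\<phi> \<oplus>\<^bsub>?P\<^esub> \<psi>)) = (\<Sum>w\<in>?S. emb R (\<phi> w \<oplus> \<psi> w) * emb R (B w))"
   using \<phi> \<psi> f by (subst emb_ev[of _ ?S]) auto
  also have "... = (\<Sum>w\<in>?S. emb R (\<phi> w) * emb R (B w)) + (\<Sum>w\<in>?S. emb R (\<psi> w) * emb R (B w))"
   using \<phi> \<psi> by (simp add: emb_add distrib_right sum.distrib)
  also have "... = emb R (ev B \<phi>) + emb R (ev B \<psi>)"
   using \<phi> \<psi> by (intro arg_cong2[of _ _ _ _ "(+)"] emb_ev[symmetric]) auto
  finally show ?thesis by (simp add: emb_add[symmetric] emb_inj)
 qed
 show "ev B (r \<odot>\<^bsub>?P\<^esub> \<phi>) = r \<otimes> ev B \<phi>" if r: "r \<in> carrier R" for r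
 proof -
  let ?S = "{w. \<phi> w ~= \<zero>}"
  have "emb R (ev B (r \<odot>\<^bsub>?P\<^esub> \<phi>)) = (\<Sum>w\<in>?S. emb R (r \<otimes> \<phi> w) * emb R (B w))"
   using \<phi> r by (subst emb_ev[of _ ?S]) auto
  also have "... = emb R r * emb R (ev B \<phi>)"
   using \<phi> r by (subst emb_ev[of _ ?S]) (auto simp: emb_mult sum_distrib_left mult.assoc)
  finally show ?thesis using r by (simp add: emb_mult[symmetric] emb_inj)
 qed
qed

lemma ev_basis: "B x \<in> carrier R ==> ev B (free_basis R x) = B x"
proof -
 assume B: "B x \<in> carrier R"
 have "emb R (ev B (free_basis R x)) = (\<Sum>w\<in>{x}. emb R (free_basis R x w) * emb R (B w))"
  by (rule emb_ev) (auto simp: free_basis_def)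
 also have "... = emb R (B x)" using B by (simp add: free_basis_def)
 finally show ?thesis using B by (simp add: emb_inj)
qed

text \<open>A coordinate of the image is the linear extension of the indicator function of a fibre
  of \<open>h\<close>; linearity of \<open>free_map\<close> is inherited from
  \<open>ev\<close>.\<close>

lemma free_map_ev:
 assumes "\<phi> \<in> carrier (permutation_module R X \<alpha>)"
 shows "free_map R h \<phi> z = ev (%w. if h w = z then \<one> else \<zero>) \<phi>"
proof -
 let ?S = "{w. \<phi> w ~= \<zero>}"
 have p: "finite ?S" "!!w. \<phi> w \<in> carrier R" using assms by simp_all
 have "free_map R h \<phi> z \<in> carrier R" unfolding free_map_def by (rule finsum_closed) (use p in auto)
 then have cl: "free_map R h \<phi> z \<in> carrier R" .
 have "emb R (free_map R h \<phi> z) = (\<Sum>w\<in>{w\<in>?S. h w = z}. emb R (\<phi> w))"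
  unfolding free_map_def by (subst emb_finsum) (use p in \<open>auto intro!: sum.cong\<close>)
 also have "... = (\<Sum>w\<in>?S. if h w = z then emb R (\<phi> w) else 0)" by (rule sum.inter_filter[OF p(1)])
 also have "... = (\<Sum>w\<in>?S. emb R (\<phi> w) * emb R (if h w = z then \<one> else \<zero>))"
  using p(2) by (intro sum.cong) (auto simp: emb_mult[symmetric])
 also have "... = emb R (ev (%w. if h w = z then \<one> else \<zero>) \<phi>)" by (rule emb_ev[symmetric]) (use p in auto)
 finally show ?thesis using cl by (simp add: emb_inj)
qed

lemma free_map_basis: "free_map R h (free_basis R x) = free_basis R (h x)"
proof
 fix z
 have "free_basis R x \<in> carrier (permutation_module R UNIV undefined)" by (rule free_basis_perm) simp
 then show "free_map R h (free_basis R x) z = free_basis R (h x) z"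
  by (subst free_map_ev) (auto simp: ev_basis, auto simp: free_basis_def)
qed

lemma lmap_free_map:
 assumes h: "!!x. x \<in> X ==> h x \<in> Y"
 shows "lmap R (permutation_module R X \<alpha>) (permutation_module R Y \<beta>) (free_map R h)" unfolding lmap_def
proof (intro conjI ballI)
 let ?P = "permutation_module R X \<alpha>" and ?Q = "permutation_module R Y \<beta>"
 interpret P: Module.module R ?P by (rule module_perm)
 fix \<phi> assume \<phi>: "\<phi> \<in> carrier ?P"
 have e: "free_map R h \<phi> = (%z. ev (%w. if h w = z then \<one> else \<zero>) \<phi>)" if "\<phi> \<in> carrier ?P" for \<phi>
  by (rule ext) (rule free_map_ev[OF that])
 have z: "free_map R h \<phi> z = \<zero>" if "z ~: h ` {w. \<phi> w ~= \<zero>}" for z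
 proof -
  have "{w. \<phi> w ~= \<zero> & h w = z} = {}" using that by auto
  then show ?thesis unfolding free_map_def by (simp only: finsum_empty)
 qed
 have "{z. free_map R h \<phi> z ~= \<zero>} \<subseteq> h ` {w. \<phi> w ~= \<zero>}" using z by blast
 then have "finite {z. free_map R h \<phi> z ~= \<zero>}" by (rule finite_subset) (use \<phi> in simp)
 moreover have "free_map R h \<phi> z = \<zero>" if "z ~: Y" for z
 proof (rule z)
  have "w \<in> X" if "\<phi> w ~= \<zero>" for w using \<phi> that by auto
  then show "z ~: h ` {w. \<phi> w ~= \<zero>}" using h \<open>z ~: Y\<close> by blast
 qed
 ultimately show "free_map R h \<phi> \<in> carrier ?Q" using \<phi> by (simp add: e)
 show "free_map R h (\<phi> \<oplus>\<^bsub>?P\<^esub> \<psi>) = free_map R h \<phi> \<oplus>\<^bsub>?Q\<^esub> free_map R h \<psi>" if \<psi>: "\<psi> \<in> carrier ?P" for \<psi>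
  unfolding e[OF P.M.a_closed[OF \<phi> \<psi>]] e[OF \<phi>] e[OF \<psi>] linfD(2)[OF linf_ev \<phi> \<psi>] by simp
 show "free_map R h (r \<odot>\<^bsub>?P\<^esub> \<phi>) = r \<odot>\<^bsub>?Q\<^esub> free_map R h \<phi>" if r: "r \<in> carrier R" for r
  unfolding e[OF P.smult_closed[OF r \<phi>]] e[OF \<phi>] linfD(3)[OF linf_ev r \<phi>] by simp
qed

end

subsection \<open>Tensor products\<close>

definition tens :: "('k, 'z) ring_scheme => ('k, 'm, 'g) gmod => ('k, 'n, 'g) gmod =>
  'm => 'n => ('m \<times> 'n => 'k) set" where
 "tens K M N x y = bilinear_rels K M N +>\<^bsub>pairs_module K M N\<^esub> free_basis K (x, y)"

text \<open>The map on the tensor product induced by \<open>B\<close>. The representative of the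
  coset is arbitrary, since for bilinear \<open>B\<close> the extension \<open>ev\<close> vanishes
  on the relations.\<close>

definition tlift :: "('k, 'z) ring_scheme => ('m \<times> 'n => 'k) => ('m \<times> 'n => 'k) set => 'k" where
 "tlift K B A = field.ev K B (SOME \<phi>. \<phi> \<in> A)"

locale tensor_pair = field K + M: Module.module K M + N: Module.module K N
 for K :: "('k, 'z) ring_scheme" (structure) and M :: "('k, 'm, 'g) gmod" and N :: "('k, 'n, 'g) gmod"
begin

abbreviation "FF \<equiv> pairs_module K M N"
abbreviation "RR \<equiv> bilinear_rels K M N"
abbreviation "TT \<equiv> tensor_module K M N"
abbreviation "e2 x y \<equiv> free_basis K (x, y)"

definition rel_gens :: "('m \<times> 'n => 'k) set" where
 "rel_gens = {e2 (x \<oplus>\<^bsub>M\<^esub> x') y \<ominus>\<^bsub>FF\<^esub> (e2 x y \<oplus>\<^bsub>FF\<^esub> e2 x' y) | x x' y.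
     x \<in> carrier M & x' \<in> carrier M & y \<in> carrier N} \<union>
    {e2 x (y \<oplus>\<^bsub>N\<^esub> y') \<ominus>\<^bsub>FF\<^esub> (e2 x y \<oplus>\<^bsub>FF\<^esub> e2 x y') | x y y'. x \<in> carrier M & y \<in> carrier N & y' \<in> carrier N} \<union>
    {e2 (r \<odot>\<^bsub>M\<^esub> x) y \<ominus>\<^bsub>FF\<^esub> (r \<odot>\<^bsub>FF\<^esub> e2 x y) | r x y. r \<in> carrier K & x \<in> carrier M & y \<in> carrier N} \<union>
    {e2 x (r \<odot>\<^bsub>N\<^esub> y) \<ominus>\<^bsub>FF\<^esub> (r \<odot>\<^bsub>FF\<^esub> e2 x y) | r x y. r \<in> carrier K & x \<in> carrier M & y \<in> carrier N}"

lemma RR_span: "RR = module_span K FF rel_gens" unfolding bilinear_rels_def rel_gens_def Let_def ..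

lemma module_FF: "Module.module K FF" unfolding pairs_module_def by (rule module_perm)

sublocale F: gmodule K FF by (rule gmodule.intro[OF module_FF])

lemma e2_in: "x \<in> carrier M ==> y \<in> carrier N ==> e2 x y \<in> carrier FF"
 unfolding pairs_module_def by (rule free_basis_perm) simp

lemma rel_gens_FF: "rel_gens \<subseteq> carrier FF" unfolding rel_gens_def
 by (auto simp del: perm_simps intro!: F.M.minus_closed F.M.a_closed F.smult_closed e2_in)

lemma sub_RR: "submodule RR K FF" unfolding RR_span by (rule F.submodule_span[OF rel_gens_FF])

lemma TT_def': "TT = quotient_mod FF RR (%g. coset_map FF RR (act FF g))" unfolding tensor_module_def Let_def ..

lemma module_TT: "Module.module K TT" unfolding TT_def' by (rule F.module_quotient[OF sub_RR])

lemma tens_in: "x \<in> carrier M ==> y \<in> carrier N ==> tens K M N x y \<in> carrier TT"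
 unfolding TT_def' tens_def by (rule F.quotient_simps(2)[OF sub_RR e2_in])

lemma carrier_TT: "carrier TT = (%\<phi>. RR +>\<^bsub>FF\<^esub> \<phi>) ` carrier FF" unfolding TT_def' by (rule F.carrier_quotient)

text \<open>Pure tensors are the images of the basis of the free module, and this basis determines a
  linear map.\<close>

lemma tens_ext:
 assumes N': "Module.module K N'" and L: "lmap K TT N' \<Lambda>" "lmap K TT N' \<Lambda>'"
  and eq: "!!x y. x \<in> carrier M ==> y \<in> carrier N ==> \<Lambda> (tens K M N x y) = \<Lambda>' (tens K M N x y)"
  and A: "A \<in> carrier TT"
 shows "\<Lambda> A = \<Lambda>' A"
proof -
 have q: "lmap K FF TT (%\<phi>. RR +>\<^bsub>FF\<^esub> \<phi>)" unfolding TT_def' by (rule F.lmap_quotient[OF sub_RR])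
 obtain \<phi> where \<phi>: "\<phi> \<in> carrier FF" "A = RR +>\<^bsub>FF\<^esub> \<phi>" using A unfolding carrier_TT by blast
 have e: "\<Lambda> (RR +>\<^bsub>FF\<^esub> free_basis K z) = \<Lambda>' (RR +>\<^bsub>FF\<^esub> free_basis K z)" if "z \<in> carrier M \<times> carrier N" for z
  using that eq[unfolded tens_def] by auto
 show ?thesis unfolding \<phi>(2)
  using perm_ext[OF N' lmap_comp[OF q L(1), unfolded pairs_module_def] lmap_comp[OF q L(2), unfolded pairs_module_def]]
   e \<phi>(1) unfolding pairs_module_def by blast
qed

lemma tens_ext_linf:
 assumes "linf K TT \<Lambda>" "linf K TT \<Lambda>'"
  "!!x y. x \<in> carrier M ==> y \<in> carrier N ==> \<Lambda> (tens K M N x y) = \<Lambda>' (tens K M N x y)" "A \<in> carrier TT"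
 shows "\<Lambda> A = \<Lambda>' A"
 using tens_ext[OF module_trivial[OF is_cring] assms(1,2)[unfolded linf_iff_lmap] assms(3,4)] .

lemma RR_gens: "x \<in> carrier M ==> x' \<in> carrier M ==> y \<in> carrier N ==>
  e2 (x \<oplus>\<^bsub>M\<^esub> x') y \<ominus>\<^bsub>FF\<^esub> (e2 x y \<oplus>\<^bsub>FF\<^esub> e2 x' y) \<in> RR" "x \<in> carrier M ==> y \<in> carrier N ==> y' \<in> carrier N ==>
  e2 x (y \<oplus>\<^bsub>N\<^esub> y') \<ominus>\<^bsub>FF\<^esub> (e2 x y \<oplus>\<^bsub>FF\<^esub> e2 x y') \<in> RR" "r \<in> carrier K ==> x \<in> carrier M ==> y \<in> carrier N ==>
  e2 (r \<odot>\<^bsub>M\<^esub> x) y \<ominus>\<^bsub>FF\<^esub> (r \<odot>\<^bsub>FF\<^esub> e2 x y) \<in> RR" "r \<in> carrier K ==> x \<in> carrier M ==> y \<in> carrier N ==>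
  e2 x (r \<odot>\<^bsub>N\<^esub> y) \<ominus>\<^bsub>FF\<^esub> (r \<odot>\<^bsub>FF\<^esub> e2 x y) \<in> RR"
 unfolding RR_span by (rule subsetD[OF module_span_incl]; unfold rel_gens_def; blast)+

lemma TT_ops: "\<phi> \<in> carrier FF ==> \<psi> \<in> carrier FF ==> (RR +>\<^bsub>FF\<^esub> \<phi>) \<oplus>\<^bsub>TT\<^esub> (RR +>\<^bsub>FF\<^esub> \<psi>) = RR +>\<^bsub>FF\<^esub> (\<phi> \<oplus>\<^bsub>FF\<^esub> \<psi>)"
 "r \<in> carrier K ==> \<phi> \<in> carrier FF ==> r \<odot>\<^bsub>TT\<^esub> (RR +>\<^bsub>FF\<^esub> \<phi>) = RR +>\<^bsub>FF\<^esub> (r \<odot>\<^bsub>FF\<^esub> \<phi>)"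
 unfolding TT_def' by (rule F.quotient_simps[OF sub_RR]; assumption)+

lemma tens_add_left:
 assumes "x \<in> carrier M" "x' \<in> carrier M" "y \<in> carrier N"
 shows "tens K M N (x \<oplus>\<^bsub>M\<^esub> x') y = tens K M N x y \<oplus>\<^bsub>TT\<^esub> tens K M N x' y"
 unfolding tens_def TT_ops(1)[OF e2_in[OF assms(1,3)] e2_in[OF assms(2,3)]]
 by (rule F.coset_eq_iff[OF sub_RR, THEN iffD2]) (rule e2_in F.M.a_closed M.M.a_closed RR_gens assms)+

lemma tens_add_right:
 assumes "x \<in> carrier M" "y \<in> carrier N" "y' \<in> carrier N"
 shows "tens K M N x (y \<oplus>\<^bsub>N\<^esub> y') = tens K M N x y \<oplus>\<^bsub>TT\<^esub> tens K M N x y'"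
 unfolding tens_def TT_ops(1)[OF e2_in[OF assms(1,2)] e2_in[OF assms(1,3)]]
 by (rule F.coset_eq_iff[OF sub_RR, THEN iffD2]) (rule e2_in F.M.a_closed N.M.a_closed RR_gens assms)+

lemma tens_smult_left:
 assumes "r \<in> carrier K" "x \<in> carrier M" "y \<in> carrier N"
 shows "tens K M N (r \<odot>\<^bsub>M\<^esub> x) y = r \<odot>\<^bsub>TT\<^esub> tens K M N x y"
 unfolding tens_def TT_ops(2)[OF assms(1) e2_in[OF assms(2,3)]] by (rule F.coset_eq_iff[OF sub_RR, THEN iffD2])
  (rule e2_in F.smult_closed M.smult_closed RR_gens assms)+

lemma tens_smult_right:
 assumes "r \<in> carrier K" "x \<in> carrier M" "y \<in> carrier N"
 shows "tens K M N x (r \<odot>\<^bsub>N\<^esub> y) = r \<odot>\<^bsub>TT\<^esub> tens K M N x y"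
 unfolding tens_def TT_ops(2)[OF assms(1) e2_in[OF assms(2,3)]] by (rule F.coset_eq_iff[OF sub_RR, THEN iffD2])
  (rule e2_in F.smult_closed N.smult_closed RR_gens assms)+

text \<open>Bilinearity of \<open>B\<close> places the generators of the relations, and hence the
  submodule they span, in the kernel of the linear extension.\<close>

lemma tlift:
 assumes B: "!!x y. x \<in> carrier M ==> y \<in> carrier N ==> B (x, y) \<in> carrier K"
  and B1: "!!y. y \<in> carrier N ==> linf K M (%x. B (x, y))"
  and B2: "!!x. x \<in> carrier M ==> linf K N (%y. B (x, y))"
 shows "linf K TT (tlift K B)" "x \<in> carrier M ==> y \<in> carrier N ==> tlift K B (tens K M N x y) = B (x, y)"
proof -
 have l: "linf K FF (ev B)" unfolding pairs_module_def by (rule linf_ev)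
 note lD = linfD[OF l] and lm = linf_minus[OF module_FF l]
 have eb: "ev B (e2 x y) = B (x, y)" if "x \<in> carrier M" "y \<in> carrier N" for x y
  by (rule ev_basis[of B "(x, y)", OF B[OF that]])
 have ss: "x \<in> carrier K ==> x \<ominus> x = \<zero>" for x by (simp add: a_minus_def r_neg)
 have "rel_gens \<subseteq> {\<phi>\<in>carrier FF. ev B \<phi> = \<zero>}"
 proof
  fix \<phi> assume \<phi>: "\<phi> \<in> rel_gens"
  have "ev B \<phi> = \<zero>" using \<phi> unfolding rel_gens_def by (elim UnE; clarify)
    (simp_all add: lm(1) lD eb e2_in linfD[OF B1] linfD[OF B2] B F.M.a_closed F.smult_closed ss
     del: perm_simps)
  then show "\<phi> \<in> {\<phi>\<in>carrier FF. ev B \<phi> = \<zero>}" using \<phi> rel_gens_FF by blast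
 qed
 then have R0: "RR \<subseteq> {\<phi>\<in>carrier FF. ev B \<phi> = \<zero>}"
  unfolding RR_span by (rule module_span_least[OF linf_ker[OF module_FF l]])
 have tl: "tlift K B (RR +>\<^bsub>FF\<^esub> \<phi>) = ev B \<phi>" if \<phi>: "\<phi> \<in> carrier FF" for \<phi>
 proof -
  define \<psi> where "\<psi> = (SOME \<psi>. \<psi> \<in> RR +>\<^bsub>FF\<^esub> \<phi>)"
  have "\<psi> \<in> RR +>\<^bsub>FF\<^esub> \<phi>" unfolding \<psi>_def by (rule someI[of "%\<psi>. \<psi> \<in> RR +>\<^bsub>FF\<^esub> \<phi>", OF F.coset_self[OF sub_RR \<phi>]])
  then obtain n where n: "n \<in> RR" "\<psi> = n \<oplus>\<^bsub>FF\<^esub> \<phi>" unfolding a_r_coset_def' by blast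
  then have "n \<in> carrier FF" "ev B n = \<zero>" using R0 by blast+
  then have "ev B \<psi> = ev B \<phi>" using n lD \<phi> by simp
  then show ?thesis by (simp add: tlift_def \<psi>_def)
 qed
 note q = TT_ops
 have c1: "tlift K B A \<in> carrier K" if "A \<in> carrier TT" for A
 proof -
  obtain \<phi> where \<phi>: "\<phi> \<in> carrier FF" "A = RR +>\<^bsub>FF\<^esub> \<phi>" using \<open>A \<in> carrier TT\<close> unfolding carrier_TT by blast
  show ?thesis unfolding \<phi>(2) tl[OF \<phi>(1)] by (rule ev_closed)
 qed
 have c2: "tlift K B (A \<oplus>\<^bsub>TT\<^esub> A') = tlift K B A \<oplus> tlift K B A'" if A: "A \<in> carrier TT" "A' \<in> carrier TT" for A A'
 proof -
  obtain \<phi> where \<phi>: "\<phi> \<in> carrier FF" "A = RR +>\<^bsub>FF\<^esub> \<phi>" using A(1) unfolding carrier_TT by blast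
  obtain \<psi> where \<psi>: "\<psi> \<in> carrier FF" "A' = RR +>\<^bsub>FF\<^esub> \<psi>" using A(2) unfolding carrier_TT by blast
  show ?thesis unfolding \<phi>(2) \<psi>(2) q(1)[OF \<phi>(1) \<psi>(1)] tl[OF F.M.a_closed[OF \<phi>(1) \<psi>(1)]] tl[OF \<phi>(1)] tl[OF \<psi>(1)]
   by (rule lD(2)[OF \<phi>(1) \<psi>(1)])
 qed
 have c3: "tlift K B (r \<odot>\<^bsub>TT\<^esub> A) = r \<otimes> tlift K B A" if r: "r \<in> carrier K" and A: "A \<in> carrier TT" for r A
 proof -
  obtain \<phi> where \<phi>: "\<phi> \<in> carrier FF" "A = RR +>\<^bsub>FF\<^esub> \<phi>" using A unfolding carrier_TT by blast
  show ?thesis unfolding \<phi>(2) q(2)[OF r \<phi>(1)] tl[OF F.smult_closed[OF r \<phi>(1)]] tl[OF \<phi>(1)]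
   by (rule lD(3)[OF r \<phi>(1)])
 qed
 show "linf K TT (tlift K B)" unfolding linf_def by (intro conjI ballI c1 c2 c3)
 show "x \<in> carrier M ==> y \<in> carrier N ==> tlift K B (tens K M N x y) = B (x, y)"
  unfolding tens_def by (simp only: tl[OF e2_in] eb)
qed

lemma linf_tens:
 assumes L: "linf K TT \<Lambda>"
 shows "y \<in> carrier N ==> linf K M (%x. \<Lambda> (tens K M N x y))"
  "x \<in> carrier M ==> linf K N (%y. \<Lambda> (tens K M N x y))" unfolding linf_def
 by (auto simp: tens_add_left tens_add_right tens_smult_left tens_smult_right tens_in linfD[OF L])

end

text \<open>The map of free modules sends each generator of the relations to a generator of the same
  kind, so it descends to the quotients.\<close>

lemma lmap_tensor:
 assumes T: "tensor_pair K M N" and T': "tensor_pair K M' N'" and f: "lmap K M M' f" and g: "lmap K N N' g"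
 shows "lmap K (tensor_module K M N) (tensor_module K M' N') (tensor_map K M' N' f g)"
  "x \<in> carrier M ==> y \<in> carrier N ==> tensor_map K M' N' f g (tens K M N x y) = tens K M' N' (f x) (g y)"
proof -
 interpret S: tensor_pair K M N by (rule T)
 interpret T: tensor_pair K M' N' by (rule T')
 let ?h = "free_map K (map_prod f g)"
 have h: "lmap K S.FF T.FF ?h" unfolding pairs_module_def
  by (rule S.lmap_free_map) (auto simp: lmapD[OF f] lmapD[OF g])
 note hD = lmapD[OF h] and hz = lmap_zero[OF S.module_FF T.module_FF h]
 have hb: "?h (S.e2 x y) = T.e2 (f x) (g y)" for x y by (simp add: S.free_map_basis)
 have "S.rel_gens \<subseteq> {\<phi>\<in>carrier S.FF. ?h \<phi> \<in> T.RR}"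
 proof
  fix \<phi> assume \<phi>: "\<phi> \<in> S.rel_gens"
  have "?h \<phi> \<in> T.RR" using \<phi> unfolding S.rel_gens_def by (elim UnE; clarify)
    (simp_all add: hz hD hb S.e2_in S.F.M.a_closed S.F.smult_closed lmapD[OF f] lmapD[OF g]
     T.RR_gens del: S.perm_simps)
  then show "\<phi> \<in> {\<phi>\<in>carrier S.FF. ?h \<phi> \<in> T.RR}" using \<phi> S.rel_gens_FF by blast
 qed
 then have R: "S.RR \<subseteq> {\<phi>\<in>carrier S.FF. ?h \<phi> \<in> T.RR}" unfolding S.RR_span
  by (rule module_span_least[OF submodule_vimage[OF S.module_FF T.module_FF h T.sub_RR]])
 have tm: "tensor_map K M' N' f g (S.RR +>\<^bsub>S.FF\<^esub> \<phi>) = T.RR +>\<^bsub>T.FF\<^esub> ?h \<phi>" if \<phi>: "\<phi> \<in> carrier S.FF" for \<phi>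
  unfolding tensor_map_def
 proof (rule T.F.coset_map_coset[OF T.sub_RR])
  show "S.RR ~= {}" using S.F.submodule_zero[OF S.sub_RR] by blast
  show "?h \<phi> \<in> carrier T.FF" by (rule hD(1)[OF \<phi>])
  fix n assume "n \<in> S.RR"
  then have n: "n \<in> carrier S.FF" "?h n \<in> T.RR" using R by blast+
  show "?h n \<in> T.RR" by (rule n)
  show "?h (n \<oplus>\<^bsub>S.FF\<^esub> \<phi>) = ?h n \<oplus>\<^bsub>T.FF\<^esub> ?h \<phi>" by (rule hD(2)[OF n(1) \<phi>])
 qed
 note q = S.TT_ops and q' = T.TT_ops
 have c1: "tensor_map K M' N' f g A \<in> carrier T.TT" if A: "A \<in> carrier S.TT" for A
 proof -
  obtain \<phi> where \<phi>: "\<phi> \<in> carrier S.FF" "A = S.RR +>\<^bsub>S.FF\<^esub> \<phi>" using A unfolding S.carrier_TT by blast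
  show ?thesis unfolding \<phi>(2) tm[OF \<phi>(1)] T.carrier_TT using hD(1)[OF \<phi>(1)] by blast
 qed
 have c2: "tensor_map K M' N' f g (A \<oplus>\<^bsub>S.TT\<^esub> A') = tensor_map K M' N' f g A \<oplus>\<^bsub>T.TT\<^esub> tensor_map K M' N' f g A'"
  if A: "A \<in> carrier S.TT" "A' \<in> carrier S.TT" for A A'
 proof -
  obtain \<phi> where \<phi>: "\<phi> \<in> carrier S.FF" "A = S.RR +>\<^bsub>S.FF\<^esub> \<phi>" using A(1) unfolding S.carrier_TT by blast
  obtain \<psi> where \<psi>: "\<psi> \<in> carrier S.FF" "A' = S.RR +>\<^bsub>S.FF\<^esub> \<psi>" using A(2) unfolding S.carrier_TT by blast
  show ?thesis
   unfolding \<phi>(2) \<psi>(2) q(1)[OF \<phi>(1) \<psi>(1)] tm[OF S.F.M.a_closed[OF \<phi>(1) \<psi>(1)]] tm[OF \<phi>(1)] tm[OF \<psi>(1)]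
    q'(1)[OF hD(1)[OF \<phi>(1)] hD(1)[OF \<psi>(1)]] hD(2)[OF \<phi>(1) \<psi>(1)] ..
 qed
 have c3: "tensor_map K M' N' f g (r \<odot>\<^bsub>S.TT\<^esub> A) = r \<odot>\<^bsub>T.TT\<^esub> tensor_map K M' N' f g A"
  if r: "r \<in> carrier K" and A: "A \<in> carrier S.TT" for r A
 proof -
  obtain \<phi> where \<phi>: "\<phi> \<in> carrier S.FF" "A = S.RR +>\<^bsub>S.FF\<^esub> \<phi>" using A unfolding S.carrier_TT by blast
  show ?thesis unfolding \<phi>(2) q(2)[OF r \<phi>(1)] tm[OF S.F.smult_closed[OF r \<phi>(1)]] tm[OF \<phi>(1)]
    q'(2)[OF r hD(1)[OF \<phi>(1)]] hD(3)[OF r \<phi>(1)] ..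
 qed
 show "lmap K S.TT T.TT (tensor_map K M' N' f g)" unfolding lmap_def by (intro conjI ballI c1 c2 c3)
 show "x \<in> carrier M ==> y \<in> carrier N ==> tensor_map K M' N' f g (tens K M N x y) = tens K M' N' (f x) (g y)"
  unfolding tens_def by (simp only: tm S.e2_in hb)
qed

lemma act_tensor: "act (tensor_module K M N) g = tensor_map K M N (act M g) (act N g)"
 by (simp add: tensor_module_def Let_def quotient_mod_def tensor_map_def pairs_module_def permutation_module_def)

subsection \<open>Direct sums and duals\<close>

lemma direct_sum_simps [simp]: "u \<in> carrier (direct_sum N) \<longleftrightarrow> (\<forall>i. u i \<in> carrier (N i)) & finite {i. u i ~= \<zero>\<^bsub>N i\<^esub>}"
 "\<zero>\<^bsub>direct_sum N\<^esub> = (%i. \<zero>\<^bsub>N i\<^esub>)" "u \<oplus>\<^bsub>direct_sum N\<^esub> v = (%i. u i \<oplus>\<^bsub>N i\<^esub> v i)" "r \<odot>\<^bsub>direct_sum N\<^esub> u = (%i. r \<odot>\<^bsub>N i\<^esub> u i)"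
 "act (direct_sum N) g u = (%i. act (N i) g (u i))" by (simp_all add: direct_sum_def)

lemma (in Module.module) smult_zero: "r \<in> carrier R ==> r \<odot>\<^bsub>M\<^esub> \<zero>\<^bsub>M\<^esub> = \<zero>\<^bsub>M\<^esub>"
 using smult_r_distr[of r "\<zero>\<^bsub>M\<^esub>" "\<zero>\<^bsub>M\<^esub>"] by (simp add: M.add.r_cancel_one')

lemma module_direct_sum:
 assumes N: "!!i. Module.module K (N i)" shows "Module.module K (direct_sum N)"
proof -
 interpret N: Module.module K "N i" for i by (rule N)
 have fa: "finite {i. u i \<oplus>\<^bsub>N i\<^esub> v i ~= \<zero>\<^bsub>N i\<^esub>}" if "finite {i. u i ~= \<zero>\<^bsub>N i\<^esub>}" "finite {i. v i ~= \<zero>\<^bsub>N i\<^esub>}" for u v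
  by (rule finite_subset[OF _ finite_UnI[OF that]]) auto
 have fs: "finite {i. r \<odot>\<^bsub>N i\<^esub> u i ~= \<zero>\<^bsub>N i\<^esub>}" if "finite {i. u i ~= \<zero>\<^bsub>N i\<^esub>}" "r \<in> carrier K" for r u
  by (rule finite_subset[OF _ that(1)]) (use that(2) N.smult_zero in auto)
 show ?thesis
 proof (rule Module.moduleI)
 show "cring K" by (rule N.R.cring_axioms)
 show "abelian_group (direct_sum N)"
 proof (rule abelian_groupI)
  fix u assume "u \<in> carrier (direct_sum N)"
  then show "\<exists>v\<in>carrier (direct_sum N). v \<oplus>\<^bsub>direct_sum N\<^esub> u = \<zero>\<^bsub>direct_sum N\<^esub>"
   by (intro bexI[of _ "%i. \<ominus>\<^bsub>N i\<^esub> u i"]) (auto simp: N.M.l_neg elim!: rev_finite_subset)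
 qed (auto simp: fa N.M.a_ac fun_eq_iff)
qed (auto simp: fa fs Module.module.smult_l_distr[OF N] Module.module.smult_r_distr[OF N]
  Module.module.smult_assoc1[OF N] Module.module.smult_closed[OF N] Module.module.smult_one[OF N]
  intro: Module.module.smult_closed[OF N] abelian_monoid.a_closed)
qed

definition dsingle :: "('i => ('k, 'm, 'g) gmod) => 'i => 'm => 'i => 'm" where
 "dsingle N i a = (%j. if j = i then a else \<zero>\<^bsub>N j\<^esub>)"

lemma lmap_dsingle:
 assumes N: "!!i. Module.module K (N i)" shows "lmap K (N i) (direct_sum N) (dsingle N i)"
proof -
 interpret N: Module.module K "N i" for i by (rule N)
 have "finite {j. dsingle N i a j ~= \<zero>\<^bsub>N j\<^esub>}" for a by (rule finite_subset[of _ "{i}"]) (auto simp: dsingle_def)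
 then show ?thesis unfolding lmap_def by (auto simp: dsingle_def fun_eq_iff N.smult_zero)
qed

lemma lmap_component: "lmap K (direct_sum N) (N i) (%u. u i)" unfolding lmap_def by simp

lemma direct_sum_ext:
 assumes N: "!!i. Module.module K (N i)" and L: "linf K (direct_sum N) \<Lambda>" "linf K (direct_sum N) \<Lambda>'"
  and eq: "!!i a. a \<in> carrier (N i) ==> \<Lambda> (dsingle N i a) = \<Lambda>' (dsingle N i a)"
 shows "u \<in> carrier (direct_sum N) ==> \<Lambda> u = \<Lambda>' u"
proof (induction "card {i. u i ~= \<zero>\<^bsub>N i\<^esub>}" arbitrary: u rule: less_induct)
 case less
 interpret N: Module.module K "N i" for i by (rule N)
 interpret D: Module.module K "direct_sum N" by (rule module_direct_sum[OF N])
 note z = linf_minus(2)[OF module_direct_sum[OF N] L(1) D.M.zero_closed D.M.zero_closed]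
  linf_minus(2)[OF module_direct_sum[OF N] L(2) D.M.zero_closed D.M.zero_closed]
 show ?case
 proof (cases "\<exists>i. u i ~= \<zero>\<^bsub>N i\<^esub>")
  case True
  then obtain i where i: "u i ~= \<zero>\<^bsub>N i\<^esub>" by blast
  have u: "!!j. u j \<in> carrier (N j)" "finite {i. u i ~= \<zero>\<^bsub>N i\<^esub>}" using less.prems by simp_all
  define v where "v = u(i := \<zero>\<^bsub>N i\<^esub>)"
  have s: "{j. v j ~= \<zero>\<^bsub>N j\<^esub>} = {j. u j ~= \<zero>\<^bsub>N j\<^esub>} - {i}" by (auto simp: v_def)
  have "card {j. v j ~= \<zero>\<^bsub>N j\<^esub>} < card {j. u j ~= \<zero>\<^bsub>N j\<^esub>}"
   unfolding s by (rule card_Diff1_less[OF u(2)]) (simp add: i)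
  moreover have v: "v \<in> carrier (direct_sum N)" unfolding direct_sum_simps s using u by (auto simp: v_def)
  ultimately have IH: "\<Lambda> v = \<Lambda>' v" using less.hyps by blast
  have uv: "u = dsingle N i (u i) \<oplus>\<^bsub>direct_sum N\<^esub> v" using u by (auto simp: v_def dsingle_def fun_eq_iff)
  have d: "dsingle N i (u i) \<in> carrier (direct_sum N)" by (rule lmapD(1)[OF lmap_dsingle[OF N] u(1)])
  show ?thesis by (subst (1 2) uv) (simp only: linfD(2)[OF L(1) d v] linfD(2)[OF L(2) d v] IH eq[OF u(1)])
 next
  case False
  then have "u = \<zero>\<^bsub>direct_sum N\<^esub>" by auto
  then show ?thesis using z by simp
 qed
qed

lemma dual_carrier: "\<phi> \<in> carrier (dual_module K G M) \<longleftrightarrow> \<phi> \<in> extensional (carrier M) & linf K M \<phi>"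
 unfolding dual_module_def linf_def PiE_def by auto

lemma dual_simps: "\<zero>\<^bsub>dual_module K G M\<^esub> = (\<lambda>x\<in>carrier M. \<zero>\<^bsub>K\<^esub>)"
 "\<phi> \<oplus>\<^bsub>dual_module K G M\<^esub> \<psi> = (\<lambda>x\<in>carrier M. \<phi> x \<oplus>\<^bsub>K\<^esub> \<psi> x)" "r \<odot>\<^bsub>dual_module K G M\<^esub> \<phi> = (\<lambda>x\<in>carrier M. r \<otimes>\<^bsub>K\<^esub> \<phi> x)"
 "act (dual_module K G M) g \<phi> = (\<lambda>x\<in>carrier M. \<phi> (act M (inv\<^bsub>G\<^esub> g) x))" by (simp_all add: dual_module_def)

lemma linf_restrict:
 assumes "Module.module K M" shows "linf K M (restrict \<phi> (carrier M)) = linf K M \<phi>"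
proof -
 interpret M: Module.module K M by (rule assms)
 show ?thesis unfolding linf_def by simp
qed

lemma module_dual:
 assumes M: "Module.module K M" shows "Module.module K (dual_module K G M)"
proof (rule Module.moduleI)
 interpret M: Module.module K M by (rule M)
 let ?D = "dual_module K G M"
 have a: "linf K M (%x. \<phi> x \<oplus>\<^bsub>K\<^esub> \<psi> x)" if "linf K M \<phi>" "linf K M \<psi>" for \<phi> \<psi> unfolding linf_def
  by (auto simp: linfD[OF that(1)] linfD[OF that(2)] M.R.a_ac M.R.r_distr)
 have s: "linf K M (%x. r \<otimes>\<^bsub>K\<^esub> \<phi> x)" if "linf K M \<phi>" "r \<in> carrier K" for r \<phi> unfolding linf_def
  by (auto simp: linfD[OF that(1)] that(2) M.R.r_distr M.R.m_lcomm)
 have z: "linf K M (%x. \<zero>\<^bsub>K\<^esub>)" unfolding linf_def by simp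
 have n: "linf K M (%x. \<ominus>\<^bsub>K\<^esub> \<phi> x)" if "linf K M \<phi>" for \<phi> unfolding linf_def
  by (auto simp: linfD[OF that(1)] M.R.minus_add M.R.r_minus)
 have cl: "restrict \<phi> (carrier M) \<in> carrier ?D" if "linf K M \<phi>" for \<phi>
  using that by (simp add: dual_carrier linf_restrict[OF M])
 have val: "\<phi> x \<in> carrier K" if "\<phi> \<in> carrier ?D" "x \<in> carrier M" for \<phi> x
  using that by (auto simp: dual_carrier intro: linfD(1))
 have ext: "\<phi> = \<psi>" if "\<phi> \<in> extensional (carrier M)" "\<psi> \<in> extensional (carrier M)"
  "!!x. x \<in> carrier M ==> \<phi> x = \<psi> x" for \<phi> \<psi> :: "'c => 'a" using that by (rule extensionalityI)
 have dc: "\<phi> \<in> carrier ?D ==> \<phi> \<in> extensional (carrier M) & linf K M \<phi>" for \<phi> by (simp add: dual_carrier)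
 show "cring K" by (rule M.R.cring_axioms)
 show "abelian_group ?D"
 proof (rule abelian_groupI)
  show "\<zero>\<^bsub>?D\<^esub> \<in> carrier ?D" unfolding dual_simps by (rule cl[OF z])
  fix \<phi> assume \<phi>: "\<phi> \<in> carrier ?D"
  show "\<phi> \<oplus>\<^bsub>?D\<^esub> \<psi> \<in> carrier ?D" if "\<psi> \<in> carrier ?D" for \<psi>
   unfolding dual_simps using dc[OF \<phi>] dc[OF that] by (intro cl a) auto
  show "\<zero>\<^bsub>?D\<^esub> \<oplus>\<^bsub>?D\<^esub> \<phi> = \<phi>" by (rule ext) (use dc[OF \<phi>] val[OF \<phi>] in \<open>auto simp: dual_simps\<close>)
  have "restrict (%x. \<ominus>\<^bsub>K\<^esub> \<phi> x) (carrier M) \<oplus>\<^bsub>?D\<^esub> \<phi> = \<zero>\<^bsub>?D\<^esub>"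
   by (rule ext) (use val[OF \<phi>] in \<open>auto simp: dual_simps M.R.l_neg\<close>)
  then show "\<exists>\<psi>\<in>carrier ?D. \<psi> \<oplus>\<^bsub>?D\<^esub> \<phi> = \<zero>\<^bsub>?D\<^esub>" using cl[OF n] dc[OF \<phi>] by blast
  show "\<phi> \<oplus>\<^bsub>?D\<^esub> \<psi> = \<psi> \<oplus>\<^bsub>?D\<^esub> \<phi>" if "\<psi> \<in> carrier ?D" for \<psi>
   by (rule ext) (use val[OF \<phi>] val[OF that] in \<open>auto simp: dual_simps M.R.a_comm\<close>)
  show "\<phi> \<oplus>\<^bsub>?D\<^esub> \<psi> \<oplus>\<^bsub>?D\<^esub> \<chi> = \<phi> \<oplus>\<^bsub>?D\<^esub> (\<psi> \<oplus>\<^bsub>?D\<^esub> \<chi>)" if "\<psi> \<in> carrier ?D" "\<chi> \<in> carrier ?D" for \<psi> \<chi>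
   by (rule ext) (use val[OF \<phi>] val[OF that(1)] val[OF that(2)] in \<open>auto simp: dual_simps M.R.a_assoc\<close>)
 qed
 show "\<one>\<^bsub>K\<^esub> \<odot>\<^bsub>?D\<^esub> \<phi> = \<phi>" if \<phi>: "\<phi> \<in> carrier ?D" for \<phi>
  by (rule ext) (use dc[OF \<phi>] val[OF \<phi>] in \<open>auto simp: dual_simps\<close>)
 fix r \<phi> assume r: "r \<in> carrier K" and \<phi>: "\<phi> \<in> carrier ?D"
 show "r \<odot>\<^bsub>?D\<^esub> \<phi> \<in> carrier ?D" unfolding dual_simps using dc[OF \<phi>] by (intro cl s r) auto
 show "(r \<oplus>\<^bsub>K\<^esub> r') \<odot>\<^bsub>?D\<^esub> \<phi> = r \<odot>\<^bsub>?D\<^esub> \<phi> \<oplus>\<^bsub>?D\<^esub> r' \<odot>\<^bsub>?D\<^esub> \<phi>" if "r' \<in> carrier K" for r'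
  by (rule ext) (use r that val[OF \<phi>] in \<open>auto simp: dual_simps M.R.l_distr\<close>)
 show "(r \<otimes>\<^bsub>K\<^esub> r') \<odot>\<^bsub>?D\<^esub> \<phi> = r \<odot>\<^bsub>?D\<^esub> (r' \<odot>\<^bsub>?D\<^esub> \<phi>)" if "r' \<in> carrier K" for r'
  by (rule ext) (use r that val[OF \<phi>] in \<open>auto simp: dual_simps M.R.m_assoc\<close>)
 show "r \<odot>\<^bsub>?D\<^esub> (\<phi> \<oplus>\<^bsub>?D\<^esub> \<psi>) = r \<odot>\<^bsub>?D\<^esub> \<phi> \<oplus>\<^bsub>?D\<^esub> r \<odot>\<^bsub>?D\<^esub> \<psi>" if "\<psi> \<in> carrier ?D" for \<psi>
  by (rule ext) (use r val[OF \<phi>] val[OF that] in \<open>auto simp: dual_simps M.R.r_distr\<close>)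
qed

subsection \<open>Frames of \<open>p\<close>-permutation modules\<close>

text \<open>Coordinates on a direct summand of a permutation module: \<open>m x\<close> is the
  projection of a basis vector and \<open>\<phi> x\<close> a coordinate. A zero module has no
  indices, so that a bounded complex has finitely many in total. By the last clause a vector with
  vanishing coordinates is zero.\<close>

definition perm_frame :: "('k, 'z) ring_scheme => ('g, 'y) monoid_scheme => ('k, 'm, 'g) gmod =>
  nat set => ('g => nat => nat) => (nat => 'm) => (nat => 'm => 'k) => bool" where
 "perm_frame K G M X \<alpha> m \<phi> \<longleftrightarrow> finite X & (carrier M = {\<zero>\<^bsub>M\<^esub>} --> X = {}) &
  (\<forall>x\<in>X. m x \<in> carrier M & linf K M (\<phi> x) & \<alpha> \<one>\<^bsub>G\<^esub> x = x &
   (\<forall>g\<in>carrier G. \<alpha> g x \<in> X & act M g (m x) = m (\<alpha> g x) & (\<forall>h\<in>carrier G. \<alpha> (g \<otimes>\<^bsub>G\<^esub> h) x = \<alpha> g (\<alpha> h x)) &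
    (\<forall>v\<in>carrier M. \<phi> (\<alpha> g x) (act M g v) = \<phi> x v))) &
  (\<forall>\<Lambda> v. linf K M \<Lambda> --> v \<in> carrier M --> \<Lambda> v = (\<Oplus>\<^bsub>K\<^esub>x\<in>X. \<phi> x v \<otimes>\<^bsub>K\<^esub> \<Lambda> (m x))) &
  (\<forall>v\<in>carrier M. (\<forall>x\<in>X. \<phi> x v = \<zero>\<^bsub>K\<^esub>) --> v = \<zero>\<^bsub>M\<^esub>)"

lemma perm_frameD:
 assumes "perm_frame K G M X \<alpha> m \<phi>"
 shows "finite X" "carrier M = {\<zero>\<^bsub>M\<^esub>} ==> X = {}"
 "x \<in> X ==> m x \<in> carrier M" "x \<in> X ==> linf K M (\<phi> x)"
 "x \<in> X ==> \<alpha> \<one>\<^bsub>G\<^esub> x = x" "x \<in> X ==> g \<in> carrier G ==> \<alpha> g x \<in> X"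
 "x \<in> X ==> g \<in> carrier G ==> act M g (m x) = m (\<alpha> g x)"
 "x \<in> X ==> g \<in> carrier G ==> h \<in> carrier G ==> \<alpha> (g \<otimes>\<^bsub>G\<^esub> h) x = \<alpha> g (\<alpha> h x)"
 "x \<in> X ==> g \<in> carrier G ==> v \<in> carrier M ==> \<phi> (\<alpha> g x) (act M g v) = \<phi> x v"
 "linf K M \<Lambda> ==> v \<in> carrier M ==> \<Lambda> v = (\<Oplus>\<^bsub>K\<^esub>x\<in>X. \<phi> x v \<otimes>\<^bsub>K\<^esub> \<Lambda> (m x))"
 "v \<in> carrier M ==> \<forall>x\<in>X. \<phi> x v = \<zero>\<^bsub>K\<^esub> ==> v = \<zero>\<^bsub>M\<^esub>"
 using assms unfolding perm_frame_def by blast+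

lemma (in field) perm_recon:
 assumes X: "finite X" and L: "linf R (permutation_module R X \<alpha>) \<Lambda>"
  and \<psi>: "\<psi> \<in> carrier (permutation_module R X \<alpha>)"
 shows "\<Lambda> \<psi> = (\<Oplus>x\<in>X. \<psi> x \<otimes> \<Lambda> (free_basis R x))"
proof -
 let ?B = "%x. \<Lambda> (free_basis R x)"
 have B: "?B x \<in> carrier R" if "x \<in> X" for x by (rule linfD(1)[OF L free_basis_perm[OF that]])
 have "\<Lambda> \<psi> = ev ?B \<psi>"
  by (rule perm_ext[OF module_trivial[OF is_cring] L[unfolded linf_iff_lmap] linf_ev[unfolded linf_iff_lmap] _ \<psi>])
   (simp add: ev_basis B)
 moreover have "emb R (ev ?B \<psi>) = (\<Sum>x\<in>X. emb R (\<psi> x) * emb R (?B x))" by (rule emb_ev) (use X \<psi> in auto)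
 moreover have "... = (\<Sum>x\<in>X. emb R (\<psi> x \<otimes> ?B x))" using \<psi> B by (intro sum.cong) (auto simp: emb_mult)
 moreover have "... = emb R (\<Oplus>x\<in>X. \<psi> x \<otimes> ?B x)" using \<psi> B by (intro emb_finsum[symmetric]) auto
 moreover have "(\<Oplus>x\<in>X. \<psi> x \<otimes> ?B x) \<in> carrier R" using \<psi> B by (intro finsum_closed) auto
 ultimately show ?thesis by (simp add: emb_inj)
qed

lemma (in fbase) perm_frame_exists:
 assumes "p_permutation K G M" shows "\<exists>X \<alpha> m \<phi>. perm_frame K G M X \<alpha> m \<phi>"
proof (cases "carrier M = {\<zero>\<^bsub>M\<^esub>}")
 case True
 interpret M: kG_module K G M using assms unfolding p_permutation_def by blast
 have "linf K M \<Lambda> ==> \<Lambda> \<zero>\<^bsub>M\<^esub> = \<zero>\<^bsub>K\<^esub>" for \<Lambda> by (rule linf_zero[OF M.module_axioms])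
 then have "perm_frame K G M {} \<alpha> m \<phi>" for \<alpha> m \<phi> unfolding perm_frame_def using True by auto
 then show ?thesis by blast
next
 case False
 obtain X :: "nat set" and \<alpha> A B f where X: "finite X" and \<alpha>: "group_action G X \<alpha>"
  and A: "kG_submodule K G (permutation_module K X \<alpha>) A" "kG_submodule K G (permutation_module K X \<alpha>) B"
  and AB: "A \<inter> B = {\<zero>\<^bsub>permutation_module K X \<alpha>\<^esub>}"
   "A <+>\<^bsub>permutation_module K X \<alpha>\<^esub> B = carrier (permutation_module K X \<alpha>)"
  and f: "f \<in> kG_hom K G M ((permutation_module K X \<alpha>)\<lparr>carrier := A\<rparr>)" and bf: "bij_betw f (carrier M) A"
  using assms unfolding p_permutation_def Let_def by blast
 define P where "P = permutation_module K X \<alpha>"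
 interpret M: kG_module K G M using assms unfolding p_permutation_def by blast
 interpret P: gmodule K P unfolding P_def by (rule gmodule.intro[OF K.module_perm])
 interpret \<alpha>: group_action G X \<alpha> by (rule \<alpha>)
 have sA: "submodule A K P" "submodule B K P" and actA: "!!g x. g \<in> carrier G ==> x \<in> A ==> act P g x \<in> A"
  "!!g x. g \<in> carrier G ==> x \<in> B ==> act P g x \<in> B" using A unfolding kG_submodule_def P_def by blast+
 note EA = P.submoduleE[OF sA(1)] and EB = P.submoduleE[OF sA(2)]
 have AP: "a \<in> carrier P" if "a \<in> A \<or> a \<in> B" for a using that EA(1) EB(1) by blast
 have fD: "f u \<in> A" "f (u \<oplus>\<^bsub>M\<^esub> v) = f u \<oplus>\<^bsub>P\<^esub> f v" "f (r \<odot>\<^bsub>M\<^esub> u) = r \<odot>\<^bsub>P\<^esub> f u" "f (act M g u) = act P g (f u)"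
  if "u \<in> carrier M" "v \<in> carrier M" "r \<in> carrier K" "g \<in> carrier G" for u v r g
  using kG_homD[OF f] that unfolding P_def by (simp_all add: permutation_module_def)
 have inj: "f u = f v ==> u = v" if "u \<in> carrier M" "v \<in> carrier M" for u v
  using bf that unfolding bij_betw_def inj_on_def by blast
 have actl: "lmap K P P (act P g)" if "g \<in> carrier G" for g unfolding P_def K.perm_simps(5)
  by (rule K.lmap_free_map) (rule \<alpha>.element_image[OF that _ refl])
 have uniq: "a = a'" if "a \<in> A" "b \<in> B" "a' \<in> A" "b' \<in> B" "a \<oplus>\<^bsub>P\<^esub> b = a' \<oplus>\<^bsub>P\<^esub> b'" for a a' b b'
 proof -
  have c: "a \<in> carrier P" "b \<in> carrier P" "a' \<in> carrier P" "b' \<in> carrier P" using that AP by blast+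
  have "a = (a \<oplus>\<^bsub>P\<^esub> b) \<oplus>\<^bsub>P\<^esub> \<ominus>\<^bsub>P\<^esub> b" using c by (simp add: P.M.a_assoc P.M.r_neg)
  then have a: "a = (a' \<oplus>\<^bsub>P\<^esub> b') \<oplus>\<^bsub>P\<^esub> \<ominus>\<^bsub>P\<^esub> b" by (simp only: that(5))
  have "a \<ominus>\<^bsub>P\<^esub> a' = \<ominus>\<^bsub>P\<^esub> a' \<oplus>\<^bsub>P\<^esub> a" using c by (simp add: a_minus_def P.M.a_comm)
  also have "... = \<ominus>\<^bsub>P\<^esub> a' \<oplus>\<^bsub>P\<^esub> ((a' \<oplus>\<^bsub>P\<^esub> b') \<oplus>\<^bsub>P\<^esub> \<ominus>\<^bsub>P\<^esub> b)" by (rule arg_cong[OF a])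
  also have "... = b' \<ominus>\<^bsub>P\<^esub> b" using c by (simp add: a_minus_def P.M.a_assoc P.M.r_neg1)
  finally have e: "a \<ominus>\<^bsub>P\<^esub> a' = b' \<ominus>\<^bsub>P\<^esub> b" .
  have "a \<ominus>\<^bsub>P\<^esub> a' \<in> A" "b' \<ominus>\<^bsub>P\<^esub> b \<in> B" using EA EB that by (simp_all add: a_minus_def)
  then have z: "a \<ominus>\<^bsub>P\<^esub> a' = \<zero>\<^bsub>P\<^esub>" using AB(1) e unfolding P_def by auto
  have "a = (a \<ominus>\<^bsub>P\<^esub> a') \<oplus>\<^bsub>P\<^esub> a'" using c by (simp add: a_minus_def P.M.a_assoc P.M.l_neg)
  then show ?thesis using c by (simp add: z)
 qed
 have "\<exists>a. a \<in> A & (\<exists>b\<in>B. u = a \<oplus>\<^bsub>P\<^esub> b)" if "u \<in> carrier P" for u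
  using that AB(2) unfolding P_def set_add_def' by blast
 \<comment> \<open>The projection to \<open>A\<close> along its complement. Uniqueness of the
   decomposition makes it linear and equivariant.\<close>
 then obtain pr where pr: "!!u. u \<in> carrier P ==> pr u \<in> A & (\<exists>b\<in>B. u = pr u \<oplus>\<^bsub>P\<^esub> b)" by metis
 have prI: "pr u = a" if "a \<in> A" "b \<in> B" "u = a \<oplus>\<^bsub>P\<^esub> b" for u a b
 proof -
  have "u \<in> carrier P" using that AP by simp
  then obtain b' where "pr u \<in> A" "b' \<in> B" "u = pr u \<oplus>\<^bsub>P\<^esub> b'" using pr by blast
  then show ?thesis using uniq[of "pr u" b' a b] that by simp
 qed
 have prA: "pr a = a" if "a \<in> A" for a
  by (rule prI[OF that, of "\<zero>\<^bsub>P\<^esub>"]) (use AP that P.submodule_zero[OF sA(2)] in auto)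
 have pradd: "pr (u \<oplus>\<^bsub>P\<^esub> v) = pr u \<oplus>\<^bsub>P\<^esub> pr v" if uv: "u \<in> carrier P" "v \<in> carrier P" for u v
 proof -
  obtain b c where b: "b \<in> B" "u = pr u \<oplus>\<^bsub>P\<^esub> b" "pr u \<in> A" and c: "c \<in> B" "v = pr v \<oplus>\<^bsub>P\<^esub> c" "pr v \<in> A"
   using pr[OF uv(1)] pr[OF uv(2)] by blast
  have cc: "b \<in> carrier P" "c \<in> carrier P" "pr u \<in> carrier P" "pr v \<in> carrier P" using b c AP by blast+
  have "u \<oplus>\<^bsub>P\<^esub> v = (pr u \<oplus>\<^bsub>P\<^esub> b) \<oplus>\<^bsub>P\<^esub> (pr v \<oplus>\<^bsub>P\<^esub> c)" using b(2) c(2) by simp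
  also have "... = (pr u \<oplus>\<^bsub>P\<^esub> pr v) \<oplus>\<^bsub>P\<^esub> (b \<oplus>\<^bsub>P\<^esub> c)" using cc by (simp add: P.M.a_ac)
  finally show ?thesis by (rule prI[rotated 2]) (use EA(5) EB(5) b c in auto)
 qed
 have prsm: "pr (r \<odot>\<^bsub>P\<^esub> u) = r \<odot>\<^bsub>P\<^esub> pr u" if r: "r \<in> carrier K" and u: "u \<in> carrier P" for r u
 proof -
  obtain b where b: "b \<in> B" "u = pr u \<oplus>\<^bsub>P\<^esub> b" "pr u \<in> A" using pr[OF u] by blast
  then have "b \<in> carrier P" "pr u \<in> carrier P" using AP by blast+
  then have "r \<odot>\<^bsub>P\<^esub> u = r \<odot>\<^bsub>P\<^esub> pr u \<oplus>\<^bsub>P\<^esub> r \<odot>\<^bsub>P\<^esub> b" using P.smult_r_distr[OF r] b(2) by metis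
  then show ?thesis by (rule prI[rotated 2]) (use EA(4) EB(4) b r in auto)
 qed
 have pract: "pr (act P g u) = act P g (pr u)" if g: "g \<in> carrier G" and u: "u \<in> carrier P" for g u
 proof -
  obtain b where b: "b \<in> B" "u = pr u \<oplus>\<^bsub>P\<^esub> b" "pr u \<in> A" using pr[OF u] by blast
  then have "b \<in> carrier P" "pr u \<in> carrier P" using AP by blast+
  then have "act P g u = act P g (pr u) \<oplus>\<^bsub>P\<^esub> act P g b" using lmapD(2)[OF actl[OF g]] b(2) by metis
  then show ?thesis by (rule prI[rotated 2]) (use actA b g in auto)
 qed
 \<comment> \<open>A left inverse of \<open>f\<close>: first project to the summand, then invert the
   isomorphism. The spanning vectors of \<open>M\<close> are the images of the basis under
   it.\<close>
 define q where "q u = inv_into (carrier M) f (pr u)" for u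
 have q: "q u \<in> carrier M" "f (q u) = pr u" if "u \<in> carrier P" for u
  using pr[OF that] bf unfolding q_def bij_betw_def by (auto intro: inv_into_into f_inv_into_f)
 define \<delta> where "\<delta> x = free_basis K x" for x :: nat
 have \<delta>: "\<delta> x \<in> carrier P" if "x \<in> X" for x unfolding \<delta>_def P_def by (rule K.free_basis_perm[OF that])
 have ql: "lmap K P M q" unfolding lmap_def
 proof (intro conjI ballI)
  fix u v assume uv: "u \<in> carrier P" "v \<in> carrier P"
  show "q (u \<oplus>\<^bsub>P\<^esub> v) = q u \<oplus>\<^bsub>M\<^esub> q v"
   by (rule inj) (use uv q fD(2)[OF q(1) q(1) K.one_closed one_closed] pradd in \<open>simp_all del: K.perm_simps\<close>)
 next
  fix r u assume r: "r \<in> carrier K" and u: "u \<in> carrier P"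
  show "q (r \<odot>\<^bsub>P\<^esub> u) = r \<odot>\<^bsub>M\<^esub> q u"
   by (rule inj) (use u r q fD(3)[OF q(1) q(1) r one_closed] prsm in \<open>simp_all del: K.perm_simps\<close>)
 qed (simp add: q)
 define m where "m x = q (\<delta> x)" for x
 define \<phi> where "\<phi> x v = f v x" for x v
 have fP: "f v \<in> carrier P" if "v \<in> carrier M" for v using AP fD(1)[OF that that K.one_closed one_closed] by blast
 have fC: "f v x \<in> carrier K" if "v \<in> carrier M" for v x using fP[OF that] unfolding P_def by simp
 have f0: "f \<zero>\<^bsub>M\<^esub> = \<zero>\<^bsub>P\<^esub>" using fD(2)[of "\<zero>\<^bsub>M\<^esub>" "\<zero>\<^bsub>M\<^esub>" "\<one>\<^bsub>K\<^esub>" \<one>] fP[of "\<zero>\<^bsub>M\<^esub>"] by (simp add: P.M.add.r_cancel_one')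
 have lin: "linf K M (\<phi> x)" for x unfolding linf_def \<phi>_def
  using fC fD(2)[OF _ _ K.one_closed one_closed] fD(3)[OF _ _ _ one_closed] by (auto simp: P_def)
 have recon: "\<Lambda> v = (\<Oplus>\<^bsub>K\<^esub>x\<in>X. \<phi> x v \<otimes>\<^bsub>K\<^esub> \<Lambda> (m x))" if L: "linf K M \<Lambda>" and v: "v \<in> carrier M" for \<Lambda> v
 proof -
  have "q (f v) = v"
   by (rule inj) (use q[OF fP[OF v]] v prA[OF fD(1)[OF v v K.one_closed one_closed]] in auto)
  then have "\<Lambda> v = \<Lambda> (q (f v))" by simp
  also have "... = (\<Oplus>\<^bsub>K\<^esub>x\<in>X. f v x \<otimes>\<^bsub>K\<^esub> \<Lambda> (q (\<delta> x)))"
   unfolding \<delta>_def by (rule K.perm_recon[OF X linf_lmap[OF ql[unfolded P_def] L] fP[OF v, unfolded P_def]])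
  finally show ?thesis by (simp add: \<phi>_def m_def)
 qed
 have sep: "v = \<zero>\<^bsub>M\<^esub>" if v: "v \<in> carrier M" and z: "\<forall>x\<in>X. \<phi> x v = \<zero>\<^bsub>K\<^esub>" for v
 proof (rule inj[OF v M.M.zero_closed])
  show "f v = f \<zero>\<^bsub>M\<^esub>" unfolding f0 using fP[OF v] z unfolding P_def \<phi>_def by (auto simp: fun_eq_iff)
 qed
 have mact: "act M g (m x) = m (\<alpha> g x)" if g: "g \<in> carrier G" and x: "x \<in> X" for g x
 proof -
  have gx: "\<alpha> g x \<in> X" by (rule \<alpha>.element_image[OF g x refl])
  show ?thesis
  proof (rule inj)
   show "act M g (m x) \<in> carrier M" "m (\<alpha> g x) \<in> carrier M"
    unfolding m_def using q(1)[OF \<delta>[OF x]] q(1)[OF \<delta>[OF gx]] M.act_closed[OF g] by auto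
   have "f (act M g (m x)) = act P g (pr (\<delta> x))"
    unfolding m_def using fD(4)[OF q(1) q(1) K.one_closed g, OF \<delta> \<delta>] x q(2)[OF \<delta>[OF x]] by simp
   also have "... = pr (act P g (\<delta> x))" by (simp only: pract[OF g \<delta>[OF x]])
   also have "act P g (\<delta> x) = \<delta> (\<alpha> g x)" unfolding P_def \<delta>_def K.perm_simps(5) by (rule K.free_map_basis)
   finally show "f (act M g (m x)) = f (m (\<alpha> g x))" unfolding m_def q(2)[OF \<delta>[OF gx]] .
  qed
 qed
 have \<phi>act: "\<phi> (\<alpha> g x) (act M g v) = \<phi> x v" if g: "g \<in> carrier G" and x: "x \<in> X" and v: "v \<in> carrier M" for g x v
 proof -
  have "{w. f v w ~= \<zero>\<^bsub>K\<^esub> & \<alpha> g w = \<alpha> g x} = (if f v x = \<zero>\<^bsub>K\<^esub> then {} else {x})"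
   using \<alpha>.inj_prop[OF g] x fP[OF v] unfolding inj_on_def P_def by auto
  then have "free_map K (\<alpha> g) (f v) (\<alpha> g x) = f v x" unfolding free_map_def using fC[OF v] by simp
  then show ?thesis unfolding \<phi>_def using fD(4)[OF v v K.one_closed g] by (simp add: P_def)
 qed
 have "perm_frame K G M X \<alpha> m \<phi>" unfolding perm_frame_def
 proof (intro conjI ballI allI impI)
  show "finite X" by (rule X)
  show "X = {}" if "carrier M = {\<zero>\<^bsub>M\<^esub>}" using that False by simp
  show "v = \<zero>\<^bsub>M\<^esub>" if "v \<in> carrier M" "\<forall>x\<in>X. \<phi> x v = \<zero>\<^bsub>K\<^esub>" for v by (rule sep[OF that])
  show "\<Lambda> v = (\<Oplus>\<^bsub>K\<^esub>x\<in>X. \<phi> x v \<otimes>\<^bsub>K\<^esub> \<Lambda> (m x))" if "linf K M \<Lambda>" "v \<in> carrier M" for \<Lambda> v by (rule recon[OF that])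
  fix x assume x: "x \<in> X"
  show "m x \<in> carrier M" unfolding m_def by (rule q(1)[OF \<delta>[OF x]])
  show "linf K M (\<phi> x)" by (rule lin)
  show "\<alpha> \<one> x = x" using x by (simp add: \<alpha>.id_eq_one[symmetric])
  fix g assume g: "g \<in> carrier G"
  show "\<alpha> g x \<in> X" by (rule \<alpha>.element_image[OF g x refl])
  show "act M g (m x) = m (\<alpha> g x)" by (rule mact[OF g x])
  show "\<alpha> (g \<otimes> h) x = \<alpha> g (\<alpha> h x)" if "h \<in> carrier G" for h by (rule \<alpha>.composition_rule[OF x g that])
  show "\<phi> (\<alpha> g x) (act M g v) = \<phi> x v" if "v \<in> carrier M" for v by (rule \<phi>act[OF g x that])
 qed
 then show ?thesis by blast
qed

section \<open>The framed complex and its endomorphism complex\<close>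

lemma lmap_add:
 assumes N: "Module.module K N" and f: "lmap K M N f" and g: "lmap K M N g"
 shows "lmap K M N (%u. f u \<oplus>\<^bsub>N\<^esub> g u)"
proof -
 interpret N: Module.module K N by (rule N)
 show ?thesis unfolding lmap_def by (auto simp: lmapD[OF f] lmapD[OF g] N.M.a_ac N.smult_r_distr)
qed

lemma lmap_uminus:
 assumes N: "Module.module K N" and f: "lmap K M N f" shows "lmap K M N (%u. \<ominus>\<^bsub>N\<^esub> f u)"
proof -
 interpret N: Module.module K N by (rule N)
 show ?thesis unfolding lmap_def by (auto simp: lmapD[OF f] N.M.minus_add N.smult_r_minus)
qed

lemma lmap_signed:
 assumes "Module.module K N" "lmap K M N f" shows "lmap K M N (%u. signed N i (f u))"
 unfolding signed_def using assms lmap_uminus[OF assms] by (cases "even i") simp_all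

lemma lmap_of_signed:
 assumes "Module.module K M" "Module.module K N" "lmap K M N f" "u \<in> carrier M"
 shows "f (signed M i u) = signed N i (f u)"
 unfolding signed_def by (simp add: lmap_zero[OF assms(1-3)] assms(4))

lemma linf_of_signed:
 assumes "Module.module K M" "linf K M f" "u \<in> carrier M"
 shows "f (signed M i u) = signed K i (f u)" unfolding signed_def using linf_minus[OF assms(1,2,3,3)] by simp

lemma linf_sum:
 assumes K: "cring K" and f: "!!z. z \<in> S ==> linf K M (f z)" and c: "!!z. z \<in> S ==> c z \<in> carrier K"
 shows "linf K M (%u. \<Oplus>\<^bsub>K\<^esub>z\<in>S. f z u \<otimes>\<^bsub>K\<^esub> c z)"
proof -
 interpret cring K by (rule K)
 show ?thesis unfolding linf_def
 proof (intro conjI ballI)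
  fix u assume u: "u \<in> carrier M"
  have fu: "f z u \<in> carrier K" if "z \<in> S" for z by (rule linfD(1)[OF f[OF that] u])
  show "(\<Oplus>\<^bsub>K\<^esub>z\<in>S. f z u \<otimes>\<^bsub>K\<^esub> c z) \<in> carrier K" by (rule finsum_closed) (simp add: fu c Pi_iff)
  show "(\<Oplus>\<^bsub>K\<^esub>z\<in>S. f z (u \<oplus>\<^bsub>M\<^esub> v) \<otimes>\<^bsub>K\<^esub> c z) = (\<Oplus>\<^bsub>K\<^esub>z\<in>S. f z u \<otimes>\<^bsub>K\<^esub> c z) \<oplus>\<^bsub>K\<^esub> (\<Oplus>\<^bsub>K\<^esub>z\<in>S. f z v \<otimes>\<^bsub>K\<^esub> c z)"
   if v: "v \<in> carrier M" for v
  proof -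
   have fv: "f z v \<in> carrier K" if "z \<in> S" for z by (rule linfD(1)[OF f[OF that] v])
   have "(\<Oplus>\<^bsub>K\<^esub>z\<in>S. f z (u \<oplus>\<^bsub>M\<^esub> v) \<otimes>\<^bsub>K\<^esub> c z) = (\<Oplus>\<^bsub>K\<^esub>z\<in>S. f z u \<otimes>\<^bsub>K\<^esub> c z \<oplus>\<^bsub>K\<^esub> f z v \<otimes>\<^bsub>K\<^esub> c z)"
    by (rule finsum_cong') (simp_all add: linfD(2)[OF f u v] l_distr fu fv c Pi_iff)
   then show ?thesis by (simp add: finsum_addf fu fv c Pi_iff)
  qed
  show "(\<Oplus>\<^bsub>K\<^esub>z\<in>S. f z (r \<odot>\<^bsub>M\<^esub> u) \<otimes>\<^bsub>K\<^esub> c z) = r \<otimes>\<^bsub>K\<^esub> (\<Oplus>\<^bsub>K\<^esub>z\<in>S. f z u \<otimes>\<^bsub>K\<^esub> c z)" if r: "r \<in> carrier K" for r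
  proof -
   have "(\<Oplus>\<^bsub>K\<^esub>z\<in>S. f z (r \<odot>\<^bsub>M\<^esub> u) \<otimes>\<^bsub>K\<^esub> c z) = (\<Oplus>\<^bsub>K\<^esub>z\<in>S. r \<otimes>\<^bsub>K\<^esub> (f z u \<otimes>\<^bsub>K\<^esub> c z))"
    by (rule finsum_cong') (simp_all add: linfD(3)[OF f r u] m_assoc fu c r Pi_iff)
   then show ?thesis by (cases "finite S") (simp_all add: finsum_rdistr fu c r Pi_iff)
  qed
 qed
qed

lemma kG_hom_from_lmap:
 assumes "lmap K M N f" "!!g u. g \<in> carrier G ==> u \<in> carrier M ==> f (act M g u) = act N g (f u)"
 shows "f \<in> kG_hom K G M N" by (rule kG_homI) (simp_all add: lmapD[OF assms(1)] assms(2))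

lemma act_lmap:
 assumes "kG_module K G M" "g \<in> carrier G" shows "lmap K M M (act M g)"
proof -
 interpret kG_module K G M by (rule assms)
 show ?thesis unfolding lmap_def using assms(2) by (simp add: act_closed act_add act_smult)
qed

locale pframe = fbase K G p
 for K :: "('k, 'z) ring_scheme" and G :: "('g, 'y) monoid_scheme" (structure) and p :: nat +
 fixes C :: "('k, 'm, 'g) gcomplex" and X :: "int => nat set" and \<alpha> :: "int => 'g => nat => nat"
  and m :: "int => nat => 'm" and \<phi> :: "int => nat => 'm => 'k"
 assumes cx: "kG_complex K G C" and pf: "!!n. perm_frame K G (ob C n) (X n) (\<alpha> n) (m n) (\<phi> n)"
  and fin: "finite {n. carrier (ob C n) ~= {\<zero>\<^bsub>ob C n\<^esub>}}"
begin

text \<open>The successor keeps the index \<open>(0, 0)\<close> free; it serves as the index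
  \<open>pt\<close> of the ground field.\<close>

definition JJ :: "(int \<times> nat) set" where "JJ = Sigma UNIV (%n. Suc ` X n)"
definition tt :: "int \<times> nat => 'm" where "tt z = m (fst z) (snd z - 1)"
definition kk :: "int \<times> nat => 'm => 'k" where "kk z = \<phi> (fst z) (snd z - 1)"
text \<open>Indices outside of \<open>JJ\<close> stay in place, because \<open>isact\<close> asks
  for an action on the whole index type and the index of the ground field has to be fixed.\<close>

definition gg :: "'g => int \<times> nat => int \<times> nat" where
 "gg g z = (if z \<in> JJ then (fst z, Suc (\<alpha> (fst z) g (snd z - 1))) else z)"

lemma kGC: "kG_module K G (ob C n)" using cx unfolding kG_complex_def by blast
lemma modC: "Module.module K (ob C n)" using kGC kG_module.axioms(1) by blast
lemma bdC: "bd C n \<in> kG_hom K G (ob C n) (ob C (n - 1))" using cx unfolding kG_complex_def by blast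
lemma bdbdC: "x \<in> carrier (ob C n) ==> bd C (n - 1) (bd C n x) = \<zero>\<^bsub>ob C (n - 2)\<^esub>"
 using cx unfolding kG_complex_def by blast

lemmas pfD = perm_frameD[OF pf]

lemma JJ_iff: "z \<in> JJ \<longleftrightarrow> snd z ~= 0 & snd z - 1 \<in> X (fst z)" unfolding JJ_def by (cases z; cases "snd z") auto

lemma JJ_fibre: "{z\<in>JJ. fst z = n} = (%x. (n, Suc x)) ` X n" unfolding JJ_def by auto

lemma gg_in: "z \<in> JJ ==> g \<in> carrier G ==> gg g z \<in> JJ" by (simp add: gg_def JJ_iff pfD)

lemma isact_gg: "isact G gg" unfolding isact_def
proof (intro conjI allI ballI)
 fix z show "gg \<one> z = z" by (cases z; cases "snd z") (auto simp: gg_def JJ_iff pfD)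
next
 fix g h z assume g: "g \<in> carrier G" and h: "h \<in> carrier G"
 show "gg (g \<otimes> h) z = gg g (gg h z)"
  using gg_in[OF _ h, of z] g h by (cases "z \<in> JJ") (auto simp: gg_def JJ_iff pfD)
qed

lemma kk_linf: "z \<in> JJ ==> linf K (ob C (fst z)) (kk z)" by (simp add: kk_def JJ_iff pfD)
lemma tt_in: "z \<in> JJ ==> tt z \<in> carrier (ob C (fst z))" by (simp add: tt_def JJ_iff pfD)

sublocale fr: framed K G p "ob C" JJ fst tt kk gg "(0, 0)"
proof (rule framed.intro[OF fbase_axioms], rule framed_axioms.intro)
 show "finite JJ"
 proof (rule finite_subset)
  show "JJ \<subseteq> Sigma {n. carrier (ob C n) ~= {\<zero>\<^bsub>ob C n\<^esub>}} (%n. Suc ` X n)"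
   unfolding JJ_def using pfD(2) by fastforce
  show "finite (Sigma {n. carrier (ob C n) ~= {\<zero>\<^bsub>ob C n\<^esub>}} (%n. Suc ` X n))"
   by (intro finite_SigmaI fin finite_imageI pfD)
 qed
 show "\<Lambda> u = (\<Oplus>\<^bsub>K\<^esub>z\<in>{z\<in>JJ. fst z = n}. kk z u \<otimes>\<^bsub>K\<^esub> \<Lambda> (tt z))"
  if "linf K (ob C n) \<Lambda>" "u \<in> carrier (ob C n)" for n \<Lambda> u
 proof -
  have "(\<Oplus>\<^bsub>K\<^esub>z\<in>{z\<in>JJ. fst z = n}. kk z u \<otimes>\<^bsub>K\<^esub> \<Lambda> (tt z)) = (\<Oplus>\<^bsub>K\<^esub>x\<in>X n. \<phi> n x u \<otimes>\<^bsub>K\<^esub> \<Lambda> (m n x))" unfolding JJ_fibre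
   by (subst K.finsum_reindex)
    (auto simp: kk_def tt_def inj_on_def linfD(1)[OF pfD(4)] linfD(1)[OF that(1)] pfD(3) that(2))
  then show ?thesis using pfD(10)[OF that] by simp
 qed
 show "gg g z \<in> JJ \<longleftrightarrow> z \<in> JJ" if "g \<in> carrier G" for g z using gg_in[OF _ that] by (auto simp: gg_def)
qed (auto simp: modC tt_in kk_linf isact_gg gg_def JJ_iff tt_def kk_def pfD)

section \<open>The tensor product of the dual complex with the complex, and its frame\<close>

definition Nt :: "int => int => ('k, (('m => 'k) \<times> 'm => 'k) set, 'g) gmod" where
 "Nt n i = tensor_module K (dual_module K G (ob C (- i))) (ob C (n - i))"

abbreviation "DC \<equiv> dual_complex K G C"
abbreviation "TC \<equiv> tensor_complex K DC C"
abbreviation "dualC n \<equiv> dual_module K G (ob C n)"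

lemma ob_TC: "ob TC n = direct_sum (Nt n)" by (simp add: tensor_complex_def dual_complex_def Nt_def[abs_def])

lemma modD: "Module.module K (dualC n)" by (rule module_dual[OF modC])
lemma tp: "tensor_pair K (dualC i) (ob C j)" by (intro tensor_pair.intro K.is_field modD modC)
lemma modT: "Module.module K (tensor_module K (dualC i) (ob C j))" by (rule tensor_pair.module_TT[OF tp])
lemma modN: "Module.module K (Nt n i)" unfolding Nt_def by (rule modT)

definition ek :: "int \<times> nat => 'm => 'k" where "ek x = restrict (kk x) (carrier (ob C (fst x)))"

lemma ek_in: "x \<in> JJ ==> ek x \<in> carrier (dualC (fst x))"
 by (simp add: dual_carrier ek_def linf_restrict[OF modC] kk_linf)
lemma ek_val: "u \<in> carrier (ob C (fst x)) ==> ek x u = kk x u" by (simp add: ek_def)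

lemma linf_eval: "u \<in> carrier (ob C n) ==> linf K (dualC n) (%\<psi>. \<psi> u)"
 unfolding linf_def by (auto simp: dual_carrier dual_simps linfD)

lemma kk_closed: "z \<in> JJ ==> fst z = n ==> u \<in> carrier (ob C n) ==> kk z u \<in> carrier K"
 using linfD(1)[OF kk_linf] by blast

text \<open>In the dual module the roles are exchanged: the coordinate functionals
  \<open>ek x\<close> span, and evaluation at \<open>tt x\<close> is the coordinate.\<close>

lemma dual_recon:
 assumes L: "linf K (dualC n) \<Lambda>" and \<psi>: "\<psi> \<in> carrier (dualC n)"
 shows "\<Lambda> \<psi> = (\<Oplus>\<^bsub>K\<^esub>x\<in>{x\<in>JJ. fst x = n}. \<psi> (tt x) \<otimes>\<^bsub>K\<^esub> \<Lambda> (ek x))"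
proof -
 interpret D: Module.module K "dualC n" by (rule modD)
 let ?S = "{x\<in>JJ. fst x = n}"
 define \<psi>' where "\<psi>' = (\<Oplus>\<^bsub>dualC n\<^esub>x\<in>?S. \<psi> (tt x) \<odot>\<^bsub>dualC n\<^esub> ek x)"
 have l\<psi>: "linf K (ob C n) \<psi>" and e\<psi>: "\<psi> \<in> extensional (carrier (ob C n))" using \<psi> by (simp_all add: dual_carrier)
 have c: "\<psi> (tt x) \<in> carrier K" if "x \<in> ?S" for x using linfD(1)[OF l\<psi>] tt_in[of x] that by auto
 have e: "ek x \<in> carrier (dualC n)" if "x \<in> ?S" for x using ek_in[of x] that by auto
 have t: "(%x. \<psi> (tt x) \<odot>\<^bsub>dualC n\<^esub> ek x) \<in> ?S \<rightarrow> carrier (dualC n)"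
  using D.smult_closed[OF c e] by (simp add: Pi_iff)
 have \<psi>': "\<psi>' \<in> carrier (dualC n)" unfolding \<psi>'_def by (rule D.M.finsum_closed[OF t])
 have "\<psi>' = \<psi>"
 proof (rule extensionalityI[OF _ e\<psi>])
  show "\<psi>' \<in> extensional (carrier (ob C n))" using \<psi>' by (simp add: dual_carrier)
  fix u assume u: "u \<in> carrier (ob C n)"
  have "\<psi>' u = (\<Oplus>\<^bsub>K\<^esub>x\<in>?S. (\<psi> (tt x) \<odot>\<^bsub>dualC n\<^esub> ek x) u)"
   unfolding \<psi>'_def by (rule linf_finsum[OF modD linf_eval[OF u] t])
  also have "... = (\<Oplus>\<^bsub>K\<^esub>x\<in>?S. kk x u \<otimes>\<^bsub>K\<^esub> \<psi> (tt x))"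
  proof (rule K.finsum_cong')
   show "(%x. kk x u \<otimes>\<^bsub>K\<^esub> \<psi> (tt x)) \<in> ?S \<rightarrow> carrier K" using c kk_closed u by auto
   show "(\<psi> (tt x) \<odot>\<^bsub>dualC n\<^esub> ek x) u = kk x u \<otimes>\<^bsub>K\<^esub> \<psi> (tt x)" if "x \<in> ?S" for x
    using that c[OF that] kk_closed[of x n u] u ek_val[of u x] by (auto simp: dual_simps K.m_comm)
  qed simp
  also have "... = \<psi> u" using fr.recon[OF l\<psi> u] by simp
  finally show "\<psi>' u = \<psi> u" .
 qed
 then have "\<Lambda> \<psi> = \<Lambda> \<psi>'" by simp
 also have "... = (\<Oplus>\<^bsub>K\<^esub>x\<in>?S. \<Lambda> (\<psi> (tt x) \<odot>\<^bsub>dualC n\<^esub> ek x))" unfolding \<psi>'_def by (rule linf_finsum[OF modD L t])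
 also have "... = (\<Oplus>\<^bsub>K\<^esub>x\<in>?S. \<psi> (tt x) \<otimes>\<^bsub>K\<^esub> \<Lambda> (ek x))"
  by (rule K.finsum_cong') (use c e linfD(3)[OF L] linfD(1)[OF L] in auto)
 finally show ?thesis .
qed

text \<open>The pair of \<open>x\<close> and \<open>y\<close> stands for the tensor of
  \<open>ek x\<close> and \<open>tt y\<close>. The first factor has degree \<open>- fst x\<close> in
  the dual complex, so the tensor lies in the summand \<open>- fst x\<close> of the total degree
  \<open>fst y - fst x\<close>.\<close>

definition t2 :: "(int \<times> nat) \<times> (int \<times> nat) => int => (('m => 'k) \<times> 'm => 'k) set" where
 "t2 z = dsingle (Nt (fst (snd z) - fst (fst z))) (- fst (fst z))
  (tens K (dualC (fst (fst z))) (ob C (fst (snd z))) (ek (fst z)) (tt (snd z)))"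

definition tlf :: "int \<times> nat => int \<times> nat => (('m => 'k) \<times> 'm => 'k) set => 'k" where
 "tlf x y = tlift K (%w. fst w (tt x) \<otimes>\<^bsub>K\<^esub> kk y (snd w))"

definition k2 :: "(int \<times> nat) \<times> (int \<times> nat) => (int => (('m => 'k) \<times> 'm => 'k) set) => 'k" where
 "k2 z u = tlf (fst z) (snd z) (u (- fst (fst z)))"

lemma tlf:
 assumes x: "x \<in> JJ" and y: "y \<in> JJ"
 shows "linf K (tensor_module K (dualC (fst x)) (ob C (fst y))) (tlf x y)"
  "\<psi> \<in> carrier (dualC (fst x)) ==> c \<in> carrier (ob C (fst y)) ==>
   tlf x y (tens K (dualC (fst x)) (ob C (fst y)) \<psi> c) = \<psi> (tt x) \<otimes>\<^bsub>K\<^esub> kk y c"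
proof -
 interpret T: tensor_pair K "dualC (fst x)" "ob C (fst y)" by (rule tp)
 have e: "linf K (dualC (fst x)) (%\<psi>. \<psi> (tt x))" by (rule linf_eval[OF tt_in[OF x]])
 note eD = linfD[OF e] and kD = linfD[OF kk_linf[OF y]]
 let ?B = "%w. fst w (tt x) \<otimes>\<^bsub>K\<^esub> kk y (snd w)"
 have 1: "\<psi> \<in> carrier (dualC (fst x)) ==> c \<in> carrier (ob C (fst y)) ==> ?B (\<psi>, c) \<in> carrier K" for \<psi> c
  using eD(1) kD(1) by simp
 have 2: "linf K (dualC (fst x)) (%\<psi>. ?B (\<psi>, c))" if "c \<in> carrier (ob C (fst y))" for c
  unfolding linf_def using eD kD(1)[OF that] by (simp add: K.l_distr K.m_assoc)
 have 3: "linf K (ob C (fst y)) (%c. ?B (\<psi>, c))" if "\<psi> \<in> carrier (dualC (fst x))" for \<psi>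
  unfolding linf_def using kD eD(1)[OF that] by (simp add: K.r_distr K.m_lcomm)
 show "linf K (tensor_module K (dualC (fst x)) (ob C (fst y))) (tlf x y)"
  unfolding tlf_def by (rule T.tlift(1)[OF 1 2 3])
 show "tlf x y (tens K (dualC (fst x)) (ob C (fst y)) \<psi> c) = \<psi> (tt x) \<otimes>\<^bsub>K\<^esub> kk y c"
  if "\<psi> \<in> carrier (dualC (fst x))" "c \<in> carrier (ob C (fst y))"
  unfolding tlf_def using T.tlift(2)[OF 1 2 3 that] by simp
qed

lemma Nt_eq: "fst y - fst x = n ==> Nt n (- fst x) = tensor_module K (dualC (fst x)) (ob C (fst y))"
 for x y :: "int \<times> nat" unfolding Nt_def by auto

lemma linf_k2:
 assumes "x \<in> JJ" "y \<in> JJ" "fst y - fst x = n" shows "linf K (direct_sum (Nt n)) (k2 (x, y))"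
proof -
 have "linf K (Nt n (- fst x)) (tlf x y)" unfolding Nt_eq[OF assms(3)] by (rule tlf(1)[OF assms(1,2)])
 from linf_lmap[OF lmap_component[of K "Nt n" "- fst x"] this] show ?thesis by (simp add: k2_def[abs_def])
qed

lemma t2_in:
 assumes "x \<in> JJ" "y \<in> JJ" "fst y - fst x = n" shows "t2 (x, y) \<in> carrier (direct_sum (Nt n))"
proof -
 interpret T: tensor_pair K "dualC (fst x)" "ob C (fst y)" by (rule tp)
 have "tens K (dualC (fst x)) (ob C (fst y)) (ek x) (tt y) \<in> carrier (Nt n (- fst x))"
  unfolding Nt_eq[OF assms(3)] by (rule T.tens_in[OF ek_in tt_in]) (use assms in auto)
 from lmapD(1)[OF lmap_dsingle[where K = K and N = "Nt n", OF modN] this] show ?thesis by (simp add: t2_def assms(3))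
qed

lemma tlf_zero: "x \<in> JJ ==> y \<in> JJ ==> fst y - fst x = n ==> tlf x y \<zero>\<^bsub>Nt n (- fst x)\<^esub> = \<zero>\<^bsub>K\<^esub>"
 using linf_zero[OF modT tlf(1)] by (simp add: Nt_eq)

text \<open>Pure tensors in single summands determine a functional, and for them the expansion is
  the product of the expansions of the two factors.\<close>

lemma T_recon:
 assumes L: "linf K (direct_sum (Nt n)) \<Lambda>" and u: "u \<in> carrier (direct_sum (Nt n))"
 shows "\<Lambda> u = (\<Oplus>\<^bsub>K\<^esub>z\<in>{z\<in>JJ \<times> JJ. hom_deg fst fst z = n}. k2 z u \<otimes>\<^bsub>K\<^esub> \<Lambda> (t2 z))"
proof (rule direct_sum_ext[OF modN L _ _ u])
 let ?S = "{z\<in>JJ \<times> JJ. hom_deg fst fst z = n}"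
 have k2l: "linf K (direct_sum (Nt n)) (k2 z)" if "z \<in> ?S" for z
  using linf_k2[of "fst z" "snd z" n] that by (auto simp: hom_deg_def)
 have Lc: "\<Lambda> (t2 z) \<in> carrier K" if "z \<in> ?S" for z
  using t2_in[of "fst z" "snd z" n] that linfD(1)[OF L] by (auto simp: hom_deg_def)
 define R where "R u = (\<Oplus>\<^bsub>K\<^esub>z\<in>?S. k2 z u \<otimes>\<^bsub>K\<^esub> \<Lambda> (t2 z))" for u
 have R: "linf K (direct_sum (Nt n)) R" unfolding R_def by (rule linf_sum[OF K.is_cring k2l Lc])
 then show "linf K (direct_sum (Nt n)) (%u. \<Oplus>\<^bsub>K\<^esub>z\<in>?S. k2 z u \<otimes>\<^bsub>K\<^esub> \<Lambda> (t2 z))" unfolding R_def .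
 fix i a assume a: "a \<in> carrier (Nt n i)"
 interpret T: tensor_pair K "dualC (- i)" "ob C (n - i)" by (rule tp)
 have ds: "lmap K (Nt n i) (direct_sum (Nt n)) (dsingle (Nt n) i)" by (rule lmap_dsingle[OF modN])
 have L1: "linf K T.TT (%a. \<Lambda> (dsingle (Nt n) i a))" using linf_lmap[OF ds L] unfolding Nt_def .
 have R1: "linf K T.TT (%a. R (dsingle (Nt n) i a))" using linf_lmap[OF ds R] unfolding Nt_def .
 have "\<Lambda> (dsingle (Nt n) i a) = R (dsingle (Nt n) i a)"
 proof (rule T.tens_ext_linf[OF L1 R1 _ a[unfolded Nt_def]])
  fix \<psi> c assume \<psi>: "\<psi> \<in> carrier (dualC (- i))" and c: "c \<in> carrier (ob C (n - i))"
  let ?S1 = "{x\<in>JJ. fst x = - i}" and ?S2 = "{y\<in>JJ. fst y = n - i}"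
  let ?t = "%\<psi> c. tens K (dualC (- i)) (ob C (n - i)) \<psi> c"
  let ?L = "%\<psi> c. \<Lambda> (dsingle (Nt n) i (?t \<psi> c))"
  have f: "finite JJ" by (rule fr.fin_J)
  have tin: "?t \<psi> c \<in> carrier (Nt n i)" if "\<psi> \<in> carrier (dualC (- i))" "c \<in> carrier (ob C (n - i))" for \<psi> c
   unfolding Nt_def by (rule T.tens_in[OF that])
  have Lcl: "?L \<psi> c \<in> carrier K" if "\<psi> \<in> carrier (dualC (- i))" "c \<in> carrier (ob C (n - i))" for \<psi> c
   by (rule linfD(1)[OF L lmapD(1)[OF ds tin[OF that]]])
  have ek1: "ek x \<in> carrier (dualC (- i))" "\<psi> (tt x) \<in> carrier K" if "x \<in> ?S1" for x
   using ek_in[of x] tt_in[of x] that \<psi> linfD(1)[of K "ob C (- i)" \<psi>] by (auto simp: dual_carrier)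
  have tt2: "tt y \<in> carrier (ob C (n - i))" "kk y c \<in> carrier K" if "y \<in> ?S2" for y
   using tt_in[of y] kk_closed[of y "n - i" c] that c by auto
  have inner: "?L \<psi>' c = (\<Oplus>\<^bsub>K\<^esub>y\<in>?S2. kk y c \<otimes>\<^bsub>K\<^esub> ?L \<psi>' (tt y))" if "\<psi>' \<in> carrier (dualC (- i))" for \<psi>'
   by (rule fr.recon[OF T.linf_tens(2)[OF L1 that] c])
  have ic: "kk y c \<otimes>\<^bsub>K\<^esub> ?L (ek x) (tt y) \<in> carrier K" if "x \<in> ?S1" "y \<in> ?S2" for x y
   using that by (intro K.m_closed tt2(2) Lcl ek1 tt2(1))
  have "emb K (?L \<psi> c) = emb K (\<Oplus>\<^bsub>K\<^esub>x\<in>?S1. \<psi> (tt x) \<otimes>\<^bsub>K\<^esub> ?L (ek x) c)"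
   using dual_recon[OF T.linf_tens(1)[OF L1 c] \<psi>] by simp
  also have "... = (\<Sum>x\<in>?S1. emb K (\<psi> (tt x)) * emb K (?L (ek x) c))"
   using ek1 Lcl[OF _ c] by (subst K.emb_finsum) (auto simp: K.emb_mult intro!: sum.cong)
  also have "... = (\<Sum>x\<in>?S1. \<Sum>y\<in>?S2. emb K (\<psi> (tt x)) * (emb K (kk y c) * emb K (?L (ek x) (tt y))))"
  proof (rule sum.cong[OF refl])
   fix x assume x: "x \<in> ?S1"
   have "emb K (?L (ek x) c) = (\<Sum>y\<in>?S2. emb K (kk y c \<otimes>\<^bsub>K\<^esub> ?L (ek x) (tt y)))"
    unfolding inner[OF ek1(1)[OF x]] by (rule K.emb_finsum) (use ic[OF x] in blast)
   also have "... = (\<Sum>y\<in>?S2. emb K (kk y c) * emb K (?L (ek x) (tt y)))"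
    by (rule sum.cong[OF refl], rule K.emb_mult[OF tt2(2) Lcl[OF ek1(1)[OF x] tt2(1)]])
   finally show "emb K (\<psi> (tt x)) * emb K (?L (ek x) c)
    = (\<Sum>y\<in>?S2. emb K (\<psi> (tt x)) * (emb K (kk y c) * emb K (?L (ek x) (tt y))))"
    by (simp only: sum_distrib_left)
  qed
  also have "... = (\<Sum>z\<in>?S1 \<times> ?S2. emb K (\<psi> (tt (fst z))) * (emb K (kk (snd z) c) * emb K (?L (ek (fst z)) (tt (snd z)))))"
   by (subst sum.cartesian_product) (simp add: case_prod_beta)
  also have "... = (\<Sum>z\<in>?S1 \<times> ?S2. emb K (k2 z (dsingle (Nt n) i (?t \<psi> c)) \<otimes>\<^bsub>K\<^esub> \<Lambda> (t2 z)))"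
  proof (rule sum.cong[OF refl])
   fix z assume z: "z \<in> ?S1 \<times> ?S2"
   obtain x y where xy: "z = (x, y)" "x \<in> JJ" "y \<in> JJ" "fst x = - i" "fst y = n - i" using z by auto
   have k: "k2 z (dsingle (Nt n) i (?t \<psi> c)) = \<psi> (tt x) \<otimes>\<^bsub>K\<^esub> kk y c"
    using tlf(2)[OF xy(2,3), of \<psi> c] \<psi> c xy by (simp add: k2_def dsingle_def)
   have t: "t2 z = dsingle (Nt n) i (?t (ek x) (tt y))" using xy by (simp add: t2_def)
   have c: "\<psi> (tt x) \<in> carrier K" "kk y c \<in> carrier K" "?L (ek x) (tt y) \<in> carrier K"
    using ek1[of x] tt2[of y] Lcl xy by auto
   show "emb K (\<psi> (tt (fst z))) * (emb K (kk (snd z) c) * emb K (?L (ek (fst z)) (tt (snd z))))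
    = emb K (k2 z (dsingle (Nt n) i (?t \<psi> c)) \<otimes>\<^bsub>K\<^esub> \<Lambda> (t2 z))"
    unfolding k t using c xy(1) by (simp add: K.emb_mult mult.assoc)
  qed
  \<comment> \<open>The pairs of total degree \<open>n\<close> that belong to another summand may be
    added, since \<open>dsingle\<close> has the component zero there.\<close>
  also have "... = (\<Sum>z\<in>?S. emb K (k2 z (dsingle (Nt n) i (?t \<psi> c)) \<otimes>\<^bsub>K\<^esub> \<Lambda> (t2 z)))"
  proof (rule sum.mono_neutral_left)
   show "finite ?S" using f by simp
   show "?S1 \<times> ?S2 \<subseteq> ?S" by (auto simp: hom_deg_def)
   show "\<forall>z\<in>?S - ?S1 \<times> ?S2. emb K (k2 z (dsingle (Nt n) i (?t \<psi> c)) \<otimes>\<^bsub>K\<^esub> \<Lambda> (t2 z)) = 0"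
   proof
    fix z assume z: "z \<in> ?S - ?S1 \<times> ?S2"
    then obtain x y where xy: "z = (x, y)" "x \<in> JJ" "y \<in> JJ" "fst y - fst x = n" by (auto simp: hom_deg_def)
    moreover from this z have "fst x ~= - i" by auto
    ultimately have "k2 z (dsingle (Nt n) i (?t \<psi> c)) = \<zero>\<^bsub>K\<^esub>"
     using tlf_zero[OF xy(2,3,4)] by (auto simp: k2_def dsingle_def)
    then show "emb K (k2 z (dsingle (Nt n) i (?t \<psi> c)) \<otimes>\<^bsub>K\<^esub> \<Lambda> (t2 z)) = 0" using Lc[of z] z by simp
   qed
  qed
  also have "... = emb K (R (dsingle (Nt n) i (?t \<psi> c)))" unfolding R_def
  proof (rule K.emb_finsum[symmetric])
   show "(%z. k2 z (dsingle (Nt n) i (?t \<psi> c)) \<otimes>\<^bsub>K\<^esub> \<Lambda> (t2 z)) \<in> ?S \<rightarrow> carrier K"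
    using Lc linfD(1)[OF k2l lmapD(1)[OF ds tin[OF \<psi> c]]] by (simp only: Pi_iff K.m_closed) blast
  qed
  finally show "?L \<psi> c = R (dsingle (Nt n) i (?t \<psi> c))"
   using Lcl[OF \<psi> c] linfD(1)[OF R lmapD(1)[OF ds tin[OF \<psi> c]]] by (simp add: K.emb_inj)
 qed
 then show "\<Lambda> (dsingle (Nt n) i a) = (\<Oplus>\<^bsub>K\<^esub>z\<in>?S. k2 z (dsingle (Nt n) i a) \<otimes>\<^bsub>K\<^esub> \<Lambda> (t2 z))" unfolding R_def .
qed

end

context p_group_field
begin

text \<open>All matrices involved are invariant under \<open>L\<close>, so the Brauer homomorphism
  preserves each equation of \<open>retracts\<close>.\<close>

lemma retracts_rho:
 assumes ga: "isact G ga" and L: "subgroup L G" and pt: "pt \<in> fixs ga L" and C: "cplx dg eps d"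
  and i: "invt G ga L eps" "invt G ga L d" "invt G ga L s" "invt G ga L v" "invt G ga L w"
  and r: "retracts dg pt eps d h s v w"
 shows "retracts dg pt (rho ga L eps) (rho ga L d) h (rho ga L s) (rho ga L v) (rho ga L w)"
proof -
 note c = C[unfolded cplx_def] and q = r[unfolded retracts_def]
 have u: "rho ga L (upt pt) = upt pt" using pt by (simp add: upt_def)
 have iu: "invt G ga L (upt pt)" using invt_rho[OF ga L, of "upt pt"] by (simp add: u)
 note m = rho_mult[OF ga L, symmetric]
 have "rho ga L (d * s + s * d) = rho ga L (eps - v * w)" using q by simp
 then have "rho ga L d * rho ga L s + rho ga L s * rho ga L d = rho ga L eps - rho ga L v * rho ga L w"
  unfolding restr_add restr_diff using c q i by (simp add: rho_mult[OF ga L])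
 moreover have "rho ga L v * upt pt = rho ga L v" "upt pt * rho ga L w = rho ga L w" "rho ga L w * rho ga L v = upt pt"
  using m[of v "upt pt"] m[of "upt pt" w] m[of w v] i iu q by (simp_all add: u)
 ultimately show ?thesis unfolding retracts_def using c q i by (simp add: cor_restr homg_restr m)
qed

lemma cplx_rho_invt:
 assumes ga: "isact G ga" and L: "subgroup L G" and C: "cplx dg eps d" and i: "invt G ga L eps" "invt G ga L d"
 shows "cplx dg (rho ga L eps) (rho ga L d)"
proof -
 note c = C[unfolded cplx_def] and m = rho_mult[OF ga L, symmetric]
 show ?thesis
  unfolding cplx_def using c homg_restr[of dg 0 eps] homg_restr[of dg "- 1" d] by (simp add: cor_restr m i)
qed

end

lemma (in cring) signed_closed: "a \<in> carrier R ==> signed R i a \<in> carrier R" by (simp add: signed_def)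

lemma (in cring) signed_ring:
 assumes "a \<in> carrier R" "b \<in> carrier R"
 shows "signed R i (a \<oplus> b) = signed R i a \<oplus> signed R i b"
  "signed R i (a \<otimes> b) = a \<otimes> signed R i b" "signed R i (a \<otimes> b) = signed R i a \<otimes> b"
 using assms by (simp_all add: signed_def minus_add r_minus l_minus)

lemma linf_signed:
 assumes K: "cring K" and f: "linf K M f" shows "linf K M (%x. signed K i (f x))"
proof -
 interpret cring K by (rule K)
 show ?thesis unfolding linf_def by (simp add: linfD[OF f] signed_closed signed_ring)
qed

lemma lmap_id: "lmap K M M id" unfolding lmap_def by simp

section \<open>The action of the group on the frame of the tensor product\<close>

context pframe
begin

lemma act_actC:
 assumes "g \<in> carrier G" "u \<in> carrier (ob C n)"
 shows "act (ob C n) g u \<in> carrier (ob C n)" "act (ob C n) g (act (ob C n) (inv g) u) = u"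
  "act (ob C n) (inv g) (act (ob C n) g u) = u"
proof -
 interpret kG_module K G "ob C n" by (rule kGC)
 show "act (ob C n) g u \<in> carrier (ob C n)" using assms by (rule act_closed)
 show "act (ob C n) g (act (ob C n) (inv g) u) = u" "act (ob C n) (inv g) (act (ob C n) g u) = u"
  using assms by (simp_all add: act_mult[symmetric] act_one)
qed

lemma act_dual_lmap:
 assumes g: "g \<in> carrier G" shows "lmap K (dualC n) (dualC n) (act (dualC n) g)"
proof -
 have ig: "inv g \<in> carrier G" using g by simp
 note a = act_actC(1)[OF ig]
 have 1: "act (dualC n) g \<psi> \<in> carrier (dualC n)" if "\<psi> \<in> carrier (dualC n)" for \<psi>
  using linf_lmap[OF act_lmap[OF kGC ig, of n]] that
  by (simp add: dual_carrier dual_simps linf_restrict[OF modC])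
 have 2: "act (dualC n) g (\<psi> \<oplus>\<^bsub>dualC n\<^esub> \<chi>) = act (dualC n) g \<psi> \<oplus>\<^bsub>dualC n\<^esub> act (dualC n) g \<chi>" for \<psi> \<chi>
  by (rule ext) (simp add: dual_simps restrict_def a)
 have 3: "act (dualC n) g (r \<odot>\<^bsub>dualC n\<^esub> \<psi>) = r \<odot>\<^bsub>dualC n\<^esub> act (dualC n) g \<psi>" for r \<psi>
  by (rule ext) (simp add: dual_simps restrict_def a)
 show ?thesis unfolding lmap_def by (simp add: 1 2 3)
qed

lemma act_ek:
 assumes g: "g \<in> carrier G" and x: "x \<in> JJ" shows "act (dualC (fst x)) g (ek x) = ek (gg g x)"
proof -
 have ig: "inv g \<in> carrier G" using g by simp
 have f: "fst (gg g x) = fst x" by (simp add: gg_def)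
 have "kk x (act (ob C (fst x)) (inv g) u) = kk (gg g x) u" if "u \<in> carrier (ob C (fst x))" for u
  using fr.\<kappa>_act[OF g x act_actC(1)[OF ig that]] act_actC(2)[OF g that] by simp
 then show ?thesis by (intro ext) (simp add: dual_simps ek_def f restrict_def act_actC(1)[OF ig])
qed

lemma tensor_act:
 assumes g: "g \<in> carrier G"
 shows "lmap K (tensor_module K (dualC i) (ob C j)) (tensor_module K (dualC i) (ob C j))
   (act (tensor_module K (dualC i) (ob C j)) g)" "\<psi> \<in> carrier (dualC i) ==> c \<in> carrier (ob C j) ==>
   act (tensor_module K (dualC i) (ob C j)) g (tens K (dualC i) (ob C j) \<psi> c)
    = tens K (dualC i) (ob C j) (act (dualC i) g \<psi>) (act (ob C j) g c)" unfolding act_tensor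
 by (rule lmap_tensor[OF tp tp act_dual_lmap[OF g] act_lmap[OF kGC g]]; assumption)+

lemma act_Nt: "g \<in> carrier G ==> lmap K (Nt n i) (Nt n i) (act (Nt n i) g)"
 unfolding Nt_def by (rule tensor_act(1))

lemma act_t2:
 assumes g: "g \<in> carrier G" and x: "x \<in> JJ" and y: "y \<in> JJ"
 shows "act (direct_sum (Nt (fst y - fst x))) g (t2 (x, y)) = t2 (gg g x, gg g y)"
proof
 fix i
 let ?n = "fst y - fst x"
 have f: "fst (gg g z) = fst z" for z by (simp add: gg_def)
 show "act (direct_sum (Nt ?n)) g (t2 (x, y)) i = t2 (gg g x, gg g y) i"
 proof (cases "i = - fst x")
  case True
  have "act (Nt ?n (- fst x)) g (tens K (dualC (fst x)) (ob C (fst y)) (ek x) (tt y))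
   = tens K (dualC (fst x)) (ob C (fst y)) (ek (gg g x)) (tt (gg g y))"
   unfolding Nt_eq[OF refl] tensor_act(2)[OF g ek_in[OF x] tt_in[OF y]] act_ek[OF g x] fr.t_act[OF g y] ..
  then show ?thesis using True by (simp add: t2_def dsingle_def f)
 next
  case False
  then show ?thesis using lmap_zero(1)[OF modN modN act_Nt[OF g]] by (simp add: t2_def dsingle_def f)
 qed
qed

lemma act_k2:
 assumes g: "g \<in> carrier G" and x: "x \<in> JJ" and y: "y \<in> JJ" and n: "fst y - fst x = n"
  and u: "u \<in> carrier (direct_sum (Nt n))"
 shows "k2 (gg g x, gg g y) (act (direct_sum (Nt n)) g u) = k2 (x, y) u"
proof -
 interpret T: tensor_pair K "dualC (fst x)" "ob C (fst y)" by (rule tp)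
 have f: "fst (gg g z) = fst z" for z by (simp add: gg_def)
 have ig: "inv g \<in> carrier G" using g by simp
 note gx = gg_in[OF x g] and gy = gg_in[OF y g]
 have l: "linf K T.TT (%A. tlf (gg g x) (gg g y) (act T.TT g A))"
  by (rule linf_lmap[OF tensor_act(1)[OF g] tlf(1)[OF gx gy, unfolded f]])
 have uc: "u (- fst x) \<in> carrier T.TT" using u by (simp add: Nt_eq[OF n, symmetric])
 have "tlf (gg g x) (gg g y) (act T.TT g (u (- fst x))) = tlf x y (u (- fst x))"
 proof (rule T.tens_ext_linf[OF l tlf(1)[OF x y] _ uc])
  fix \<psi> c assume \<psi>: "\<psi> \<in> carrier (dualC (fst x))" and c: "c \<in> carrier (ob C (fst y))"
  have "act (ob C (fst x)) (inv g) (tt (gg g x)) = tt x"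
   unfolding fr.t_act[OF g x, symmetric] by (rule act_actC(3)[OF g tt_in[OF x]])
  moreover have "tt (gg g x) \<in> carrier (ob C (fst x))" using tt_in[OF gx] by (simp add: f)
  ultimately have "act (dualC (fst x)) g \<psi> (tt (gg g x)) = \<psi> (tt x)" by (simp add: dual_simps)
  then show "tlf (gg g x) (gg g y) (act T.TT g (tens K (dualC (fst x)) (ob C (fst y)) \<psi> c))
   = tlf x y (tens K (dualC (fst x)) (ob C (fst y)) \<psi> c)"
   using tlf(2)[OF gx gy, unfolded f, OF lmapD(1)[OF act_dual_lmap[OF g] \<psi>] act_actC(1)[OF g c]]
    tlf(2)[OF x y \<psi> c] fr.\<kappa>_act[OF g y c] by (simp add: tensor_act(2)[OF g \<psi> c])
 qed
 then show ?thesis by (simp add: k2_def f Nt_eq[OF n])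
qed

sublocale T: framed K G p "ob TC" "JJ \<times> JJ" "hom_deg fst fst" t2 k2 "pact gg" "((0, 0), (0, 0))"
proof (rule framed.intro[OF fbase_axioms], rule framed_axioms.intro, unfold ob_TC)
 have f: "fst (gg g z) = fst z" for g z by (simp add: gg_def)
 show "finite (JJ \<times> JJ)" using fr.fin_J by simp
 show "isact G (pact gg)" by (rule isact_pact[OF isact_gg])
 show "Module.module K (direct_sum (Nt n))" for n by (rule module_direct_sum[OF modN])
 show "\<Lambda> u = (\<Oplus>\<^bsub>K\<^esub>z\<in>{z\<in>JJ \<times> JJ. hom_deg fst fst z = n}. k2 z u \<otimes>\<^bsub>K\<^esub> \<Lambda> (t2 z))"
  if "linf K (direct_sum (Nt n)) \<Lambda>" "u \<in> carrier (direct_sum (Nt n))" for n \<Lambda> u by (rule T_recon[OF that])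
 show "hom_deg fst fst (pact gg g z) = hom_deg fst fst z" for g z by (simp add: hom_deg_def pact_def f)
 show "pact gg g z \<in> JJ \<times> JJ \<longleftrightarrow> z \<in> JJ \<times> JJ" if "g \<in> carrier G" for g z
  using fr.ga_J[OF that] by (cases z) (simp add: pact_def)
 show "((0, 0), (0, 0)) ~: JJ \<times> JJ" by (simp add: JJ_iff)
 show "pact gg g ((0, 0), (0, 0)) = ((0, 0), (0, 0))" for g by (simp add: pact_def gg_def JJ_iff)
 show "hom_deg fst fst ((0, 0 :: nat), (0, 0 :: nat)) = 0" by (simp add: hom_deg_def)
 fix z assume z: "z \<in> JJ \<times> JJ"
 obtain x y where xy: "z = (x, y)" "x \<in> JJ" "y \<in> JJ" using z by auto
 have h: "hom_deg fst fst z = fst y - fst x" by (simp add: xy hom_deg_def)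
 show "t2 z \<in> carrier (direct_sum (Nt (hom_deg fst fst z)))" unfolding h unfolding xy(1) by (rule t2_in[OF xy(2,3) refl])
 show "linf K (direct_sum (Nt (hom_deg fst fst z))) (k2 z)" unfolding h unfolding xy(1) by (rule linf_k2[OF xy(2,3) refl])
 show "act (direct_sum (Nt (hom_deg fst fst z))) g (t2 z) = t2 (pact gg g z)" if "g \<in> carrier G" for g
  unfolding h unfolding xy(1) act_t2[OF that xy(2,3)] by (simp add: pact_def)
 show "k2 (pact gg g z) (act (direct_sum (Nt (hom_deg fst fst z))) g u) = k2 z u"
  if "g \<in> carrier G" "u \<in> carrier (direct_sum (Nt (hom_deg fst fst z)))" for g u
  using act_k2[OF that(1) xy(2,3) h[symmetric] that(2)] by (simp add: xy(1) pact_def)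
qed

section \<open>The differential of the tensor product as a matrix\<close>

lemma ob_DC: "ob DC n = dualC (- n)" by (simp add: dual_complex_def)

lemma bd_DC: "bd DC n \<psi> = (\<lambda>x\<in>carrier (ob C (1 - n)). signed K (n + 1) (\<psi> (bd C (1 - n) x)))"
 by (simp add: dual_complex_def)

lemma bdC': "bd C (1 - n) \<in> kG_hom K G (ob C (1 - n)) (ob C (- n))" using bdC[of "1 - n"] by simp

lemma lmap_bd_DC: "lmap K (dualC (- n)) (dualC (1 - n)) (bd DC n)"
proof -
 note b = kG_homD[OF bdC'[of n]]
 have 1: "bd DC n \<psi> \<in> carrier (dualC (1 - n))" if "\<psi> \<in> carrier (dualC (- n))" for \<psi>
  using linf_signed[OF K.is_cring linf_comp[OF bdC'[of n]]] that
  by (simp add: dual_carrier bd_DC linf_restrict[OF modC])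
 have v: "\<psi> (bd C (1 - n) x) \<in> carrier K" if "\<psi> \<in> carrier (dualC (- n))" "x \<in> carrier (ob C (1 - n))" for \<psi> x
  using linfD(1)[of K "ob C (- n)" \<psi>] that b(1) by (simp add: dual_carrier)
 have 2: "bd DC n (\<psi> \<oplus>\<^bsub>dualC (- n)\<^esub> \<chi>) = bd DC n \<psi> \<oplus>\<^bsub>dualC (1 - n)\<^esub> bd DC n \<chi>"
  if "\<psi> \<in> carrier (dualC (- n))" "\<chi> \<in> carrier (dualC (- n))" for \<psi> \<chi>
  by (rule ext) (simp add: dual_simps bd_DC restrict_def b(1) K.signed_ring v that)
 have 3: "bd DC n (r \<odot>\<^bsub>dualC (- n)\<^esub> \<psi>) = r \<odot>\<^bsub>dualC (1 - n)\<^esub> bd DC n \<psi>"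
  if "\<psi> \<in> carrier (dualC (- n))" "r \<in> carrier K" for r \<psi>
  by (rule ext) (simp add: dual_simps bd_DC restrict_def b(1) K.signed_ring(2) v that)
 show ?thesis unfolding lmap_def by (simp add: 1 2 3)
qed

lemma bd_DC_act:
 assumes g: "g \<in> carrier G"
 shows "bd DC n (act (dualC (- n)) g \<psi>) = act (dualC (1 - n)) g (bd DC n \<psi>)"
proof -
 have ig: "inv g \<in> carrier G" using g by simp
 note b = kG_homD[OF bdC'[of n]]
 show ?thesis by (rule ext) (simp add: dual_simps bd_DC restrict_def b(1) act_actC(1)[OF ig] b(4)[OF ig])
qed

text \<open>The two contributions to the component \<open>i\<close> of the differential:
  \<open>L1\<close> comes from the summand \<open>i + 1\<close> through the differential of the
  dual, and \<open>L2\<close> from the summand \<open>i\<close> through that of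
  \<open>C\<close>.\<close>

definition L1 :: "int => int => (('m => 'k) \<times> 'm => 'k) set => (('m => 'k) \<times> 'm => 'k) set" where
 "L1 n i = tensor_map K (dualC (- i)) (ob C (n - 1 - i)) (bd DC (i + 1)) id"
definition L2 :: "int => int => (('m => 'k) \<times> 'm => 'k) set => (('m => 'k) \<times> 'm => 'k) set" where
 "L2 n i = tensor_map K (dualC (- i)) (ob C (n - 1 - i)) id (bd C (n - i))"

lemma bd_TC: "bd TC n u i = L1 n i (u (i + 1)) \<oplus>\<^bsub>Nt (n - 1) i\<^esub> signed (Nt (n - 1) i) i (L2 n i (u i))"
 by (simp add: tensor_complex_def[of K DC] Let_def Nt_def ob_DC L1_def L2_def)

lemma Nt_Suc: "Nt n (i + 1) = tensor_module K (dualC (- (i + 1))) (ob C (n - 1 - i))"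
proof -
 have e: "n - (i + 1) = n - 1 - i" by simp
 show ?thesis unfolding Nt_def e ..
qed

lemma bd1: "lmap K (dualC (- (i + 1))) (dualC (- i)) (bd DC (i + 1))" using lmap_bd_DC[of "i + 1"] by simp

lemma bd2: "bd C (n - i) \<in> kG_hom K G (ob C (n - i)) (ob C (n - 1 - i))"
proof -
 have e: "n - i - 1 = n - 1 - i" by simp
 show ?thesis using bdC[of "n - i"] unfolding e .
qed

lemma L1: "lmap K (Nt n (i + 1)) (Nt (n - 1) i) (L1 n i)"
 "\<psi> \<in> carrier (dualC (- (i + 1))) ==> c \<in> carrier (ob C (n - 1 - i)) ==>
  L1 n i (tens K (dualC (- (i + 1))) (ob C (n - 1 - i)) \<psi> c)
   = tens K (dualC (- i)) (ob C (n - 1 - i)) (bd DC (i + 1) \<psi>) c"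
 unfolding Nt_Suc L1_def using lmap_tensor[OF tp tp bd1 lmap_id] by (simp_all add: Nt_def)

lemma L2: "lmap K (Nt n i) (Nt (n - 1) i) (L2 n i)"
 "\<psi> \<in> carrier (dualC (- i)) ==> c \<in> carrier (ob C (n - i)) ==> L2 n i (tens K (dualC (- i)) (ob C (n - i)) \<psi> c)
   = tens K (dualC (- i)) (ob C (n - 1 - i)) \<psi> (bd C (n - i) c)"
 unfolding L2_def using lmap_tensor[OF tp tp lmap_id kG_hom_lmap[OF bd2]] by (simp_all add: Nt_def)

lemma L1_act:
 assumes g: "g \<in> carrier G" and A: "A \<in> carrier (Nt n (i + 1))"
 shows "L1 n i (act (Nt n (i + 1)) g A) = act (Nt (n - 1) i) g (L1 n i A)"
proof -
 interpret T: tensor_pair K "dualC (- (i + 1))" "ob C (n - 1 - i)" by (rule tp)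
 have N: "Nt (n - 1) i = tensor_module K (dualC (- i)) (ob C (n - 1 - i))" unfolding Nt_def ..
 have b: "bd DC (i + 1) \<psi> \<in> carrier (dualC (- i))" if "\<psi> \<in> carrier (dualC (- (i + 1)))" for \<psi>
  by (rule lmapD(1)[OF bd1 that])
 have ba: "bd DC (i + 1) (act (dualC (- (i + 1))) g \<psi>) = act (dualC (- i)) g (bd DC (i + 1) \<psi>)" for \<psi>
  using bd_DC_act[OF g, of "i + 1" \<psi>] by simp
 show ?thesis
 proof (rule T.tens_ext[where \<Lambda> = "%A. L1 n i (act (Nt n (i + 1)) g A)"
    and \<Lambda>' = "%A. act (Nt (n - 1) i) g (L1 n i A)", OF modN[of "n - 1" i]])
  show "lmap K T.TT (Nt (n - 1) i) (%A. L1 n i (act (Nt n (i + 1)) g A))"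
   using lmap_comp[OF act_Nt[OF g, of n "i + 1"] L1(1)] unfolding Nt_Suc .
  show "lmap K T.TT (Nt (n - 1) i) (%A. act (Nt (n - 1) i) g (L1 n i A))"
   using lmap_comp[OF L1(1)[of n i] act_Nt[OF g]] unfolding Nt_Suc .
  show "A \<in> carrier T.TT" using A unfolding Nt_Suc .
  fix \<psi> c assume pc: "\<psi> \<in> carrier (dualC (- (i + 1)))" "c \<in> carrier (ob C (n - 1 - i))"
  show "L1 n i (act (Nt n (i + 1)) g (tens K (dualC (- (i + 1))) (ob C (n - 1 - i)) \<psi> c))
   = act (Nt (n - 1) i) g (L1 n i (tens K (dualC (- (i + 1))) (ob C (n - 1 - i)) \<psi> c))"
   unfolding Nt_Suc tensor_act(2)[OF g pc] L1(2)[OF pc]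
    L1(2)[OF lmapD(1)[OF act_dual_lmap[OF g] pc(1)] act_actC(1)[OF g pc(2)]]
    N tensor_act(2)[OF g b[OF pc(1)] pc(2)] ba ..
 qed
qed

lemma L2_act:
 assumes g: "g \<in> carrier G" and A: "A \<in> carrier (Nt n i)"
 shows "L2 n i (act (Nt n i) g A) = act (Nt (n - 1) i) g (L2 n i A)"
proof -
 interpret T: tensor_pair K "dualC (- i)" "ob C (n - i)" by (rule tp)
 have N: "Nt (n - 1) i = tensor_module K (dualC (- i)) (ob C (n - 1 - i))" "Nt n i = T.TT" unfolding Nt_def by simp_all
 note b = kG_homD[OF bd2[of n i]]
 show ?thesis
 proof (rule T.tens_ext[where \<Lambda> = "%A. L2 n i (act (Nt n i) g A)"
    and \<Lambda>' = "%A. act (Nt (n - 1) i) g (L2 n i A)", OF modN[of "n - 1" i]])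
  show "lmap K T.TT (Nt (n - 1) i) (%A. L2 n i (act (Nt n i) g A))"
   using lmap_comp[OF act_Nt[OF g, of n i] L2(1)] unfolding N(2) .
  show "lmap K T.TT (Nt (n - 1) i) (%A. act (Nt (n - 1) i) g (L2 n i A))"
   using lmap_comp[OF L2(1)[of n i] act_Nt[OF g]] unfolding N(2) .
  show "A \<in> carrier T.TT" using A unfolding N(2) .
  fix \<psi> c assume pc: "\<psi> \<in> carrier (dualC (- i))" "c \<in> carrier (ob C (n - i))"
  show "L2 n i (act (Nt n i) g (tens K (dualC (- i)) (ob C (n - i)) \<psi> c))
   = act (Nt (n - 1) i) g (L2 n i (tens K (dualC (- i)) (ob C (n - i)) \<psi> c))"
   unfolding N tensor_act(2)[OF g pc] L2(2)[OF pc]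
    L2(2)[OF lmapD(1)[OF act_dual_lmap[OF g] pc(1)] act_actC(1)[OF g pc(2)]]
    tensor_act(2)[OF g pc(1) b(1)[OF pc(2)]] b(4)[OF g pc(2)] ..
 qed
qed

lemma lmap_bd_TC: "lmap K (direct_sum (Nt n)) (Nt (n - 1) i) (%u. bd TC n u i)"
proof -
 have 1: "lmap K (direct_sum (Nt n)) (Nt (n - 1) i) (%u. L1 n i (u (i + 1)))"
  by (rule lmap_comp[OF lmap_component[of K "Nt n" "i + 1"] L1(1)])
 have 2: "lmap K (direct_sum (Nt n)) (Nt (n - 1) i) (%u. L2 n i (u i))"
  by (rule lmap_comp[OF lmap_component[of K "Nt n" i] L2(1)])
 show ?thesis unfolding bd_TC by (rule lmap_add[OF modN 1 lmap_signed[OF modN 2]])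
qed

lemma hfam_bd_TC: "T.hfam (- 1) (bd TC)" unfolding T.hfam_def ob_TC
proof
 fix n
 note c = lmapD[OF lmap_bd_TC[of n]]
 have fs: "finite {i. bd TC n u i ~= \<zero>\<^bsub>Nt (n - 1) i\<^esub>}" if u: "u \<in> carrier (direct_sum (Nt n))" for u
 proof (rule finite_subset)
  let ?S = "{i. u i ~= \<zero>\<^bsub>Nt n i\<^esub>}"
  show "finite ((%i. i - 1) ` ?S \<union> ?S)" using u by simp
  show "{i. bd TC n u i ~= \<zero>\<^bsub>Nt (n - 1) i\<^esub>} \<subseteq> (%i. i - 1) ` ?S \<union> ?S"
  proof (rule subsetI, rule ccontr)
   fix i assume i: "i \<in> {i. bd TC n u i ~= \<zero>\<^bsub>Nt (n - 1) i\<^esub>}" "i ~: (%i. i - 1) ` ?S \<union> ?S"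
   interpret N: Module.module K "Nt (n - 1) i" by (rule modN)
   have "u (i + 1) = \<zero>\<^bsub>Nt n (i + 1)\<^esub>"
   proof (rule ccontr)
    assume "u (i + 1) ~= \<zero>\<^bsub>Nt n (i + 1)\<^esub>"
    then have "(i + 1) - 1 \<in> (%i. i - 1) ` ?S" by blast
    then show False using i(2) by simp
   qed
   moreover have "u i = \<zero>\<^bsub>Nt n i\<^esub>" using i(2) by blast
   ultimately have "bd TC n u i = \<zero>\<^bsub>Nt (n - 1) i\<^esub>" unfolding bd_TC signed_def
    using lmap_zero(1)[OF modN modN L1(1)[of n i]] lmap_zero(1)[OF modN modN L2(1)[of n i]] by simp
   then show False using i(1) by blast
  qed
 qed
 have l: "lmap K (direct_sum (Nt n)) (direct_sum (Nt (n - 1))) (bd TC n)" unfolding lmap_def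
 proof (intro conjI ballI)
  fix u assume u: "u \<in> carrier (direct_sum (Nt n))"
  show "bd TC n u \<in> carrier (direct_sum (Nt (n - 1)))"
   unfolding direct_sum_simps using c(1)[OF u] fs[OF u] by blast
  show "bd TC n (u \<oplus>\<^bsub>direct_sum (Nt n)\<^esub> v) = bd TC n u \<oplus>\<^bsub>direct_sum (Nt (n - 1))\<^esub> bd TC n v"
   if v: "v \<in> carrier (direct_sum (Nt n))" for v
   unfolding direct_sum_simps(3)[of "Nt (n - 1)"] by (rule ext) (rule c(2)[OF u v])
 next
  fix r u assume r: "r \<in> carrier K" and u: "u \<in> carrier (direct_sum (Nt n))"
  show "bd TC n (r \<odot>\<^bsub>direct_sum (Nt n)\<^esub> u) = r \<odot>\<^bsub>direct_sum (Nt (n - 1))\<^esub> bd TC n u"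
   by (rule ext) (use c(3)[OF r u] in \<open>simp only: direct_sum_simps(4)\<close>)
 qed
 have "bd TC n \<in> kG_hom K G (direct_sum (Nt n)) (direct_sum (Nt (n - 1)))"
 proof (rule kG_hom_from_lmap[OF l])
  fix g u assume g: "g \<in> carrier G" and u: "u \<in> carrier (direct_sum (Nt n))"
  have uc: "u i \<in> carrier (Nt n i)" for i using u by simp
  show "bd TC n (act (direct_sum (Nt n)) g u) = act (direct_sum (Nt (n - 1))) g (bd TC n u)"
  proof
   fix i
   interpret N: Module.module K "Nt (n - 1) i" by (rule modN)
   have 1: "L1 n i (u (i + 1)) \<in> carrier (Nt (n - 1) i)" by (rule lmapD(1)[OF L1(1) uc])
   have 2: "L2 n i (u i) \<in> carrier (Nt (n - 1) i)" by (rule lmapD(1)[OF L2(1) uc])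
   have 3: "signed (Nt (n - 1) i) i (L2 n i (u i)) \<in> carrier (Nt (n - 1) i)"
    using 2 by (simp add: signed_def)
   show "bd TC n (act (direct_sum (Nt n)) g u) i = act (direct_sum (Nt (n - 1))) g (bd TC n u) i"
    unfolding direct_sum_simps(5) bd_TC L1_act[OF g uc] L2_act[OF g uc]
     lmapD(2)[OF act_Nt[OF g] 1 3] lmap_of_signed[OF modN modN act_Nt[OF g] 2] ..
  qed
 qed
 then show "bd TC n \<in> kG_hom K G (direct_sum (Nt n)) (direct_sum (Nt (n + - 1)))" by simp
qed

abbreviation dm :: "(int \<times> nat, ('k, 'z) fam) fmat" where "dm \<equiv> fr.mt (- 1) (bd C)"

lemma hfam_bd: "fr.hfam (- 1) (bd C)" unfolding fr.hfam_def using bdC by simp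

lemma tlf_t2:
 assumes "x \<in> JJ" "y \<in> JJ" "x' \<in> JJ" "y' \<in> JJ" "fst x = fst x'" "fst y = fst y'"
 shows "tlf x y (tens K (dualC (fst x')) (ob C (fst y')) (ek x') (tt y')) = kk x' (tt x) \<otimes>\<^bsub>K\<^esub> kk y (tt y')"
 using tlf(2)[OF assms(1,2), of "ek x'" "tt y'"] ek_in[OF assms(3)] tt_in[OF assms(4)] tt_in[OF assms(1)] assms
 by (simp add: ek_val)

text \<open>The coordinate of a spanning tensor is a product of two coordinates. That of
  \<open>ek x'\<close> at \<open>x\<close> is its value at \<open>tt x\<close>, which accounts for
  the transpose in \<open>hom_eps\<close>.\<close>

lemma T_idm: "T.idm = hom_eps fr.idm fr.idm"
proof (rule fmat_eqI)
 fix z w :: "(int \<times> nat) \<times> (int \<times> nat)"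
 obtain x y x' y' where zw: "z = (x, y)" "w = (x', y')" by (cases z, cases w) auto
 have c: "kk x' (tt x) \<in> carrier K" if "x \<in> JJ" "x' \<in> JJ" "fst x = fst x'" for x x'
  using kk_closed[OF that(2)] tt_in[OF that(1)] that(3) by simp
 show "ent T.idm z w = ent (hom_eps fr.idm fr.idm) z w"
 proof (cases "x \<in> JJ & y \<in> JJ & x' \<in> JJ & y' \<in> JJ & fst y - fst x = fst y' - fst x'")
  case True
  then show ?thesis using tlf_t2[of x y x' y'] tlf_zero[of x y] c[of x x'] c[of y' y]
   by (auto simp: zw T.ent_mt hom_eps_def ent_kron fr.ent_mt hom_deg_def k2_def t2_def dsingle_def K.emb_mult)
 next
  case False
  then show ?thesis by (auto simp: zw T.ent_mt hom_eps_def ent_kron fr.ent_mt hom_deg_def)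
 qed
qed

lemma k2_bd:
 assumes x: "x \<in> JJ" and y: "y \<in> JJ" and n: "fst y - fst x = n - 1" and v: "v \<in> carrier (direct_sum (Nt n))"
 shows "k2 (x, y) (bd TC n v) = tlf x y (L1 n (- fst x) (v (- fst x + 1)))
  \<oplus>\<^bsub>K\<^esub> signed K (fst x) (tlf x y (L2 n (- fst x) (v (- fst x))))"
proof -
 have l: "linf K (Nt (n - 1) (- fst x)) (tlf x y)" using tlf(1)[OF x y] by (simp add: Nt_eq[OF n])
 interpret N: Module.module K "Nt (n - 1) (- fst x)" by (rule modN)
 have vc: "v i \<in> carrier (Nt n i)" for i using v by simp
 have 1: "L1 n (- fst x) (v (- fst x + 1)) \<in> carrier (Nt (n - 1) (- fst x))" by (rule lmapD(1)[OF L1(1) vc])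
 have 2: "L2 n (- fst x) (v (- fst x)) \<in> carrier (Nt (n - 1) (- fst x))" by (rule lmapD(1)[OF L2(1) vc])
 have 3: "signed (Nt (n - 1) (- fst x)) (- fst x) (L2 n (- fst x) (v (- fst x))) \<in> carrier (Nt (n - 1) (- fst x))"
  using 2 by (simp add: signed_def)
 have "k2 (x, y) (bd TC n v) = tlf x y (L1 n (- fst x) (v (- fst x + 1)))
  \<oplus>\<^bsub>K\<^esub> signed K (- fst x) (tlf x y (L2 n (- fst x) (v (- fst x))))"
  unfolding k2_def fst_conv snd_conv bd_TC linfD(2)[OF l 1 3] linf_of_signed[OF modN l 2] ..
 then show ?thesis by (simp add: signed_def)
qed

text \<open>Here the sign conventions meet: the sign of the dual differential and the sign in front
  of the second term of the tensor differential become the two sign operators of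
  \<open>hom_d\<close>. The first term needs \<open>fst x = fst x' + 1\<close>, the second one
  \<open>fst x = fst x'\<close>, so at most one is present in an entry.\<close>

lemma T_dm: "T.mt (- 1) (bd TC) = hom_d fst fr.idm dm fr.idm dm"
proof (rule fmat_eqI)
 fix z w :: "(int \<times> nat) \<times> (int \<times> nat)"
 obtain x y x' y' where zw: "z = (x, y)" "w = (x', y')" by (cases z, cases w) auto
 show "ent (T.mt (- 1) (bd TC)) z w = ent (hom_d fst fr.idm dm fr.idm dm) z w"
 proof (cases "x \<in> JJ & y \<in> JJ & x' \<in> JJ & y' \<in> JJ & fst y - fst x = fst y' - fst x' - 1")
  case True
  then have x: "x \<in> JJ" "x' \<in> JJ" and y: "y \<in> JJ" "y' \<in> JJ" by auto
  define n where "n = fst y' - fst x'"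
  have n: "fst y - fst x = n - 1" "fst y' - fst x' = n" using True by (auto simp: n_def)
  have v: "t2 (x', y') \<in> carrier (direct_sum (Nt n))" by (rule t2_in[OF x(2) y(2) n(2)])
  have t2v: "t2 (x', y') i = (if i = - fst x'
    then tens K (dualC (fst x')) (ob C (fst y')) (ek x') (tt y') else \<zero>\<^bsub>Nt n i\<^esub>)" for i
   unfolding t2_def dsingle_def by (simp add: n(2))
  have tz: "tlf x y \<zero>\<^bsub>Nt (n - 1) (- fst x)\<^esub> = \<zero>\<^bsub>K\<^esub>" by (rule tlf_zero[OF x(1) y(1) n(1)])
  have e1: "tlf x y (L1 n (- fst x) (t2 (x', y') (- fst x + 1))) = (if fst x = fst x' + 1
   then signed K (fst x) (kk x' (bd C (fst x) (tt x))) \<otimes>\<^bsub>K\<^esub> kk y (tt y') else \<zero>\<^bsub>K\<^esub>)"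
  proof (cases "fst x = fst x' + 1")
   case True
   then have e: "- (- fst x + 1) = fst x'" "n - 1 - (- fst x) = fst y'" "fst y = fst y'" "- (- fst x) = fst x"
    using n by auto
   have b: "bd DC (- fst x + 1) (ek x') \<in> carrier (dualC (fst x))"
    using lmapD(1)[OF bd1[of "- fst x", unfolded e] ek_in[OF x(2)]] .
   have "L1 n (- fst x) (t2 (x', y') (- fst x + 1))
    = tens K (dualC (fst x)) (ob C (fst y)) (bd DC (- fst x + 1) (ek x')) (tt y')"
   proof -
    have "t2 (x', y') (- fst x + 1) = tens K (dualC (fst x')) (ob C (fst y')) (ek x') (tt y')"
     using True by (simp add: t2v)
    then show ?thesis unfolding e(3)
     using L1(2)[of "ek x'" "- fst x" "tt y'" n, unfolded e, OF ek_in[OF x(2)] tt_in[OF y(2)]] by metis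
   qed
   moreover have "tlf x y (tens K (dualC (fst x)) (ob C (fst y)) (bd DC (- fst x + 1) (ek x')) (tt y'))
    = bd DC (- fst x + 1) (ek x') (tt x) \<otimes>\<^bsub>K\<^esub> kk y (tt y')"
    using tlf(2)[OF x(1) y(1) b] tt_in[OF y(2)] e(3) by simp
   \<comment> \<open>The dual differential carries the sign of \<open>n + 1\<close>, which is
     \<open>2 - fst x\<close> here and has the parity of \<open>fst x\<close>.\<close>
   moreover have "bd DC (- fst x + 1) (ek x') (tt x) = signed K (fst x) (kk x' (bd C (fst x) (tt x)))"
   proof -
    have e5: "1 - (- fst x + 1) = fst x" by simp
    have "bd C (fst x) (tt x) \<in> carrier (ob C (fst x'))"
     using kG_homD(1)[OF bdC[of "fst x"] tt_in[OF x(1)]] True by simp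
    then show ?thesis unfolding bd_DC e5 using tt_in[OF x(1)] by (simp add: ek_val signed_def)
   qed
   ultimately show ?thesis using True by simp
  next
   case False
   then have "t2 (x', y') (- fst x + 1) = \<zero>\<^bsub>Nt n (- fst x + 1)\<^esub>" by (simp add: t2v)
   then show ?thesis using False tz lmap_zero(1)[OF modN modN L1(1)[of n "- fst x"]] by simp
  qed
  have e2: "tlf x y (L2 n (- fst x) (t2 (x', y') (- fst x))) = (if fst x = fst x'
   then kk x' (tt x) \<otimes>\<^bsub>K\<^esub> kk y (bd C (fst y') (tt y')) else \<zero>\<^bsub>K\<^esub>)"
  proof (cases "fst x = fst x'")
   case True
   then have e: "- (- fst x) = fst x" "n - (- fst x) = fst y'" "n - 1 - (- fst x) = fst y" "fst y = fst y' - 1"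
    using n by auto
   have b: "bd C (fst y') (tt y') \<in> carrier (ob C (fst y))"
    using kG_homD(1)[OF bdC tt_in[OF y(2)]] e(4) by simp
   have "L2 n (- fst x) (t2 (x', y') (- fst x))
    = tens K (dualC (fst x)) (ob C (fst y)) (ek x') (bd C (fst y') (tt y'))"
   proof -
    have "ek x' \<in> carrier (dualC (fst x))" using ek_in[OF x(2)] True by simp
    note L = L2(2)[of "ek x'" "- fst x" "tt y'" n, unfolded e(1-3), OF this tt_in[OF y(2)]]
    have "t2 (x', y') (- fst x) = tens K (dualC (fst x)) (ob C (fst y')) (ek x') (tt y')"
     using True by (simp add: t2v)
    then show ?thesis using L by metis
   qed
   moreover have "tlf x y (tens K (dualC (fst x)) (ob C (fst y)) (ek x') (bd C (fst y') (tt y')))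
    = ek x' (tt x) \<otimes>\<^bsub>K\<^esub> kk y (bd C (fst y') (tt y'))"
    using tlf(2)[OF x(1) y(1) _ b] ek_in[OF x(2)] True by simp
   ultimately show ?thesis using True tt_in[OF x(1)] by (simp add: ek_val)
  next
   case False
   then have "t2 (x', y') (- fst x) = \<zero>\<^bsub>Nt n (- fst x)\<^esub>" by (simp add: t2v)
   then show ?thesis using False tz lmap_zero(1)[OF modN modN L2(1)[of n "- fst x"]] by simp
  qed
  have c: "kk x' (bd C (fst x) (tt x)) \<in> carrier K" "kk y (tt y') \<in> carrier K" if "fst x = fst x' + 1"
   using that n kk_closed[OF x(2)] kk_closed[OF y(1)] tt_in[OF y(2)] kG_homD(1)[OF bdC tt_in[OF x(1)]]
   by auto
  have c': "kk x' (tt x) \<in> carrier K" "kk y (bd C (fst y') (tt y')) \<in> carrier K" if "fst x = fst x'"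
  proof -
   have "fst y = fst y' - 1" using that n by auto
   then show "kk x' (tt x) \<in> carrier K" "kk y (bd C (fst y') (tt y')) \<in> carrier K"
    using that kk_closed[OF x(2)] kk_closed[OF y(1)] tt_in[OF x(1)] kG_homD(1)[OF bdC tt_in[OF y(2)]]
    by auto
  qed
  have "ent (T.mt (- 1) (bd TC)) z w = emb K (k2 (x, y) (bd TC n (t2 (x', y'))))"
   using True by (simp add: zw T.ent_mt hom_deg_def n_def)
  also have "... = ent (hom_d fst fr.idm dm fr.idm dm) z w"
  proof -
   have h: "ent (hom_d fst fr.idm dm fr.idm dm) z w =
     - (if even (fst x') then ent dm x' x else - ent dm x' x) * ent fr.idm y y'
     + (if even (fst x') then ent fr.idm x' x else - ent fr.idm x' x) * ent dm y y'"
    by (simp add: zw hom_d_def ent_kron ent_sg)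
   consider "fst x = fst x' + 1" | "fst x = fst x'" | "fst x ~= fst x' + 1" "fst x ~= fst x'" by blast
   then show ?thesis
   proof cases
    case 1
    define a b where "a = kk x' (bd C (fst x) (tt x))" and "b = kk y (tt y')"
    have ab: "a \<in> carrier K" "b \<in> carrier K" using c[OF 1] by (simp_all add: a_def b_def)
    have "ent dm x' x = emb K a" "ent fr.idm y y' = emb K b" "ent fr.idm x' x = 0"
     using x y n 1 by (simp_all add: fr.ent_mt a_def b_def)
    moreover have "even (fst x) \<longleftrightarrow> odd (fst x')" "fst x ~= fst x'" using 1 by simp_all
    ultimately show ?thesis unfolding h k2_bd[OF x(1) y(1) n(1) v] e1 e2 a_def[symmetric] b_def[symmetric]
     using ab 1 by (auto simp: signed_def K.emb_mult K.emb_uminus)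
   next
    case 2
    define a b where "a = kk x' (tt x)" and "b = kk y (bd C (fst y') (tt y'))"
    have ab: "a \<in> carrier K" "b \<in> carrier K" using c'[OF 2] by (simp_all add: a_def b_def)
    have "ent fr.idm x' x = emb K a" "ent dm y y' = emb K b" "ent dm x' x = 0"
     using x y n 2 by (simp_all add: fr.ent_mt a_def b_def)
    moreover have "fst x ~= fst x' + 1" using 2 by simp
    ultimately show ?thesis unfolding h k2_bd[OF x(1) y(1) n(1) v] e1 e2 a_def[symmetric] b_def[symmetric]
     using ab 2 by (auto simp: signed_def K.emb_mult K.emb_uminus)
   next
    case 3
    then have "ent dm x' x = 0" "ent fr.idm x' x = 0" by (simp_all add: fr.ent_mt)
    then show ?thesis unfolding h k2_bd[OF x(1) y(1) n(1) v] e1 e2 using 3 by (simp add: signed_def)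
   qed
  qed
  finally show ?thesis .
 next
  case False
  then show ?thesis by (auto simp: zw T.ent_mt hom_d_def ent_kron fr.ent_mt ent_sg hom_deg_def)
 qed
qed

lemma cplxC: "cplx fst fr.idm dm" by (rule fr.cplx_mt[OF hfam_bd bdbdC])

lemma pt_fixs_gg: "(0, 0) \<in> fixs gg L" by (simp add: fixs_def gg_def JJ_iff)

lemma invt_idm: "subgroup L G ==> invt G gg L fr.idm"
 by (rule invt_mono[OF fr.invt_mt[OF fr.hfam_id] subgroup.subset])
lemma invt_dm: "subgroup L G ==> invt G gg L dm" by (rule invt_mono[OF fr.invt_mt[OF hfam_bd] subgroup.subset])

text \<open>The equivalence yields invariant matrices, which can be restricted to the indices fixed
  by \<open>L\<close>. What is left is a complex over the field whose endomorphism complex is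
  one-dimensional up to homotopy, and \<open>sphere_if_sphere_hom\<close> applies to it.\<close>

lemma endotrivial_sphere:
 assumes E: "homotopy_equivalent K G TC (unit_complex K)" and L: "subgroup L G"
 shows "\<exists>i. sphere fst (0, 0) (rho gg L fr.idm) (rho gg L dm) i"
proof -
 let ?U = "unit_complex K :: ('k, 'k, 'g) gcomplex"
 have U: "ob ?U 0 = trivial_module K" "n ~= 0 ==> carrier (ob ?U n) = {\<zero>\<^bsub>K\<^esub>}" "bd ?U n x = \<zero>\<^bsub>K\<^esub>"
  "\<zero>\<^bsub>ob ?U n\<^esub> = \<zero>\<^bsub>K\<^esub>" for n x by (simp_all add: unit_complex_def trivial_module_def)
 have modU: "Module.module K (ob ?U n)" for n
 proof (cases "n = 0")
  case False
  then show ?thesis unfolding unit_complex_def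
   by (intro Module.moduleI abelian_groupI K.is_cring) (auto simp: trivial_module_def)
 qed (simp add: U module_trivial K.is_cring)
 have t: "carrier (trivial_module K :: ('k, 'k, 'g) gmod) = carrier K" "act (trivial_module K :: ('k, 'k, 'g) gmod) a u = u"
  "r \<odot>\<^bsub>trivial_module K :: ('k, 'k, 'g) gmod\<^esub> u = r \<otimes>\<^bsub>K\<^esub> u" "u \<oplus>\<^bsub>trivial_module K :: ('k, 'k, 'g) gmod\<^esub> v = u \<oplus>\<^bsub>K\<^esub> v"
  "\<zero>\<^bsub>trivial_module K :: ('k, 'k, 'g) gmod\<^esub> = \<zero>\<^bsub>K\<^esub>" for a u r v by (simp_all add: trivial_module_def)
 obtain f g where f: "chain_map K G TC ?U f" and g: "chain_map K G ?U TC g"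
  and h1: "homotopic K G TC TC (%n. g n \<circ> f n) (%n. id)" and h2: "homotopic K G ?U ?U (%n. f n \<circ> g n) (%n. id)"
  using E unfolding homotopy_equivalent_def by blast
 obtain S where S: "!!n. S n \<in> kG_hom K G (ob TC n) (ob TC (n + 1))" and hS: "!!n u. u \<in> carrier (ob TC n) ==>
   (g n \<circ> f n) u \<ominus>\<^bsub>ob TC n\<^esub> id u = bd TC (n + 1) (S n u) \<oplus>\<^bsub>ob TC n\<^esub> S (n - 1) (bd TC n u)"
  using h1 unfolding homotopic_def by blast
 obtain S' where S': "!!n. S' n \<in> kG_hom K G (ob ?U n) (ob ?U (n + 1))"
  and hS': "!!n u. u \<in> carrier (ob ?U n) ==>
   (f n \<circ> g n) u \<ominus>\<^bsub>ob ?U n\<^esub> id u = bd ?U (n + 1) (S' n u) \<oplus>\<^bsub>ob ?U n\<^esub> S' (n - 1) (bd ?U n u)"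
  using h2 unfolding homotopic_def by blast
 have fh: "f n \<in> kG_hom K G (ob TC n) (ob ?U n)" and gh: "g n \<in> kG_hom K G (ob ?U n) (ob TC n)" for n
  using f g unfolding chain_map_def by blast+
 have fbd: "u \<in> carrier (ob TC n) ==> f (n - 1) (bd TC n u) = bd ?U n (f n u)"
  and gbd: "v \<in> carrier (ob ?U n) ==> g (n - 1) (bd ?U n v) = bd TC n (g n v)" for n u v
  using f g unfolding chain_map_def by blast+
 have g0: "g n \<zero>\<^bsub>K\<^esub> = \<zero>\<^bsub>ob TC n\<^esub>" for n
  using lmap_zero(1)[OF modU T.obmod kG_hom_lmap[OF gh], of n] by (simp only: U(4))
 have s0: "S' n \<zero>\<^bsub>K\<^esub> = \<zero>\<^bsub>K\<^esub>" for n using lmap_zero(1)[OF modU modU kG_hom_lmap[OF S'], of n] by (simp only: U(4))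
 note fD = kG_homD[OF fh[of 0], unfolded U(1) t] and gD = kG_homD[OF gh[of 0], unfolded U(1) t]
 \<comment> \<open>A map from the unit is determined by the image of 1, which is a fixed cycle; a
   map to the unit is an invariant functional.\<close>
 define \<eta> where "\<eta> = g 0 \<one>\<^bsub>K\<^esub>"
 have \<eta>: "\<eta> \<in> carrier (ob TC 0)" unfolding \<eta>_def by (rule gD(1)[OF K.one_closed])
 have fl: "linf K (ob TC 0) (f 0)" unfolding linf_def using fD by blast
 have \<eta>a: "act (ob TC 0) a \<eta> = \<eta>" if "a \<in> carrier G" for a
  unfolding \<eta>_def by (rule gD(4)[OF that K.one_closed, symmetric])
 have \<eta>b: "bd TC 0 \<eta> = \<zero>\<^bsub>ob TC (- 1)\<^esub>" using gbd[of "\<one>\<^bsub>K\<^esub>" 0] g0[of "- 1"] by (simp add: U(1) t \<eta>_def U(3))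
 \<comment> \<open>The unit complex is concentrated in degree 0, so a homotopy on it vanishes, and
   the composite on the unit is the identity on the nose.\<close>
 have f\<eta>: "f 0 \<eta> = \<one>\<^bsub>K\<^esub>"
 proof -
  interpret U0: Module.module K "trivial_module K :: ('k, 'k, 'g) gmod" by (rule module_trivial[OF K.is_cring])
  have c: "f 0 \<eta> \<in> carrier K" by (rule fD(1)[OF \<eta>])
  have "f 0 \<eta> \<ominus>\<^bsub>trivial_module K :: ('k, 'k, 'g) gmod\<^esub> \<one>\<^bsub>K\<^esub> = \<zero>\<^bsub>K\<^esub>"
   using hS'[of "\<one>\<^bsub>K\<^esub>" 0] by (simp add: U(1) U(3) t s0 \<eta>_def)
  moreover have "f 0 \<eta> = (f 0 \<eta> \<ominus>\<^bsub>trivial_module K :: ('k, 'k, 'g) gmod\<^esub> \<one>\<^bsub>K\<^esub>) \<oplus>\<^bsub>trivial_module K :: ('k, 'k, 'g) gmod\<^esub> \<one>\<^bsub>K\<^esub>"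
   using c U0.M.a_assoc[of "f 0 \<eta>" "\<ominus>\<^bsub>trivial_module K :: ('k, 'k, 'g) gmod\<^esub> \<one>\<^bsub>K\<^esub>" "\<one>\<^bsub>K\<^esub>"] U0.M.l_neg[of "\<one>\<^bsub>K\<^esub>"]
    U0.M.a_inv_closed[of "\<one>\<^bsub>K\<^esub>"] by (simp add: a_minus_def t)
  ultimately show ?thesis by (simp add: t)
 qed
 have hty: "(if n = 0 then f 0 u \<odot>\<^bsub>ob TC 0\<^esub> \<eta> else \<zero>\<^bsub>ob TC n\<^esub>) \<ominus>\<^bsub>ob TC n\<^esub> u
   = bd TC (n + 1) (S n u) \<oplus>\<^bsub>ob TC n\<^esub> S (n - 1) (bd TC n u)" if u: "u \<in> carrier (ob TC n)" for n u
 proof -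
  have "g n (f n u) = (if n = 0 then f 0 u \<odot>\<^bsub>ob TC 0\<^esub> \<eta> else \<zero>\<^bsub>ob TC n\<^esub>)"
  proof (cases "n = 0")
   case True
   then show ?thesis using gD(3)[OF fD(1) K.one_closed, of u] fD(1)[of u] u by (simp add: \<eta>_def)
  next
   case False
   then show ?thesis using kG_homD(1)[OF fh u] U(2)[OF False] g0[of n] by simp
  qed
  then show ?thesis using hS[OF u] by simp
 qed
 have fbd0: "f 0 (bd TC 1 u) = \<zero>\<^bsub>K\<^esub>" if "u \<in> carrier (ob TC 1)" for u using fbd[OF that] by (simp add: U(3))
 have fa: "f 0 (act (ob TC 0) a u) = f 0 u" if "a \<in> carrier G" "u \<in> carrier (ob TC 0)" for a u
  by (rule fD(4)[OF that])
 have "T.hfam 1 S" unfolding T.hfam_def using S by blast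
 from T.retracts_mt[OF hfam_bd_TC this fl fa fbd0 \<eta> \<eta>a \<eta>b f\<eta> hty]
 obtain s v w where r: "retracts (hom_deg fst fst) ((0, 0), (0, 0)) T.idm (T.mt (- 1) (bd TC)) 0 s v w"
  and i: "invt G (pact gg) (carrier G) s" "invt G (pact gg) (carrier G) v" "invt G (pact gg) (carrier G) w"
  by blast
 note sub = invt_mono[OF _ subgroup.subset[OF L]]
 have ci: "invt G (pact gg) L T.idm" "invt G (pact gg) L (T.mt (- 1) (bd TC))"
  by (rule sub[OF T.invt_mt[OF T.hfam_id]], rule sub[OF T.invt_mt[OF hfam_bd_TC]])
 have pt2: "((0, 0), (0, 0)) \<in> fixs (pact gg) L" by (simp add: fixs_pact pt_fixs_gg)
 have cT: "cplx (hom_deg fst fst) T.idm (T.mt (- 1) (bd TC))"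
  unfolding T_idm T_dm by (rule cplx_hom[OF cplxC cplxC])
 note r' = retracts_rho[OF T.ga L pt2 cT ci sub[OF i(1)] sub[OF i(2)] sub[OF i(3)] r]
 have e: "rho (pact gg) L T.idm = hom_eps (rho gg L fr.idm) (rho gg L fr.idm)"
  unfolding T_idm hom_eps_def fixs_pact by (simp add: restr_kron restr_tpose)
 have d: "rho (pact gg) L (T.mt (- 1) (bd TC)) = hom_d fst (rho gg L fr.idm) (rho gg L dm) (rho gg L fr.idm) (rho gg L dm)"
  unfolding T_dm hom_d_def fixs_pact by (simp add: restr_kron restr_tpose restr_add restr_uminus restr_sg)
 have "sphere (hom_deg fst fst) ((0, 0), (0, 0)) (hom_eps (rho gg L fr.idm) (rho gg L fr.idm))
  (hom_d fst (rho gg L fr.idm) (rho gg L dm) (rho gg L fr.idm) (rho gg L dm)) 0"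
  using r' unfolding sphere_def e d by blast
 then show ?thesis
  by (intro sphere_if_sphere_hom[OF cplx_rho_invt[OF isact_gg L cplxC invt_idm[OF L] invt_dm[OF L]]]) simp_all
qed

end

section \<open>Homology by elements\<close>

lemma coset_carrier_update [simp]: "N +>\<^bsub>M\<lparr>carrier := A\<rparr>\<^esub> x = N +>\<^bsub>M\<^esub> x" by (simp add: a_r_coset_def')

lemma lmap_finsum:
 assumes M: "Module.module K M" and N: "Module.module K N" and l: "lmap K M N F" and f: "f \<in> A \<rightarrow> carrier M"
 shows "F (finsum M f A) = (\<Oplus>\<^bsub>N\<^esub>x\<in>A. F (f x))"
proof -
 interpret M: Module.module K M by (rule M)
 interpret N: Module.module K N by (rule N)
 show ?thesis using f
 proof (induction A rule: infinite_finite_induct)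
  case (insert x A)
  then show ?case using lmapD[OF l] by (simp add: Pi_iff)
 qed (simp_all add: lmap_zero[OF M N l])
qed

text \<open>Stated with a sum instead of a difference: negation depends on the carrier of a record
  and addition does not, and the lemma is applied to modules whose carrier was reduced to cycles or
  to fixed points.\<close>

lemma (in gmodule) coset_eq_iff_add:
 assumes N: "submodule N K M" and x: "x \<in> carrier M" and y: "y \<in> carrier M"
 shows "N +>\<^bsub>M\<^esub> x = N +>\<^bsub>M\<^esub> y \<longleftrightarrow> (\<exists>n\<in>N. x = n \<oplus>\<^bsub>M\<^esub> y)"
proof
 assume "N +>\<^bsub>M\<^esub> x = N +>\<^bsub>M\<^esub> y"
 then have "x \<in> N +>\<^bsub>M\<^esub> y" using coset_self[OF N x] by simp
 then show "\<exists>n\<in>N. x = n \<oplus>\<^bsub>M\<^esub> y" unfolding a_r_coset_def' by blast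
next
 assume "\<exists>n\<in>N. x = n \<oplus>\<^bsub>M\<^esub> y"
 then show "N +>\<^bsub>M\<^esub> x = N +>\<^bsub>M\<^esub> y" using coset_absorb[OF N y] by auto
qed

text \<open>Complexes of modules without a group. Homology needs linearity only, and a Brauer
  quotient is acted on by the Weyl group instead of \<open>G\<close>.\<close>

definition mcx :: "('k, 'z) ring_scheme => ('k, 'm, 'g) gcomplex => bool" where
 "mcx K D \<longleftrightarrow> (\<forall>n. Module.module K (ob D n) & lmap K (ob D n) (ob D (n - 1)) (bd D n) &
   (\<forall>x\<in>carrier (ob D n). bd D (n - 1) (bd D n x) = \<zero>\<^bsub>ob D (n - 2)\<^esub>))"

lemma mcxD:
 assumes "mcx K D"
 shows "Module.module K (ob D n)" "lmap K (ob D n) (ob D (n - 1)) (bd D n)"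
  "x \<in> carrier (ob D n) ==> bd D (n - 1) (bd D n x) = \<zero>\<^bsub>ob D (n - 2)\<^esub>" using assms unfolding mcx_def by blast+

lemma submodule_carrier_update:
 fixes M :: "('k, 'm, 'g) gmod"
 assumes M: "Module.module K M" and A: "submodule A K M" and B: "submodule B K M" "B \<subseteq> A"
 shows "submodule B K (M\<lparr>carrier := A\<rparr>)"
proof -
 interpret M: gmodule K M by (rule gmodule.intro[OF M])
 have m: "Module.module K (M\<lparr>carrier := A\<rparr>)" by (rule submodule.submodule_is_module[OF A M])
 interpret A: Module.module K "M\<lparr>carrier := A\<rparr>" by (rule m)
 note E = M.submoduleE[OF B(1)]
 have inv: "\<ominus>\<^bsub>M\<lparr>carrier := A\<rparr>\<^esub> b \<in> B" if b: "b \<in> B" for b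
 proof -
  have bM: "b \<in> carrier M" using E(1) b by blast
  have bA: "\<ominus>\<^bsub>M\<^esub> b \<in> A" "b \<in> A" using E(3)[OF b] B(2) b by blast+
  have "\<ominus>\<^bsub>M\<lparr>carrier := A\<rparr>\<^esub> b = \<ominus>\<^bsub>M\<^esub> b" by (rule A.M.minus_equality) (use bA bM M.M.l_neg in simp_all)
  then show ?thesis using E(3)[OF b] by simp
 qed
 show ?thesis by (rule A.submoduleI) (use E B(2) inv M.submodule_zero[OF B(1)] in auto)
qed

lemma submodule_image:
 assumes M: "Module.module K M" and N: "Module.module K N" and l: "lmap K M N f"
 shows "submodule (f ` carrier M) K N"
proof -
 interpret M: Module.module K M by (rule M)
 interpret N: Module.module K N by (rule N)
 show ?thesis
 proof (rule N.submoduleI)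
  show "f ` carrier M \<subseteq> carrier N" using lmapD(1)[OF l] by blast
  show "\<zero>\<^bsub>N\<^esub> \<in> f ` carrier M" using lmap_zero(1)[OF M N l] M.M.zero_closed by (metis imageI)
  show "\<ominus>\<^bsub>N\<^esub> a \<in> f ` carrier M" if "a \<in> f ` carrier M" for a
   using that lmap_zero(2)[OF M N l, symmetric] M.M.a_inv_closed by auto
  show "a \<oplus>\<^bsub>N\<^esub> b \<in> f ` carrier M" if "a \<in> f ` carrier M" "b \<in> f ` carrier M" for a b
   using that lmapD(2)[OF l, symmetric] M.M.a_closed by auto
  show "r \<odot>\<^bsub>N\<^esub> a \<in> f ` carrier M" if "r \<in> carrier K" "a \<in> f ` carrier M" for r a
   using that lmapD(3)[OF l, symmetric] M.smult_closed by auto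
 qed
qed

context
 fixes K :: "('k, 'z) ring_scheme" and D :: "('k, 'm, 'g) gcomplex"
 assumes D: "mcx K D"
begin

lemma submodule_zero_set:
 assumes "Module.module K M" shows "submodule {\<zero>\<^bsub>M\<^esub>} K M"
proof -
 interpret M: Module.module K M by (rule assms)
 show ?thesis by (rule M.submoduleI) (auto simp: M.smult_zero)
qed

lemma submodule_cycles: "submodule (cycles D n) K (ob D n)"
 using submodule_vimage[OF mcxD(1)[OF D] mcxD(1)[OF D] mcxD(2)[OF D] submodule_zero_set[OF mcxD(1)[OF D]]]
 by (simp add: cycles_def)

lemma submodule_boundaries: "submodule (boundaries D n) K (ob D n)"
 using submodule_image[OF mcxD(1)[OF D] mcxD(1)[OF D] mcxD(2)[OF D, of "n + 1"]] by (simp add: boundaries_def)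

lemma boundaries_cycles: "boundaries D n \<subseteq> cycles D n"
proof
 fix b assume "b \<in> boundaries D n"
 then obtain x where x: "x \<in> carrier (ob D (n + 1))" "b = bd D (n + 1) x" unfolding boundaries_def by blast
 then show "b \<in> cycles D n" using mcxD(3)[OF D x(1)] lmapD(1)[OF mcxD(2)[OF D] x(1)] by (simp add: cycles_def)
qed

lemma gmodule_cycles: "gmodule K ((ob D n)\<lparr>carrier := cycles D n\<rparr>)"
 by (rule gmodule.intro[OF submodule.submodule_is_module[OF submodule_cycles mcxD(1)[OF D]]])

lemma submodule_boundaries': "submodule (boundaries D n) K ((ob D n)\<lparr>carrier := cycles D n\<rparr>)"
 by (rule submodule_carrier_update[OF mcxD(1)[OF D] submodule_cycles submodule_boundaries boundaries_cycles])

lemma carrier_homology: "carrier (homology D n) = (%x. boundaries D n +>\<^bsub>ob D n\<^esub> x) ` cycles D n"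
 unfolding homology_def gmodule.carrier_quotient[OF gmodule_cycles] by simp

lemma zero_homology: "\<zero>\<^bsub>homology D n\<^esub> = boundaries D n" by (simp add: homology_def quotient_mod_def)

lemma homology_coset_eq:
 assumes "x \<in> cycles D n" "y \<in> cycles D n"
 shows "boundaries D n +>\<^bsub>ob D n\<^esub> x = boundaries D n +>\<^bsub>ob D n\<^esub> y \<longleftrightarrow> (\<exists>b\<in>boundaries D n. x = b \<oplus>\<^bsub>ob D n\<^esub> y)"
 using gmodule.coset_eq_iff_add[OF gmodule_cycles submodule_boundaries', of x n y] assms by simp

lemma homology_zero_iff: "carrier (homology D n) = {\<zero>\<^bsub>homology D n\<^esub>} \<longleftrightarrow> cycles D n \<subseteq> boundaries D n"
proof -
 interpret Z: gmodule K "(ob D n)\<lparr>carrier := cycles D n\<rparr>" by (rule gmodule_cycles)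
 have "boundaries D n +>\<^bsub>ob D n\<^esub> x = boundaries D n \<longleftrightarrow> x \<in> boundaries D n" if "x \<in> cycles D n" for x
  using Z.coset_eq_zero_iff[OF submodule_boundaries', of x] that by simp
 moreover have "cycles D n ~= {}" using Z.M.zero_closed by auto
 ultimately show ?thesis unfolding carrier_homology zero_homology by auto
qed

end

lemma homology_map_bij:
 assumes D: "mcx K D" and E: "mcx K E" and f: "!!n. lmap K (ob D n) (ob E n) (f n)"
  and c: "!!n x. x \<in> carrier (ob D n) ==> f (n - 1) (bd D n x) = bd E n (f n x)"
  and inj: "!!x. x \<in> cycles D n ==> f n x \<in> boundaries E n ==> x \<in> boundaries D n"
  and surj: "!!y. y \<in> cycles E n ==> \<exists>b\<in>boundaries E n. \<exists>x\<in>cycles D n. y = b \<oplus>\<^bsub>ob E n\<^esub> f n x"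
 shows "bij_betw (homology_map E f n) (carrier (homology D n)) (carrier (homology E n))"
proof -
 interpret D: Module.module K "ob D n" by (rule mcxD(1)[OF D])
 interpret E: gmodule K "ob E n" by (rule gmodule.intro[OF mcxD(1)[OF E]])
 note l = lmapD[OF f]
 note SD = submodule_cycles[OF D, of n] and SE = submodule_boundaries[OF E, of n]
 note SDE = D.submoduleE[OF SD]
 have cD: "x \<in> carrier (ob D n)" if "x \<in> cycles D n" for x using that by (simp add: cycles_def)
 have bD: "x \<in> carrier (ob D n)" if "x \<in> boundaries D n" for x using that boundaries_cycles[OF D] cD by blast
 have z: "f k \<zero>\<^bsub>ob D k\<^esub> = \<zero>\<^bsub>ob E k\<^esub>" for k by (rule lmap_zero(1)[OF mcxD(1)[OF D] mcxD(1)[OF E] f])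
 have fc: "f n x \<in> cycles E n" if x: "x \<in> cycles D n" for x
 proof -
  have "bd E n (f n x) = f (n - 1) \<zero>\<^bsub>ob D (n - 1)\<^esub>" using c[OF cD[OF x]] x by (simp add: cycles_def)
  then show ?thesis using l(1)[OF cD[OF x]] by (simp add: cycles_def z)
 qed
 have fb: "f n x \<in> boundaries E n" if x: "x \<in> boundaries D n" for x
 proof -
  obtain y where y: "y \<in> carrier (ob D (n + 1))" "x = bd D (n + 1) y" using x unfolding boundaries_def by blast
  then have "f n x = bd E (n + 1) (f (n + 1) y)" using c[OF y(1)] by simp
  then show ?thesis unfolding boundaries_def using l(1)[OF y(1)] by blast
 qed
 have hm: "homology_map E f n (boundaries D n +>\<^bsub>ob D n\<^esub> x) = boundaries E n +>\<^bsub>ob E n\<^esub> f n x"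
  if x: "x \<in> cycles D n" for x unfolding homology_map_def
 proof (rule E.coset_map_coset[OF SE])
  show "boundaries D n ~= {}"
   using gmodule.submodule_zero[OF gmodule.intro[OF mcxD(1)[OF D]] submodule_boundaries[OF D]] by blast
  show "f n x \<in> carrier (ob E n)" by (rule l(1)[OF cD[OF x]])
  fix b assume b: "b \<in> boundaries D n"
  show "f n b \<in> boundaries E n" by (rule fb[OF b])
  show "f n (b \<oplus>\<^bsub>ob D n\<^esub> x) = f n b \<oplus>\<^bsub>ob E n\<^esub> f n x" by (rule l(2)[OF bD[OF b] cD[OF x]])
 qed
 have i: "boundaries D n +>\<^bsub>ob D n\<^esub> x = boundaries D n +>\<^bsub>ob D n\<^esub> y" if x: "x \<in> cycles D n" and y: "y \<in> cycles D n"
   and e: "boundaries E n +>\<^bsub>ob E n\<^esub> f n x = boundaries E n +>\<^bsub>ob E n\<^esub> f n y" for x y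
 proof -
  obtain b where b: "b \<in> boundaries E n" "f n x = b \<oplus>\<^bsub>ob E n\<^esub> f n y"
   using e homology_coset_eq[OF E fc[OF x] fc[OF y]] by blast
  define w where "w = x \<oplus>\<^bsub>ob D n\<^esub> \<ominus>\<^bsub>ob D n\<^esub> y"
  have w: "w \<in> cycles D n" unfolding w_def by (intro SDE(5) SDE(3) x y)
  have xw: "x = w \<oplus>\<^bsub>ob D n\<^esub> y" unfolding w_def using cD[OF x] cD[OF y] by (simp add: D.M.a_assoc D.M.l_neg)
  have bE: "b \<in> carrier (ob E n)" using b(1) E.submoduleE(1)[OF SE] by blast
  have "f n w \<oplus>\<^bsub>ob E n\<^esub> f n y = b \<oplus>\<^bsub>ob E n\<^esub> f n y" using l(2)[OF cD[OF w] cD[OF y]] b(2) xw by simp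
  then have "f n w = b" using l(1)[OF cD[OF w]] l(1)[OF cD[OF y]] bE E.M.add.right_cancel by blast
  then have "w \<in> boundaries D n" using inj[OF w] b(1) by simp
  then show ?thesis using homology_coset_eq[OF D x y] xw by blast
 qed
 show ?thesis unfolding bij_betw_def
 proof (intro conjI inj_onI)
  fix A B assume A: "A \<in> carrier (homology D n)" and B: "B \<in> carrier (homology D n)"
   and e: "homology_map E f n A = homology_map E f n B"
  obtain x y where "x \<in> cycles D n" "A = boundaries D n +>\<^bsub>ob D n\<^esub> x"
   "y \<in> cycles D n" "B = boundaries D n +>\<^bsub>ob D n\<^esub> y" using A B unfolding carrier_homology[OF D] by blast
  then show "A = B" using i[of x y] e hm by simp
 next
  show "homology_map E f n ` carrier (homology D n) = carrier (homology E n)"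
  proof (intro equalityI subsetI)
   fix A assume "A \<in> homology_map E f n ` carrier (homology D n)"
   then obtain x where x: "x \<in> cycles D n" "A = boundaries E n +>\<^bsub>ob E n\<^esub> f n x"
    unfolding carrier_homology[OF D] using hm by auto
   then show "A \<in> carrier (homology E n)" unfolding carrier_homology[OF E] using fc by blast
  next
   fix A assume "A \<in> carrier (homology E n)"
   then obtain y where y: "y \<in> cycles E n" "A = boundaries E n +>\<^bsub>ob E n\<^esub> y"
    unfolding carrier_homology[OF E] by blast
   then obtain b x where bx: "b \<in> boundaries E n" "x \<in> cycles D n" "y = b \<oplus>\<^bsub>ob E n\<^esub> f n x" using surj by blast
   then have "A = boundaries E n +>\<^bsub>ob E n\<^esub> f n x"
    using homology_coset_eq[OF E y(1) fc[OF bx(2)]] y(2) by blast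
   then show "A \<in> homology_map E f n ` carrier (homology D n)"
    unfolding carrier_homology[OF D] using hm[OF bx(2)] bx(2) by (metis imageI)
  qed
 qed
qed

section \<open>Relative transfers of permutation modules\<close>

context fbase
begin

lemma coset_rep:
 assumes L: "subgroup L G" and h: "h \<in> carrier G"
 shows "\<exists>l\<in>L. (SOME g. g \<in> h <#\<^bsub>G\<^esub> L) = h \<otimes> l"
proof -
 have "h \<otimes> \<one> \<in> h <#\<^bsub>G\<^esub> L" unfolding l_coset_def using subgroup.one_closed[OF L] by blast
 then have "(SOME g. g \<in> h <#\<^bsub>G\<^esub> L) \<in> h <#\<^bsub>G\<^esub> L" by (rule someI)
 then show ?thesis unfolding l_coset_def by blast
qed

text \<open>A coset fixed by \<open>H\<close> would force \<open>H \<subseteq> L\<close>. Without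
  fixed points the number of cosets is divisible by \<open>p\<close>.\<close>

lemma card_cosets_dvd:
 assumes H: "subgroup H G" and L: "subgroup L G" and LH: "L \<subset> H"
 shows "p dvd card ((%h. h <#\<^bsub>G\<^esub> L) ` H)"
proof -
 let ?Q = "(%h. h <#\<^bsub>G\<^esub> L) ` H"
 have Hc: "!!h. h \<in> H ==> h \<in> carrier G" using subgroup.subset[OF H] by blast
 have Lc: "L \<subseteq> carrier G" by (rule subgroup.subset[OF L])
 have a: "acts_on H (%g c. g <#\<^bsub>G\<^esub> c) ?Q" unfolding acts_on_def
  using lcos_m_assoc[OF Lc] Hc subgroup.m_closed[OF H]
  by (auto simp: m_assoc lcos_mult_one[OF l_coset_subset_G[OF Lc]] l_coset_subset_G[OF Lc] lcos_m_assoc[OF l_coset_subset_G[OF Lc]])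
 have e: "{c\<in>?Q. \<forall>g\<in>H. g <#\<^bsub>G\<^esub> c = c} = {}"
 proof (rule ccontr)
  assume "{c\<in>?Q. \<forall>g\<in>H. g <#\<^bsub>G\<^esub> c = c} ~= {}"
  then obtain h where h: "h \<in> H" "!!g. g \<in> H ==> g <#\<^bsub>G\<^esub> (h <#\<^bsub>G\<^esub> L) = h <#\<^bsub>G\<^esub> L" by blast
  have "inv h <#\<^bsub>G\<^esub> (h <#\<^bsub>G\<^esub> L) = L"
   using lcos_m_assoc[OF Lc, of "inv h" h] Hc[OF h(1)] lcos_mult_one[OF Lc] by simp
  then have hL: "h <#\<^bsub>G\<^esub> L = L" using h(2)[OF subgroup.m_inv_closed[OF H h(1)]] by simp
  have "H \<subseteq> L"
  proof
   fix g assume g: "g \<in> H"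
   have "g \<otimes> \<one> \<in> g <#\<^bsub>G\<^esub> L" unfolding l_coset_def using subgroup.one_closed[OF L] by blast
   then show "g \<in> L" using h(2)[OF g] Hc[OF g] by (simp add: hL)
  qed
  then show False using LH by blast
 qed
 show ?thesis using card_fixed_points[OF H finite_imageI[OF finite_subgroup[OF H]] a] unfolding e by simp
qed

section \<open>Proper transfers in coordinates\<close>

context
 fixes M :: "('k, 'm, 'g) gmod" and X \<alpha> m \<phi> and H :: "'g set"
 assumes kG: "kG_module K G M" and pf: "perm_frame K G M X \<alpha> m \<phi>" and H: "subgroup H G"
begin

lemma modM: "Module.module K M" using kG kG_module.axioms(1) by blast

lemmas frameD = perm_frameD(1,3-11)[OF pf]

lemma frame_ext:
 assumes "u \<in> carrier M" "v \<in> carrier M" "!!x. x \<in> X ==> \<phi> x u = \<phi> x v" shows "u = v"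
proof -
 interpret M: Module.module K M by (rule modM)
 have "\<phi> x (u \<ominus>\<^bsub>M\<^esub> v) = \<zero>\<^bsub>K\<^esub>" if "x \<in> X" for x
  using linf_minus(1)[OF modM frameD(3)[OF that] assms(1,2)] assms(3)[OF that]
   linfD(1)[OF frameD(3)[OF that] assms(2)] by (simp add: a_minus_def K.r_neg)
 then have "u \<ominus>\<^bsub>M\<^esub> v = \<zero>\<^bsub>M\<^esub>" using frameD(10) assms(1,2) by simp
 moreover have "u = (u \<ominus>\<^bsub>M\<^esub> v) \<oplus>\<^bsub>M\<^esub> v" using assms(1,2) by (simp add: a_minus_def M.M.a_assoc M.M.l_neg)
 ultimately show ?thesis using assms(2) by simp
qed

lemma frame_expand:
 assumes v: "v \<in> carrier M" shows "v = (\<Oplus>\<^bsub>M\<^esub>x\<in>X. \<phi> x v \<odot>\<^bsub>M\<^esub> m x)"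
proof -
 interpret M: Module.module K M by (rule modM)
 have c: "\<phi> x v \<in> carrier K" if "x \<in> X" for x by (rule linfD(1)[OF frameD(3)[OF that] v])
 have f: "(%x. \<phi> x v \<odot>\<^bsub>M\<^esub> m x) \<in> X \<rightarrow> carrier M" using c frameD(2) by auto
 show ?thesis
 proof (rule frame_ext[OF v M.M.finsum_closed[OF f]])
  fix y assume y: "y \<in> X"
  note ly = frameD(3)[OF y]
  have "\<phi> y (\<Oplus>\<^bsub>M\<^esub>x\<in>X. \<phi> x v \<odot>\<^bsub>M\<^esub> m x) = (\<Oplus>\<^bsub>K\<^esub>x\<in>X. \<phi> y (\<phi> x v \<odot>\<^bsub>M\<^esub> m x))" by (rule linf_finsum[OF modM ly f])
  also have "... = (\<Oplus>\<^bsub>K\<^esub>x\<in>X. \<phi> x v \<otimes>\<^bsub>K\<^esub> \<phi> y (m x))" by (rule K.finsum_cong') (use c frameD(2) linfD[OF ly] in auto)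
  finally show "\<phi> y v = \<phi> y (\<Oplus>\<^bsub>M\<^esub>x\<in>X. \<phi> x v \<odot>\<^bsub>M\<^esub> m x)" using frameD(9)[OF ly v] by simp
 qed
qed

lemma submodule_fixed: "submodule (fixed_points M H) K M"
proof -
 interpret M: kG_module K G M by (rule kG)
 have Hc: "!!h. h \<in> H ==> h \<in> carrier G" using subgroup.subset[OF H] by blast
 note z = lmap_zero[OF modM modM act_lmap[OF kG]]
 show ?thesis by (rule M.submoduleI) (auto simp: fixed_points_def z Hc M.act_add M.act_smult)
qed

text \<open>This will be the submodule of proper transfers. Coordinates at indices that
  \<open>H\<close> moves are not constrained, since the sum of the spanning vectors over such an
  orbit is a transfer.\<close>

definition tker :: "'m set" where "tker = {v\<in>fixed_points M H. \<forall>x\<in>X. (\<forall>g\<in>H. \<alpha> g x = x) --> \<phi> x v = \<zero>\<^bsub>K\<^esub>}"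

lemma submodule_tker: "submodule tker K M"
proof -
 interpret M: kG_module K G M by (rule kG)
 note E = M.submoduleE[OF submodule_fixed]
 have Fz: "\<zero>\<^bsub>M\<^esub> \<in> fixed_points M H" by (rule gmodule.submodule_zero[OF gmodule.intro[OF modM] submodule_fixed])
 have Fc: "v \<in> carrier M" if "v \<in> fixed_points M H" for v using that by (simp add: fixed_points_def)
 have mn: "\<phi> x (\<ominus>\<^bsub>M\<^esub> v) = \<ominus>\<^bsub>K\<^esub> \<phi> x v" if "x \<in> X" "v \<in> carrier M" for x v
  by (rule linf_minus(3)[OF modM frameD(3)[OF that(1)] that(2,2)])
 show ?thesis by (rule M.submoduleI)
   (auto simp: tker_def E Fz Fc mn linf_zero[OF modM frameD(3)] linfD[OF frameD(3)])
qed

text \<open>At an index fixed by \<open>H\<close> all terms of the transfer have the same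
  coordinate, and their number, the index of \<open>L\<close> in \<open>H\<close>, is divisible by
  \<open>p\<close>.\<close>

lemma rel_transfer_tker:
 assumes L: "subgroup L G" and LH: "L \<subset> H" and u: "u \<in> fixed_points M L"
 shows "rel_transfer G M L H u \<in> tker"
proof -
 interpret M: kG_module K G M by (rule kG)
 let ?Q = "(%h. h <#\<^bsub>G\<^esub> L) ` H"
 let ?r = "%c. SOME g. g \<in> c"
 have Hc: "!!h. h \<in> H ==> h \<in> carrier G" using subgroup.subset[OF H] by blast
 have Lc: "!!h. h \<in> L ==> h \<in> carrier G" using subgroup.subset[OF L] by blast
 have uc: "u \<in> carrier M" and uf: "!!l. l \<in> L ==> act M l u = u" using u by (auto simp: fixed_points_def)
 have ra: "act M (?r (h <#\<^bsub>G\<^esub> L)) u = act M h u" if "h \<in> H" for h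
  using coset_rep[OF L Hc[OF that]] Hc[OF that] Lc uf uc by (auto simp: M.act_mult)
 have rc: "(%c. act M (?r c) u) \<in> ?Q \<rightarrow> carrier M" using ra Hc M.act_closed uc by auto
 define v where "v = (\<Oplus>\<^bsub>M\<^esub>c\<in>?Q. act M (?r c) u)"
 have vc: "v \<in> carrier M" unfolding v_def by (rule M.M.finsum_closed[OF rc])
 have fQ: "finite ?Q" using finite_subgroup[OF H] by simp
 have "act M g v = v" if g: "g \<in> H" for g
 proof -
  have "act M g v = (\<Oplus>\<^bsub>M\<^esub>c\<in>?Q. act M g (act M (?r c) u))"
   unfolding v_def by (rule lmap_finsum[OF modM modM act_lmap[OF kG Hc[OF g]] rc])
  also have "... = (\<Oplus>\<^bsub>M\<^esub>c\<in>?Q. act M (?r (g <#\<^bsub>G\<^esub> c)) u)"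
  proof (rule M.M.finsum_cong')
   show "(%c. act M (?r (g <#\<^bsub>G\<^esub> c)) u) \<in> ?Q \<rightarrow> carrier M"
    using ra[OF subgroup.m_closed[OF H g]] Hc g M.act_closed uc lcos_m_assoc[OF subgroup.subset[OF L]] by auto
   fix c assume "c \<in> ?Q"
   then obtain h where h: "h \<in> H" "c = h <#\<^bsub>G\<^esub> L" by blast
   then show "act M g (act M (?r c) u) = act M (?r (g <#\<^bsub>G\<^esub> c)) u"
    using ra[OF h(1)] ra[OF subgroup.m_closed[OF H g h(1)]] Hc g uc lcos_m_assoc[OF subgroup.subset[OF L]]
    by (simp add: M.act_mult)
  qed simp
  also have "... = (\<Oplus>\<^bsub>M\<^esub>c\<in>(%c. g <#\<^bsub>G\<^esub> c) ` ?Q. act M (?r c) u)"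
  proof (rule M.M.finsum_reindex[symmetric])
   have im: "(%c. g <#\<^bsub>G\<^esub> c) ` ?Q \<subseteq> ?Q"
    using subgroup.m_closed[OF H g] Hc g lcos_m_assoc[OF subgroup.subset[OF L]] by auto
   then show "(%c. act M (?r c) u) \<in> (%c. g <#\<^bsub>G\<^esub> c) ` ?Q \<rightarrow> carrier M" using rc by blast
   show "inj_on (%c. g <#\<^bsub>G\<^esub> c) ?Q"
   proof (rule inj_on_inverseI)
    fix c assume "c \<in> ?Q"
    then have "c \<subseteq> carrier G" using l_coset_subset_G[OF subgroup.subset[OF L]] Hc by blast
    then show "inv g <#\<^bsub>G\<^esub> (g <#\<^bsub>G\<^esub> c) = c" using Hc[OF g] by (simp add: lcos_m_assoc lcos_mult_one)
   qed
  qed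
  also have "(%c. g <#\<^bsub>G\<^esub> c) ` ?Q = ?Q"
  proof
   show "(%c. g <#\<^bsub>G\<^esub> c) ` ?Q \<subseteq> ?Q"
    using subgroup.m_closed[OF H g] Hc g lcos_m_assoc[OF subgroup.subset[OF L]] by auto
   show "?Q \<subseteq> (%c. g <#\<^bsub>G\<^esub> c) ` ?Q"
   proof
    fix c assume "c \<in> ?Q"
    then obtain h where h: "h \<in> H" "c = h <#\<^bsub>G\<^esub> L" by blast
    have "c = g <#\<^bsub>G\<^esub> ((inv g \<otimes> h) <#\<^bsub>G\<^esub> L)"
     using h Hc g lcos_m_assoc[OF subgroup.subset[OF L], of g "inv g \<otimes> h"] by (simp add: inv_solve_left m_assoc[symmetric])
    then show "c \<in> (%c. g <#\<^bsub>G\<^esub> c) ` ?Q"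
     using subgroup.m_closed[OF H subgroup.m_inv_closed[OF H g] h(1)] by blast
   qed
  qed
  finally show ?thesis unfolding v_def .
 qed
 then have 1: "v \<in> fixed_points M H" using vc by (simp add: fixed_points_def)
 have 2: "\<phi> x v = \<zero>\<^bsub>K\<^esub>" if x: "x \<in> X" and xf: "\<forall>g\<in>H. \<alpha> g x = x" for x
 proof -
  note l = frameD(3)[OF x]
  have c: "\<phi> x u \<in> carrier K" by (rule linfD(1)[OF l uc])
  have "\<phi> x v = (\<Oplus>\<^bsub>K\<^esub>c\<in>?Q. \<phi> x (act M (?r c) u))" unfolding v_def by (rule linf_finsum[OF modM l rc])
  also have "... = (\<Oplus>\<^bsub>K\<^esub>c\<in>?Q. \<phi> x u)"
  proof (rule K.finsum_cong')
   fix c assume "c \<in> ?Q"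
   then obtain h where h: "h \<in> H" "c = h <#\<^bsub>G\<^esub> L" by blast
   show "\<phi> x (act M (?r c) u) = \<phi> x u" using frameD(8)[OF x Hc[OF h(1)] uc] xf h ra[OF h(1)] by simp
  qed (use c in auto)
  finally have "emb K (\<phi> x v) = (\<Sum>c\<in>?Q. emb K (\<phi> x u))" using c by (simp add: K.emb_finsum)
  also have "... = of_nat (card ?Q) * emb K (\<phi> x u)" by simp
  also have "... = 0" by (rule of_nat_dvd_e[OF card_cosets_dvd[OF H L LH]]) (simp add: c)
  finally show ?thesis using K.emb_0_iff[OF linfD(1)[OF l vc]] by simp
 qed
 show ?thesis unfolding rel_transfer_def using 1 2 by (simp add: tker_def v_def)
qed

text \<open>The sum over the orbit is the transfer of \<open>m x\<close> from the stabilizer of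
  \<open>x\<close>, a proper subgroup because \<open>x\<close> is moved.\<close>

lemma orbit_sum_transfer:
 assumes x: "x \<in> X" and nf: "\<exists>g\<in>H. \<alpha> g x ~= x"
 shows "(\<Oplus>\<^bsub>M\<^esub>y\<in>(%g. \<alpha> g x) ` H. m y) \<in> proper_transfers K G H M"
proof -
 interpret M: kG_module K G M by (rule kG)
 have Hc: "!!h. h \<in> H ==> h \<in> carrier G" using subgroup.subset[OF H] by blast
 define L where "L = {g\<in>H. \<alpha> g x = x}"
 have L: "subgroup L G"
 proof (rule subgroupI)
  show "L \<subseteq> carrier G" using Hc by (auto simp: L_def)
  show "L ~= {}" using subgroup.one_closed[OF H] frameD(4)[OF x] by (auto simp: L_def)
  show "inv a \<in> L" if "a \<in> L" for a
   using that subgroup.m_inv_closed[OF H] frameD(7)[OF x, of "inv a" a] Hc frameD(4)[OF x] by (auto simp: L_def)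
  show "a \<otimes> b \<in> L" if "a \<in> L" "b \<in> L" for a b
   using that subgroup.m_closed[OF H] frameD(7)[OF x, of a b] Hc by (auto simp: L_def)
 qed
 have LH: "L \<subset> H" using nf by (auto simp: L_def)
 let ?Q = "(%h. h <#\<^bsub>G\<^esub> L) ` H"
 let ?r = "%c. SOME g. g \<in> c"
 have mf: "m x \<in> fixed_points M L"
  using frameD(2)[OF x] frameD(6)[OF x] Hc by (auto simp: fixed_points_def L_def)
 have r: "\<exists>g\<in>H. ?r (h <#\<^bsub>G\<^esub> L) = g & \<alpha> g x = \<alpha> h x" if h: "h \<in> H" for h
 proof -
  obtain l where l: "l \<in> L" "?r (h <#\<^bsub>G\<^esub> L) = h \<otimes> l" using coset_rep[OF L Hc[OF h]] by blast
  then show ?thesis using subgroup.m_closed[OF H h] frameD(7)[OF x Hc[OF h]] Hc by (auto simp: L_def)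
 qed
 have ra: "\<alpha> (?r (h <#\<^bsub>G\<^esub> L)) x = \<alpha> h x" "?r (h <#\<^bsub>G\<^esub> L) \<in> carrier G" if "h \<in> H" for h using r[OF that] Hc by auto
 have im: "(%c. \<alpha> (?r c) x) ` ?Q = (%g. \<alpha> g x) ` H" using ra by (auto simp: image_image)
 have inj: "inj_on (%c. \<alpha> (?r c) x) ?Q"
 proof (rule inj_onI)
  fix c c' assume "c \<in> ?Q" "c' \<in> ?Q" and e: "\<alpha> (?r c) x = \<alpha> (?r c') x"
  then obtain h h' where h: "h \<in> H" "c = h <#\<^bsub>G\<^esub> L" "h' \<in> H" "c' = h' <#\<^bsub>G\<^esub> L" by blast
  have "\<alpha> h x = \<alpha> h' x" using e h ra by simp
  then have "\<alpha> (inv h \<otimes> h') x = \<alpha> (inv h \<otimes> h) x"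
   unfolding frameD(7)[OF x inv_closed[OF Hc[OF h(1)]] Hc[OF h(3)]]
    frameD(7)[OF x inv_closed[OF Hc[OF h(1)]] Hc[OF h(1)]] by simp
  then have "inv h \<otimes> h' \<in> L"
   using frameD(4)[OF x] Hc[OF h(1)] subgroup.m_closed[OF H subgroup.m_inv_closed[OF H h(1)] h(3)]
   by (simp add: L_def)
  then have "h \<otimes> (inv h \<otimes> h') \<in> h <#\<^bsub>G\<^esub> L" unfolding l_coset_def by blast
  then have "h' \<in> h <#\<^bsub>G\<^esub> L" using Hc[OF h(1)] Hc[OF h(3)] by (simp add: m_assoc[symmetric])
  then show "c = c'" using l_repr_independence[OF _ Hc[OF h(1)] L] h by simp
 qed
 have "(\<Oplus>\<^bsub>M\<^esub>y\<in>(%g. \<alpha> g x) ` H. m y) = (\<Oplus>\<^bsub>M\<^esub>c\<in>?Q. m (\<alpha> (?r c) x))" unfolding im[symmetric]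
  by (rule M.M.finsum_reindex[OF _ inj]) (use frameD(2,5) x ra Hc in auto)
 also have "... = rel_transfer G M L H (m x)" unfolding rel_transfer_def
  by (rule M.M.finsum_cong') (use frameD(6)[OF x ra(2)] frameD(2,5) x ra Hc M.act_closed in auto)
 finally have e: "(\<Oplus>\<^bsub>M\<^esub>y\<in>(%g. \<alpha> g x) ` H. m y) = rel_transfer G M L H (m x)" .
 have "rel_transfer G M L H (m x) \<in> (\<Union>L\<in>{L. subgroup L G & L \<subset> H}. rel_transfer G M L H ` fixed_points M L)"
  using L LH mf by blast
 then show ?thesis unfolding e proper_transfers_def by (rule subsetD[OF module_span_incl])
qed

text \<open>The coefficients are constant on orbits, so the sum consists of multiples of orbit sums.
  The orbits are removed one at a time, by induction on the number of nonzero coefficients.\<close>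

lemma invariant_sum_transfer:
 assumes "!!x. x \<in> X ==> c x \<in> carrier K" "!!g x. g \<in> H ==> x \<in> X ==> c (\<alpha> g x) = c x"
  "!!x. x \<in> X ==> \<forall>g\<in>H. \<alpha> g x = x ==> c x = \<zero>\<^bsub>K\<^esub>" and S: "submodule S K M" "proper_transfers K G H M \<subseteq> S"
 shows "(\<Oplus>\<^bsub>M\<^esub>x\<in>X. c x \<odot>\<^bsub>M\<^esub> m x) \<in> S" using assms(1-3)
proof (induction "card {x\<in>X. c x ~= \<zero>\<^bsub>K\<^esub>}" arbitrary: c rule: less_induct)
 case less
 interpret M: gmodule K M by (rule gmodule.intro[OF modM])
 have Hc: "!!h. h \<in> H ==> h \<in> carrier G" using subgroup.subset[OF H] by blast
 have z: "\<zero>\<^bsub>K\<^esub> \<odot>\<^bsub>M\<^esub> u = \<zero>\<^bsub>M\<^esub>" if "u \<in> carrier M" for u using that by (rule M.smult_l_null)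
 show ?case
 proof (cases "\<exists>x\<in>X. c x ~= \<zero>\<^bsub>K\<^esub>")
  case True
  then obtain x where x: "x \<in> X" "c x ~= \<zero>\<^bsub>K\<^esub>" by blast
  define O' where "O' = (%g. \<alpha> g x) ` H"
  have OX: "O' \<subseteq> X" using frameD(5)[OF x(1)] Hc by (auto simp: O'_def)
  have xO: "x \<in> O'" using subgroup.one_closed[OF H] frameD(4)[OF x(1)] by (force simp: O'_def)
  have cO: "c y = c x" if "y \<in> O'" for y using that less.prems(2) x(1) by (auto simp: O'_def)
  have Ost: "\<alpha> g y \<in> O' \<longleftrightarrow> y \<in> O'" if g: "g \<in> H" and y: "y \<in> X" for g y
  proof
   assume "y \<in> O'"
   then obtain h where h: "h \<in> H" "y = \<alpha> h x" by (auto simp: O'_def)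
   then have "\<alpha> g y = \<alpha> (g \<otimes> h) x" using frameD(7)[OF x(1)] Hc g by simp
   then show "\<alpha> g y \<in> O'" using subgroup.m_closed[OF H g h(1)] by (auto simp: O'_def)
  next
   assume "\<alpha> g y \<in> O'"
   then obtain h where h: "h \<in> H" "\<alpha> g y = \<alpha> h x" by (auto simp: O'_def)
   have ig: "inv g \<in> H" by (rule subgroup.m_inv_closed[OF H g])
   have "y = \<alpha> (inv g \<otimes> g) y" using frameD(4)[OF y] Hc[OF g] by simp
   also have "... = \<alpha> (inv g) (\<alpha> h x)" using frameD(7)[OF y Hc[OF ig] Hc[OF g]] h by simp
   also have "... = \<alpha> (inv g \<otimes> h) x" using frameD(7)[OF x(1) Hc[OF ig] Hc[OF h(1)]] by simp
   finally show "y \<in> O'" using subgroup.m_closed[OF H ig h(1)] by (auto simp: O'_def)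
  qed
  define c' where "c' y = (if y \<in> O' then \<zero>\<^bsub>K\<^esub> else c y)" for y
  have "{y\<in>X. c' y ~= \<zero>\<^bsub>K\<^esub>} \<subset> {y\<in>X. c y ~= \<zero>\<^bsub>K\<^esub>}" using x xO by (auto simp: c'_def)
  then have "card {y\<in>X. c' y ~= \<zero>\<^bsub>K\<^esub>} < card {y\<in>X. c y ~= \<zero>\<^bsub>K\<^esub>}" by (intro psubset_card_mono) (simp add: frameD(1))
  then have IH: "(\<Oplus>\<^bsub>M\<^esub>y\<in>X. c' y \<odot>\<^bsub>M\<^esub> m y) \<in> S" by (rule less.hyps) (use less.prems Ost in \<open>auto simp: c'_def\<close>)
  have nf: "\<exists>g\<in>H. \<alpha> g x ~= x" using less.prems(3)[OF x(1)] x(2) by blast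
  let ?o = "\<Oplus>\<^bsub>M\<^esub>y\<in>O'. m y"
  have oS: "?o \<in> S" using orbit_sum_transfer[OF x(1) nf] S(2) unfolding O'_def by blast
  have mO: "m \<in> O' \<rightarrow> carrier M" using frameD(2) OX by blast
  have fO: "finite O'" by (rule finite_subset[OF OX frameD(1)])
  have split: "(\<Oplus>\<^bsub>M\<^esub>y\<in>X. d y \<odot>\<^bsub>M\<^esub> m y) = (\<Oplus>\<^bsub>M\<^esub>y\<in>O'. d y \<odot>\<^bsub>M\<^esub> m y) \<oplus>\<^bsub>M\<^esub> (\<Oplus>\<^bsub>M\<^esub>y\<in>X - O'. d y \<odot>\<^bsub>M\<^esub> m y)"
   if d: "!!y. y \<in> X ==> d y \<in> carrier K" for d
  proof -
   have "X = O' \<union> (X - O')" using OX by blast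
   then have "(\<Oplus>\<^bsub>M\<^esub>y\<in>X. d y \<odot>\<^bsub>M\<^esub> m y) = (\<Oplus>\<^bsub>M\<^esub>y\<in>O' \<union> (X - O'). d y \<odot>\<^bsub>M\<^esub> m y)" by simp
   also have "... = (\<Oplus>\<^bsub>M\<^esub>y\<in>O'. d y \<odot>\<^bsub>M\<^esub> m y) \<oplus>\<^bsub>M\<^esub> (\<Oplus>\<^bsub>M\<^esub>y\<in>X - O'. d y \<odot>\<^bsub>M\<^esub> m y)"
    by (rule M.M.finsum_Un_disjoint) (use fO frameD(1,2) d OX in \<open>auto intro!: M.smult_closed\<close>)
   finally show ?thesis .
  qed
  have cl: "(\<Oplus>\<^bsub>M\<^esub>y\<in>X - O'. c y \<odot>\<^bsub>M\<^esub> m y) \<in> carrier M"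
   by (rule M.M.finsum_closed) (use less.prems(1) frameD(2) in \<open>auto intro!: M.smult_closed\<close>)
  have "(\<Oplus>\<^bsub>M\<^esub>y\<in>O'. c' y \<odot>\<^bsub>M\<^esub> m y) = (\<Oplus>\<^bsub>M\<^esub>y\<in>O'. \<zero>\<^bsub>M\<^esub>)"
   by (rule M.M.finsum_cong') (use mO z in \<open>auto simp: c'_def Pi_iff\<close>)
  moreover have "(\<Oplus>\<^bsub>M\<^esub>y\<in>X - O'. c' y \<odot>\<^bsub>M\<^esub> m y) = (\<Oplus>\<^bsub>M\<^esub>y\<in>X - O'. c y \<odot>\<^bsub>M\<^esub> m y)"
   by (rule M.M.finsum_cong') (use less.prems(1) frameD(2) in \<open>auto simp: c'_def intro!: M.smult_closed\<close>)
  ultimately have 1: "(\<Oplus>\<^bsub>M\<^esub>y\<in>X - O'. c y \<odot>\<^bsub>M\<^esub> m y) \<in> S"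
   using IH split[of c'] less.prems(1) cl by (simp add: c'_def)
  have "(\<Oplus>\<^bsub>M\<^esub>y\<in>O'. c y \<odot>\<^bsub>M\<^esub> m y) = (\<Oplus>\<^bsub>M\<^esub>y\<in>O'. c x \<odot>\<^bsub>M\<^esub> m y)"
   by (rule M.M.finsum_cong') (use less.prems(1)[OF x(1)] mO cO in \<open>auto intro!: M.smult_closed\<close>)
  also have "... = c x \<odot>\<^bsub>M\<^esub> ?o" by (rule M.finsum_smult_ldistr[symmetric, OF fO less.prems(1)[OF x(1)] mO])
  finally have 2: "(\<Oplus>\<^bsub>M\<^esub>y\<in>O'. c y \<odot>\<^bsub>M\<^esub> m y) \<in> S" using M.submoduleE(4)[OF S(1) less.prems(1)[OF x(1)] oS] by simp
  show ?thesis by (subst split[OF less.prems(1)], assumption) (rule M.submoduleE(5)[OF S(1) 2 1])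
 next
  case False
  have "(\<Oplus>\<^bsub>M\<^esub>x\<in>X. c x \<odot>\<^bsub>M\<^esub> m x) = (\<Oplus>\<^bsub>M\<^esub>x\<in>X. \<zero>\<^bsub>M\<^esub>)" by (rule M.M.finsum_cong') (use False z frameD(2) in auto)
  then show ?thesis using M.submodule_zero[OF S(1)] by simp
 qed
qed

lemma proper_transfers_eq: "proper_transfers K G H M = tker"
proof
 interpret M: gmodule K M by (rule gmodule.intro[OF modM])
 let ?R = "\<Union>L\<in>{L. subgroup L G & L \<subset> H}. rel_transfer G M L H ` fixed_points M L"
 have R: "?R \<subseteq> tker" using rel_transfer_tker by blast
 have tc: "tker \<subseteq> carrier M" by (auto simp: tker_def fixed_points_def)
 show "proper_transfers K G H M \<subseteq> tker"
  unfolding proper_transfers_def by (rule module_span_least[OF submodule_tker R])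
 have S: "submodule (proper_transfers K G H M) K M"
  unfolding proper_transfers_def by (rule M.submodule_span) (use R tc in blast)
 show "tker \<subseteq> proper_transfers K G H M"
 proof
  fix v assume v: "v \<in> tker"
  then have vc: "v \<in> carrier M" and vf: "!!g. g \<in> H ==> act M g v = v" by (auto simp: tker_def fixed_points_def)
  have "(\<Oplus>\<^bsub>M\<^esub>x\<in>X. \<phi> x v \<odot>\<^bsub>M\<^esub> m x) \<in> proper_transfers K G H M"
  proof (rule invariant_sum_transfer[OF _ _ _ S subset_refl])
   show "\<phi> x v \<in> carrier K" if "x \<in> X" for x by (rule linfD(1)[OF frameD(3)[OF that] vc])
   show "\<phi> (\<alpha> g x) v = \<phi> x v" if "g \<in> H" "x \<in> X" for g x
    using frameD(8)[OF that(2) subgroup.mem_carrier[OF H that(1)] vc] vf[OF that(1)] by simp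
   show "\<phi> x v = \<zero>\<^bsub>K\<^esub>" if "x \<in> X" "\<forall>g\<in>H. \<alpha> g x = x" for x using v that by (simp add: tker_def)
  qed
  then show "v \<in> proper_transfers K G H M" using frame_expand[OF vc] by simp
 qed
qed

end
end

section \<open>Brauer quotients of the framed complex\<close>

lemma shift_0 [simp]: "shift 0 D = D" for D :: "('k, 'm, 'g) gcomplex"
 by (cases D) (simp add: shift_def signed_def)

lemma restr_mult_single: "z \<in> A ==> restr A (a * single z z c) = restr A a * single z z c"
 by (rule fmat_eqI) auto

context pframe
begin

lemma cvec_inj:
 assumes u: "u \<in> carrier (ob C n)" and v: "v \<in> carrier (ob C n)" and e: "fr.cvec n u = fr.cvec n v"
 shows "u = v"
proof (rule frame_ext[OF kGC pf subgroup_self u v])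
 fix x assume x: "x \<in> X n"
 have "ent (fr.cvec n u) (n, Suc x) (0, 0) = ent (fr.cvec n v) (n, Suc x) (0, 0)" using e by simp
 then have "emb K (\<phi> n x u) = emb K (\<phi> n x v)" using x by (simp add: fr.ent_cvec JJ_iff kk_def)
 then show "\<phi> n x u = \<phi> n x v" using linfD(1)[OF pfD(4)[OF x]] u v by (simp add: K.emb_inj)
qed

lemma cvec_uminus:
 assumes u: "u \<in> carrier (ob C n)" shows "fr.cvec n (\<ominus>\<^bsub>ob C n\<^esub> u) = - fr.cvec n u"
proof -
 interpret M: Module.module K "ob C n" by (rule modC)
 show ?thesis using fr.cvec_add[of u n "\<ominus>\<^bsub>ob C n\<^esub> u"] u by (simp add: M.M.r_neg add_eq_0_iff)
qed

lemma cvec_signed: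
 "u \<in> carrier (ob C n) ==> fr.cvec n (signed (ob C n) i u) = (if even i then fr.cvec n u else - fr.cvec n u)"
 by (simp add: signed_def cvec_uminus)

text \<open>The entries of \<open>V\<close> are used as coefficients of the spanning vectors. The
  coordinates of the resulting vector are those of \<open>idm * V\<close>, which is \<open>V\<close>
  by assumption.\<close>

lemma cvec_surj:
 assumes V: "cor V" "V * upt (0, 0) = V" "homg fst n V" "fr.idm * V = V"
 shows "\<exists>u\<in>carrier (ob C n). fr.cvec n u = V"
proof -
 interpret M: Module.module K "ob C n" by (rule modC)
 define c where "c x = coef K (ent V (n, Suc x) (0, 0))" for x
 have ec: "emb K (c x) = ent V (n, Suc x) (0, 0)" for x
  unfolding c_def by (rule K.emb_coef[OF corD(1)[OF V(1)]])
 have cc: "c x \<in> carrier K" for x by (simp add: c_def)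
 define u where "u = (\<Oplus>\<^bsub>ob C n\<^esub>x\<in>X n. c x \<odot>\<^bsub>ob C n\<^esub> m n x)"
 have f: "(%x. c x \<odot>\<^bsub>ob C n\<^esub> m n x) \<in> X n \<rightarrow> carrier (ob C n)" using cc pfD(3) by auto
 have u: "u \<in> carrier (ob C n)" unfolding u_def by (rule M.M.finsum_closed[OF f])
 have dg: "y = (0, 0) & fst x = n" if nz: "ent V x y ~= 0" for x y
 proof -
  have "y = (0, 0)" using V(2)[unfolded col_iff[OF V(1)]] nz by blast
  then show ?thesis using homgD[OF V(3) nz] by simp
 qed
 have "fr.cvec n u = V"
 proof (rule fmat_eqI)
  fix z y
  have e: "ent V z y = (\<Sum>w\<in>(%x. (n, Suc x)) ` X n. ent fr.idm z w * ent V w y)"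
  proof -
   have "ent (fr.idm * V) z y = (\<Sum>w\<in>(%x. (n, Suc x)) ` X n. ent fr.idm z w * ent V w y)"
   proof (rule ent_mult_gen)
    show "finite ((%x. (n, Suc x)) ` X n)" by (simp add: pfD(1))
    fix w assume "ent fr.idm z w ~= 0" "ent V w y ~= 0"
    then have "w \<in> {w\<in>JJ. fst w = n}" using dg by (auto simp: fr.ent_mt split: if_splits)
    then show "w \<in> (%x. (n, Suc x)) ` X n" unfolding JJ_fibre .
   qed
   then show ?thesis using V(4) by simp
  qed
  show "ent (fr.cvec n u) z y = ent V z y"
  proof (cases "y = (0, 0) & z \<in> JJ & fst z = n")
   case True
   then obtain i where i: "z = (n, Suc i)" "i \<in> X n" by (cases z; cases "snd z") (auto simp: JJ_iff)
   note l = pfD(4)[OF i(2)]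
   have "\<phi> n i u = (\<Oplus>\<^bsub>K\<^esub>x\<in>X n. \<phi> n i (c x \<odot>\<^bsub>ob C n\<^esub> m n x))" unfolding u_def by (rule linf_finsum[OF modC l f])
   also have "... = (\<Oplus>\<^bsub>K\<^esub>x\<in>X n. c x \<otimes>\<^bsub>K\<^esub> \<phi> n i (m n x))"
    by (rule K.finsum_cong') (use cc pfD(3) linfD[OF l] in auto)
   finally have "emb K (\<phi> n i u) = (\<Sum>x\<in>X n. emb K (c x \<otimes>\<^bsub>K\<^esub> \<phi> n i (m n x)))"
    using K.emb_finsum[of "%x. c x \<otimes>\<^bsub>K\<^esub> \<phi> n i (m n x)" "X n"] cc pfD(3) linfD(1)[OF l] by auto
   also have "... = (\<Sum>x\<in>X n. ent fr.idm z (n, Suc x) * ent V (n, Suc x) y)"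
    using True i cc pfD(3) linfD(1)[OF l]
    by (intro sum.cong) (auto simp: K.emb_mult ec fr.ent_mt JJ_iff kk_def tt_def mult.commute)
   also have "... = ent V z y" unfolding e by (subst sum.reindex) (auto simp: inj_on_def)
   finally show ?thesis using True i by (simp add: fr.ent_cvec kk_def)
  next
   case False
   have "ent V z y = 0"
   proof (rule ccontr)
    assume nz: "ent V z y ~= 0"
    then have "z ~: JJ" using False dg by blast
    then have "ent V z y = 0" unfolding e by (simp add: fr.ent_mt)
    then show False using nz by simp
   qed
   then show ?thesis using False by (auto simp: fr.ent_cvec)
  qed
 qed
 then show ?thesis using u by blast
qed

lemma fixed_iff_invt:
 assumes L: "subgroup L G" and u: "u \<in> carrier (ob C n)"
 shows "u \<in> fixed_points (ob C n) L \<longleftrightarrow> invt G gg L (fr.cvec n u)"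
 using u subgroup.mem_carrier[OF L] cvec_inj[OF act_actC(1) u]
 by (auto simp: fixed_points_def invt_def fr.tw_cvec)

lemma rho_cvec_zero_iff:
 assumes H: "subgroup H G" and v: "v \<in> carrier (ob C n)"
 shows "rho gg H (fr.cvec n v) = 0 \<longleftrightarrow> (\<forall>x\<in>X n. (\<forall>g\<in>H. \<alpha> n g x = x) --> \<phi> n x v = \<zero>\<^bsub>K\<^esub>)"
proof -
 have fx: "(n, Suc x) \<in> fixs gg H \<longleftrightarrow> (\<forall>g\<in>H. \<alpha> n g x = x)" if "x \<in> X n" for x
  using that by (auto simp: fixs_def gg_def JJ_iff)
 have vc: "\<phi> n x v \<in> carrier K" if "x \<in> X n" for x by (rule linfD(1)[OF pfD(4)[OF that] v])
 show ?thesis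
 proof
  assume a: "rho gg H (fr.cvec n v) = 0"
  show "\<forall>x\<in>X n. (\<forall>g\<in>H. \<alpha> n g x = x) --> \<phi> n x v = \<zero>\<^bsub>K\<^esub>"
  proof (intro ballI impI)
   fix x assume x: "x \<in> X n" "\<forall>g\<in>H. \<alpha> n g x = x"
   have "ent (rho gg H (fr.cvec n v)) (n, Suc x) (0, 0) = 0" using a by simp
   then have "emb K (\<phi> n x v) = 0" using x fx[OF x(1)] pt_fixs_gg by (simp add: fr.ent_cvec JJ_iff kk_def)
   then show "\<phi> n x v = \<zero>\<^bsub>K\<^esub>" using K.emb_0_iff[OF vc[OF x(1)]] by simp
  qed
 next
  assume a: "\<forall>x\<in>X n. (\<forall>g\<in>H. \<alpha> n g x = x) --> \<phi> n x v = \<zero>\<^bsub>K\<^esub>"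
  show "rho gg H (fr.cvec n v) = 0"
  proof (rule fmat_eqI)
   fix z y
   show "ent (rho gg H (fr.cvec n v)) z y = ent 0 z y"
   proof (cases "z \<in> JJ & fst z = n & z \<in> fixs gg H")
    case True
    then obtain i where i: "z = (n, Suc i)" "i \<in> X n" by (cases z; cases "snd z") (auto simp: JJ_iff)
    then have "\<phi> n i v = \<zero>\<^bsub>K\<^esub>" using a fx[OF i(2)] True by blast
    then show ?thesis using i by (simp add: fr.ent_cvec kk_def)
   qed (auto simp: fr.ent_cvec)
  qed
 qed
qed

text \<open>This identifies the Brauer quotient with the coordinate columns of fixed vectors,
  restricted to the indices that \<open>H\<close> fixes.\<close>

lemma transfers_iff:
 assumes H: "subgroup H G"
 shows "v \<in> proper_transfers K G H (ob C n) \<longleftrightarrow> v \<in> fixed_points (ob C n) H & rho gg H (fr.cvec n v) = 0"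
 unfolding proper_transfers_eq[OF kGC pf H] tker_def[OF kGC pf H]
 using rho_cvec_zero_iff[OF H, of v n] by (auto simp: fixed_points_def)

lemma bd_shift_hom: "bd (shift i C) n \<in> kG_hom K G (ob C (n - i)) (ob C (n - 1 - i))"
proof -
 note b = bd2[of n i]
 have e: "bd (shift i C) n = (%x. signed (ob C (n - 1 - i)) i (bd C (n - i) x))" by (simp add: shift_def)
 show ?thesis unfolding e
 proof (rule kG_hom_from_lmap[OF lmap_signed[OF modC kG_hom_lmap[OF b]]])
  show "signed (ob C (n - 1 - i)) i (bd C (n - i) (act (ob C (n - i)) g u))
   = act (ob C (n - 1 - i)) g (signed (ob C (n - 1 - i)) i (bd C (n - i) u))"
   if "g \<in> carrier G" "u \<in> carrier (ob C (n - i))" for g u unfolding kG_homD(4)[OF b that]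
   by (rule lmap_of_signed[OF modC modC act_lmap[OF kGC that(1)] kG_homD(1)[OF b that(2)], symmetric])
 qed
qed

section \<open>The Brauer quotient at \<open>H\<close> and its homology in coordinates\<close>

context
 fixes H :: "'g set"
 assumes H: "subgroup H G"
begin

abbreviation "FF n \<equiv> fixed_points (ob C n) H"
abbreviation "Tr n \<equiv> proper_transfers K G H (ob C n)"
abbreviation "BQ n \<equiv> brauer_quotient K G H (ob C n)"
abbreviation "rv n v \<equiv> rho gg H (fr.cvec n v)"
abbreviation "rd \<equiv> rho gg H dm"
abbreviation "re \<equiv> rho gg H fr.idm"
abbreviation "bq n v \<equiv> Tr n +>\<^bsub>ob C n\<^esub> v"
abbreviation "MF i \<equiv> modular_fixed K G H (shift i C)"

lemma sub_F: "submodule (FF n) K (ob C n)" by (rule submodule_fixed[OF kGC pf H])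

lemma FF_carrier: "v \<in> FF n ==> v \<in> carrier (ob C n)" by (simp add: fixed_points_def)

lemma FF_ops: "v \<in> FF n ==> w \<in> FF n ==> v \<oplus>\<^bsub>ob C n\<^esub> w \<in> FF n" "v \<in> FF n ==> \<ominus>\<^bsub>ob C n\<^esub> v \<in> FF n"
 "r \<in> carrier K ==> v \<in> FF n ==> r \<odot>\<^bsub>ob C n\<^esub> v \<in> FF n" "\<zero>\<^bsub>ob C n\<^esub> \<in> FF n" "v \<in> FF n ==> signed (ob C n) i v \<in> FF n"
proof -
 interpret M: gmodule K "ob C n" by (rule gmodule.intro[OF modC])
 note E = M.submoduleE[OF sub_F]
 show "v \<in> FF n ==> w \<in> FF n ==> v \<oplus>\<^bsub>ob C n\<^esub> w \<in> FF n" "v \<in> FF n ==> \<ominus>\<^bsub>ob C n\<^esub> v \<in> FF n"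
  "r \<in> carrier K ==> v \<in> FF n ==> r \<odot>\<^bsub>ob C n\<^esub> v \<in> FF n" "\<zero>\<^bsub>ob C n\<^esub> \<in> FF n"
  using E M.submodule_zero[OF sub_F] by blast+
 then show "v \<in> FF n ==> signed (ob C n) i v \<in> FF n" by (simp add: signed_def)
qed

lemma sub_T: "submodule (Tr n) K (ob C n)"
 unfolding proper_transfers_eq[OF kGC pf H] by (rule submodule_tker[OF kGC pf H])

lemma Tr_iff: "v \<in> Tr n \<longleftrightarrow> v \<in> FF n & rv n v = 0" by (rule transfers_iff[OF H])

lemma gFM: "gmodule K ((ob C n)\<lparr>carrier := FF n\<rparr>)"
 by (rule gmodule.intro[OF submodule.submodule_is_module[OF sub_F modC]])

lemma sub_T': "submodule (Tr n) K ((ob C n)\<lparr>carrier := FF n\<rparr>)"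
 by (rule submodule_carrier_update[OF modC sub_F sub_T]) (auto simp: Tr_iff)

lemma rv_ops: "v \<in> FF n ==> w \<in> FF n ==> rv n (v \<oplus>\<^bsub>ob C n\<^esub> w) = rv n v + rv n w"
 "v \<in> FF n ==> rv n (\<ominus>\<^bsub>ob C n\<^esub> v) = - rv n v"
 "v \<in> FF n ==> rv n (signed (ob C n) i v) = (if even i then rv n v else - rv n v)"
 "r \<in> carrier K ==> v \<in> FF n ==> rv n (r \<odot>\<^bsub>ob C n\<^esub> v) = rv n v * single (0, 0) (0, 0) (emb K r)"
 "rv n \<zero>\<^bsub>ob C n\<^esub> = 0"
 by (simp_all add: FF_carrier fr.cvec_add cvec_uminus cvec_signed fr.cvec_smult restr_add restr_uminus
   restr_mult_single pt_fixs_gg)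

lemma BQ_zero: "\<zero>\<^bsub>BQ n\<^esub> = Tr n" by (simp add: brauer_quotient_def quotient_mod_def)

lemma carrier_BQ: "carrier (BQ n) = bq n ` FF n"
 unfolding brauer_quotient_def gmodule.carrier_quotient[OF gFM] by simp

lemma modBQ: "Module.module K (BQ n)"
 unfolding brauer_quotient_def by (rule gmodule.module_quotient[OF gFM sub_T'])

lemma BQ_ops: "v \<in> FF n ==> w \<in> FF n ==> bq n v \<oplus>\<^bsub>BQ n\<^esub> bq n w = bq n (v \<oplus>\<^bsub>ob C n\<^esub> w)"
 "r \<in> carrier K ==> v \<in> FF n ==> r \<odot>\<^bsub>BQ n\<^esub> bq n v = bq n (r \<odot>\<^bsub>ob C n\<^esub> v)" unfolding brauer_quotient_def
 by (simp_all add: gmodule.quotient_simps(3,4)[OF gFM[of n] sub_T'[of n], simplified])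

lemma BQ_eq:
 assumes v: "v \<in> FF n" and w: "w \<in> FF n" shows "bq n v = bq n w \<longleftrightarrow> rv n v = rv n w"
proof -
 interpret M: Module.module K "ob C n" by (rule modC)
 have "bq n v = bq n w \<longleftrightarrow> (\<exists>t\<in>Tr n. v = t \<oplus>\<^bsub>ob C n\<^esub> w)"
  using gmodule.coset_eq_iff_add[OF gFM sub_T', of v n w] v w by simp
 also have "... \<longleftrightarrow> rv n v = rv n w"
 proof
  assume "\<exists>t\<in>Tr n. v = t \<oplus>\<^bsub>ob C n\<^esub> w"
  then show "rv n v = rv n w" using rv_ops(1)[OF _ w] by (auto simp: Tr_iff)
 next
  assume e: "rv n v = rv n w"
  have "v \<oplus>\<^bsub>ob C n\<^esub> \<ominus>\<^bsub>ob C n\<^esub> w \<in> Tr n"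
   using e rv_ops(1)[OF v FF_ops(2)[OF w]] rv_ops(2)[OF w] FF_ops v w by (simp add: Tr_iff)
  moreover have "v = (v \<oplus>\<^bsub>ob C n\<^esub> \<ominus>\<^bsub>ob C n\<^esub> w) \<oplus>\<^bsub>ob C n\<^esub> w"
   using FF_carrier[OF v] FF_carrier[OF w] by (simp add: M.M.a_assoc M.M.l_neg)
  ultimately show "\<exists>t\<in>Tr n. v = t \<oplus>\<^bsub>ob C n\<^esub> w" by blast
 qed
 finally show ?thesis .
qed

lemma BQ_zero_iff: "v \<in> FF n ==> bq n v = Tr n \<longleftrightarrow> rv n v = 0"
 using gmodule.coset_eq_zero_iff[OF gFM sub_T', of v n] by (simp add: Tr_iff)

lemma invt_cvec: "v \<in> FF n ==> invt G gg H (fr.cvec n v)" using fixed_iff_invt[OF H FF_carrier] by blast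

text \<open>Both the differential and the column of a fixed vector are invariant under
  \<open>H\<close>, which is what the Brauer homomorphism requires.\<close>

lemma rv_bd:
 assumes v: "v \<in> FF n" shows "rd * rv n v = rv (n - 1) (bd C n v)"
 using rho_mult[OF isact_gg H invt_dm[OF H] invt_cvec[OF v] fr.cor_mt[OF hfam_bd]]
  fr.mt_cvec[OF hfam_bd FF_carrier[OF v]] by simp

lemma rv_vec:
 assumes v: "v \<in> FF n"
 shows "cor (rv n v)" "rv n v * upt (0, 0) = rv n v" "homg fst n (rv n v)" "re * rv n v = rv n v"
proof -
 have c: "cor (fr.cvec n v)" by (rule fr.cor_cvec[OF FF_carrier[OF v]])
 then show cr: "cor (rv n v)" by (rule cor_restr)
 show "rv n v * upt (0, 0) = rv n v" unfolding col_iff[OF cr] by (simp add: fr.ent_cvec)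
 show "homg fst n (rv n v)" by (rule homg_restr[OF fr.homg_cvec])
 show "re * rv n v = rv n v"
  using rho_mult[OF isact_gg H invt_idm[OF H] invt_cvec[OF v] fr.cor_mt[OF fr.hfam_id]]
   fr.idm_cvec[OF FF_carrier[OF v]] by simp
qed

text \<open>A column supported on fixed indices is invariant under \<open>H\<close>, and therefore
  so is \<open>idm * V\<close>, which is the column of a fixed vector. By the Brauer homomorphism
  its restriction is \<open>re * V\<close>.\<close>

lemma rv_lift:
 assumes V: "cor V" "V * upt (0, 0) = V" "homg fst n V" "re * V = V"
 shows "\<exists>v\<in>FF n. rv n v = V"
proof -
 have rV: "rho gg H V = V"
 proof (rule fmat_eqI)
  fix x y
  show "ent (rho gg H V) x y = ent V x y"
  proof (cases "ent V x y = 0")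
   case False
   then have "y = (0, 0)" using V(2)[unfolded col_iff[OF V(1)]] by blast
   moreover have "x \<in> fixs gg H"
   proof (rule ccontr)
    assume "x ~: fixs gg H"
    then have "ent (re * V) x y = 0" by (simp add: ent_mult[of "idx re"])
    then show False using False V(4) by simp
   qed
   ultimately show ?thesis using pt_fixs_gg by simp
  qed simp
 qed
 have iV: "invt G gg H V" using invt_rho[OF isact_gg H, of V] by (simp add: rV)
 define W where "W = fr.idm * V"
 have ii: "fr.idm * fr.idm = fr.idm" using cplxC by (simp add: cplx_def)
 have W: "cor W" "W * upt (0, 0) = W" "homg fst n W" "fr.idm * W = W"
 proof -
  show "cor W" unfolding W_def by (rule cor_mult2[OF V(1)])
  show "W * upt (0, 0) = W" unfolding W_def by (simp add: mult.assoc V(2))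
  show "homg fst n W" unfolding W_def by (rule homg_mult[OF fr.homg_mt V(3)]) simp
  show "fr.idm * W = W" unfolding W_def by (simp add: mult.assoc[symmetric] ii)
 qed
 obtain u where u: "u \<in> carrier (ob C n)" "fr.cvec n u = W" using cvec_surj[OF W] by blast
 have "invt G gg H W"
  unfolding W_def by (rule invt_closed(3)[OF isact_gg subgroup.subset[OF H] invt_idm[OF H] iV])
 then have "u \<in> FF n" using fixed_iff_invt[OF H u(1)] u(2) by simp
 moreover have "rho gg H W = V"
  unfolding W_def rho_mult[OF isact_gg H invt_idm[OF H] iV fr.cor_mt[OF fr.hfam_id]] by (simp add: rV V(4))
 ultimately show ?thesis using u(2) by blast
qed

lemma FF_hom:
 assumes f: "f \<in> kG_hom K G (ob C n) (ob C k)" and v: "v \<in> FF n" shows "f v \<in> FF k"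
 using v kG_homD(1)[OF f] kG_homD(4)[OF f, symmetric] subgroup.mem_carrier[OF H]
 by (simp add: fixed_points_def)

lemma bd_shift_rv:
 assumes v: "v \<in> FF (n - i)"
 shows "bd (shift i C) n v \<in> FF (n - 1 - i)"
  "rv (n - 1 - i) (bd (shift i C) n v) = (if even i then rd * rv (n - i) v else - (rd * rv (n - i) v))"
proof -
 show "bd (shift i C) n v \<in> FF (n - 1 - i)" by (rule FF_hom[OF bd_shift_hom v])
 have b: "bd C (n - i) v \<in> FF (n - 1 - i)" by (rule FF_hom[OF bd2 v])
 have "n - i - 1 = n - 1 - i" by simp
 then have "rd * rv (n - i) v = rv (n - 1 - i) (bd C (n - i) v)" using rv_bd[OF v] by metis
 then show "rv (n - 1 - i) (bd (shift i C) n v) = (if even i then rd * rv (n - i) v else - (rd * rv (n - i) v))"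
  using rv_ops(3)[OF b, of i] by (simp add: shift_def)
qed

lemma ob_MF: "ob (MF i) n = BQ (n - i)" by (simp add: modular_fixed_def shift_def)

lemma bd_MF:
 assumes v: "v \<in> FF (n - i)"
 shows "bd (MF i) n (bq (n - i) v) = bq (n - 1 - i) (bd (shift i C) n v)"
proof -
 interpret M: gmodule K "ob C (n - 1 - i)" by (rule gmodule.intro[OF modC])
 have "coset_map (ob C (n - 1 - i)) (Tr (n - 1 - i)) (bd (shift i C) n) (bq (n - i) v)
  = bq (n - 1 - i) (bd (shift i C) n v)"
 proof (rule M.coset_map_coset[OF sub_T])
  show "Tr (n - i) ~= {}" using gmodule.submodule_zero[OF gmodule.intro[OF modC] sub_T] by blast
  show "bd (shift i C) n v \<in> carrier (ob C (n - 1 - i))" by (rule FF_carrier[OF bd_shift_rv(1)[OF v]])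
  fix t assume t: "t \<in> Tr (n - i)"
  then show "bd (shift i C) n t \<in> Tr (n - 1 - i)" using bd_shift_rv[of t n i] by (simp add: Tr_iff)
  have "t \<in> carrier (ob C (n - i))" using t FF_carrier by (simp add: Tr_iff)
  then show "bd (shift i C) n (t \<oplus>\<^bsub>ob C (n - i)\<^esub> v) = bd (shift i C) n t \<oplus>\<^bsub>ob C (n - 1 - i)\<^esub> bd (shift i C) n v"
   by (rule kG_homD(2)[OF bd_shift_hom _ FF_carrier[OF v]])
 qed
 moreover have "ob (shift i C) (n - 1) = ob C (n - 1 - i)" by (simp add: shift_def)
 ultimately show ?thesis by (simp add: modular_fixed_def brauer_map_def)
qed

lemma mcx_MF: "mcx K (MF i)" unfolding mcx_def
proof (intro allI conjI ballI)
 fix n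
 show "Module.module K (ob (MF i) n)" unfolding ob_MF by (rule modBQ)
 show "lmap K (ob (MF i) n) (ob (MF i) (n - 1)) (bd (MF i) n)" unfolding lmap_def ob_MF carrier_BQ
  by (auto simp: bd_MF BQ_ops FF_ops bd_shift_rv(1) kG_homD(2,3)[OF bd_shift_hom] FF_carrier)
 fix A assume "A \<in> carrier (ob (MF i) n)"
 then obtain v where v: "v \<in> FF (n - i)" "A = bq (n - i) v" unfolding ob_MF carrier_BQ by blast
 have dd: "rd * rd = 0" using cplx_rho_invt[OF isact_gg H cplxC invt_idm[OF H] invt_dm[OF H]] by (simp add: cplx_def)
 have b: "bd (shift i C) n v \<in> FF (n - 1 - i)" by (rule bd_shift_rv(1)[OF v(1)])
 have "rv (n - 1 - 1 - i) (bd (shift i C) (n - 1) (bd (shift i C) n v)) = 0"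
  using bd_shift_rv(2)[OF b] bd_shift_rv(2)[OF v(1)] dd by (simp add: mult.assoc[symmetric])
 then have "bd (MF i) (n - 1) (bd (MF i) n A) = Tr (n - 1 - 1 - i)"
  unfolding v(2) bd_MF[OF v(1)] bd_MF[OF b] using BQ_zero_iff[OF bd_shift_rv(1)[OF b]] by simp
 then show "bd (MF i) (n - 1) (bd (MF i) n A) = \<zero>\<^bsub>ob (MF i) (n - 2)\<^esub>" by (simp add: ob_MF BQ_zero)
qed

lemma cycles_MF: "A \<in> cycles (MF i) n \<longleftrightarrow> (\<exists>v\<in>FF (n - i). A = bq (n - i) v & rd * rv (n - i) v = 0)"
proof -
 have "bd (MF i) n (bq (n - i) v) = \<zero>\<^bsub>ob (MF i) (n - 1)\<^esub> \<longleftrightarrow> rd * rv (n - i) v = 0" if v: "v \<in> FF (n - i)" for v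
  unfolding bd_MF[OF v] ob_MF BQ_zero BQ_zero_iff[OF bd_shift_rv(1)[OF v]] bd_shift_rv(2)[OF v] by simp
 then show ?thesis unfolding cycles_def ob_MF carrier_BQ by blast
qed

text \<open>The sign of the shifted differential is absorbed by the preimage, so it does not appear
  in this description.\<close>

lemma boundaries_MF:
 "A \<in> boundaries (MF i) n \<longleftrightarrow> (\<exists>v\<in>FF (n - i). A = bq (n - i) v & (\<exists>w\<in>FF (n + 1 - i). rv (n - i) v = rd * rv (n + 1 - i) w))"
proof -
 have e: "n + 1 - 1 - i = n - i" by simp
 note b = bd_shift_rv[of _ "n + 1" i, unfolded e] and m = bd_MF[of _ "n + 1" i, unfolded e]
 show ?thesis
 proof
  assume "A \<in> boundaries (MF i) n"
  then obtain w where w: "w \<in> FF (n + 1 - i)" "A = bq (n - i) (bd (shift i C) (n + 1) w)"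
   unfolding boundaries_def ob_MF carrier_BQ using m by auto
  have "rv (n - i) (bd (shift i C) (n + 1) w) = rd * rv (n + 1 - i) (signed (ob C (n + 1 - i)) i w)"
   unfolding b(2)[OF w(1)] rv_ops(3)[OF w(1)] by simp
  then show "\<exists>v\<in>FF (n - i). A = bq (n - i) v & (\<exists>w\<in>FF (n + 1 - i). rv (n - i) v = rd * rv (n + 1 - i) w)"
   using w(2) b(1)[OF w(1)] FF_ops(5)[OF w(1)] by blast
 next
  assume "\<exists>v\<in>FF (n - i). A = bq (n - i) v & (\<exists>w\<in>FF (n + 1 - i). rv (n - i) v = rd * rv (n + 1 - i) w)"
  then obtain v w where v: "v \<in> FF (n - i)" "A = bq (n - i) v" and w: "w \<in> FF (n + 1 - i)"
   and e: "rv (n - i) v = rd * rv (n + 1 - i) w" by blast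
  let ?w = "signed (ob C (n + 1 - i)) i w"
  have w': "?w \<in> FF (n + 1 - i)" by (rule FF_ops(5)[OF w])
  have "rv (n - i) (bd (shift i C) (n + 1) ?w) = rv (n - i) v" unfolding b(2)[OF w'] rv_ops(3)[OF w] e by simp
  then have "A = bd (MF i) (n + 1) (bq (n + 1 - i) ?w)"
   unfolding m[OF w'] v(2) using BQ_eq[OF v(1) b(1)[OF w']] by simp
  then show "A \<in> boundaries (MF i) n" unfolding boundaries_def ob_MF carrier_BQ using w' by blast
 qed
qed

text \<open>All three claims come from applying \<open>d * s + s * d = eps - v * w\<close> to a
  cycle: up to a boundary, the cycle is a multiple of \<open>v\<close>, and it is a boundary unless
  the degree is \<open>j\<close>.\<close>

lemma sphere_homology:
 assumes S: "sphere fst (0, 0) re rd j"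
 shows "n ~= j ==> v \<in> FF n ==> rd * rv n v = 0 ==> \<exists>w\<in>FF (n + 1). rv n v = rd * rv (n + 1) w"
  "\<exists>v\<in>FF j. rd * rv j v = 0 & (\<forall>z. rv j v ~= rd * z)"
  "v \<in> FF j ==> rd * rv j v = 0 ==> u \<in> FF j ==> rd * rv j u = 0 ==> \<forall>z. rv j u ~= rd * z ==>
   \<exists>r\<in>carrier K. \<exists>w\<in>FF (j + 1). rv j v = rd * rv (j + 1) w + rv j (r \<odot>\<^bsub>ob C j\<^esub> u)"
proof -
 obtain s v0 w0 where r: "retracts fst (0, 0) re rd j s v0 w0" using S unfolding sphere_def by blast
 note q = r[unfolded retracts_def]
 \<comment> \<open>The coordinate of a cycle in the one-dimensional homology.\<close>
 define cf where "cf V = ent (w0 * V) (0, 0) (0, 0)" for V :: "(int \<times> nat, ('k, 'z) fam) fmat"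
 have key: "\<exists>w\<in>FF (n + 1). rv n v = rd * rv (n + 1) w + v0 * single (0, 0) (0, 0) (cf (rv n v))"
  and dg: "cf (rv n v) ~= 0 ==> n = j" if v: "v \<in> FF n" "rd * rv n v = 0" for n v
 proof -
  let ?V = "rv n v"
  note V = rv_vec[OF v(1)]
  have sV: "cor (s * ?V)" "s * ?V * upt (0, 0) = s * ?V" "homg fst (n + 1) (s * ?V)" "re * (s * ?V) = s * ?V"
  proof -
   show "cor (s * ?V)" by (rule cor_mult2[OF V(1)])
   show "s * ?V * upt (0, 0) = s * ?V" by (simp add: mult.assoc V(2))
   show "homg fst (n + 1) (s * ?V)" by (rule homg_mult[of _ 1 _ n]) (use q V in simp_all)
   show "re * (s * ?V) = s * ?V" using q by (simp add: mult.assoc[symmetric])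
  qed
  obtain w where w: "w \<in> FF (n + 1)" "rv (n + 1) w = s * ?V" using rv_lift[OF sV] by blast
  have cw: "cor (w0 * ?V)" by (rule cor_mult2[OF V(1)])
  have "w0 * ?V = upt (0, 0) * (w0 * ?V) * upt (0, 0)"
   using q by (simp add: mult.assoc[symmetric]) (simp add: mult.assoc V(2))
  also have "... = single (0, 0) (0, 0) (cf ?V)" unfolding cf_def by (rule upt_scalar[OF cw])
  finally have wV: "w0 * ?V = single (0, 0) (0, 0) (cf ?V)" .
  have "(rd * s + s * rd) * ?V = (re - v0 * w0) * ?V" using q by simp
  then have "rd * (s * ?V) = ?V - v0 * single (0, 0) (0, 0) (cf ?V)"
   by (simp add: distrib_right left_diff_distrib mult.assoc v(2) V(4) wV)
  then show "\<exists>w\<in>FF (n + 1). ?V = rd * rv (n + 1) w + v0 * single (0, 0) (0, 0) (cf ?V)"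
   using w by (intro bexI[of _ w]) simp_all
  show "n = j" if "cf ?V ~= 0"
  proof -
   have "homg fst (- j + n) (w0 * ?V)" by (rule homg_mult[of _ "- j" _ n]) (use q V in simp_all)
   then show ?thesis using homgD[of fst "- j + n" "w0 * ?V" "(0, 0)" "(0, 0)"] that by (simp add: cf_def)
  qed
 qed
 show "\<exists>w\<in>FF (n + 1). rv n v = rd * rv (n + 1) w" if h: "n ~= j" "v \<in> FF n" "rd * rv n v = 0"
 proof -
  obtain w where w: "w \<in> FF (n + 1)"
   "rv n v = rd * rv (n + 1) w + v0 * single (0, 0) (0, 0) (cf (rv n v))" using key[OF h(2,3)] by blast
  have "cf (rv n v) = 0" using dg[OF h(2,3)] h(1) by blast
  then have "v0 * single (0, 0) (0, 0) (cf (rv n v)) = 0" by (intro fmat_eqI) simp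
  then show ?thesis using w by (intro bexI[of _ w]) simp_all
 qed
 have v0: "cor v0" "v0 * upt (0, 0) = v0" "homg fst j v0" "re * v0 = v0" using q by simp_all
 obtain v1 where v1: "v1 \<in> FF j" "rv j v1 = v0" using rv_lift[OF v0] by blast
 have "v0 ~= rd * z" for z
 proof
  assume "v0 = rd * z"
  then have "w0 * v0 = w0 * rd * z" by (simp add: mult.assoc)
  then have "upt (0, 0) = (0 :: (int \<times> nat, ('k, 'z) fam) fmat)" using q by simp
  then show False by (simp add: upt_nz)
 qed
 then show "\<exists>v\<in>FF j. rd * rv j v = 0 & (\<forall>z. rv j v ~= rd * z)" using v1 q by (intro bexI[of _ v1]) simp_all
 assume v: "v \<in> FF j" "rd * rv j v = 0" and u: "u \<in> FF j" "rd * rv j u = 0" "\<forall>z. rv j u ~= rd * z"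
 obtain w1 where w1: "w1 \<in> FF (j + 1)" "rv j v = rd * rv (j + 1) w1 + v0 * single (0, 0) (0, 0) (cf (rv j v))"
  using key[OF v] by blast
 obtain w2 where w2: "w2 \<in> FF (j + 1)" "rv j u = rd * rv (j + 1) w2 + v0 * single (0, 0) (0, 0) (cf (rv j u))"
  using key[OF u(1,2)] by blast
 have cc: "fr.ee * cf (rv j x) = cf (rv j x)" if "x \<in> FF j" for x
  unfolding cf_def by (rule corD(1)[OF cor_mult2[OF rv_vec(1)[OF that]]])
 define a b where "a = coef K (cf (rv j v))" and "b = coef K (cf (rv j u))"
 have ab: "cf (rv j v) = emb K a" "cf (rv j u) = emb K b" "a \<in> carrier K" "b \<in> carrier K"
  unfolding a_def b_def by (simp_all add: K.emb_coef cc v(1) u(1))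
 have "b ~= \<zero>\<^bsub>K\<^esub>"
 proof
  assume "b = \<zero>\<^bsub>K\<^esub>"
  moreover have "v0 * single (0, 0) (0, 0) 0 = 0" by (rule fmat_eqI) simp
  ultimately have "rv j u = rd * rv (j + 1) w2" using w2(2)[unfolded ab(2)] \<open>b = \<zero>\<^bsub>K\<^esub>\<close> by simp
  then show False using u(3) by blast
 qed
 then have ub: "b \<in> Units K" using ab(4) K.field_Units by blast
 \<comment> \<open>The quotient of the two homology coordinates; it can be formed because
   \<open>u\<close> is no boundary.\<close>
 define r where "r = inv\<^bsub>K\<^esub> b \<otimes>\<^bsub>K\<^esub> a"
 have ib: "inv\<^bsub>K\<^esub> b \<in> carrier K" by (rule K.Units_inv_closed[OF ub])
 have r: "r \<in> carrier K" "b \<otimes>\<^bsub>K\<^esub> r = a"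
  using ib ab ub by (simp_all add: r_def K.m_assoc[symmetric] K.Units_r_inv)
 let ?s = "%c. single (0, 0) (0, 0) c :: (int \<times> nat, ('k, 'z) fam) fmat"
 let ?w = "w1 \<oplus>\<^bsub>ob C (j + 1)\<^esub> \<ominus>\<^bsub>ob C (j + 1)\<^esub> (r \<odot>\<^bsub>ob C (j + 1)\<^esub> w2)"
 have w: "?w \<in> FF (j + 1)" by (intro FF_ops w1(1) w2(1) r(1))
 have rw: "rv (j + 1) ?w = rv (j + 1) w1 - rv (j + 1) w2 * ?s (emb K r)"
  using FF_ops w1(1) w2(1) r(1) by (simp add: rv_ops)
 have "rv j (r \<odot>\<^bsub>ob C j\<^esub> u) = rv j u * ?s (emb K r)" by (rule rv_ops(4)[OF r(1) u(1)])
 also have "... = rd * rv (j + 1) w2 * ?s (emb K r) + v0 * (?s (emb K b) * ?s (emb K r))"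
  unfolding w2(2)[unfolded ab(2)] by (simp add: distrib_right mult.assoc)
 also have "?s (emb K b) * ?s (emb K r) = ?s (emb K a)"
  using r ab(4) by (simp add: single_mult_single K.emb_mult[symmetric])
 finally have "rv j (r \<odot>\<^bsub>ob C j\<^esub> u) = rd * rv (j + 1) w2 * ?s (emb K r) + v0 * ?s (emb K a)" .
 then have "rv j v = rd * rv (j + 1) ?w + rv j (r \<odot>\<^bsub>ob C j\<^esub> u)"
  unfolding rw w1(2)[unfolded ab(1)] by (simp add: right_diff_distrib mult.assoc)
 then show "\<exists>r\<in>carrier K. \<exists>w\<in>FF (j + 1). rv j v = rd * rv (j + 1) w + rv j (r \<odot>\<^bsub>ob C j\<^esub> u)" using r(1) w by blast
qed

lemma h_mark_eq:
 assumes S: "sphere fst (0, 0) re rd j" shows "h_mark K G C H = j"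
proof -
 note z = homology_zero_iff[OF mcx_MF[of 0], unfolded shift_0]
 note cy = cycles_MF[of _ 0, unfolded shift_0 diff_0_right] and bo = boundaries_MF[of _ 0, unfolded shift_0 diff_0_right]
 let ?M = "modular_fixed K G H C"
 have 1: "cycles ?M n \<subseteq> boundaries ?M n" if "n ~= j" for n
 proof
  fix A assume "A \<in> cycles ?M n"
  then obtain v where "v \<in> FF n" "A = bq n v" "rd * rv n v = 0" unfolding cy by blast
  then show "A \<in> boundaries ?M n" unfolding bo using sphere_homology(1)[OF S that] by blast
 qed
 have 2: "\<not> cycles ?M j \<subseteq> boundaries ?M j"
 proof
  assume sub: "cycles ?M j \<subseteq> boundaries ?M j"
  obtain v where v: "v \<in> FF j" "rd * rv j v = 0" "!!z. rv j v ~= rd * z" using sphere_homology(2)[OF S] by blast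
  then have "bq j v \<in> boundaries ?M j" using sub cy by blast
  then obtain v' w where "v' \<in> FF j" "bq j v = bq j v'" "rv j v' = rd * rv (j + 1) w" unfolding bo by blast
  then show False using BQ_eq[OF v(1)] v(3) by metis
 qed
 show ?thesis unfolding h_mark_def Let_def z by (rule the_equality) (use 1 2 in blast)+
qed

text \<open>Each element of a coset in the Weyl group normalizes \<open>H\<close>, hence preserves
  the transfers, and it fixes \<open>v\<close>. The lemma is used for the equivariance of the
  induced map of Brauer quotients.\<close>

lemma act_BQ_fixed:
 assumes v: "v \<in> fixed_points (ob C n) (carrier G)" and c: "c \<in> carrier (weyl_group G H)"
 shows "act (BQ n) c (bq n v) = bq n v"
proof -
 interpret M: gmodule K "ob C n" by (rule gmodule.intro[OF modC])
 interpret A: kG_module K G "ob C n" by (rule kGC)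
 have Hc: "!!h. h \<in> H ==> h \<in> carrier G" using subgroup.subset[OF H] by blast
 have vc: "v \<in> carrier (ob C n)" and vf: "!!g. g \<in> carrier G ==> act (ob C n) g v = v"
  using v by (auto simp: fixed_points_def)
 obtain a where a: "a \<in> normalizer G H" and ca: "c = (%h. h \<otimes> a) ` H"
  using c unfolding weyl_group_def FactGroup_def RCOSETS_def r_coset_def by auto
 have ac: "a \<in> carrier G" and conj: "(%h. a \<otimes> h \<otimes> inv a) ` H = H"
  using a subgroup.subset[OF H] unfolding normalizer_def stabilizer_def l_coset_def r_coset_def by auto
 have at: "act (ob C n) a t \<in> Tr n" if t: "t \<in> Tr n" for t
 proof -
  have tF: "t \<in> FF n" "rv n t = 0" using t by (auto simp: Tr_iff)
  note tc = FF_carrier[OF tF(1)]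
  have "act (ob C n) h (act (ob C n) a t) = act (ob C n) a t" if h: "h \<in> H" for h
  proof -
   obtain h' where h': "h' \<in> H" "h = a \<otimes> h' \<otimes> inv a" using h conj by blast
   have "h \<otimes> a = a \<otimes> h'" using h' ac Hc[OF h'(1)] by (simp add: m_assoc)
   then have "act (ob C n) h (act (ob C n) a t) = act (ob C n) a (act (ob C n) h' t)"
    using A.act_mult[OF Hc[OF h] ac tc] A.act_mult[OF ac Hc[OF h'(1)] tc] by simp
   then show ?thesis using tF(1) h'(1) by (simp add: fixed_points_def)
  qed
  then have "act (ob C n) a t \<in> FF n" using act_actC(1)[OF ac tc] by (simp add: fixed_points_def)
  moreover have "rv n (act (ob C n) a t) = 0"
   using tw_restr[OF isact_gg ac fixs_stable_normal[OF isact_gg H ac conj], of "fr.cvec n t"] tF(2)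
   by (simp add: fr.tw_cvec[OF ac tc] tw_0[OF isact_gg ac])
  ultimately show ?thesis by (simp add: Tr_iff)
 qed
 have gt: "act (ob C n) g t \<in> Tr n" "g \<in> carrier G" if g: "g \<in> c" and t: "t \<in> Tr n" for g t
 proof -
  obtain h where h: "h \<in> H" "g = h \<otimes> a" using g ca by blast
  show "g \<in> carrier G" using h Hc ac by simp
  have tc: "t \<in> carrier (ob C n)" using t FF_carrier by (simp add: Tr_iff)
  have "act (ob C n) g t = act (ob C n) a t"
   using A.act_mult[OF Hc[OF h(1)] ac tc] at[OF t] h by (simp add: Tr_iff fixed_points_def)
  then show "act (ob C n) g t \<in> Tr n" using at[OF t] by simp
 qed
 have Tz: "\<zero>\<^bsub>ob C n\<^esub> \<in> Tr n" by (rule M.submodule_zero[OF sub_T])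
 have Tc: "t \<in> carrier (ob C n)" if "t \<in> Tr n" for t using that FF_carrier by (simp add: Tr_iff)
 have e: "coset_map (ob C n) (Tr n) (act (ob C n) g) (bq n v) = bq n v" if g: "g \<in> c" for g
 proof -
  have gc: "g \<in> carrier G" by (rule gt(2)[OF g Tz])
  have "coset_map (ob C n) (Tr n) (act (ob C n) g) (bq n v) = bq n (act (ob C n) g v)"
  proof (rule M.coset_map_coset[OF sub_T])
   show "Tr n ~= {}" using Tz by blast
   show "act (ob C n) g v \<in> carrier (ob C n)" by (rule act_actC(1)[OF gc vc])
   show "act (ob C n) g t \<in> Tr n" if "t \<in> Tr n" for t by (rule gt(1)[OF g that])
   show "act (ob C n) g (t \<oplus>\<^bsub>ob C n\<^esub> v) = act (ob C n) g t \<oplus>\<^bsub>ob C n\<^esub> act (ob C n) g v" if "t \<in> Tr n" for t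
    by (rule A.act_add[OF gc Tc[OF that] vc])
  qed
  then show ?thesis using vf[OF gc] by simp
 qed
 have "c ~= {}" using ca subgroup.one_closed[OF H] by blast
 then have "(\<Union>g\<in>c. coset_map (ob C n) (Tr n) (act (ob C n) g) (bq n v)) = bq n v" using e by auto
 then show ?thesis by (simp add: brauer_quotient_def quotient_mod_def)
qed

end
end

section \<open>Forerunners\<close>

lemma unit_simps [simp]: "carrier (ob (unit_complex K) n) = (if n = 0 then carrier K else {\<zero>\<^bsub>K\<^esub>})"
 "\<zero>\<^bsub>ob (unit_complex K) n\<^esub> = \<zero>\<^bsub>K\<^esub>" "bd (unit_complex K) n r = \<zero>\<^bsub>K\<^esub>"
 "r \<oplus>\<^bsub>ob (unit_complex K) n\<^esub> r' = r \<oplus>\<^bsub>K\<^esub> r'" "r \<odot>\<^bsub>ob (unit_complex K) n\<^esub> r' = r \<otimes>\<^bsub>K\<^esub> r'"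
 "act (ob (unit_complex K) n) g r = r" by (simp_all add: unit_complex_def trivial_module_def)

lemma (in fbase) module_unit: "Module.module K (ob (unit_complex K) n)"
proof (cases "n = 0")
 case True
 then show ?thesis using module_trivial[OF K.is_cring] by (simp add: unit_complex_def)
next
 case False
 then show ?thesis by (intro Module.moduleI abelian_groupI K.is_cring) auto
qed

text \<open>One index in degree 0 frames the unit complex, so that its Brauer quotients are covered
  by the same description as those of \<open>C\<close>.\<close>

lemma (in fbase) pframe_unit:
 "pframe K G p (unit_complex K :: ('k, 'k, 'g) gcomplex) (%n. if n = 0 then {0} else {})
  (%n g x. x) (%n x. \<one>\<^bsub>K\<^esub>) (%n x r. r)"
proof (rule pframe.intro[OF fbase_axioms], rule pframe_axioms.intro)
 let ?U = "unit_complex K :: ('k, 'k, 'g) gcomplex"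
 have k: "kG_module K G (ob ?U n)" for n
  by (rule kG_module.intro[OF module_unit]) (simp add: kG_module_axioms_def)
 have b: "bd ?U n \<in> kG_hom K G (ob ?U n) (ob ?U (n - 1))" for n by (rule kG_homI) auto
 show "kG_complex K G ?U" unfolding kG_complex_def using k b by simp
 show "finite {n. carrier (ob ?U n) ~= {\<zero>\<^bsub>ob ?U n\<^esub>}}" by (rule finite_subset[of _ "{0}"]) auto
 fix n
 have nt: "carrier K ~= {\<zero>\<^bsub>K\<^esub>}" using K.one_closed K.one_not_zero by blast
 have l: "\<Lambda> v = v \<otimes>\<^bsub>K\<^esub> \<Lambda> \<one>\<^bsub>K\<^esub>" "\<Lambda> \<one>\<^bsub>K\<^esub> \<in> carrier K" if "linf K (ob ?U 0) \<Lambda>" "v \<in> carrier K" for \<Lambda> v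
  using linfD(3)[OF that(1), of v "\<one>\<^bsub>K\<^esub>"] linfD(1)[OF that(1), of "\<one>\<^bsub>K\<^esub>"] that(2) by simp_all
 have l0: "\<Lambda> \<zero>\<^bsub>K\<^esub> = \<zero>\<^bsub>K\<^esub>" if "linf K (ob ?U n) \<Lambda>" for \<Lambda> using linf_zero[OF module_unit that] by simp
 show "perm_frame K G (ob ?U n) (if n = 0 then {0} else {}) (%g x. x) (%x. \<one>\<^bsub>K\<^esub>) (%x r. r)"
 proof (cases "n = 0")
  case True
  have "linf K (ob ?U 0) (%r. r)" unfolding linf_def by simp
  moreover have "\<Lambda> v = (\<Oplus>\<^bsub>K\<^esub>x\<in>{0::nat}. v \<otimes>\<^bsub>K\<^esub> \<Lambda> \<one>\<^bsub>K\<^esub>)" if "linf K (ob ?U 0) \<Lambda>" "v \<in> carrier (ob ?U 0)" for \<Lambda> v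
  proof -
   have v: "v \<in> carrier K" using that(2) by simp
   have "(\<Oplus>\<^bsub>K\<^esub>x\<in>{0::nat}. v \<otimes>\<^bsub>K\<^esub> \<Lambda> \<one>\<^bsub>K\<^esub>) = v \<otimes>\<^bsub>K\<^esub> \<Lambda> \<one>\<^bsub>K\<^esub>" using K.m_closed[OF v l(2)[OF that(1) v]] by simp
   then show ?thesis using l(1)[OF that(1) v] by simp
  qed
  ultimately have "perm_frame K G (ob ?U 0) {0} (%g x. x) (%x. \<one>\<^bsub>K\<^esub>) (%x r. r)" unfolding perm_frame_def
   by (intro conjI) ((use nt in \<open>simp; fail\<close>) | blast)+
  then show ?thesis using True by simp
 next
  case False
  then show ?thesis unfolding perm_frame_def using l0 by auto
 qed
qed

context pframe
begin

theorem forerunner_exists: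
 assumes E: "homotopy_equivalent K G TC (unit_complex K)" and eff: "effective K G C" and H: "subgroup H G"
 shows "\<exists>\<iota>. forerunner K G C H \<iota>"
proof -
 define h where "h L = h_mark K G C L" for L
 have sph: "sphere fst (0, 0) (rho gg L fr.idm) (rho gg L dm) (h L)" if L: "subgroup L G" for L
 proof -
  obtain i where i: "sphere fst (0, 0) (rho gg L fr.idm) (rho gg L dm) i" using endotrivial_sphere[OF E L] by blast
  then show ?thesis using h_mark_eq[OF L i] by (simp add: h_def)
 qed
 have mono: "h H \<le> h L" if "subgroup L G" "subgroup H G" "L \<subseteq> H" for L H
  using eff that unfolding effective_def h_def by blast
 obtain V where V: "cor V" "V * upt (0, 0) = V" "fr.idm * V = V" "dm * V = 0" "homg fst (h H) V"
   "invt G gg (carrier G) V" "!!z. rho gg H V ~= rho gg H dm * z"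
  using matrix_forerunner[OF isact_gg fr.dg_ga fr.pt_ga fr.dg_pt cplxC
    invt_idm[OF subgroup_self] invt_dm[OF subgroup_self] sph mono H] by blast
 \<comment> \<open>The matrix cycle is the coordinate column of a vector, which is fixed by
   \<open>G\<close> because the column is invariant.\<close>
 obtain x where x: "x \<in> carrier (ob C (h H))" "fr.cvec (h H) x = V" using cvec_surj[OF V(1,2,5,3)] by blast
 have xf: "x \<in> fixed_points (ob C (h H)) (carrier G)" using fixed_iff_invt[OF subgroup_self x(1)] x(2) V(6) by simp
 have bdx: "bd C (h H) x = \<zero>\<^bsub>ob C (h H - 1)\<^esub>"
 proof (rule cvec_inj)
  show "bd C (h H) x \<in> carrier (ob C (h H - 1))" by (rule kG_homD(1)[OF bdC x(1)])
  show "\<zero>\<^bsub>ob C (h H - 1)\<^esub> \<in> carrier (ob C (h H - 1))"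
   using module.axioms(1) modC[of "h H - 1"] by (meson Module.module_def abelian_group_def abelian_monoid.zero_closed)
  show "fr.cvec (h H - 1) (bd C (h H) x) = fr.cvec (h H - 1) \<zero>\<^bsub>ob C (h H - 1)\<^esub>"
   using fr.mt_cvec[OF hfam_bd x(1)] x(2) V(4) by simp
 qed
 \<comment> \<open>With this shift, degree 0 of the shifted complex is degree \<open>h H\<close> of
   \<open>C\<close>.\<close>
 define i where "i = - h H"
 let ?U = "unit_complex K :: ('k, 'k, 'g) gcomplex"
 let ?D = "shift i C"
 interpret U: pframe K G p ?U "%n. if n = 0 then {0} else {}" "%n g x. x" "%n x. \<one>\<^bsub>K\<^esub>" "%n x r. r"
  by (rule pframe_unit)
 have obD: "ob ?D n = ob C (n - i)" for n by (simp add: shift_def)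
 have i0: "0 - i = h H" and i0': "- i = h H" by (simp_all add: i_def)
 define \<iota> where "\<iota> n r = (if n = 0 then r \<odot>\<^bsub>ob C (h H)\<^esub> x else \<zero>\<^bsub>ob C (n - i)\<^esub>)" for n :: int and r
 have FG: "submodule (fixed_points (ob C n) (carrier G)) K (ob C n)" for n by (rule sub_F[OF subgroup_self])
 note Fops = FF_ops[OF subgroup_self]
 have \<iota>F: "\<iota> n r \<in> fixed_points (ob C (n - i)) (carrier G)" if "r \<in> carrier (ob ?U n)" for n r
  using that Fops(3)[OF _ xf] Fops(4) by (auto simp: \<iota>_def i0' split: if_splits)
 have \<iota>FH: "\<iota> n r \<in> fixed_points (ob C (n - i)) H" if "r \<in> carrier (ob ?U n)" for n r
  using \<iota>F[OF that] subgroup.subset[OF H] by (auto simp: fixed_points_def)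
 have \<iota>c: "\<iota> n r \<in> carrier (ob C (n - i))" if "r \<in> carrier (ob ?U n)" for n r
  by (rule FF_carrier[OF subgroup_self \<iota>F[OF that]])
 have \<iota>hom: "\<iota> n \<in> kG_hom K G (ob ?U n) (ob C (n - i))" for n
 proof -
  interpret M: Module.module K "ob C (n - i)" by (rule modC)
  interpret M0: Module.module K "ob C (h H)" by (rule modC)
  show ?thesis
  proof (rule kG_homI)
   show "\<iota> n r \<in> carrier (ob C (n - i))" if "r \<in> carrier (ob ?U n)" for r by (rule \<iota>c[OF that])
   show "\<iota> n (r \<oplus>\<^bsub>ob ?U n\<^esub> r') = \<iota> n r \<oplus>\<^bsub>ob C (n - i)\<^esub> \<iota> n r'"
    if "r \<in> carrier (ob ?U n)" "r' \<in> carrier (ob ?U n)" for r r'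
    using that x(1) by (auto simp: \<iota>_def i0' M0.smult_l_distr)
   show "\<iota> n (s \<odot>\<^bsub>ob ?U n\<^esub> r) = s \<odot>\<^bsub>ob C (n - i)\<^esub> \<iota> n r" if "s \<in> carrier K" "r \<in> carrier (ob ?U n)" for s r
    using that x(1) by (auto simp: \<iota>_def i0' M0.smult_assoc1 M.smult_zero)
   show "\<iota> n (act (ob ?U n) g r) = act (ob C (n - i)) g (\<iota> n r)"
    if "g \<in> carrier G" "r \<in> carrier (ob ?U n)" for g r
    using \<iota>F[OF that(2)] that(1) by (simp add: fixed_points_def)
  qed
 qed
 have \<iota>z: "\<iota> n \<zero>\<^bsub>K\<^esub> = \<zero>\<^bsub>ob C (n - i)\<^esub>" for n
  using lmap_zero(1)[OF module_unit modC kG_hom_lmap[OF \<iota>hom], of n] by simp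
 have bd\<iota>: "bd ?D n (\<iota> n r) = \<zero>\<^bsub>ob C (n - 1 - i)\<^esub>" if r: "r \<in> carrier (ob ?U n)" for n r
 proof (cases "n = 0")
  case True
  interpret M: Module.module K "ob C (h H - 1)" by (rule modC)
  have "bd C (h H) (r \<odot>\<^bsub>ob C (h H)\<^esub> x) = \<zero>\<^bsub>ob C (h H - 1)\<^esub>"
   using kG_homD(3)[OF bdC _ x(1), of r] r True bdx by (simp add: M.smult_zero)
  moreover have "\<ominus>\<^bsub>ob C (h H - 1)\<^esub> \<zero>\<^bsub>ob C (h H - 1)\<^esub> = \<zero>\<^bsub>ob C (h H - 1)\<^esub>" by simp
  ultimately show ?thesis using True by (simp add: shift_def signed_def \<iota>_def i_def add.commute)
 next
  case False
  then show ?thesis using lmap_zero(1)[OF modC modC kG_hom_lmap[OF bd_shift_hom]] by (simp add: \<iota>_def)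
 qed
 have chain: "chain_map K G ?U ?D \<iota>" unfolding chain_map_def obD using \<iota>hom bd\<iota> \<iota>z by simp
 let ?MU = "modular_fixed K G H ?U" and ?MD = "modular_fixed K G H ?D"
 let ?W = "weyl_group G H"
 let ?f = "modular_fixed_map K G H ?D \<iota>"
 note Uob = U.ob_MF[OF H, of 0, unfolded shift_0 diff_0_right]
 note UbqC = U.carrier_BQ[OF H]
 have UF: "fixed_points (ob ?U n) L = carrier (ob ?U n)" for n L by (auto simp: fixed_points_def)
 \<comment> \<open>The only index of the unit complex is fixed, so its transfers vanish and the
   Brauer quotient divides out nothing.\<close>
 have UT: "U.Tr H n = {\<zero>\<^bsub>K\<^esub>}" for n
 proof -
  have "v \<in> U.Tr H n \<longleftrightarrow> v = \<zero>\<^bsub>K\<^esub>" for v unfolding U.transfers_iff[OF H] UF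
   using U.rho_cvec_zero_iff[OF H, of v n] by auto
  then show ?thesis by blast
 qed
 have fbq: "?f n (U.bq H n r) = bq H (n - i) (\<iota> n r)" if r: "r \<in> carrier (ob ?U n)" for n r
 proof -
  interpret M: gmodule K "ob C (n - i)" by (rule gmodule.intro[OF modC])
  interpret MU: Module.module K "ob ?U n" by (rule module_unit)
  have "coset_map (ob C (n - i)) (Tr H (n - i)) (\<iota> n) (U.bq H n r) = bq H (n - i) (\<iota> n r)"
  proof (rule M.coset_map_coset[OF sub_T[OF H]])
   show "U.Tr H n ~= {}" by (simp add: UT)
   show "\<iota> n r \<in> carrier (ob C (n - i))" by (rule \<iota>c[OF r])
   fix t assume "t \<in> U.Tr H n"
   then have t: "t = \<zero>\<^bsub>ob ?U n\<^esub>" by (simp add: UT)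
   show "\<iota> n t \<in> Tr H (n - i)" unfolding t using \<iota>z[of n] M.submodule_zero[OF sub_T[OF H]] by simp
   show "\<iota> n (t \<oplus>\<^bsub>ob ?U n\<^esub> r) = \<iota> n t \<oplus>\<^bsub>ob C (n - i)\<^esub> \<iota> n r"
    unfolding t by (rule kG_homD(2)[OF \<iota>hom MU.M.zero_closed r])
  qed
  then show ?thesis by (simp add: modular_fixed_map_def brauer_map_def obD)
 qed
 have MUc: "carrier (ob ?MU n) = U.bq H n ` carrier (ob ?U n)" for n unfolding Uob UbqC UF ..
 have fl: "lmap K (ob ?MU n) (ob ?MD n) (?f n)" for n unfolding lmap_def
 proof (intro conjI ballI)
  fix A assume "A \<in> carrier (ob ?MU n)"
  then obtain r where r: "r \<in> carrier (ob ?U n)" "A = U.bq H n r" unfolding MUc by blast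
  show "?f n A \<in> carrier (ob ?MD n)"
   unfolding r(2) fbq[OF r(1)] ob_MF[OF H] carrier_BQ[OF H] using \<iota>FH[OF r(1)] by blast
 next
  fix A B assume "A \<in> carrier (ob ?MU n)" "B \<in> carrier (ob ?MU n)"
  then obtain r s where r: "r \<in> carrier (ob ?U n)" "A = U.bq H n r" and s: "s \<in> carrier (ob ?U n)" "B = U.bq H n s"
   unfolding MUc by blast
  interpret MU: Module.module K "ob ?U n" by (rule module_unit)
  show "?f n (A \<oplus>\<^bsub>ob ?MU n\<^esub> B) = ?f n A \<oplus>\<^bsub>ob ?MD n\<^esub> ?f n B"
   unfolding r(2) s(2) Uob U.BQ_ops(1)[OF H r(1)[folded UF[of _ H]] s(1)[folded UF[of _ H]]] fbq[OF r(1)] fbq[OF s(1)]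
    fbq[OF MU.M.a_closed[OF r(1) s(1)]] ob_MF[OF H] BQ_ops(1)[OF H \<iota>FH[OF r(1)] \<iota>FH[OF s(1)]]
    kG_homD(2)[OF \<iota>hom r(1) s(1)] ..
 next
  fix c A assume c: "c \<in> carrier K" and "A \<in> carrier (ob ?MU n)"
  then obtain r where r: "r \<in> carrier (ob ?U n)" "A = U.bq H n r" unfolding MUc by blast
  interpret MU: Module.module K "ob ?U n" by (rule module_unit)
  show "?f n (c \<odot>\<^bsub>ob ?MU n\<^esub> A) = c \<odot>\<^bsub>ob ?MD n\<^esub> ?f n A"
   unfolding r(2) Uob U.BQ_ops(2)[OF H c r(1)[folded UF[of _ H]]] fbq[OF r(1)]
    fbq[OF MU.smult_closed[OF c r(1)]] ob_MF[OF H] BQ_ops(2)[OF H c \<iota>FH[OF r(1)]] kG_homD(3)[OF \<iota>hom c r(1)] ..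
 qed
 \<comment> \<open>The values of \<open>\<iota>\<close> are fixed by \<open>G\<close>, so the Weyl
   group acts trivially on the classes on both sides.\<close>
 have fhom: "?f n \<in> kG_hom K ?W (ob ?MU n) (ob ?MD n)" for n
 proof (rule kG_hom_from_lmap[OF fl])
  fix c A assume c: "c \<in> carrier ?W" and "A \<in> carrier (ob ?MU n)"
  then obtain r where r: "r \<in> carrier (ob ?U n)" "A = U.bq H n r" unfolding MUc by blast
  show "?f n (act (ob ?MU n) c A) = act (ob ?MD n) c (?f n A)"
   unfolding r(2) Uob U.act_BQ_fixed[OF H r(1)[folded UF[of _ "carrier G"]] c] fbq[OF r(1)] ob_MF[OF H]
    act_BQ_fixed[OF H \<iota>F[OF r(1)] c] ..
 qed
 note mU = U.mcx_MF[OF H, of 0, unfolded shift_0] and mD = mcx_MF[OF H, of i]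
 have bdU: "bd ?MU n (U.bq H n r) = U.bq H (n - 1) \<zero>\<^bsub>K\<^esub>" if "r \<in> carrier (ob ?U n)" for n r
  using U.bd_MF[OF H, of r n 0, unfolded shift_0 diff_0_right UF, OF that] by simp
 have fchain: "?f (n - 1) (bd ?MU n A) = bd ?MD n (?f n A)" if A: "A \<in> carrier (ob ?MU n)" for n A
 proof -
  obtain r where r: "r \<in> carrier (ob ?U n)" "A = U.bq H n r" using A unfolding MUc by blast
  have z: "\<zero>\<^bsub>K\<^esub> \<in> carrier (ob ?U (n - 1))" by simp
  show ?thesis unfolding r(2) bdU[OF r(1)] fbq[OF r(1)] fbq[OF z] bd_MF[OF H \<iota>FH[OF r(1)]] bd\<iota>[OF r(1)] \<iota>z ..
 qed
 have S: "sphere fst (0, 0) (re H) (rd H) (h H)" by (rule sph[OF H])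
 have dd: "rd H * rv H (h H) x = 0"
 proof -
  have xF: "x \<in> FF H (h H)" using xf subgroup.subset[OF H] by (auto simp: fixed_points_def)
  show ?thesis using rv_bd[OF H xF] bdx rv_ops(5)[OF H] by simp
 qed
 have xFH: "x \<in> FF H (h H)" using xf subgroup.subset[OF H] by (auto simp: fixed_points_def)
 have nb: "\<forall>z. rv H (h H) x ~= rd H * z" using V(7) x(2) by simp
 have zero_U: "\<zero>\<^bsub>K\<^esub> \<in> carrier (ob ?U n)" for n by simp
 have Uz: "U.bq H n \<zero>\<^bsub>K\<^esub> \<in> boundaries ?MU n" for n
 proof -
  have "\<zero>\<^bsub>ob ?MU n\<^esub> \<in> boundaries ?MU n"
   by (rule gmodule.submodule_zero[OF gmodule.intro[OF mcxD(1)[OF mU]] submodule_boundaries[OF mU]])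
  moreover have "U.bq H n \<zero>\<^bsub>K\<^esub> = U.Tr H n"
   using U.BQ_zero_iff[OF H, of "\<zero>\<^bsub>K\<^esub>" n] U.rv_ops(5)[OF H, of n] zero_U by (simp add: UF del: unit_simps(1))
  ultimately show ?thesis by (simp add: Uob U.BQ_zero[OF H])
 qed
 have "bij_betw (homology_map ?MD ?f n) (carrier (homology ?MU n)) (carrier (homology ?MD n))" for n
 proof (rule homology_map_bij[OF mU mD fl fchain])
  fix A assume A: "A \<in> cycles ?MU n" and fA: "?f n A \<in> boundaries ?MD n"
  obtain r where r: "r \<in> carrier (ob ?U n)" "A = U.bq H n r" using A unfolding cycles_def MUc by blast
  \<comment> \<open>If \<open>r\<close> were nonzero, it could be inverted, and the restriction of
    \<open>x\<close> itself would be a boundary.\<close>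
  have "r = \<zero>\<^bsub>K\<^esub>"
  proof (cases "n = 0")
   case True
   then have rK: "r \<in> carrier K" using r(1) by simp
   have "bq H (h H) (r \<odot>\<^bsub>ob C (h H)\<^esub> x) \<in> boundaries ?MD 0"
    using fA r(2) fbq[OF r(1)] True by (simp add: \<iota>_def i_def)
   then obtain v w where v: "v \<in> FF H (h H)" "bq H (h H) (r \<odot>\<^bsub>ob C (h H)\<^esub> x) = bq H (h H) v"
    and w: "rv H (h H) v = rd H * rv H (0 + 1 - i) w" unfolding boundaries_MF[OF H, of _ i 0] i0 by blast
   have "rv H (h H) (r \<odot>\<^bsub>ob C (h H)\<^esub> x) = rd H * rv H (0 + 1 - i) w"
    using BQ_eq[OF H FF_ops(3)[OF H rK xFH] v(1)] v(2) w by simp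
   then have e: "rv H (h H) x * single (0, 0) (0, 0) (emb K r) = rd H * rv H (0 + 1 - i) w"
    unfolding rv_ops(4)[OF H rK xFH] .
   show ?thesis
   proof (rule ccontr)
    assume "r ~= \<zero>\<^bsub>K\<^esub>"
    then have u: "r \<in> Units K" using rK K.field_Units by blast
    have iv: "inv\<^bsub>K\<^esub> r \<in> carrier K" by (rule K.Units_inv_closed[OF u])
    have "(single (0, 0) (0, 0) (emb K r) :: (int \<times> nat, ('k, 'z) fam) fmat) * single (0, 0) (0, 0) (emb K (inv\<^bsub>K\<^esub> r)) = upt (0, 0)"
     using rK iv u by (simp add: single_mult_single upt_def K.emb_mult[symmetric] K.Units_r_inv)
    then have "rv H (h H) x = rv H (h H) x * single (0, 0) (0, 0) (emb K r) * single (0, 0) (0, 0) (emb K (inv\<^bsub>K\<^esub> r))"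
     using rv_vec(2)[OF H xFH] by (simp add: mult.assoc)
    also have "... = rd H * (rv H (0 + 1 - i) w * single (0, 0) (0, 0) (emb K (inv\<^bsub>K\<^esub> r)))"
     unfolding e by (simp add: mult.assoc)
    finally show False using nb by blast
   qed
  next
   case False
   then show ?thesis using r(1) by simp
  qed
  then show "A \<in> boundaries ?MU n" using Uz r(2) by simp
 next
  fix B assume B: "B \<in> cycles ?MD n"
  then obtain v where v: "v \<in> FF H (n - i)" "B = bq H (n - i) v" "rd H * rv H (n - i) v = 0"
   unfolding cycles_MF[OF H] by blast
  have cU: "U.bq H n r \<in> cycles ?MU n" if "r \<in> carrier (ob ?U n)" for r
  proof -
   have "U.bq H (n - 1) \<zero>\<^bsub>K\<^esub> = U.Tr H (n - 1)"
    using U.BQ_zero_iff[OF H, of "\<zero>\<^bsub>K\<^esub>" "n - 1"] U.rv_ops(5)[OF H, of "n - 1"] zero_U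
    by (simp add: UF del: unit_simps(1))
   then show ?thesis
    unfolding cycles_def MUc using that bdU[OF that] by (simp add: Uob U.BQ_zero[OF H] del: unit_simps(1))
  qed
  \<comment> \<open>In degree 0 a cycle is a multiple of the class of \<open>x\<close> up to a
    boundary, because the homology is one-dimensional. In every other degree it is a boundary, and
    \<open>r\<close> is zero.\<close>
  obtain r w where r: "r \<in> carrier (ob ?U n)" and w: "w \<in> FF H (n + 1 - i)"
   and e: "rv H (n - i) v = rd H * rv H (n + 1 - i) w + rv H (n - i) (\<iota> n r)"
  proof (cases "n = 0")
   case True
   have "v \<in> FF H (h H)" "rd H * rv H (h H) v = 0" using v True by (simp_all add: i_def)
   then obtain r w where "r \<in> carrier K" "w \<in> FF H (h H + 1)"
    "rv H (h H) v = rd H * rv H (h H + 1) w + rv H (h H) (r \<odot>\<^bsub>ob C (h H)\<^esub> x)"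
    using sphere_homology(3)[OF H S _ _ xFH dd nb] by blast
   then show thesis using that[of r w] True by (simp add: i_def \<iota>_def add.commute)
  next
   case False
   then have ne: "n - i ~= h H" by (simp add: i_def)
   obtain w where w: "w \<in> FF H (n - i + 1)" "rv H (n - i) v = rd H * rv H (n - i + 1) w"
    using sphere_homology(1)[OF H S ne v(1,3)] by blast
   have e1: "n - i + 1 = n + 1 - i" by simp
   show thesis by (rule that[of "\<zero>\<^bsub>K\<^esub>" w]) (use w[unfolded e1] rv_ops(5)[OF H] in \<open>simp_all add: \<iota>z\<close>)
  qed
  let ?b = "v \<oplus>\<^bsub>ob C (n - i)\<^esub> \<ominus>\<^bsub>ob C (n - i)\<^esub> \<iota> n r"
  note \<iota>r = \<iota>FH[OF r]
  have b: "?b \<in> FF H (n - i)" by (rule FF_ops(1)[OF H v(1) FF_ops(2)[OF H \<iota>r]])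
  have "rv H (n - i) ?b = rd H * rv H (n + 1 - i) w"
   unfolding rv_ops(1)[OF H v(1) FF_ops(2)[OF H \<iota>r]] rv_ops(2)[OF H \<iota>r] e by simp
  then have bb: "bq H (n - i) ?b \<in> boundaries ?MD n" unfolding boundaries_MF[OF H] using b w by blast
  interpret M: Module.module K "ob C (n - i)" by (rule modC)
  have "v = ?b \<oplus>\<^bsub>ob C (n - i)\<^esub> \<iota> n r"
   using FF_carrier[OF H v(1)] FF_carrier[OF H \<iota>r] by (simp add: M.M.a_assoc M.M.l_neg)
  then have "B = bq H (n - i) ?b \<oplus>\<^bsub>ob ?MD n\<^esub> ?f n (U.bq H n r)"
   unfolding v(2) fbq[OF r] ob_MF[OF H] BQ_ops(1)[OF H b \<iota>r] by simp
  then show "\<exists>b\<in>boundaries ?MD n. \<exists>A\<in>cycles ?MU n. B = b \<oplus>\<^bsub>ob ?MD n\<^esub> ?f n A" using bb cU[OF r] by blast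
 qed
 then have "forerunner K G C H \<iota>"
  unfolding forerunner_def Let_def h_def[symmetric] i_def[symmetric] quasi_iso_def
  using chain fhom fchain by (simp add: chain_map_def[of K ?W])
 then show ?thesis by blast
qed

end

theorem theoremA:
  fixes K :: "('k, 'z) ring_scheme" and G :: "('g, 'y) monoid_scheme" and p :: nat
    and C :: "('k, 'm, 'g) gcomplex" and H :: "'g set"
  assumes "prime p" and "field K" and "has_char K p"
    and "group G" and "finite (carrier G)" and "\<exists>n. order G = p ^ n"
    and "endotrivial K G C" and "effective K G C"
    and "subgroup H G"
  shows "\<exists>\<iota>. forerunner K G C H \<iota>"
proof -
 interpret fbase K G p by (intro fbase.intro fbase_axioms.intro assms)
 have pc: "p_perm_complex K G C" and E: "homotopy_equivalent K G (tensor_complex K (dual_complex K G C) C) (unit_complex K)"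
  using assms(7) unfolding endotrivial_def by blast+
 have "\<forall>n. \<exists>X \<alpha> m \<phi>. perm_frame K G (ob C n) X \<alpha> m \<phi>"
  using pc perm_frame_exists unfolding p_perm_complex_def by blast
 then obtain X \<alpha> m \<phi> where "!!n. perm_frame K G (ob C n) (X n) (\<alpha> n) (m n) (\<phi> n)" by metis
 then interpret pframe K G p C X \<alpha> m \<phi> using pc unfolding p_perm_complex_def
  by (intro pframe.intro[OF fbase_axioms] pframe_axioms.intro) blast+
 show ?thesis by (rule forerunner_exists[OF E assms(8,9)])
qed

end
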